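(* Let $T$ be a monomial operator, and let $h,\varphi$ be its associated symbols, that is, $\varphi:\mathbb C_+\to\mathbb C_+$ and $h:\mathbb C_+\to\mathbb C$ are holomorphic and $T_0^*G=h\cdot(G\circ\varphi)$ for all $G\in H^2(\mathbb C_+)$, where $T_0=UTU^{-1}$. Let $\mu$ be the Borel measure on $\overline{\mathbb C_+}$ given by $$\mu(E)=\int_{\{y\in\mathbb R:\ \varphi(iy)\in E\}}|h(iy)|^2\,dy .$$ Then $T$ is compact if and only if $$\sup_{I:\ C(I)\in S_r}\frac{\mu(Q_I)}{|I|}\longrightarrow 0\qquad\text{as } r\to0,$$ where $I$ ranges over bounded nondegenerate intervals in $i\mathbb R$ and, for $0<r<1$, $$S_r=\{z\in\mathbb C_+:\ 0<\operatorname{Re}z<r\ \text{ or }\ |z|>1/r\}.$$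
   Context: $\mathbb C_+=\{s\in\mathbb C:\operatorname{Re}s>0\}$, and $H^2(\mathbb C_+)$ is the Hardy space of holomorphic functions $f$ on $\mathbb C_+$ with $\|f\|^2=\frac1{2\pi}\sup_{x>0}\int_{\mathbb R}|f(x+iy)|^2dy<\infty$. A monomial operator is a bounded linear operator $T$ on $L^2(0,1)$ with $T(x^n)=c_nx^{p_n}$ for each $n=0,1,2,\dots$, where $c_n,p_n\in\mathbb C$ and $\operatorname{Re}p_n>-1/2$. $U:L^2(0,1)\to H^2(\mathbb C_+)$ is the unitary operator $(Uf)(s)=\int_0^\infty e^{-st}e^{-t/2}f(e^{-t})\,dt$; thus $T_0=UTU^{-1}$ maps $1/(s+n+\frac12)$ to $c_n/(s+p_n+\frac12)$. The associated symbols satisfy $h(n+\frac12)=\overline{c_n}$ and $\varphi(n+\frac12)=\overline{p_n}+\frac12$ (the latter whenever $c_n\neq0$). The values $h(iy)$, $\varphi(iy)$ are nontangential boundary values, existing for almost every $y\in\mathbb R$ (with $\varphi(iy)\in\overline{\mathbb C_+}$). For a bounded interval $I\subset i\mathbb R$ of length $|I|>0$, $Q_I=\{x+iy:\ 0\le x\le|I|,\ iy\in I\}$ is the Carleson square and $C(I)$ is the centre of $Q_I$, i.e. $C(I)=|I|/2+m_I$ with $m_I\in i\mathbb R$ the midpoint of $I$. *)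

theory Defs
  imports "HOL-Complex_Analysis.Complex_Analysis"
begin

section \<open>Operators on \<open>L\<^sup>2\<close>\<close>

text \<open>Elements of \<open>L\<^sup>2(M)\<close> are represented by square-integrable functions, equality being
  equality almost everywhere. An operator acts on representatives and respects this equality.\<close>

definition L2 :: "'a measure \<Rightarrow> ('a \<Rightarrow> complex) set" where
  "L2 M = {f \<in> borel_measurable M. integrable M (\<lambda>x. (cmod (f x))\<^sup>2)}"

definition L2_norm :: "'a measure \<Rightarrow> ('a \<Rightarrow> complex) \<Rightarrow> real" where
  "L2_norm M f = sqrt (\<integral>x. (cmod (f x))\<^sup>2 \<partial>M)"

definition L2_bounded_linear ::
  "'a measure \<Rightarrow> (('a \<Rightarrow> complex) \<Rightarrow> 'a \<Rightarrow> complex) \<Rightarrow> bool" where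
  "L2_bounded_linear M T \<longleftrightarrow>
     (\<forall>f\<in>L2 M. T f \<in> L2 M) \<and>
     (\<forall>f\<in>L2 M. \<forall>g\<in>L2 M. (AE x in M. f x = g x) \<longrightarrow> (AE x in M. T f x = T g x)) \<and>
     (\<forall>f\<in>L2 M. \<forall>g\<in>L2 M. \<forall>a b.
        AE x in M. T (\<lambda>x. a * f x + b * g x) x = a * T f x + b * T g x) \<and>
     (\<exists>C. \<forall>f\<in>L2 M. L2_norm M (T f) \<le> C * L2_norm M f)"

definition L2_compact ::
  "'a measure \<Rightarrow> (('a \<Rightarrow> complex) \<Rightarrow> 'a \<Rightarrow> complex) \<Rightarrow> bool" where
  "L2_compact M T \<longleftrightarrow>
     (\<forall>f :: nat \<Rightarrow> 'a \<Rightarrow> complex. (\<forall>n. f n \<in> L2 M) \<and> (\<exists>B. \<forall>n. L2_norm M (f n) \<le> B) \<longrightarrow>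
        (\<exists>r :: nat \<Rightarrow> nat. \<exists>g\<in>L2 M. strict_mono r \<and>
           (\<lambda>n. L2_norm M (\<lambda>x. T (f (r n)) x - g x)) \<longlonglongrightarrow> 0))"

abbreviation unit_interval :: "real measure" where
  "unit_interval \<equiv> restrict_space lborel {0<..<1}"

definition monomial_operator :: "((real \<Rightarrow> complex) \<Rightarrow> real \<Rightarrow> complex) \<Rightarrow> bool" where
  "monomial_operator T \<longleftrightarrow>
     L2_bounded_linear unit_interval T \<and>
     (\<exists>c p :: nat \<Rightarrow> complex. \<forall>n. Re (p n) > - 1 / 2 \<and>
        (AE x in unit_interval.
           T (\<lambda>x. complex_of_real x ^ n) x = c n * complex_of_real x powr p n))"

section \<open>The Hardy space of the right half-plane\<close>

definition right_half_plane :: "complex set" where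
  "right_half_plane = {s. Re s > 0}"

definition H2_norm_sq :: "(complex \<Rightarrow> complex) \<Rightarrow> ennreal" where
  "H2_norm_sq f =
     ennreal (1 / (2 * pi)) *
     (SUP x\<in>{0::real<..}. \<integral>\<^sup>+y. ennreal ((cmod (f (Complex x y)))\<^sup>2) \<partial>lborel)"

text \<open>Only the values on the half-plane matter: members of \<open>H2\<close> that agree there represent
  the same element of the Hardy space.\<close>

definition H2 :: "(complex \<Rightarrow> complex) set" where
  "H2 = {f. f holomorphic_on right_half_plane \<and> H2_norm_sq f < \<infinity>}"

text \<open>The inner product (linear in the first argument) is recovered from the norm by the
  polarization identity.\<close>

definition H2_inner :: "(complex \<Rightarrow> complex) \<Rightarrow> (complex \<Rightarrow> complex) \<Rightarrow> complex" where
  "H2_inner f g =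
     (\<Sum>k<4. \<i> ^ k * complex_of_real (enn2real (H2_norm_sq (\<lambda>s. f s + \<i> ^ k * g s)))) / 4"

definition is_H2_adjoint ::
  "((complex \<Rightarrow> complex) \<Rightarrow> complex \<Rightarrow> complex) \<Rightarrow>
   ((complex \<Rightarrow> complex) \<Rightarrow> complex \<Rightarrow> complex) \<Rightarrow> bool" where
  "is_H2_adjoint A B \<longleftrightarrow>
     (\<forall>G\<in>H2. B G \<in> H2) \<and> (\<forall>F\<in>H2. \<forall>G\<in>H2. H2_inner (A F) G = H2_inner F (B G))"

definition U_op :: "(real \<Rightarrow> complex) \<Rightarrow> complex \<Rightarrow> complex" where
  "U_op f s =
     (LINT t:{0<..}|lborel. exp (- s * of_real t) * exp (- of_real t / 2) * f (exp (- t)))"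

text \<open>The preimage is unique up to equality almost everywhere.\<close>

definition U_inv :: "(complex \<Rightarrow> complex) \<Rightarrow> real \<Rightarrow> complex" where
  "U_inv F = (SOME f. f \<in> L2 unit_interval \<and> (\<forall>s\<in>right_half_plane. U_op f s = F s))"

definition T0_op ::
  "((real \<Rightarrow> complex) \<Rightarrow> real \<Rightarrow> complex) \<Rightarrow> (complex \<Rightarrow> complex) \<Rightarrow> complex \<Rightarrow> complex" where
  "T0_op T F = U_op (T (U_inv F))"

definition associated_symbols ::
  "((real \<Rightarrow> complex) \<Rightarrow> real \<Rightarrow> complex) \<Rightarrow> (complex \<Rightarrow> complex) \<Rightarrow> (complex \<Rightarrow> complex) \<Rightarrow> bool"
  where
  "associated_symbols T h \<phi> \<longleftrightarrow>
     h holomorphic_on right_half_plane \<and>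
     \<phi> holomorphic_on right_half_plane \<and> \<phi> ` right_half_plane \<subseteq> right_half_plane \<and>
     is_H2_adjoint (T0_op T) (\<lambda>G s. h s * G (\<phi> s))"

section \<open>Boundary values and the Carleson condition\<close>

definition has_nontangential_limit :: "(complex \<Rightarrow> complex) \<Rightarrow> real \<Rightarrow> complex \<Rightarrow> bool" where
  "has_nontangential_limit f y l \<longleftrightarrow>
     (\<forall>\<alpha>>0. (f \<longlongrightarrow> l)
        (at (Complex 0 y) within {z. Re z > 0 \<and> \<bar>Im z - y\<bar> < \<alpha> * Re z}))"

text \<open>The value \<open>0\<close> where no nontangential limit exists is a convention. For associated symbols
  it only concerns a null set.\<close>

definition boundary_value :: "(complex \<Rightarrow> complex) \<Rightarrow> real \<Rightarrow> complex" where
  "boundary_value f y =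
     (if \<exists>l. has_nontangential_limit f y l then THE l. has_nontangential_limit f y l else 0)"

definition symbol_measure ::
  "(complex \<Rightarrow> complex) \<Rightarrow> (complex \<Rightarrow> complex) \<Rightarrow> complex set \<Rightarrow> ennreal" where
  "symbol_measure h \<phi> E =
     (\<integral>\<^sup>+y\<in>{y. boundary_value \<phi> y \<in> E}. ennreal ((cmod (boundary_value h y))\<^sup>2) \<partial>lebesgue)"

text \<open>An interval \<open>I\<close> of the imaginary axis is given by the real interval
  \<open>J = {y. \<i> y \<in> I}\<close>; it may or may not contain its endpoints.\<close>

definition bounded_nondegenerate_interval :: "real set \<Rightarrow> bool" where
  "bounded_nondegenerate_interval J \<longleftrightarrow>
     is_interval J \<and> bounded J \<and> J \<noteq> {} \<and> Inf J < Sup J"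

definition interval_length :: "real set \<Rightarrow> real" where
  "interval_length J = Sup J - Inf J"

definition carleson_square :: "real set \<Rightarrow> complex set" where
  "carleson_square J = {z. 0 \<le> Re z \<and> Re z \<le> interval_length J \<and> Im z \<in> J}"

definition carleson_centre :: "real set \<Rightarrow> complex" where
  "carleson_centre J = Complex (interval_length J / 2) ((Inf J + Sup J) / 2)"

definition S_region :: "real \<Rightarrow> complex set" where
  "S_region r = {z \<in> right_half_plane. (0 < Re z \<and> Re z < r) \<or> cmod z > 1 / r}"

end

theory Submission
  imports Defs
begin

text \<open>Write \<open>B G = h \<cdot> (G \<circ> \<phi>)\<close>; this is the adjoint of \<open>T\<close> after the unitary transform \<open>U\<close>, and
  \<open>\<parallel>B G\<parallel>\<^sup>2 = (1 / 2\<pi>) \<integral> |G|\<^sup>2 d\<mu>\<close> whenever \<open>G\<close> is continuous up to the imaginary axis. So compactness of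
  \<open>T\<close> is compactness of the embedding of the Hardy space into \<open>L\<^sup>2(\<mu>)\<close>. If \<open>T\<close> is compact, the images of
  the normalized reproducing kernels at the centres \<open>C(I)\<close>, which tend weakly to zero, tend to
  zero in norm, and the kernel at \<open>C(I)\<close> is of size \<open>1 / |I|\<close> on \<open>Q\<^sub>I\<close>. Conversely, for a bounded sequence in the
  Hardy space tending to zero pointwise, \<open>\<mu>\<close> is split into its restriction to a compact part of the
  open half-plane, treated by dominated convergence, and a remainder with a small Carleson
  constant, treated by Carleson's embedding theorem.

  Boundary functions need neither Fourier analysis nor weak compactness: the inner product of
  the restrictions of \<open>F\<close> to the lines \<open>Re s = x\<close> and \<open>Re s = x'\<close> depends only on \<open>x + x'\<close>, hence the
  squared norm on the line \<open>Re s = x\<close> is a bounded midpoint convex function of \<open>x\<close>, and the restrictions form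
  a Cauchy family as \<open>x \<rightarrow> 0\<close>. A Vitali covering argument gives nontangential convergence and the
  Carleson embedding at once.\<close>

section \<open>Square-integrable functions\<close>

text \<open>The symbols describe only the adjoint \<open>B\<close>, while compactness is asked of
  \<open>T\<close>. The passage between them is one identity used twice: if
  \<open>U_op f = B G\<close>, the squared norm of \<open>B G\<close> is the inner product of
  \<open>U_op (T f)\<close> with \<open>G\<close>; and the squared norm of \<open>T d\<close> is the
  inner product of \<open>U_op d\<close> with \<open>B (U_op (T d))\<close>. The obstacle in the
  embedding is that the boundary map \<open>\<phi>b\<close> may send a set of positive measure into
  the imaginary axis, where a member of \<open>H2\<close> has values only almost everywhere.
  Functions are therefore pushed slightly to the right first, at a cost in norm that tends to zero.
  Finite boundary values of \<phi> are a separate matter, since \<phi> is unbounded: the Hardy space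
  argument applies to \<open>1 / (1 + \<phi>)\<close>, and boundary value 0 of that function is
  excluded by integrating \<open>ln (cmod (1 + \<phi>))\<close>. Unitarity of the transform rests on
  the reproducing kernels at \<open>n + 1/2\<close>, which are the images of the monomials, and on
  density of polynomials.\<close>

definition L2_ip :: "'a measure \<Rightarrow> ('a \<Rightarrow> complex) \<Rightarrow> ('a \<Rightarrow> complex) \<Rightarrow> complex" where
  "L2_ip M f g = (\<integral>x. f x * cnj (g x) \<partial>M)"

lemma L2_measurable: "f \<in> L2 M \<Longrightarrow> f \<in> borel_measurable M"
  by (simp add: L2_def)

lemma L2_integrable: "f \<in> L2 M \<Longrightarrow> integrable M (\<lambda>x. (cmod (f x))\<^sup>2)"
  by (simp add: L2_def)

lemma L2_iff_nn_integral:
  "f \<in> L2 M \<longleftrightarrow> f \<in> borel_measurable M \<and> (\<integral>\<^sup>+x. ennreal ((cmod (f x))\<^sup>2) \<partial>M) < \<infinity>"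
  unfolding L2_def by (auto simp: integrable_iff_bounded)

lemma borel_measurable_cnj [measurable (raw)]:
  "f \<in> borel_measurable M \<Longrightarrow> (\<lambda>x. cnj (f x)) \<in> borel_measurable M"
  by (rule measurable_compose[OF _ borel_measurable_continuous_onI]) (auto intro: continuous_intros)

lemma cmod_add_squared_le: "(cmod (a + b))\<^sup>2 \<le> 2 * (cmod a)\<^sup>2 + 2 * (cmod b)\<^sup>2"
proof -
  have "(cmod (a + b))\<^sup>2 \<le> (cmod a + cmod b)\<^sup>2"
    by (intro power_mono norm_triangle_ineq) auto
  also have "\<dots> \<le> 2 * (cmod a)\<^sup>2 + 2 * (cmod b)\<^sup>2"
    using sum_squares_bound[of "cmod a" "cmod b"] by (simp add: power2_sum)
  finally show ?thesis .
qed

lemma L2_ip_integrable: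
  assumes "f \<in> L2 M" "g \<in> L2 M"
  shows "integrable M (\<lambda>x. f x * cnj (g x))"
proof (rule Bochner_Integration.integrable_bound)
  show "integrable M (\<lambda>x. (cmod (f x))\<^sup>2 + (cmod (g x))\<^sup>2)"
    using assms by (intro Bochner_Integration.integrable_add L2_integrable)
  show "(\<lambda>x. f x * cnj (g x)) \<in> borel_measurable M"
    using L2_measurable[OF assms(1)] L2_measurable[OF assms(2)] by measurable
  show "AE x in M. norm (f x * cnj (g x)) \<le> norm ((cmod (f x))\<^sup>2 + (cmod (g x))\<^sup>2)"
  proof (rule AE_I2)
    fix x
    have "cmod (f x) * cmod (g x) \<le> (cmod (f x))\<^sup>2 + (cmod (g x))\<^sup>2"
      using sum_squares_bound[of "cmod (f x)" "cmod (g x)"]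
        mult_nonneg_nonneg[OF norm_ge_zero[of "f x"] norm_ge_zero[of "g x"]] by linarith
    then show "norm (f x * cnj (g x)) \<le> norm ((cmod (f x))\<^sup>2 + (cmod (g x))\<^sup>2)"
      by (simp add: norm_mult)
  qed
qed

lemma L2_lincomb:
  assumes "f \<in> L2 M" "g \<in> L2 M"
  shows "(\<lambda>x. a * f x + b * g x) \<in> L2 M"
  unfolding L2_def
proof (intro CollectI conjI)
  show m: "(\<lambda>x. a * f x + b * g x) \<in> borel_measurable M"
    using L2_measurable[OF assms(1)] L2_measurable[OF assms(2)] by measurable
  show "integrable M (\<lambda>x. (cmod (a * f x + b * g x))\<^sup>2)"
  proof (rule Bochner_Integration.integrable_bound)
    show "integrable M (\<lambda>x. 2 * ((cmod a)\<^sup>2 * (cmod (f x))\<^sup>2) + 2 * ((cmod b)\<^sup>2 * (cmod (g x))\<^sup>2))"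
      using assms by (intro Bochner_Integration.integrable_add integrable_mult_right L2_integrable)
    show "(\<lambda>x. (cmod (a * f x + b * g x))\<^sup>2) \<in> borel_measurable M" using m by measurable
    show "AE x in M. norm ((cmod (a * f x + b * g x))\<^sup>2)
        \<le> norm (2 * ((cmod a)\<^sup>2 * (cmod (f x))\<^sup>2) + 2 * ((cmod b)\<^sup>2 * (cmod (g x))\<^sup>2))"
      using cmod_add_squared_le[of "a * f _" "b * g _"]
      by (auto simp: norm_mult power_mult_distrib)
  qed
qed

lemma L2_add: "f \<in> L2 M \<Longrightarrow> g \<in> L2 M \<Longrightarrow> (\<lambda>x. f x + g x) \<in> L2 M"
  using L2_lincomb[of f M g 1 1] by simp

lemma L2_diff: "f \<in> L2 M \<Longrightarrow> g \<in> L2 M \<Longrightarrow> (\<lambda>x. f x - g x) \<in> L2 M"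
  using L2_lincomb[of f M g 1 "-1"] by simp

lemma L2_scale: "f \<in> L2 M \<Longrightarrow> (\<lambda>x. a * f x) \<in> L2 M"
  using L2_lincomb[of f M f a 0] by simp

lemma L2_zero: "(\<lambda>x. 0) \<in> L2 M"
  by (simp add: L2_def)

lemma L2_norm_nonneg: "0 \<le> L2_norm M f"
  by (simp add: L2_norm_def)

lemma L2_norm_power2: "(L2_norm M f)\<^sup>2 = (\<integral>x. (cmod (f x))\<^sup>2 \<partial>M)"
  by (simp add: L2_norm_def)

lemma nn_integral_L2_norm:
  "f \<in> L2 M \<Longrightarrow> (\<integral>\<^sup>+x. ennreal ((cmod (f x))\<^sup>2) \<partial>M) = ennreal ((L2_norm M f)\<^sup>2)"
  unfolding L2_norm_power2 by (intro nn_integral_eq_integral L2_integrable) auto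

lemma L2_ip_self: "L2_ip M f f = complex_of_real ((L2_norm M f)\<^sup>2)"
  unfolding L2_ip_def L2_norm_power2
  by (simp flip: complex_norm_square integral_complex_of_real add: of_real_power)

lemma L2_ip_cnj: "L2_ip M g f = cnj (L2_ip M f g)"
  unfolding L2_ip_def by (subst Bochner_Integration.integral_cnj[symmetric]) (simp add: mult.commute)

lemma L2_ip_lincomb_left:
  assumes "f \<in> L2 M" "g \<in> L2 M" "h \<in> L2 M"
  shows "L2_ip M (\<lambda>x. a * f x + b * g x) h = a * L2_ip M f h + b * L2_ip M g h"
proof -
  have "L2_ip M (\<lambda>x. a * f x + b * g x) h = (\<integral>x. a * (f x * cnj (h x)) + b * (g x * cnj (h x)) \<partial>M)"
    unfolding L2_ip_def by (intro Bochner_Integration.integral_cong) (auto simp: algebra_simps)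
  also have "\<dots> = a * L2_ip M f h + b * L2_ip M g h"
    unfolding L2_ip_def
    using L2_ip_integrable[OF assms(1,3)] L2_ip_integrable[OF assms(2,3)] by simp
  finally show ?thesis .
qed

lemma L2_ip_diff_left:
  assumes "f \<in> L2 M" "g \<in> L2 M" "h \<in> L2 M"
  shows "L2_ip M (\<lambda>x. f x - g x) h = L2_ip M f h - L2_ip M g h"
  using L2_ip_lincomb_left[OF assms, of 1 "-1"] by simp

lemma L2_ip_lincomb_right:
  assumes "f \<in> L2 M" "g \<in> L2 M" "h \<in> L2 M"
  shows "L2_ip M h (\<lambda>x. a * f x + b * g x) = cnj a * L2_ip M h f + cnj b * L2_ip M h g"
proof -
  have "L2_ip M h (\<lambda>x. a * f x + b * g x) = cnj (a * L2_ip M f h + b * L2_ip M g h)"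
    by (subst L2_ip_cnj) (simp add: L2_ip_lincomb_left[OF assms])
  also have "\<dots> = cnj a * cnj (L2_ip M f h) + cnj b * cnj (L2_ip M g h)" by simp
  finally show ?thesis by (simp flip: L2_ip_cnj)
qed

lemma L2_norm_add_power2:
  assumes "f \<in> L2 M" "g \<in> L2 M"
  shows "(L2_norm M (\<lambda>x. a * f x + b * g x))\<^sup>2 =
    (cmod a)\<^sup>2 * (L2_norm M f)\<^sup>2 + (cmod b)\<^sup>2 * (L2_norm M g)\<^sup>2 + 2 * Re (a * cnj b * L2_ip M f g)"
proof -
  have i: "integrable M (\<lambda>x. (cmod a)\<^sup>2 * (cmod (f x))\<^sup>2)" "integrable M (\<lambda>x. (cmod b)\<^sup>2 * (cmod (g x))\<^sup>2)"
     "integrable M (\<lambda>x. (a * cnj b) * (f x * cnj (g x)))"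
    using L2_integrable[OF assms(1)] L2_integrable[OF assms(2)] L2_ip_integrable[OF assms] by auto
  have "(cmod (u + v))\<^sup>2 = (cmod u)\<^sup>2 + (cmod v)\<^sup>2 + 2 * Re (u * cnj v)" for u v
    unfolding cmod_power2 by (simp add: power2_eq_square algebra_simps)
  then have "(cmod (a * f x + b * g x))\<^sup>2 = (cmod a)\<^sup>2 * (cmod (f x))\<^sup>2 + (cmod b)\<^sup>2 * (cmod (g x))\<^sup>2
      + 2 * Re ((a * cnj b) * (f x * cnj (g x)))" for x
    by (simp add: norm_mult power_mult_distrib mult.assoc mult.left_commute del: times_complex.sel)
  then have "(\<integral>x. (cmod (a * f x + b * g x))\<^sup>2 \<partial>M) = (\<integral>x. (cmod a)\<^sup>2 * (cmod (f x))\<^sup>2 \<partial>M)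
     + (\<integral>x. (cmod b)\<^sup>2 * (cmod (g x))\<^sup>2 \<partial>M) + 2 * (\<integral>x. Re ((a * cnj b) * (f x * cnj (g x))) \<partial>M)"
    using i integrable_Re[OF i(3)] by (simp del: times_complex.sel)
  also have "(\<integral>x. Re ((a * cnj b) * (f x * cnj (g x))) \<partial>M) = Re (\<integral>x. (a * cnj b) * (f x * cnj (g x)) \<partial>M)"
    by (rule integral_Re[OF i(3)])
  also have "(\<integral>x. (a * cnj b) * (f x * cnj (g x)) \<partial>M) = a * cnj b * L2_ip M f g"
    unfolding L2_ip_def by simp
  finally show ?thesis unfolding L2_norm_power2 by simp
qed

lemma L2_norm_scale: "L2_norm M (\<lambda>x. a * f x) = cmod a * L2_norm M f"
proof -
  have "(L2_norm M (\<lambda>x. a * f x))\<^sup>2 = (cmod a * L2_norm M f)\<^sup>2"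
    by (simp add: L2_norm_power2 norm_mult power_mult_distrib)
  then show ?thesis
    by (metis L2_norm_nonneg mult_nonneg_nonneg norm_ge_zero power2_eq_iff_nonneg)
qed

text \<open>Nonnegativity of the squared norm of \<open>t f - p g\<close>, with \<open>p\<close> the
  inner product, for all real \<open>t\<close>. The factor \<open>p\<close> absorbs the phase, so
  real multipliers are enough.\<close>

lemma L2_Cauchy_Schwarz:
  assumes "f \<in> L2 M" "g \<in> L2 M"
  shows "cmod (L2_ip M f g) \<le> L2_norm M f * L2_norm M g"
proof -
  define p where "p = L2_ip M f g"
  have key: "0 \<le> (t * L2_norm M f)\<^sup>2 + (cmod p * L2_norm M g)\<^sup>2 - 2 * t * (cmod p)\<^sup>2" for t :: real
  proof -
    have "0 \<le> (L2_norm M (\<lambda>x. of_real t * f x + (- p) * g x))\<^sup>2" by simp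
    also have "\<dots> = t\<^sup>2 * (L2_norm M f)\<^sup>2 + (cmod p)\<^sup>2 * (L2_norm M g)\<^sup>2 + 2 * Re (of_real t * cnj (- p) * p)"
      unfolding L2_norm_add_power2[OF assms] p_def by simp
    also have "Re (of_real t * cnj (- p) * p) = - t * (cmod p)\<^sup>2"
      unfolding cmod_power2 by (simp add: power2_eq_square algebra_simps)
    finally show ?thesis by (simp add: power_mult_distrib)
  qed
  have "(cmod p)\<^sup>2 \<le> (L2_norm M f * L2_norm M g)\<^sup>2"
  proof (cases "p = 0")
    case True then show ?thesis by simp
  next
    case False
    then have P: "cmod p > 0" by simp
    show ?thesis
    proof (cases "L2_norm M f = 0")
      case True
      \<comment> \<open>Without a quadratic term the bound is affine in \<open>t\<close>; a value
        beyond half the squared norm of \<open>g\<close> makes it negative, which contradicts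
        \<open>p \<noteq> 0\<close>.\<close>
      have "0 \<le> (cmod p * L2_norm M g)\<^sup>2 - 2 * (((L2_norm M g)\<^sup>2 + 1) / 2) * (cmod p)\<^sup>2"
        using key[of "((L2_norm M g)\<^sup>2 + 1) / 2"] True by simp
      also have "\<dots> = - (cmod p)\<^sup>2" by (simp add: power_mult_distrib field_simps)
      finally show ?thesis using P by simp
    next
      case False
      define a where "a = L2_norm M f"
      have a: "a \<noteq> 0" using False a_def by simp
      \<comment> \<open>The minimizer of the quadratic in \<open>t\<close>.\<close>
      have "0 \<le> ((cmod p)\<^sup>2 / a\<^sup>2 * a)\<^sup>2 + (cmod p * L2_norm M g)\<^sup>2 - 2 * ((cmod p)\<^sup>2 / a\<^sup>2) * (cmod p)\<^sup>2"
        using key[of "(cmod p)\<^sup>2 / a\<^sup>2"] a_def by simp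
      also have "\<dots> = (cmod p)\<^sup>2 * ((L2_norm M g)\<^sup>2 - (cmod p)\<^sup>2 / a\<^sup>2)"
        using a by (simp add: power_mult_distrib field_simps power2_eq_square)
      finally have "0 \<le> (L2_norm M g)\<^sup>2 - (cmod p)\<^sup>2 / a\<^sup>2"
        using P by (simp add: zero_le_mult_iff)
      then show ?thesis using a by (simp add: field_simps power_mult_distrib a_def)
    qed
  qed
  then show ?thesis unfolding p_def
    by (meson L2_norm_nonneg mult_nonneg_nonneg power2_le_imp_le)
qed

lemma L2_norm_triangle:
  assumes "f \<in> L2 M" "g \<in> L2 M"
  shows "L2_norm M (\<lambda>x. f x + g x) \<le> L2_norm M f + L2_norm M g"
proof -
  have "(L2_norm M (\<lambda>x. f x + g x))\<^sup>2 = (L2_norm M f)\<^sup>2 + (L2_norm M g)\<^sup>2 + 2 * Re (L2_ip M f g)"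
    using L2_norm_add_power2[OF assms, of 1 1] by simp
  also have "\<dots> \<le> (L2_norm M f + L2_norm M g)\<^sup>2"
    using L2_Cauchy_Schwarz[OF assms] complex_Re_le_cmod[of "L2_ip M f g"] by (simp add: power2_sum)
  finally show ?thesis
    by (meson L2_norm_nonneg add_nonneg_nonneg power2_le_imp_le)
qed

lemma L2_norm_minus_commute: "L2_norm M (\<lambda>x. f x - g x) = L2_norm M (\<lambda>x. g x - f x)"
  unfolding L2_norm_def by (simp add: norm_minus_commute)

lemma L2_norm_triangle_diff:
  assumes "f \<in> L2 M" "g \<in> L2 M" "h \<in> L2 M"
  shows "L2_norm M (\<lambda>x. f x - h x) \<le> L2_norm M (\<lambda>x. f x - g x) + L2_norm M (\<lambda>x. g x - h x)"
  using L2_norm_triangle[OF L2_diff[OF assms(1,2)] L2_diff[OF assms(2,3)]] by simp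

lemma L2_norm_diff_ge:
  assumes "f \<in> L2 M" "g \<in> L2 M"
  shows "\<bar>L2_norm M f - L2_norm M g\<bar> \<le> L2_norm M (\<lambda>x. f x - g x)"
  using L2_norm_triangle_diff[OF assms L2_zero] L2_norm_triangle_diff[OF assms(2,1) L2_zero]
    L2_norm_minus_commute[of M f g] by simp

lemma L2_norm_cong_AE:
  assumes "f \<in> borel_measurable M" "g \<in> borel_measurable M" "AE x in M. f x = g x"
  shows "L2_norm M f = L2_norm M g"
  unfolding L2_norm_def using assms
  by (intro arg_cong[where f=sqrt] integral_cong_AE) (measurable, auto elim: AE_mp)

lemma L2_cong_AE:
  assumes "f \<in> borel_measurable M" "g \<in> L2 M" "AE x in M. f x = g x"
  shows "f \<in> L2 M"
proof -
  have "(\<integral>\<^sup>+x. ennreal ((cmod (f x))\<^sup>2) \<partial>M) = (\<integral>\<^sup>+x. ennreal ((cmod (g x))\<^sup>2) \<partial>M)"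
    using assms(3) by (intro nn_integral_cong_AE) auto
  with assms show ?thesis by (simp add: L2_iff_nn_integral)
qed

lemma L2_ip_cong_AE:
  assumes "f \<in> borel_measurable M" "f' \<in> borel_measurable M" "AE x in M. f x = f' x"
    and "g \<in> borel_measurable M" "g' \<in> borel_measurable M" "AE x in M. g x = g' x"
  shows "L2_ip M f g = L2_ip M f' g'"
  unfolding L2_ip_def using assms
  by (intro integral_cong_AE) (measurable, auto elim: AE_mp)

lemma L2_norm_eq_0_iff:
  assumes "f \<in> L2 M"
  shows "L2_norm M f = 0 \<longleftrightarrow> (AE x in M. f x = 0)"
  using integral_nonneg_eq_0_iff_AE[OF L2_integrable[OF assms]] by (simp add: L2_norm_def)

text \<open>The squared increments have integral at most \<open>(1/4)^n\<close>, so their sum with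
  weights \<open>2^n\<close> is still integrable and hence finite almost everywhere. There the
  increments are dominated by a geometric series of ratio \<open>sqrt (1/2)\<close>.\<close>

lemma L2_rapid_Cauchy_AE:
  assumes u: "\<And>n. u n \<in> L2 M" and b: "\<And>n. (L2_norm M (\<lambda>x. u (Suc n) x - u n x))\<^sup>2 \<le> (1/4)^n"
  shows "AE x in M. convergent (\<lambda>n. u n x)"
proof -
  note m[measurable] = L2_measurable[OF u]
  have "(\<integral>\<^sup>+x. (\<Sum>n. ennreal (2^n * (cmod (u (Suc n) x - u n x))\<^sup>2)) \<partial>M)
      = (\<Sum>n. \<integral>\<^sup>+x. ennreal (2^n * (cmod (u (Suc n) x - u n x))\<^sup>2) \<partial>M)"
    by (rule nn_integral_suminf) measurable
  also have "\<dots> \<le> (\<Sum>n. ennreal ((1/2)^n))"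
  proof (rule suminf_le)
    fix n
    have "(\<integral>\<^sup>+x. ennreal (2^n * (cmod (u (Suc n) x - u n x))\<^sup>2) \<partial>M)
      = ennreal (2^n) * (\<integral>\<^sup>+x. ennreal ((cmod (u (Suc n) x - u n x))\<^sup>2) \<partial>M)"
      by (subst nn_integral_cmult[symmetric]) (auto simp: ennreal_mult)
    also have "\<dots> = ennreal (2^n * (L2_norm M (\<lambda>x. u (Suc n) x - u n x))\<^sup>2)"
      by (subst nn_integral_L2_norm) (auto intro: L2_diff u simp: ennreal_mult)
    also have "\<dots> \<le> ennreal (2^n * (1/4)^n)"
      by (intro ennreal_leI mult_left_mono b) auto
    also have "2^n * (1/4)^n = ((1/2)^n :: real)"
      by (simp flip: power_mult_distrib)
    finally show "(\<integral>\<^sup>+x. ennreal (2^n * (cmod (u (Suc n) x - u n x))\<^sup>2) \<partial>M) \<le> ennreal ((1/2)^n)" .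
  qed auto
  also have "\<dots> = ennreal (\<Sum>n. (1/2)^n)"
    by (intro suminf_ennreal2) auto
  also have "\<dots> < \<infinity>" by simp
  finally have "AE x in M. (\<Sum>n. ennreal (2^n * (cmod (u (Suc n) x - u n x))\<^sup>2)) \<noteq> \<infinity>"
    by (intro nn_integral_PInf_AE) auto
  then show ?thesis
  proof eventually_elim
    case (elim x)
    then have "summable (\<lambda>n. 2^n * (cmod (u (Suc n) x - u n x))\<^sup>2)"
      by (intro summable_suminf_not_top) auto
    then have "(\<lambda>n. 2^n * (cmod (u (Suc n) x - u n x))\<^sup>2) \<longlonglongrightarrow> 0"
      by (rule summable_LIMSEQ_zero)
    then have "Bseq (\<lambda>n. 2^n * (cmod (u (Suc n) x - u n x))\<^sup>2)"
      by (intro convergent_imp_Bseq convergentI)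
    then obtain K where "\<forall>n. norm (2^n * (cmod (u (Suc n) x - u n x))\<^sup>2) \<le> K"
      by (rule BseqE)
    then have K: "norm (2^n * (cmod (u (Suc n) x - u n x))\<^sup>2) \<le> K" for n by blast
    have le: "cmod (u (Suc n) x - u n x) \<le> sqrt K * (sqrt (1/2))^n" for n
    proof (rule power2_le_imp_le)
      have "(cmod (u (Suc n) x - u n x))\<^sup>2 \<le> K * (1/2)^n"
        using K[of n] by (simp add: field_simps power_divide)
      also have "\<dots> = (sqrt K * (sqrt (1/2))^n)\<^sup>2"
      proof -
        have "(sqrt (1/2) ^ n)\<^sup>2 = ((sqrt (1/2))\<^sup>2) ^ n"
          by (metis power_mult mult.commute)
        then show ?thesis
          using order_trans[OF norm_ge_zero K[of 0]] by (simp add: power_mult_distrib)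
      qed
      finally show "(cmod (u (Suc n) x - u n x))\<^sup>2 \<le> (sqrt K * (sqrt (1/2))^n)\<^sup>2" .
      show "0 \<le> sqrt K * sqrt (1/2) ^ n" using order_trans[OF norm_ge_zero K[of 0]] by simp
    qed
    have sm: "summable (\<lambda>n. sqrt K * (sqrt (1/2))^n)"
      by (intro summable_mult summable_geometric) (auto simp: real_sqrt_divide)
    have "summable (\<lambda>n. u (Suc n) x - u n x)"
      by (rule summable_comparison_test'[OF sm, of 0]) (rule le)
    then have "convergent (\<lambda>n. \<Sum>i<n. u (Suc i) x - u i x)"
      by (simp add: summable_iff_convergent)
    then have "convergent (\<lambda>n. u n x - u 0 x)" by (simp add: sum_lessThan_telescope[of "\<lambda>n. u n x"])
    then have "convergent (\<lambda>n. (u n x - u 0 x) + u 0 x)" by (intro convergent_add convergent_const)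
    then show ?case by simp
  qed
qed

text \<open>The Riesz-Fischer theorem. The subsequence \<open>r\<close> belongs to the conclusion
  because the almost everywhere limit along it later identifies L2 limits with pointwise
  limits.\<close>

lemma L2_complete:
  assumes u: "\<And>n. u n \<in> L2 M"
    and C: "\<And>e. e > 0 \<Longrightarrow> \<exists>N. \<forall>m\<ge>N. \<forall>n\<ge>N. L2_norm M (\<lambda>x. u m x - u n x) < e"
  obtains f r where "f \<in> L2 M" "(\<lambda>n. L2_norm M (\<lambda>x. u n x - f x)) \<longlonglongrightarrow> 0"
    "strict_mono (r :: nat \<Rightarrow> nat)" "AE x in M. (\<lambda>n. u (r n) x) \<longlonglongrightarrow> f x"
proof -
  note m[measurable] = L2_measurable[OF u]
  have "\<forall>k. \<exists>N. \<forall>m\<ge>N. \<forall>n\<ge>N. L2_norm M (\<lambda>x. u m x - u n x) < (1/2)^k"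
    by (intro allI C) simp
  then obtain N where N: "\<And>k m n. m \<ge> N k \<Longrightarrow> n \<ge> N k \<Longrightarrow> L2_norm M (\<lambda>x. u m x - u n x) < (1/2)^k"
    by metis
  \<comment> \<open>\<open>Suc\<close> and \<open>max\<close> make \<open>r\<close> strictly
    increasing with \<open>r k \<ge> N k\<close>, so consecutive terms differ in norm by at most
    \<open>(1/2)^k\<close>.\<close>
  define r where "r = rec_nat (N 0) (\<lambda>k r. Suc (max r (N (Suc k))))"
  have rS: "r (Suc k) = Suc (max (r k) (N (Suc k)))" for k by (simp add: r_def)
  have rm: "strict_mono r" by (rule strict_mono_Suc_iff[THEN iffD2]) (auto simp: rS)
  have rN: "r k \<ge> N k" for k by (cases k) (auto simp: rS r_def)
  have "AE x in M. convergent (\<lambda>k. u (r k) x)"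
  proof (rule L2_rapid_Cauchy_AE)
    fix k
    have "L2_norm M (\<lambda>x. u (r (Suc k)) x - u (r k) x) \<le> (1/2)^k"
      using N[of k "r (Suc k)" "r k"] rN[of k] strict_monoD[OF rm, of k "Suc k"] by auto
    then have "(L2_norm M (\<lambda>x. u (r (Suc k)) x - u (r k) x))\<^sup>2 \<le> ((1/2)^k)\<^sup>2"
      by (intro power_mono L2_norm_nonneg)
    also have "\<dots> = ((1/2)\<^sup>2)^k" by (simp only: power_mult[symmetric] mult.commute)
    also have "\<dots> = (1/4)^k" by (simp add: power2_eq_square)
    finally show "(L2_norm M (\<lambda>x. u (r (Suc k)) x - u (r k) x))\<^sup>2 \<le> (1/4)^k" .
  qed (rule u)
  define f where "f = (\<lambda>x. lim (\<lambda>k. u (r k) x))"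
  have fm[measurable]: "f \<in> borel_measurable M" unfolding f_def by measurable
  have lim: "AE x in M. (\<lambda>k. u (r k) x) \<longlonglongrightarrow> f x"
    using \<open>AE x in M. convergent (\<lambda>k. u (r k) x)\<close>
    by eventually_elim (simp add: f_def convergent_LIMSEQ_iff)
  \<comment> \<open>Fatou's lemma in the second index turns the Cauchy estimate into a bound on the
    distance to the limit, and so also shows that this distance is finite.\<close>
  have nnb: "(\<integral>\<^sup>+x. ennreal ((cmod (u n x - f x))\<^sup>2) \<partial>M) \<le> (ennreal ((1/2)^k))\<^sup>2" if "n \<ge> N k" for n k
  proof -
    have "(\<integral>\<^sup>+x. ennreal ((cmod (u n x - f x))\<^sup>2) \<partial>M)
       = (\<integral>\<^sup>+x. liminf (\<lambda>j. ennreal ((cmod (u n x - u (r j) x))\<^sup>2)) \<partial>M)"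
    proof (rule nn_integral_cong_AE)
      show "AE x in M. ennreal ((cmod (u n x - f x))\<^sup>2) = liminf (\<lambda>j. ennreal ((cmod (u n x - u (r j) x))\<^sup>2))"
        using lim
      proof eventually_elim
        case (elim x)
        then have "(\<lambda>j. ennreal ((cmod (u n x - u (r j) x))\<^sup>2)) \<longlonglongrightarrow> ennreal ((cmod (u n x - f x))\<^sup>2)"
          by (intro tendsto_intros)
        from lim_imp_Liminf[OF _ this] show ?case by simp
      qed
    qed
    also have "\<dots> \<le> liminf (\<lambda>j. \<integral>\<^sup>+x. ennreal ((cmod (u n x - u (r j) x))\<^sup>2) \<partial>M)"
      by (rule nn_integral_liminf) measurable
    also have "\<dots> \<le> (ennreal ((1/2)^k))\<^sup>2"
    proof (rule Liminf_le[OF sequentially_bot])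
      show "eventually (\<lambda>j. (\<integral>\<^sup>+x. ennreal ((cmod (u n x - u (r j) x))\<^sup>2) \<partial>M) \<le> (ennreal ((1/2)^k))\<^sup>2) sequentially"
        using eventually_ge_at_top[of k]
      proof eventually_elim
        case (elim j)
        have "r j \<ge> N k"
          using rN[of k] strict_mono_leD[OF rm elim] by linarith
        then have "L2_norm M (\<lambda>x. u n x - u (r j) x) \<le> (1/2)^k"
          using N[of k n "r j"] that by auto
        then have "(L2_norm M (\<lambda>x. u n x - u (r j) x))\<^sup>2 \<le> ((1/2)^k)\<^sup>2"
          by (intro power_mono L2_norm_nonneg)
        then show ?case
          by (simp add: L2_diff ennreal_power nn_integral_L2_norm u)
      qed
    qed
    finally show ?thesis .
  qed
  have d: "(\<lambda>x. u n x - f x) \<in> L2 M" if "n \<ge> N k" for n k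
  proof -
    have "(ennreal ((1/2)^k))\<^sup>2 = ennreal (((1/2)^k)\<^sup>2)" by (rule ennreal_power) simp
    then have "(\<integral>\<^sup>+x. ennreal ((cmod (u n x - f x))\<^sup>2) \<partial>M) < \<infinity>"
      using le_less_trans[OF nnb[OF that], of \<infinity>] by (metis ennreal_less_top infinity_ennreal_def)
    then show ?thesis unfolding L2_iff_nn_integral by auto
  qed
  have f: "f \<in> L2 M"
    using L2_diff[OF u[of "N 0"] d[of 0 "N 0"]] by simp
  have le: "L2_norm M (\<lambda>x. u n x - f x) \<le> (1/2)^k" if "n \<ge> N k" for n k
  proof (rule power2_le_imp_le)
    have "ennreal ((L2_norm M (\<lambda>x. u n x - f x))\<^sup>2) \<le> ennreal (((1/2)^k)\<^sup>2)"
      using nnb[OF that] nn_integral_L2_norm[OF d[OF that]] by (simp add: ennreal_power)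
    then show "(L2_norm M (\<lambda>x. u n x - f x))\<^sup>2 \<le> ((1/2)^k)\<^sup>2" by (subst (asm) ennreal_le_iff) auto
  qed simp
  have "(\<lambda>n. L2_norm M (\<lambda>x. u n x - f x)) \<longlonglongrightarrow> 0"
  proof (rule LIMSEQ_I)
    fix e :: real assume "e > 0"
    then obtain k where "(1/2)^k < e" using real_arch_pow_inv[of e "1/2"] by auto
    then show "\<exists>no. \<forall>n\<ge>no. norm (L2_norm M (\<lambda>x. u n x - f x) - 0) < e"
      using le by (intro exI[of _ "N k"]) (auto simp: L2_norm_nonneg intro: le_less_trans)
  qed
  with f rm lim show thesis by (intro that)
qed

text \<open>A subsequence converges almost everywhere to the L2 limit, and along it the given
  pointwise limit must be the same.\<close>

lemma L2_limit_AE_unique: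
  assumes u: "\<And>n. u n \<in> L2 M" and f: "f \<in> L2 M" and l: "(\<lambda>n. L2_norm M (\<lambda>x. u n x - f x)) \<longlonglongrightarrow> 0"
    and g: "AE x in M. (\<lambda>n. u n x) \<longlonglongrightarrow> g x"
  shows "AE x in M. f x = g x"
proof -
  have C: "\<exists>N. \<forall>m\<ge>N. \<forall>n\<ge>N. L2_norm M (\<lambda>x. u m x - u n x) < e" if "e > 0" for e
  proof -
    have "e / 2 > 0" using that by simp
    from LIMSEQ_D[OF l this] obtain N where N: "\<And>n. n \<ge> N \<Longrightarrow> L2_norm M (\<lambda>x. u n x - f x) < e / 2"
      by (auto simp: L2_norm_nonneg)
    have "L2_norm M (\<lambda>x. u m x - u n x) < e" if "m \<ge> N" "n \<ge> N" for m n
      using L2_norm_triangle_diff[OF u[of m] f u[of n]] N[OF that(1)] N[OF that(2)]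
        L2_norm_minus_commute[of M f "u n"] by linarith
    then show ?thesis by blast
  qed
  obtain f' r where f': "f' \<in> L2 M" "(\<lambda>n. L2_norm M (\<lambda>x. u n x - f' x)) \<longlonglongrightarrow> 0"
    "strict_mono (r :: nat \<Rightarrow> nat)" "AE x in M. (\<lambda>n. u (r n) x) \<longlonglongrightarrow> f' x"
    by (rule L2_complete[OF u C])
  have "(\<lambda>n. L2_norm M (\<lambda>x. u n x - f x) + L2_norm M (\<lambda>x. u n x - f' x)) \<longlonglongrightarrow> 0 + 0"
    by (intro tendsto_add l f')
  then have "(\<lambda>n. L2_norm M (\<lambda>x. u n x - f x) + L2_norm M (\<lambda>x. u n x - f' x)) \<longlonglongrightarrow> 0" by simp
  then have "L2_norm M (\<lambda>x. f x - f' x) \<le> 0"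
    by (rule tendsto_lowerbound)
      (auto intro!: always_eventually simp: L2_norm_minus_commute[of M _ f] intro: L2_norm_triangle_diff f u f')
  then have "AE x in M. f x - f' x = 0"
    using L2_norm_eq_0_iff[OF L2_diff[OF f f'(1)]] L2_norm_nonneg[of M "\<lambda>x. f x - f' x"] by auto
  with f'(4) g show ?thesis
  proof eventually_elim
    case (elim x)
    from LIMSEQ_subseq_LIMSEQ[OF elim(2) f'(3)] elim(1) have "f' x = g x"
      by (intro LIMSEQ_unique) (auto simp: o_def)
    with elim show ?case by simp
  qed
qed

lemma tendsto_L2_norm:
  assumes "\<And>n. u n \<in> L2 M" "f \<in> L2 M" "((\<lambda>n. L2_norm M (\<lambda>x. u n x - f x)) \<longlongrightarrow> 0) F"
  shows "((\<lambda>n. L2_norm M (u n)) \<longlongrightarrow> L2_norm M f) F"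
proof -
  have "((\<lambda>n. L2_norm M (u n) - L2_norm M f) \<longlongrightarrow> 0) F"
    by (rule Lim_null_comparison[OF _ assms(3)]) (auto intro!: always_eventually L2_norm_diff_ge assms)
  then show ?thesis by (simp add: LIM_zero_iff)
qed

lemma tendsto_L2_ip:
  assumes "\<And>n. u n \<in> L2 M" "f \<in> L2 M" "g \<in> L2 M" "((\<lambda>n. L2_norm M (\<lambda>x. u n x - f x)) \<longlongrightarrow> 0) F"
  shows "((\<lambda>n. L2_ip M (u n) g) \<longlongrightarrow> L2_ip M f g) F"
proof -
  have "((\<lambda>n. L2_norm M (\<lambda>x. u n x - f x) * L2_norm M g) \<longlongrightarrow> 0) F"
    using tendsto_mult_right[OF assms(4), of "L2_norm M g"] by simp
  then have "((\<lambda>n. L2_ip M (u n) g - L2_ip M f g) \<longlongrightarrow> 0) F"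
    by (rule Lim_null_comparison[rotated])
      (auto intro!: always_eventually L2_Cauchy_Schwarz L2_diff assms simp flip: L2_ip_diff_left[OF assms(1,2,3)])
  then show ?thesis by (simp add: LIM_zero_iff)
qed

text \<open>\<open>K\<close> is a closed subspace of representatives. A minimizing sequence for the
  distance is Cauchy by the parallelogram law, and minimality makes the remainder orthogonal to
  \<open>K\<close>. The application is to the boundary functions of the range of the
  transform.\<close>

lemma L2_projection:
  assumes K: "K \<subseteq> L2 M" "K \<noteq> {}"
    and lin: "\<And>f g a b. f \<in> K \<Longrightarrow> g \<in> K \<Longrightarrow> (\<lambda>x. a * f x + b * g x) \<in> K"
    and closed: "\<And>u f. (\<And>n::nat. u n \<in> K) \<Longrightarrow> f \<in> L2 M \<Longrightarrow> (\<lambda>n. L2_norm M (\<lambda>x. u n x - f x)) \<longlonglongrightarrow> 0 \<Longrightarrow> f \<in> K"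
    and F: "F \<in> L2 M"
  obtains k where "k \<in> K" "\<And>g. g \<in> K \<Longrightarrow> L2_ip M (\<lambda>x. F x - k x) g = 0"
proof -
  define D where "D = (\<lambda>k. (L2_norm M (\<lambda>x. F x - k x))\<^sup>2) ` K"
  define d where "d = Inf D"
  have bdd: "bdd_below D" unfolding D_def by (intro bdd_belowI2[where m=0]) simp
  have dle: "d \<le> (L2_norm M (\<lambda>x. F x - k x))\<^sup>2" if "k \<in> K" for k
    unfolding d_def using bdd that by (intro cInf_lower) (auto simp: D_def)
  have "\<exists>k\<in>K. (L2_norm M (\<lambda>x. F x - k x))\<^sup>2 < d + 1 / real (Suc n)" for n
    using cInf_less_iff[of D "d + 1 / real (Suc n)"] bdd K(2) unfolding d_def D_def by auto
  then obtain k where k: "\<And>n. k n \<in> K" "\<And>n. (L2_norm M (\<lambda>x. F x - k n x))\<^sup>2 < d + 1 / real (Suc n)"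
    by metis
  have kL: "k n \<in> L2 M" for n using k(1) K(1) by blast
  have par: "(L2_norm M (\<lambda>x. k m x - k n x))\<^sup>2 \<le> 2 / real (Suc m) + 2 / real (Suc n)" for m n
  proof -
    let ?f = "\<lambda>x. F x - k m x" and ?g = "\<lambda>x. F x - k n x"
    have L: "?f \<in> L2 M" "?g \<in> L2 M" using F kL by (auto intro: L2_diff)
    have "(L2_norm M (\<lambda>x. k m x - k n x))\<^sup>2 + (L2_norm M (\<lambda>x. 2 * (F x - (1/2 * k m x + 1/2 * k n x))))\<^sup>2
        = 2 * (L2_norm M ?f)\<^sup>2 + 2 * (L2_norm M ?g)\<^sup>2"
      using L2_norm_add_power2[OF L, of "-1" 1] L2_norm_add_power2[OF L, of 1 1]
      by (simp add: algebra_simps)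
    \<comment> \<open>The midpoint of \<open>k m\<close> and \<open>k n\<close> lies in
      \<open>K\<close>, so its squared distance to \<open>F\<close> is at least \<open>d\<close>;
      the factor 2 inside the norm gives 4.\<close>
    moreover have "4 * d \<le> (L2_norm M (\<lambda>x. 2 * (F x - (1/2 * k m x + 1/2 * k n x))))\<^sup>2"
      using dle[OF lin[OF k(1)[of m] k(1)[of n], of "1/2" "1/2"]]
      by (simp only: L2_norm_scale power_mult_distrib) simp
    ultimately show ?thesis using k(2)[of m] k(2)[of n] by (simp add: algebra_simps)
  qed
  have C: "\<exists>N. \<forall>m\<ge>N. \<forall>n\<ge>N. L2_norm M (\<lambda>x. k m x - k n x) < e" if "e > 0" for e
  proof -
    obtain N where N: "4 / e\<^sup>2 < real N" using reals_Archimedean2 by blast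
    show ?thesis
    proof (intro exI allI impI)
      fix m n assume mn: "m \<ge> N" "n \<ge> N"
      have N0: "real N > 0" using N that by (smt (verit) divide_pos_pos zero_less_power)
      have "2 / real (Suc m) < 2 / real N" "2 / real (Suc n) < 2 / real N"
        using mn N0 by (auto intro!: divide_strict_left_mono mult_pos_pos)
      then have "(L2_norm M (\<lambda>x. k m x - k n x))\<^sup>2 < 4 / real N" using par[of m n] by linarith
      also have "\<dots> < e\<^sup>2" using N N0 that by (simp add: field_simps)
      finally show "L2_norm M (\<lambda>x. k m x - k n x) < e" using that by (meson less_eq_real_def power2_less_imp_less)
    qed
  qed
  obtain q r where q: "q \<in> L2 M" "(\<lambda>n. L2_norm M (\<lambda>x. k n x - q x)) \<longlonglongrightarrow> 0"
    "strict_mono (r :: nat \<Rightarrow> nat)" "AE x in M. (\<lambda>n. k (r n) x) \<longlonglongrightarrow> q x"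
    by (rule L2_complete[OF kL C])
  have qK: "q \<in> K" by (rule closed[OF k(1) q(1,2)])
  have "(\<lambda>n. (L2_norm M (\<lambda>x. F x - k n x))\<^sup>2) \<longlonglongrightarrow> (L2_norm M (\<lambda>x. F x - q x))\<^sup>2"
    using q(2) by (intro tendsto_intros tendsto_L2_norm L2_diff F kL q(1))
      (simp add: L2_norm_minus_commute[of M q])
  moreover have "(\<lambda>n. d + 1 / real (Suc n)) \<longlonglongrightarrow> d + 0"
    by (intro tendsto_intros LIMSEQ_Suc[OF lim_1_over_n])
  ultimately have qd: "(L2_norm M (\<lambda>x. F x - q x))\<^sup>2 \<le> d"
    using k(2) by (intro LIMSEQ_le) (auto intro: less_imp_le)
  have "L2_ip M (\<lambda>x. F x - q x) g = 0" if g: "g \<in> K" for g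
  proof -
    let ?f = "\<lambda>x. F x - q x"
    have L: "?f \<in> L2 M" "g \<in> L2 M" using F q(1) g K(1) by (auto intro: L2_diff)
    define p where "p = L2_ip M ?f g"
    \<comment> \<open>A step of this length from \<open>q\<close> in the direction
      \<open>p g\<close> would come strictly closer to \<open>F\<close> unless
      \<open>p = 0\<close>.\<close>
    define t where "t = 1 / ((L2_norm M g)\<^sup>2 + 1)"
    have t: "t > 0" unfolding t_def by (simp add: add_nonneg_pos)
    have "d \<le> (L2_norm M (\<lambda>x. F x - (1 * q x + (of_real t * p) * g x)))\<^sup>2"
      by (rule dle[OF lin[OF qK g]])
    also have "(\<lambda>x. F x - (1 * q x + (of_real t * p) * g x)) = (\<lambda>x. 1 * (F x - q x) + (- of_real t * p) * g x)"
      by auto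
    also have "(L2_norm M \<dots>)\<^sup>2 = (L2_norm M ?f)\<^sup>2 + (t * cmod p)\<^sup>2 * (L2_norm M g)\<^sup>2 + 2 * Re (cnj (- of_real t * p) * p)"
      using t by (subst L2_norm_add_power2[OF L]) (simp add: p_def norm_mult)
    also have "Re (cnj (- of_real t * p) * p) = - t * (cmod p)\<^sup>2"
      unfolding cmod_power2 by (simp add: power2_eq_square algebra_simps)
    finally have "0 \<le> t * (cmod p)\<^sup>2 * (t * (L2_norm M g)\<^sup>2 - 2)"
      using qd by (simp add: algebra_simps power2_eq_square)
    moreover have "t * (L2_norm M g)\<^sup>2 - 2 < 0"
      unfolding t_def by (simp add: divide_less_eq add_nonneg_pos)
    ultimately have "cmod p = 0" using t
      by (smt (verit) mult_nonneg_nonneg mult_pos_neg zero_le_power2 mult_pos_pos power_eq_0_iff zero_less_power2)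
    then show ?thesis by (simp add: p_def)
  qed
  with qK show thesis by (rule that)
qed

section \<open>Shifting vertical lines and the Poisson formula\<close>

lemma borel_measurable_Complex [measurable (raw)]:
  assumes [measurable]: "f \<in> borel_measurable M" "g \<in> borel_measurable M"
  shows "(\<lambda>x. Complex (f x) (g x)) \<in> borel_measurable M"
  unfolding Complex_eq by measurable

lemma nn_integral_inverse_square_plus:
  fixes d t :: real
  assumes d: "d > 0"
  shows "(\<integral>\<^sup>+y. ennreal (1 / (d\<^sup>2 + (y - t)\<^sup>2)) \<partial>lborel) = ennreal (pi / d)"
proof -
  let ?f = "\<lambda>y::real. 1 / (d\<^sup>2 + y\<^sup>2)"
  have pos: "d\<^sup>2 + y\<^sup>2 > 0" for y using d by (simp add: add_pos_nonneg)
  have half: "(\<integral>\<^sup>+y. ennreal (?f y) * indicator {0..} y \<partial>lborel) = ennreal (pi / 2 / d - arctan (0 / d) / d)"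
  proof (rule nn_integral_FTC_atLeast)
    fix y
    have "1 + (y / d)\<^sup>2 = (d\<^sup>2 + y\<^sup>2) / d\<^sup>2"
      using d by (simp add: power_divide add_divide_distrib)
    then have "inverse (1 + (y / d)\<^sup>2) * (1 / d) / d = ?f y"
      using d by (simp add: power2_eq_square)
    moreover have "DERIV (\<lambda>y. arctan (y / d) / d) y :> inverse (1 + (y / d)\<^sup>2) * (1 / d) / d"
      using d by (auto intro!: derivative_eq_intros)
    ultimately show "DERIV (\<lambda>y. arctan (y / d) / d) y :> ?f y" by simp
    show "0 \<le> ?f y" using pos[of y] by simp
  next
    have "filterlim (\<lambda>y. y / d) at_top at_top"
      using d by real_asymp
    then have "((\<lambda>y. arctan (y / d)) \<longlongrightarrow> pi / 2) at_top"
      by (rule filterlim_compose[OF tendsto_arctan_at_top])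
    then show "((\<lambda>y. arctan (y / d) / d) \<longlongrightarrow> pi / 2 / d) at_top"
      using d by (intro tendsto_intros) auto
  qed measurable
  have "(\<integral>\<^sup>+y. ennreal (?f y) \<partial>lborel)
      = (\<integral>\<^sup>+y. ennreal (?f y) * indicator {0..} y + ennreal (?f y) * indicator {..0} y \<partial>lborel)"
    using AE_lborel_singleton[of "0::real"] by (intro nn_integral_cong_AE) (auto simp: indicator_def)
  also have "\<dots> = (\<integral>\<^sup>+y. ennreal (?f y) * indicator {0..} y \<partial>lborel) + (\<integral>\<^sup>+y. ennreal (?f y) * indicator {..0} y \<partial>lborel)"
    by (rule nn_integral_add) measurable
  also have "(\<integral>\<^sup>+y. ennreal (?f y) * indicator {..0} y \<partial>lborel) = (\<integral>\<^sup>+y. ennreal (?f y) * indicator {0..} y \<partial>lborel)"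
    by (subst nn_integral_real_affine[where c="-1" and t=0]) (auto intro!: nn_integral_cong simp: indicator_def)
  also have "(\<integral>\<^sup>+y. ennreal (?f y) * indicator {0..} y \<partial>lborel) + (\<integral>\<^sup>+y. ennreal (?f y) * indicator {0..} y \<partial>lborel)
     = ennreal (pi / d)"
    using d unfolding half by (simp flip: ennreal_plus)
  finally have *: "(\<integral>\<^sup>+y. ennreal (?f y) \<partial>lborel) = ennreal (pi / d)" .
  show ?thesis
    by (subst nn_integral_real_affine[where c=1 and t=t]) (use * in auto)
qed

lemma integrable_inverse_square_plus:
  fixes d t :: real
  assumes "d > 0"
  shows "integrable lborel (\<lambda>y. 1 / (d\<^sup>2 + (y - t)\<^sup>2))"
    and "(\<integral>y. 1 / (d\<^sup>2 + (y - t)\<^sup>2) \<partial>lborel) = pi / d"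
proof -
  have nn: "0 \<le> 1 / (d\<^sup>2 + (y - t)\<^sup>2)" for y by simp
  show "integrable lborel (\<lambda>y. 1 / (d\<^sup>2 + (y - t)\<^sup>2))"
    using nn_integral_inverse_square_plus[OF assms, of t]
    by (intro integrableI_nonneg) (auto intro!: AE_I2)
  show "(\<integral>y. 1 / (d\<^sup>2 + (y - t)\<^sup>2) \<partial>lborel) = pi / d"
    using nn_integral_inverse_square_plus[OF assms, of t] assms
    by (intro integral_eq_nn_integral[THEN trans]) (auto intro!: AE_I2)
qed

lemma has_vector_derivative_Complex:
  "((\<lambda>y. Complex x y) has_vector_derivative \<i>) (at y within A)"
  "((\<lambda>x. Complex x y) has_vector_derivative 1) (at x within A)"
  unfolding Complex_eq
  by (auto intro!: derivative_eq_intros simp: has_vector_derivative_def scaleR_conv_of_real)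

text \<open>Both signs are treated at once because the two horizontal sides of a rectangle must be
  small at the same height. If the sum stayed above \<open>e\<close> beyond \<open>b\<close>, an
  interval of length \<open>L\<close> with \<open>e * L = 2 * I + 1\<close> would already carry more
  than the total \<open>2 * I\<close>.\<close>

lemma exists_large_small_value:
  fixes W :: "real \<Rightarrow> ennreal"
  assumes [measurable]: "W \<in> borel_measurable borel" and fin: "(\<integral>\<^sup>+y. W y \<partial>lborel) < \<infinity>" and e: "e > 0"
  shows "\<exists>Y\<ge>b. W Y + W (- Y) < ennreal e"
proof (rule ccontr)
  assume "\<not> ?thesis"
  then have *: "ennreal e \<le> W Y + W (- Y)" if "Y \<ge> b" for Y using that by (auto simp: not_less)
  define I where "I = enn2real (\<integral>\<^sup>+y. W y \<partial>lborel)"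
  have I: "(\<integral>\<^sup>+y. W y \<partial>lborel) = ennreal I" "I \<ge> 0" using fin by (auto simp: I_def less_top)
  define L where "L = (2 * I + 1) / e"
  have L: "L \<ge> 0" "e * L = 2 * I + 1" using e I by (auto simp: L_def)
  have "ennreal (2 * I + 1) = ennreal e * ennreal L"
    using e L by (simp flip: ennreal_mult)
  also have "\<dots> = ennreal e * emeasure lborel {b..b + L}" using L by simp
  also have "\<dots> = (\<integral>\<^sup>+Y. ennreal e * indicator {b..b + L} Y \<partial>lborel)" by (simp add: nn_integral_cmult_indicator)
  also have "\<dots> \<le> (\<integral>\<^sup>+Y. W Y + W (- Y) \<partial>lborel)"
    using * by (intro nn_integral_mono) (auto simp: indicator_def)
  also have "\<dots> = (\<integral>\<^sup>+Y. W Y \<partial>lborel) + (\<integral>\<^sup>+Y. W (- Y) \<partial>lborel)" by (rule nn_integral_add) measurable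
  also have "(\<integral>\<^sup>+Y. W (- Y) \<partial>lborel) = ennreal I"
    using nn_integral_real_affine[of W "-1" 0] I by simp
  also note I(1)
  also have "ennreal I + ennreal I = ennreal (2 * I)" using I by (simp flip: ennreal_plus)
  finally show False using I by simp
qed

text \<open>Cauchy's theorem on rectangles with vertical sides on \<open>Re z = a\<close> and
  \<open>Re z = b\<close>; a primitive on the convex set \<open>S\<close> makes it a telescoping
  identity. Integrability over the strip need not make the horizontal sides small at all heights,
  but it does so along a sequence \<open>Y n\<close>, and this suffices.\<close>

lemma line_integral_shift:
  fixes H :: "complex \<Rightarrow> complex"
  assumes ab: "a < b" and S: "convex S" "open S" "{z. a \<le> Re z \<and> Re z \<le> b} \<subseteq> S"
    and holo: "H holomorphic_on S"
    and strip: "(\<integral>\<^sup>+x. (\<integral>\<^sup>+y. ennreal (cmod (H (Complex x y))) \<partial>lborel) * indicator {a..b} x \<partial>lborel) < \<infinity>"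
    and int: "integrable lborel (\<lambda>y. H (Complex a y))" "integrable lborel (\<lambda>y. H (Complex b y))"
  shows "(\<integral>y. H (Complex a y) \<partial>lborel) = (\<integral>y. H (Complex b y) \<partial>lborel)"
proof -
  \<comment> \<open>Extension by zero outside \<open>S\<close> gives a Borel function on the whole
    plane, to which Fubini applies.\<close>
  define G where "G z = indicator S z *\<^sub>R H z" for z
  have G[measurable]: "G \<in> borel_measurable borel"
    unfolding G_def using S(2) holomorphic_on_imp_continuous_on[OF holo]
    by (intro borel_measurable_continuous_on_indicator) auto
  have GH: "G (Complex x y) = H (Complex x y)" if "x \<in> {a..b}" for x y
    using subsetD[OF S(3), of "Complex x y"] that by (simp add: G_def)
  define W where "W Y = (\<integral>\<^sup>+x. ennreal (cmod (G (Complex x Y))) * indicator {a..b} x \<partial>lborel)" for Y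
  have Wm[measurable]: "W \<in> borel_measurable borel" unfolding W_def by measurable
  have "(\<integral>\<^sup>+Y. W Y \<partial>lborel) = (\<integral>\<^sup>+x. (\<integral>\<^sup>+Y. ennreal (cmod (G (Complex x Y))) * indicator {a..b} x \<partial>lborel) \<partial>lborel)"
    unfolding W_def by (rule lborel_pair.Fubini') measurable
  also have "\<dots> = (\<integral>\<^sup>+x. (\<integral>\<^sup>+y. ennreal (cmod (H (Complex x y))) \<partial>lborel) * indicator {a..b} x \<partial>lborel)"
    by (intro nn_integral_cong) (auto simp: indicator_def GH)
  finally have Wfin: "(\<integral>\<^sup>+Y. W Y \<partial>lborel) < \<infinity>" using strip by simp
  obtain P where P: "\<And>z. z \<in> S \<Longrightarrow> (P has_field_derivative H z) (at z within S)"
    using holomorphic_convex_primitive'[OF S(1,2) holo] by blast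
  then have P: "\<And>z. z \<in> S \<Longrightarrow> (P has_field_derivative H z) (at z)"
    using S(2) by (metis at_within_open)
  have inS: "Complex x y \<in> S" if "x \<in> {a..b}" for x y
    using subsetD[OF S(3), of "Complex x y"] that by simp
  have cont: "continuous_on A (\<lambda>y. H (Complex x y))" if "x \<in> {a..b}" for x A
    using inS[OF that] unfolding Complex_eq
    by (intro continuous_on_compose2[OF holomorphic_on_imp_continuous_on[OF holo]] continuous_intros) auto
  have conth: "continuous_on {a..b} (\<lambda>x. H (Complex x y))" for y
    using inS unfolding Complex_eq
    by (intro continuous_on_compose2[OF holomorphic_on_imp_continuous_on[OF holo]] continuous_intros) auto
  have V: "\<i> * (LINT y:{-Y..Y}|lborel. H (Complex x y)) = P (Complex x Y) - P (Complex x (- Y))"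
    if "x \<in> {a..b}" "Y \<ge> 0" for x Y
  proof -
    have "((\<lambda>y. \<i> * H (Complex x y)) has_integral (P (Complex x Y) - P (Complex x (- Y)))) {-Y..Y}"
    proof (rule fundamental_theorem_of_calculus)
      show "- Y \<le> Y" using that by simp
      fix y
      show "((\<lambda>y. P (Complex x y)) has_vector_derivative \<i> * H (Complex x y)) (at y within {- Y..Y})"
        using field_vector_diff_chain_at[OF has_vector_derivative_Complex(1) P[OF inS[OF that(1)]]]
        by (auto simp: o_def intro: has_vector_derivative_at_within)
    qed
    moreover have si: "set_integrable lborel {-Y..Y} (\<lambda>y. \<i> * H (Complex x y))"
      by (intro borel_integrable_atLeastAtMost' continuous_intros cont that)
    ultimately have "(LINT y:{-Y..Y}|lborel. \<i> * H (Complex x y)) = P (Complex x Y) - P (Complex x (- Y))"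
      using set_borel_integral_eq_integral(2)[OF si] by (metis integral_unique)
    then show ?thesis by simp
  qed
  have Hb: "ennreal (cmod (P (Complex b Y) - P (Complex a Y))) \<le> W Y" for Y
  proof -
    have hi: "((\<lambda>x. H (Complex x Y)) has_integral (P (Complex b Y) - P (Complex a Y))) {a..b}"
    proof (rule fundamental_theorem_of_calculus)
      show "a \<le> b" using ab by simp
      fix x assume "x \<in> {a..b}"
      then show "((\<lambda>x. P (Complex x Y)) has_vector_derivative H (Complex x Y)) (at x within {a..b})"
        using field_vector_diff_chain_at[OF has_vector_derivative_Complex(2) P[OF inS]]
        by (auto simp: o_def intro: has_vector_derivative_at_within)
    qed
    have si: "set_integrable lborel {a..b} (\<lambda>x. H (Complex x Y))"
      by (intro borel_integrable_atLeastAtMost' conth)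
    have "P (Complex b Y) - P (Complex a Y) = (LINT x:{a..b}|lborel. H (Complex x Y))"
      using set_borel_integral_eq_integral(2)[OF si] hi by (simp add: integral_unique)
    then have "ennreal (cmod (P (Complex b Y) - P (Complex a Y)))
      \<le> (\<integral>\<^sup>+x. ennreal (norm (indicator {a..b} x *\<^sub>R H (Complex x Y))) \<partial>lborel)"
      using integral_norm_bound_ennreal[OF si[unfolded set_integrable_def]]
      by (simp only: set_lebesgue_integral_def)
    also have "\<dots> = W Y" unfolding W_def
      by (intro nn_integral_cong) (auto simp: indicator_def GH)
    finally show ?thesis .
  qed
  have "\<exists>Y\<ge>real n. W Y + W (- Y) < ennreal (1 / real (Suc n))" for n
    by (rule exists_large_small_value) (use Wfin in auto)
  then obtain Y where Y: "\<And>n. Y n \<ge> real n" "\<And>n. W (Y n) + W (- Y n) < ennreal (1 / real (Suc n))"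
    by metis
  have Y0: "Y n \<ge> 0" for n using Y(1)[of n] by (meson of_nat_0_le_iff order_trans)
  have Ytop: "filterlim Y at_top sequentially"
    by (rule filterlim_at_top_mono[OF filterlim_real_sequentially]) (auto simp: Y)
  have lim: "(\<lambda>n. LINT y:{-Y n..Y n}|lborel. H (Complex x y)) \<longlonglongrightarrow> (\<integral>y. H (Complex x y) \<partial>lborel)"
    if i: "integrable lborel (\<lambda>y. H (Complex x y))" for x
    unfolding set_lebesgue_integral_def
  proof (rule integral_dominated_convergence[where w="\<lambda>y. cmod (H (Complex x y))"])
    show "AE y in lborel. (\<lambda>n. indicator {- Y n..Y n} y *\<^sub>R H (Complex x y)) \<longlonglongrightarrow> H (Complex x y)"
    proof (rule AE_I2, rule tendsto_eventually)
      fix y :: real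
      have "eventually (\<lambda>n. Y n \<ge> \<bar>y\<bar>) sequentially" using Ytop by (simp add: filterlim_at_top)
      then show "\<forall>\<^sub>F n in sequentially. indicator {- Y n..Y n} y *\<^sub>R H (Complex x y) = H (Complex x y)"
        by eventually_elim (auto simp: indicator_def)
    qed
  qed (use i in \<open>auto intro!: AE_I2 simp: indicator_def\<close>)
  have "(\<lambda>n. (LINT y:{-Y n..Y n}|lborel. H (Complex b y)) - (LINT y:{-Y n..Y n}|lborel. H (Complex a y))) \<longlonglongrightarrow> 0"
  proof (rule Lim_null_comparison)
    show "\<forall>\<^sub>F n in sequentially. norm ((LINT y:{-Y n..Y n}|lborel. H (Complex b y)) - (LINT y:{-Y n..Y n}|lborel. H (Complex a y))) \<le> 1 / real (Suc n)"
    proof (rule always_eventually, rule allI)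
      fix n
      let ?D = "(LINT y:{-Y n..Y n}|lborel. H (Complex b y)) - (LINT y:{-Y n..Y n}|lborel. H (Complex a y))"
      have "\<i> * ?D = (P (Complex b (Y n)) - P (Complex a (Y n))) - (P (Complex b (- Y n)) - P (Complex a (- Y n)))"
        using V[of b "Y n"] V[of a "Y n"] ab Y0[of n] by (simp add: algebra_simps)
      then have "norm ?D \<le> cmod (P (Complex b (Y n)) - P (Complex a (Y n))) + cmod (P (Complex b (- Y n)) - P (Complex a (- Y n)))"
        using norm_triangle_ineq4 by (metis mult_1 norm_ii norm_mult)
      then have "ennreal (norm ?D) \<le> ennreal (cmod (P (Complex b (Y n)) - P (Complex a (Y n)))) + ennreal (cmod (P (Complex b (- Y n)) - P (Complex a (- Y n))))"
        by (simp flip: ennreal_plus)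
      also have "\<dots> \<le> W (Y n) + W (- Y n)" by (intro add_mono Hb)
      also have "\<dots> \<le> ennreal (1 / real (Suc n))" using Y(2)[of n] by simp
      finally show "norm ?D \<le> 1 / real (Suc n)" by (subst (asm) ennreal_le_iff) auto
    qed
    show "(\<lambda>n. 1 / real (Suc n)) \<longlonglongrightarrow> 0" by (rule LIMSEQ_Suc[OF lim_1_over_n])
  qed
  moreover have "(\<lambda>n. (LINT y:{-Y n..Y n}|lborel. H (Complex b y)) - (LINT y:{-Y n..Y n}|lborel. H (Complex a y)))
     \<longlonglongrightarrow> (\<integral>y. H (Complex b y) \<partial>lborel) - (\<integral>y. H (Complex a y) \<partial>lborel)"
    by (intro tendsto_diff lim int)
  ultimately show ?thesis using LIMSEQ_unique by fastforce
qed

lemma line_measurable: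
  assumes "F holomorphic_on right_half_plane" "x > 0"
  shows "(\<lambda>y. F (Complex x y)) \<in> borel_measurable borel"
proof (rule borel_measurable_continuous_onI)
  show "continuous_on UNIV (\<lambda>y. F (Complex x y))"
    unfolding Complex_eq using assms(2)
    by (intro continuous_on_compose2[OF holomorphic_on_imp_continuous_on[OF assms(1)]] continuous_intros)
      (auto simp: right_half_plane_def)
qed

lemma open_right_half_plane: "open right_half_plane"
  unfolding right_half_plane_def by (simp add: open_halfspace_Re_gt)

text \<open>The hypothesis covers bounded functions as well as members of \<open>H2\<close>.\<close>

lemma Poisson_formula_line:
  assumes F: "F holomorphic_on right_half_plane" and a: "a > 0" and w: "Re w > a"
    and C: "\<And>x. x \<ge> a \<Longrightarrow> (\<integral>\<^sup>+y. ennreal ((cmod (F (Complex x y)))\<^sup>2 / (1 + (y - Im w)\<^sup>2)) \<partial>lborel) \<le> ennreal C"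
  shows "F w = (\<integral>y. F (Complex a y) * of_real ((Re w - a) / (pi * ((Re w - a)\<^sup>2 + (y - Im w)\<^sup>2))) \<partial>lborel)"
proof -
  define d where "d = Re w - a"
  define t where "t = Im w"
  \<comment> \<open>The reflection of \<open>w\<close> in the line \<open>Re z = a\<close>. On that
    line \<open>1 / (z - w) - 1 / (z - w')\<close> is, up to a constant, the Poisson kernel of
    \<open>w\<close>.\<close>
  define w' where "w' = w - of_real (2 * d)"
  have d: "d > 0" using w d_def by simp
  \<comment> \<open>Subtracting \<open>F w\<close> removes the pole at \<open>w\<close>, and the
    pole at \<open>w'\<close> lies left of the line. So the integral of \<open>H\<close> can be
    pushed to infinity and vanishes; its vanishing is the formula.\<close>
  define D where "D = (\<lambda>z. if z = w then deriv F w else (F z - F w) / (z - w))"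
  define H where "H z = D z * (of_real (2 * d) / (z - w'))" for z
  have D: "D holomorphic_on right_half_plane"
    unfolding D_def by (rule pole_lemma_open[OF F open_right_half_plane])
  define S where "S = {z. Re z > max 0 (a - d)}"
  have S: "convex S" "open S" "S \<subseteq> right_half_plane"
    unfolding S_def right_half_plane_def
    by (auto simp: Collect_conj_eq intro!: convex_Int open_Int convex_halfspace_Re_gt open_halfspace_Re_gt)
  have strS: "{z. x \<le> Re z \<and> Re z \<le> b} \<subseteq> S" if "x \<ge> a" for x b
    using that a d by (auto simp: S_def)
  have Rw': "Re w' = a - d" "Im w' = t" unfolding w'_def d_def t_def by (auto simp: algebra_simps)
  have Rw: "Re w = a + d" "Im w = t" unfolding d_def t_def by auto
  have holH: "H holomorphic_on S"
    unfolding H_def using Rw'(1)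
    by (intro holomorphic_intros holomorphic_on_subset[OF D S(3)]) (auto simp: S_def)
  have n1: "(cmod (z - w'))\<^sup>2 = (Re z - a + d)\<^sup>2 + (Im z - t)\<^sup>2" for z
    by (simp add: cmod_power2 Rw' algebra_simps)
  have n2: "(cmod (z - w))\<^sup>2 = (Re z - a - d)\<^sup>2 + (Im z - t)\<^sup>2" for z
    by (simp add: cmod_power2 Rw algebra_simps)
  have n12: "cmod (z - w) \<le> cmod (z - w')" if "Re z \<ge> a" for z
  proof (rule power2_le_imp_le)
    have "(Re z - a + d)\<^sup>2 - (Re z - a - d)\<^sup>2 = 4 * d * (Re z - a)"
      by (simp add: power2_eq_square algebra_simps)
    also have "\<dots> \<ge> 0" using that d by simp
    finally show "(cmod (z - w))\<^sup>2 \<le> (cmod (z - w'))\<^sup>2" unfolding n1 n2 by simp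
  qed simp
  have w'ge: "d \<le> cmod (z - w')" if "Re z \<ge> a" for z
    using that d complex_Re_le_cmod[of "z - w'"] Rw' by simp
  have u: "\<bar>Im z - t\<bar> \<le> cmod (z - w)" for z
    using abs_Im_le_cmod[of "z - w"] Rw by simp
  \<comment> \<open>Near the height of \<open>w\<close> compactness bounds \<open>D\<close>.
    Elsewhere the two denominators supply the decay \<open>1 / (1 + (y - t)^2)\<close>, and
    \<open>cmod (F z) \<le> 1 + (cmod (F z))^2\<close> leads back to the quantity in the
    hypothesis.\<close>
  have HB: "\<exists>A\<ge>0. \<forall>x\<in>{a..b}. \<forall>y. cmod (H (Complex x y)) \<le> (A + 4 * d * (cmod (F (Complex x y)))\<^sup>2) / (1 + (y - t)\<^sup>2)" for b
  proof -
    define K where "K = cbox (Complex a (t - 1)) (Complex b (t + 1))"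
    have "K \<subseteq> right_half_plane" using a by (auto simp: K_def in_cbox_complex_iff right_half_plane_def)
    then have "continuous_on K D"
      using holomorphic_on_imp_continuous_on[OF D] continuous_on_subset by blast
    then have "bounded (D ` K)" by (intro compact_imp_bounded compact_continuous_image) (auto simp: K_def)
    then obtain B where B: "B > 0" "\<And>z. z \<in> K \<Longrightarrow> cmod (D z) \<le> B"
      unfolding bounded_pos by auto
    define A where "A = 4 * B + 4 * d * (1 + cmod (F w))"
    have "cmod (H z) \<le> (A + 4 * d * (cmod (F z))\<^sup>2) / (1 + (Im z - t)\<^sup>2)" if z: "Re z \<in> {a..b}" for z
    proof (cases "\<bar>Im z - t\<bar> \<le> 1")
      case True
      then have "z \<in> K" using z by (auto simp: K_def in_cbox_complex_iff)
      then have "cmod (D z) * (2 * d / cmod (z - w')) \<le> B * (2 * d / d)"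
        using w'ge[of z] z d B by (intro mult_mono divide_left_mono mult_pos_pos B) auto
      then have "cmod (H z) \<le> B * (2 * d / d)"
        unfolding H_def using d by (simp add: norm_mult norm_divide)
      then have 1: "cmod (H z) \<le> 2 * B" using d by simp
      have "(Im z - t)\<^sup>2 \<le> 1" using True by (simp add: abs_square_le_1)
      then have "cmod (H z) * (1 + (Im z - t)\<^sup>2) \<le> (2 * B) * 2"
        using 1 B by (intro mult_mono) auto
      also have "\<dots> \<le> A + 4 * d * (cmod (F z))\<^sup>2" unfolding A_def using d by simp
      finally show ?thesis by (simp add: le_divide_eq add_pos_nonneg)
    next
      case False
      then have zw: "cmod (z - w) > 0" "z \<noteq> w" using u[of z] by auto
      have pos: "cmod (z - w) * cmod (z - w') > 0" using zw n12[of z] z by (auto intro!: mult_pos_pos)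
      have "1\<^sup>2 \<le> \<bar>Im z - t\<bar>\<^sup>2" using False by (intro power_mono) auto
      then have "1 \<le> (Im z - t)\<^sup>2" by simp
      then have "1 + (Im z - t)\<^sup>2 \<le> 2 * \<bar>Im z - t\<bar>\<^sup>2" by simp
      also have "\<dots> \<le> 2 * (cmod (z - w) * cmod (z - w'))"
        unfolding power2_eq_square using u[of z] n12[of z] z by (intro mult_left_mono mult_mono) auto
      finally have q: "1 + (Im z - t)\<^sup>2 \<le> 2 * (cmod (z - w) * cmod (z - w'))" .
      have f: "cmod (F z) \<le> 1 + (cmod (F z))\<^sup>2"
        using sum_squares_bound[of "cmod (F z)" 1] norm_ge_zero[of "F z"] zero_le_power2[of "cmod (F z)"] by (simp; linarith)
      have "cmod (H z) * (1 + (Im z - t)\<^sup>2) = 2 * d * cmod (F z - F w) * (1 + (Im z - t)\<^sup>2) / (cmod (z - w) * cmod (z - w'))"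
        unfolding H_def D_def using zw d by (simp add: norm_mult norm_divide)
      also have "\<dots> \<le> 2 * d * cmod (F z - F w) * (2 * (cmod (z - w) * cmod (z - w'))) / (cmod (z - w) * cmod (z - w'))"
        using q pos d by (intro divide_right_mono mult_left_mono) auto
      also have "\<dots> = 4 * d * cmod (F z - F w)" using pos less_imp_neq[OF pos] by (simp del: mult_eq_0_iff)
      also have "\<dots> \<le> 4 * d * (cmod (F z) + cmod (F w))"
        using d by (intro mult_left_mono norm_triangle_ineq4) auto
      also have "\<dots> \<le> 4 * d * (1 + (cmod (F z))\<^sup>2 + cmod (F w))"
        using d f by (intro mult_left_mono) auto
      also have "\<dots> \<le> A + 4 * d * (cmod (F z))\<^sup>2" unfolding A_def using B(1) by (simp add: algebra_simps)
      finally show ?thesis by (simp add: le_divide_eq add_pos_nonneg)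
    qed
    from this[of "Complex _ _"] show ?thesis using B d by (intro exI[of _ A]) (auto simp: A_def)
  qed
  have nnH: "\<exists>A. \<forall>x\<in>{a..b}. (\<integral>\<^sup>+y. ennreal (cmod (H (Complex x y))) \<partial>lborel) \<le> ennreal A" for b
  proof -
    obtain A where A: "A \<ge> 0" "\<And>x y. x\<in>{a..b} \<Longrightarrow> cmod (H (Complex x y)) \<le> (A + 4 * d * (cmod (F (Complex x y)))\<^sup>2) / (1 + (y - t)\<^sup>2)"
      using HB[of b] by blast
    show ?thesis
    proof (intro exI ballI)
      fix x assume x: "x \<in> {a..b}"
      note [measurable] = line_measurable[OF F, of x]
      have "(\<integral>\<^sup>+y. ennreal (cmod (H (Complex x y))) \<partial>lborel)
        \<le> (\<integral>\<^sup>+y. ennreal A * ennreal (1 / (1\<^sup>2 + (y - t)\<^sup>2)) + ennreal (4 * d) * ennreal ((cmod (F (Complex x y)))\<^sup>2 / (1 + (y - Im w)\<^sup>2)) \<partial>lborel)"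
      proof (rule nn_integral_mono)
        fix y
        show "ennreal (cmod (H (Complex x y))) \<le> ennreal A * ennreal (1 / (1\<^sup>2 + (y - t)\<^sup>2)) + ennreal (4 * d) * ennreal ((cmod (F (Complex x y)))\<^sup>2 / (1 + (y - Im w)\<^sup>2))"
          using A(2)[OF x, of y] A(1) d
          by (simp add: t_def add_divide_distrib flip: ennreal_mult ennreal_plus)
      qed
      also have "\<dots> = ennreal A * ennreal (pi / 1) + ennreal (4 * d) * (\<integral>\<^sup>+y. ennreal ((cmod (F (Complex x y)))\<^sup>2 / (1 + (y - Im w)\<^sup>2)) \<partial>lborel)"
        using x a by (simp add: nn_integral_add nn_integral_cmult nn_integral_inverse_square_plus[of 1, simplified])
      also have "\<dots> \<le> ennreal A * ennreal pi + ennreal (4 * d) * ennreal (max C 0)"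
        using C[of x] x by (intro add_mono mult_left_mono) (auto simp: max_def ennreal_neg split: if_splits)
      also have "\<dots> = ennreal (A * pi + 4 * d * max C 0)"
        using A d by (simp add: ennreal_mult ennreal_plus)
      finally show "(\<integral>\<^sup>+y. ennreal (cmod (H (Complex x y))) \<partial>lborel) \<le> ennreal (A * pi + 4 * d * max C 0)" .
    qed
  qed
  have Hm[measurable]: "(\<lambda>y. H (Complex x y)) \<in> borel_measurable borel" if "x \<ge> a" for x
  proof (rule borel_measurable_continuous_onI)
    show "continuous_on UNIV (\<lambda>y. H (Complex x y))"
      unfolding Complex_eq using that a d
      by (intro continuous_on_compose2[OF holomorphic_on_imp_continuous_on[OF holH]] continuous_intros)
        (auto simp: S_def)
  qed
  have Hint: "integrable lborel (\<lambda>y. H (Complex x y))" if "x \<ge> a" for x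
  proof -
    obtain A where "\<forall>x\<in>{a..x}. (\<integral>\<^sup>+y. ennreal (cmod (H (Complex x y))) \<partial>lborel) \<le> ennreal A"
      using nnH[of x] by blast
    then have "(\<integral>\<^sup>+y. ennreal (cmod (H (Complex x y))) \<partial>lborel) \<le> ennreal A" using that by simp
    then show ?thesis using Hm[OF that]
      by (intro integrableI_bounded) (auto intro: le_less_trans)
  qed
  have shift: "(\<integral>y. H (Complex a y) \<partial>lborel) = (\<integral>y. H (Complex b y) \<partial>lborel)" if "b > a" for b
  proof (rule line_integral_shift[OF that S(1,2) strS holH _ Hint Hint])
    obtain A where A: "\<And>x. x\<in>{a..b} \<Longrightarrow> (\<integral>\<^sup>+y. ennreal (cmod (H (Complex x y))) \<partial>lborel) \<le> ennreal A"
      using nnH[of b] by blast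
    have "(\<integral>\<^sup>+x. (\<integral>\<^sup>+y. ennreal (cmod (H (Complex x y))) \<partial>lborel) * indicator {a..b} x \<partial>lborel)
      \<le> (\<integral>\<^sup>+x. ennreal A * indicator {a..b} x \<partial>lborel)"
      using A by (intro nn_integral_mono) (auto simp: indicator_def)
    also have "\<dots> < \<infinity>" using that by (simp add: nn_integral_cmult_indicator ennreal_mult_less_top)
    finally show "(\<integral>\<^sup>+x. (\<integral>\<^sup>+y. ennreal (cmod (H (Complex x y))) \<partial>lborel) * indicator {a..b} x \<partial>lborel) < \<infinity>" .
  qed (use that in auto)
  \<comment> \<open>On a far line the weighted integral of the squared modulus of \<open>F\<close>
    is bounded but need not decay. The inequality
    \<open>cmod (F z) \<le> \<eta> * (cmod (F z))^2 + 1 / \<eta>\<close> puts it under the factor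
    \<eta>, while the constant part is integrated against a kernel of mass
    \<open>pi / R\<close>.\<close>
  have small: "cmod (\<integral>y. H (Complex a y) \<partial>lborel) \<le> 2 * d * \<eta> * max C 0 + e" if \<eta>: "\<eta> > 0" and e: "e > 0" for \<eta> e
  proof -
    define M where "M = 2 * d * (1 / \<eta> + cmod (F w))"
    have M: "M \<ge> 0" using \<eta> d by (simp add: M_def)
    define R where "R = max 1 (M * pi / e)"
    define b where "b = Re w + R"
    have R: "R \<ge> 1" "M * pi / R \<le> e"
    proof -
      show "R \<ge> 1" by (simp add: R_def)
      have "M * pi \<le> R * e" using e unfolding R_def by (simp add: max_def field_simps)
      then show "M * pi / R \<le> e" using \<open>R \<ge> 1\<close> by (simp add: field_simps)
    qed
    have b: "b > a" using w R b_def by simp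
    note [measurable] = line_measurable[OF F, of b]
    have "ennreal (cmod (\<integral>y. H (Complex b y) \<partial>lborel)) \<le> (\<integral>\<^sup>+y. ennreal (cmod (H (Complex b y))) \<partial>lborel)"
      by (rule integral_norm_bound_ennreal[OF Hint]) (use b in auto)
    also have "\<dots> \<le> (\<integral>\<^sup>+y. ennreal (2 * d * \<eta>) * ennreal ((cmod (F (Complex b y)))\<^sup>2 / (1 + (y - Im w)\<^sup>2))
        + ennreal M * ennreal (1 / (R\<^sup>2 + (y - t)\<^sup>2)) \<partial>lborel)"
    proof (rule nn_integral_mono)
      fix y
      let ?z = "Complex b y"
      have zw: "?z \<noteq> w"
      proof
        assume "?z = w"
        then have "Re ?z = Re w" by simp
        then show False using R(1) b_def by simp
      qed
      have z2: "R\<^sup>2 + (y - t)\<^sup>2 = (cmod (?z - w))\<^sup>2" unfolding n2 b_def using Rw by simp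
      have pos: "(cmod (?z - w))\<^sup>2 > 0" using zw by simp
      have ge: "1 + (y - Im w)\<^sup>2 \<le> (cmod (?z - w))\<^sup>2" unfolding z2[symmetric] t_def using R(1) by (simp add: one_le_power)
      have f: "cmod (F ?z) \<le> \<eta> * (cmod (F ?z))\<^sup>2 + 1 / \<eta>"
      proof -
        have "2 * (\<eta> * cmod (F ?z)) * 1 \<le> (\<eta> * cmod (F ?z))\<^sup>2 + 1\<^sup>2" by (rule sum_squares_bound)
        moreover have "0 \<le> \<eta> * cmod (F ?z)" using \<eta> by simp
        ultimately have "\<eta> * cmod (F ?z) \<le> (\<eta> * cmod (F ?z))\<^sup>2 + 1" by (simp del: mult_nonneg_nonneg zero_le_mult_iff)
        then show ?thesis using \<eta> by (simp add: field_simps power2_eq_square)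
      qed
      have "cmod (H ?z) = 2 * d * cmod (F ?z - F w) / (cmod (?z - w) * cmod (?z - w'))"
        unfolding H_def D_def using zw d by (simp add: norm_mult norm_divide)
      also have "\<dots> \<le> 2 * d * cmod (F ?z - F w) / (cmod (?z - w))\<^sup>2"
        using n12[of ?z] zw b d unfolding power2_eq_square
        by (intro divide_left_mono mult_left_mono mult_pos_pos) (auto intro: less_le_trans[of _ "cmod (?z - w)"])
      also have "\<dots> \<le> 2 * d * (\<eta> * (cmod (F ?z))\<^sup>2 + (1 / \<eta> + cmod (F w))) / (cmod (?z - w))\<^sup>2"
        using d f norm_triangle_ineq4[of "F ?z" "F w"] by (intro divide_right_mono mult_left_mono) auto
      also have "\<dots> = 2 * d * \<eta> * ((cmod (F ?z))\<^sup>2 / (cmod (?z - w))\<^sup>2) + M / (cmod (?z - w))\<^sup>2"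
        unfolding M_def by (simp add: algebra_simps add_divide_distrib)
      also have "\<dots> \<le> 2 * d * \<eta> * ((cmod (F ?z))\<^sup>2 / (1 + (y - Im w)\<^sup>2)) + M / (cmod (?z - w))\<^sup>2"
        using ge \<eta> d pos M by (intro add_mono mult_left_mono divide_left_mono mult_pos_pos) (auto simp: add_pos_nonneg)
      finally show "ennreal (cmod (H ?z)) \<le> ennreal (2 * d * \<eta>) * ennreal ((cmod (F ?z))\<^sup>2 / (1 + (y - Im w)\<^sup>2))
        + ennreal M * ennreal (1 / (R\<^sup>2 + (y - t)\<^sup>2))"
        using M \<eta> d unfolding z2 by (simp flip: ennreal_mult ennreal_plus)
    qed
    also have "\<dots> = ennreal (2 * d * \<eta>) * (\<integral>\<^sup>+y. ennreal ((cmod (F (Complex b y)))\<^sup>2 / (1 + (y - Im w)\<^sup>2)) \<partial>lborel) + ennreal M * ennreal (pi / R)"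
      using b a R by (simp add: nn_integral_add nn_integral_cmult nn_integral_inverse_square_plus[of R])
    also have "\<dots> \<le> ennreal (2 * d * \<eta>) * ennreal (max C 0) + ennreal M * ennreal (pi / R)"
      using C[of b] b by (intro add_mono mult_left_mono) (auto simp: max_def ennreal_neg split: if_splits)
    also have "\<dots> = ennreal (2 * d * \<eta> * max C 0 + M * pi / R)"
      using M d \<eta> R by (simp flip: ennreal_mult ennreal_plus)
    also have "\<dots> \<le> ennreal (2 * d * \<eta> * max C 0 + e)" using R by (intro ennreal_leI) auto
    finally show ?thesis unfolding shift[OF b]
      by (subst (asm) ennreal_le_iff) (use d \<eta> e in auto)
  qed
  have "cmod (\<integral>y. H (Complex a y) \<partial>lborel) \<le> 0"
  proof (rule field_le_epsilon)
    fix e :: real assume e: "e > 0"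
    \<comment> \<open>Keeps the first term of \<open>small\<close> at most \<open>e / 2\<close>; the
      added 1 makes the denominator positive even if \<open>max C 0\<close> vanishes.\<close>
    define \<eta> where "\<eta> = e / 2 / (2 * d * max C 0 + 1)"
    have den: "2 * d * max C 0 + 1 > 0" using d by (simp add: add_nonneg_pos)
    have "\<eta> > 0" unfolding \<eta>_def using e den by simp
    then have "cmod (\<integral>y. H (Complex a y) \<partial>lborel) \<le> 2 * d * \<eta> * max C 0 + e / 2"
      using small[of \<eta> "e/2"] e by simp
    also have "2 * d * \<eta> * max C 0 = (e / 2) * ((2 * d * max C 0) / (2 * d * max C 0 + 1))"
      unfolding \<eta>_def using den by (simp add: field_simps)
    also have "\<dots> \<le> (e / 2) * 1" using e den by (intro mult_left_mono) (auto simp: divide_le_eq)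
    finally show "cmod (\<integral>y. H (Complex a y) \<partial>lborel) \<le> 0 + e" by simp
  qed
  then have zero: "(\<integral>y. H (Complex a y) \<partial>lborel) = 0" by simp
  define k where "k y = d / (pi * (d\<^sup>2 + (y - t)\<^sup>2))" for y
  have kk: "k y = (d / pi) * (1 / (d\<^sup>2 + (y - t)\<^sup>2))" for y by (simp add: k_def)
  have ki: "integrable lborel k" "(\<integral>y. k y \<partial>lborel) = 1"
    unfolding kk
    by (intro integrable_mult_right integrable_inverse_square_plus[OF d])
      (subst integral_mult_right_zero, use integrable_inverse_square_plus(2)[OF d, of t] d in simp)
  have Ha: "H (Complex a y) = (F w - F (Complex a y)) * of_real (2 * pi * k y)" for y
  proof -
    have zw: "Complex a y \<noteq> w" using w by auto
    have e1: "Complex a y - w = Complex (- d) (y - t)" "Complex a y - w' = Complex d (y - t)"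
      using Rw Rw' by (auto simp: complex_eq_iff)
    have "(Complex a y - w) * (Complex a y - w') = - of_real (d\<^sup>2 + (y - t)\<^sup>2)"
      unfolding e1 by (simp add: complex_eq_iff power2_eq_square algebra_simps)
    then have "H (Complex a y) = (F (Complex a y) - F w) * of_real (2 * d) / (- of_real (d\<^sup>2 + (y - t)\<^sup>2))"
      unfolding H_def D_def using zw by (simp add: divide_divide_eq_left)
    also have "\<dots> = (F w - F (Complex a y)) * of_real (2 * d / (d\<^sup>2 + (y - t)\<^sup>2))"
    proof -
      have "(p - q) * c / (- k) = (q - p) * (c / k)" for p q c k :: complex
        by (cases "k = 0") (auto simp: field_simps)
      from this[of "F (Complex a y)" "F w" "of_real (2 * d)" "of_real (d\<^sup>2 + (y - t)\<^sup>2)"]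
      show ?thesis by (simp only: of_real_divide)
    qed
    also have "2 * d / (d\<^sup>2 + (y - t)\<^sup>2) = 2 * pi * k y" by (simp add: k_def)
    finally show ?thesis .
  qed
  have Fe: "F (Complex a y) * of_real (k y) = F w * of_real (k y) - H (Complex a y) / of_real (2 * pi)" for y
    unfolding Ha by (simp add: field_simps)
  have "(\<integral>y. F (Complex a y) * of_real (k y) \<partial>lborel) = F w * of_real 1 - 0 / of_real (2 * pi)"
    unfolding Fe using ki Hint[of a] zero
    by (subst Bochner_Integration.integral_diff) (auto intro!: integrable_of_real integrable_mult_right)
  then show ?thesis unfolding k_def d_def t_def by simp
qed

section \<open>Averages and Carleson measures\<close>

text \<open>The closed Carleson square with centre \<open>Complex r t\<close>. Its base has length
  \<open>2 * r\<close>, so a Carleson constant \<delta> reads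
  \<open>2 * \<delta> * r\<close>.\<close>

definition halfplane_square :: "real \<Rightarrow> real \<Rightarrow> complex set" where
  "halfplane_square t r = {z. 0 \<le> Re z \<and> Re z \<le> 2 * r \<and> \<bar>Im z - t\<bar> \<le> r}"

lemma borel_halfplane_square [measurable]: "halfplane_square t r \<in> sets borel"
proof -
  have "halfplane_square t r = cbox (Complex 0 (t - r)) (Complex (2 * r) (t + r))"
    by (auto simp: halfplane_square_def in_cbox_complex_iff)
  then show ?thesis by simp
qed

lemma borel_cball [measurable]: "cball (t :: real) r \<in> sets borel"
  by simp

text \<open>A superlevel set of the centred Hardy-Littlewood maximal function, restricted at
  \<open>s\<close> to radii of at least \<open>Re s\<close>. On the imaginary axis it is the
  classical one.\<close>

definition large_average_region :: "(real \<Rightarrow> ennreal) \<Rightarrow> real \<Rightarrow> complex set" where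
  "large_average_region f \<kappa> = {s. 0 \<le> Re s \<and>
     (\<exists>r>0. Re s \<le> r \<and> ennreal (2 * r * \<kappa>) < (\<integral>\<^sup>+y. f y * indicator (cball (Im s) r) y \<partial>lborel))}"

text \<open>The sum over the family is an integral against \<open>count_space\<close>, so no
  enumeration of the index set is chosen; disjointness of the \<open>A i\<close> collects the
  right-hand sides into one integral.\<close>

lemma emeasure_countable_UN_le:
  assumes C: "countable C" and m: "\<And>i. i \<in> C \<Longrightarrow> B i \<in> sets M"
    and le: "\<And>i. i \<in> C \<Longrightarrow> emeasure M (B i) \<le> \<integral>\<^sup>+x. g x * indicator (A i) x \<partial>N"
    and A: "\<And>i. i \<in> C \<Longrightarrow> A i \<in> sets N" "disjoint_family_on A C" and g: "g \<in> borel_measurable N"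
  shows "emeasure M (\<Union>i\<in>C. B i) \<le> \<integral>\<^sup>+x. g x \<partial>N"
proof -
  note [measurable] = g
  have "emeasure M (\<Union>i\<in>C. B i) \<le> (\<integral>\<^sup>+i. emeasure M (B i) \<partial>count_space C)"
  proof -
    have "emeasure M (\<Union>i\<in>C. B i) = (\<integral>\<^sup>+x. indicator (\<Union>i\<in>C. B i) x \<partial>M)"
      using C m by (intro nn_integral_indicator[symmetric] sets.countable_UN') auto
    also have "\<dots> \<le> (\<integral>\<^sup>+x. (\<integral>\<^sup>+i. indicator (B i) x \<partial>count_space C) \<partial>M)"
    proof (rule nn_integral_mono)
      fix x
      show "indicator (\<Union>i\<in>C. B i) x \<le> (\<integral>\<^sup>+i. indicator (B i) x \<partial>count_space C)"
      proof (cases "x \<in> (\<Union>i\<in>C. B i)")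
        case True
        then obtain j where j: "j \<in> C" "x \<in> B j" by auto
        then show ?thesis
          using nn_integral_ge_point[OF j(1), of "\<lambda>i. indicator (B i) x"] True by (simp add: indicator_def)
      qed simp
    qed
    also have "\<dots> = (\<integral>\<^sup>+i. (\<integral>\<^sup>+x. indicator (B i) x \<partial>M) \<partial>count_space C)"
      using C m by (intro nn_integral_count_space_nn_integral) auto
    also have "\<dots> = (\<integral>\<^sup>+i. emeasure M (B i) \<partial>count_space C)"
      using m by (intro nn_integral_cong nn_integral_indicator) auto
    finally show ?thesis .
  qed
  also have "\<dots> \<le> (\<integral>\<^sup>+i. emeasure (density N g) (A i) \<partial>count_space C)"
    using le A by (intro nn_integral_mono) (auto simp: emeasure_density)
  also have "\<dots> = emeasure (density N g) (\<Union>i\<in>C. A i)"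
    using C A by (intro emeasure_UN_countable[symmetric]) auto
  also have "\<dots> \<le> emeasure (density N g) (space (density N g))"
    by (rule emeasure_mono) (use A sets.sets_into_space in \<open>auto simp: C\<close>)
  also have "\<dots> = (\<integral>\<^sup>+x. g x \<partial>N)" by (simp add: emeasure_density cong: nn_integral_cong)
  finally show ?thesis .
qed

text \<open>Vitali selection keeps disjoint intervals whose fivefold enlargements catch all others.
  A square of half-base \<open>5 * r\<close> has mass at most \<open>10 * \<delta> * r\<close>, and
  the selected interval carries an integral above \<open>2 * r * \<kappa>\<close>, whence the factor
  \<open>5 * \<delta> / \<kappa>\<close>. For Lebesgue measure on the axis this is the maximal
  inequality; for restrictions of the symbol measure it drives the embedding. A Borel superset
  \<open>B\<close> is returned in place of the region itself.\<close>

lemma Carleson_weak_type: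
  fixes \<nu> :: "complex measure" and f :: "real \<Rightarrow> ennreal"
  assumes sets[measurable_cong]: "sets \<nu> = sets borel"
    and \<nu>: "\<And>t r. r > 0 \<Longrightarrow> emeasure \<nu> (halfplane_square t r) \<le> ennreal (2 * \<delta> * r)" and \<delta>: "\<delta> \<ge> 0"
    and f[measurable]: "f \<in> borel_measurable borel" and fin: "(\<integral>\<^sup>+y. f y \<partial>lborel) < \<infinity>" and \<kappa>: "\<kappa> > 0"
  obtains B where "B \<in> sets borel" "large_average_region f \<kappa> \<subseteq> B"
    "emeasure \<nu> B \<le> ennreal (5 * \<delta> / \<kappa>) * (\<integral>\<^sup>+y. f y \<partial>lborel)"
proof -
  define K where "K = {(t, r). 0 < r \<and> ennreal (2 * r * \<kappa>) < (\<integral>\<^sup>+y. f y * indicator (cball t r) y \<partial>lborel)}"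
  define N where "N = enn2real (\<integral>\<^sup>+y. f y \<partial>lborel)"
  have N: "(\<integral>\<^sup>+y. f y \<partial>lborel) = ennreal N" "N \<ge> 0" using fin by (auto simp: N_def less_top)
  \<comment> \<open>Finiteness of the integral bounds the radii, as the covering lemma
    requires.\<close>
  have bd: "0 < snd i \<and> snd i \<le> N / (2 * \<kappa>)" if "i \<in> K" for i
  proof -
    obtain t r where i: "i = (t, r)" "0 < r" "ennreal (2 * r * \<kappa>) < (\<integral>\<^sup>+y. f y * indicator (cball t r) y \<partial>lborel)"
      using \<open>i \<in> K\<close> by (auto simp: K_def)
    note i(3)
    also have "(\<integral>\<^sup>+y. f y * indicator (cball t r) y \<partial>lborel) \<le> ennreal N"
      unfolding N(1)[symmetric] by (intro nn_integral_mono) (auto simp: indicator_def)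
    finally have "2 * r * \<kappa> < N" using \<kappa> i(2) by (simp add: ennreal_less_iff)
    then show ?thesis using i \<kappa> by (simp add: field_simps)
  qed
  obtain C where C: "countable C" "C \<subseteq> K"
     "pairwise (\<lambda>i j. disjnt (cball (fst i) (snd i)) (cball (fst j) (snd j))) C"
     "\<And>i. i \<in> K \<Longrightarrow> \<exists>j. j \<in> C \<and> \<not> disjnt (cball (fst i) (snd i)) (cball (fst j) (snd j)) \<and>
                        cball (fst i) (snd i) \<subseteq> ball (fst j) (5 * snd j)"
    by (rule Vitali_covering_lemma_cballs_balls[of K snd "N / (2 * \<kappa>)" fst]) (use bd in auto)
  define B where "B = (\<Union>j\<in>C. halfplane_square (fst j) (5 * snd j))"
  have "B \<in> sets borel" unfolding B_def using C(1) by (intro sets.countable_UN') auto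
  moreover have "large_average_region f \<kappa> \<subseteq> B"
  proof
    fix s assume "s \<in> large_average_region f \<kappa>"
    then obtain r where r: "0 \<le> Re s" "r > 0" "Re s \<le> r" "(Im s, r) \<in> K"
      by (auto simp: large_average_region_def K_def)
    then obtain j where j: "j \<in> C" "cball (Im s) r \<subseteq> ball (fst j) (5 * snd j)" using C(4)[of "(Im s, r)"] by auto
    \<comment> \<open>The end points of the small interval lie in the enlarged one, so
      \<open>r < 5 * snd j\<close>; hence \<open>Re s \<le> r\<close> is below the height
      \<open>10 * snd j\<close> of the enlarged square.\<close>
    have "Im s + r \<in> cball (Im s) r" "Im s - r \<in> cball (Im s) r" using r by (auto simp: dist_real_def)
    then have "Im s + r \<in> ball (fst j) (5 * snd j)" "Im s - r \<in> ball (fst j) (5 * snd j)"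
      using j(2) by blast+
    then have "\<bar>Im s + r - fst j\<bar> < 5 * snd j" "\<bar>Im s - r - fst j\<bar> < 5 * snd j"
      by (simp_all add: dist_real_def abs_minus_commute)
    then have "s \<in> halfplane_square (fst j) (5 * snd j)"
      using r by (auto simp: halfplane_square_def)
    with j show "s \<in> B" by (auto simp: B_def)
  qed
  moreover have "emeasure \<nu> B \<le> (\<integral>\<^sup>+y. ennreal (5 * \<delta> / \<kappa>) * f y \<partial>lborel)"
    unfolding B_def
  proof (rule emeasure_countable_UN_le[where A="\<lambda>j. cball (fst j) (snd j)"])
    show "disjoint_family_on (\<lambda>j. cball (fst j) (snd j)) C"
      using C(3) by (auto simp: disjoint_family_on_def pairwise_def disjnt_def)
    fix j assume "j \<in> C"
    then have j: "j \<in> K" using C(2) by auto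
    then have r: "snd j > 0" "ennreal (2 * snd j * \<kappa>) \<le> (\<integral>\<^sup>+y. f y * indicator (cball (fst j) (snd j)) y \<partial>lborel)"
      by (auto simp: K_def)
    have "emeasure \<nu> (halfplane_square (fst j) (5 * snd j)) \<le> ennreal (2 * \<delta> * (5 * snd j))"
      using r by (intro \<nu>) simp
    also have "2 * \<delta> * (5 * snd j) = (5 * \<delta> / \<kappa>) * (2 * snd j * \<kappa>)" using \<kappa> by simp
    also have "ennreal \<dots> = ennreal (5 * \<delta> / \<kappa>) * ennreal (2 * snd j * \<kappa>)"
      using \<delta> \<kappa> r by (intro ennreal_mult) auto
    also have "\<dots> \<le> ennreal (5 * \<delta> / \<kappa>) * (\<integral>\<^sup>+y. f y * indicator (cball (fst j) (snd j)) y \<partial>lborel)"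
      by (intro mult_left_mono r) simp
    also have "\<dots> = (\<integral>\<^sup>+y. ennreal (5 * \<delta> / \<kappa>) * f y * indicator (cball (fst j) (snd j)) y \<partial>lborel)"
      by (subst nn_integral_cmult[symmetric]) (auto simp: mult.assoc)
    finally show "emeasure \<nu> (halfplane_square (fst j) (5 * snd j))
       \<le> (\<integral>\<^sup>+y. ennreal (5 * \<delta> / \<kappa>) * f y * indicator (cball (fst j) (snd j)) y \<partial>lborel)" .
  qed (use C(1) in auto)
  then have "emeasure \<nu> B \<le> ennreal (5 * \<delta> / \<kappa>) * (\<integral>\<^sup>+y. f y \<partial>lborel)"
    by (simp add: nn_integral_cmult)
  ultimately show thesis by (rule that)
qed

section \<open>Poisson integrals bounded by centred averages\<close>

definition Poisson_kernel :: "complex \<Rightarrow> real \<Rightarrow> real" where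
  "Poisson_kernel w y = Re w / (pi * ((Re w)\<^sup>2 + (y - Im w)\<^sup>2))"

lemma Poisson_kernel_nonneg: "Re w > 0 \<Longrightarrow> 0 \<le> Poisson_kernel w y"
  by (simp add: Poisson_kernel_def)

lemma Poisson_kernel_measurable [measurable]: "Poisson_kernel w \<in> borel_measurable borel"
  unfolding Poisson_kernel_def by measurable

text \<open>For the least \<open>k\<close> with \<open>\<bar>v\<bar> \<le> 2^k * s\<close> the
  single \<open>k\<close>-th term already dominates. If \<open>k > 0\<close>, minimality gives
  \<open>2^(k-1) * s < \<bar>v\<bar>\<close>, and squaring the lost factor 2 produces the 4.\<close>

lemma dyadic_kernel_bound:
  fixes s v :: real
  assumes s: "s > 0"
  shows "ennreal (s / (s\<^sup>2 + v\<^sup>2)) \<le> (\<Sum>k. ennreal (4 / 4 ^ k / s) * indicator (cball 0 (2 ^ k * s)) v)"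
proof -
  define k where "k = (LEAST k. \<bar>v\<bar> \<le> 2 ^ k * s)"
  have ex: "\<exists>k. \<bar>v\<bar> \<le> 2 ^ k * s"
  proof -
    obtain k where "\<bar>v\<bar> / s < 2 ^ k" using real_arch_pow[of 2 "\<bar>v\<bar> / s"] by auto
    then show ?thesis using s by (intro exI[of _ k]) (simp add: field_simps)
  qed
  have k: "\<bar>v\<bar> \<le> 2 ^ k * s" unfolding k_def by (rule LeastI_ex[OF ex])
  have p: "s\<^sup>2 + v\<^sup>2 > 0" using s by (simp add: add_pos_nonneg)
  have "s / (s\<^sup>2 + v\<^sup>2) \<le> 4 / 4 ^ k / s"
  proof (cases k)
    case 0
    have "s * s \<le> 4 * (s\<^sup>2 + v\<^sup>2)" using s by (simp add: power2_eq_square)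
    then show ?thesis using s p 0 by (simp add: divide_simps)
  next
    case (Suc j)
    have "\<not> \<bar>v\<bar> \<le> 2 ^ j * s" unfolding Suc using not_less_Least[of j "\<lambda>k. \<bar>v\<bar> \<le> 2 ^ k * s"] Suc k_def by auto
    then have "(2 ^ j * s)\<^sup>2 \<le> \<bar>v\<bar>\<^sup>2" using s by (intro power_mono) auto
    moreover have "(2 ^ j * s)\<^sup>2 = 4 ^ j * s\<^sup>2"
    proof -
      have "(2 ^ j)\<^sup>2 = (2\<^sup>2 :: real) ^ j" by (simp only: power_mult[symmetric] mult.commute)
      then show ?thesis by (simp add: power_mult_distrib)
    qed
    ultimately have "4 ^ j * s\<^sup>2 \<le> s\<^sup>2 + v\<^sup>2" by (simp add: add_increasing)
    then have "s * (4 ^ j * s) \<le> s\<^sup>2 + v\<^sup>2" by (simp add: power2_eq_square algebra_simps)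
    then show ?thesis using s p Suc by (simp add: divide_simps)
  qed
  then have "ennreal (s / (s\<^sup>2 + v\<^sup>2)) \<le> ennreal (4 / 4 ^ k / s) * indicator (cball 0 (2 ^ k * s)) v"
    using k s by (auto simp: indicator_def intro!: ennreal_leI)
  also have "\<dots> \<le> (\<Sum>k. ennreal (4 / 4 ^ k / s) * indicator (cball 0 (2 ^ k * s)) v)"
    using sum_le_suminf[of "\<lambda>k. ennreal (4 / 4 ^ k / s) * indicator (cball 0 (2 ^ k * s)) v" "{k}"]
    by (simp only: summableI finite.intros sum.insert_remove sum.empty) simp
  finally show ?thesis .
qed

text \<open>In a cone of aperture \<alpha> at \<open>y\<close> the Poisson kernel of
  \<open>w\<close> is at most \<open>1 + \<alpha>^2\<close> times the kernel centred at
  \<open>y\<close>, since pi is at least 2. The \<open>k\<close>-th dyadic average then contributes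
  \<open>8 * (1 + \<alpha>^2) * \<kappa> * (1/2)^k\<close>, and the series sums to 16. Positive
  \<alpha> serves nontangential limits, \<open>\<alpha> = 0\<close> the Carleson embedding.\<close>

lemma Poisson_integral_le_averages:
  fixes f :: "real \<Rightarrow> ennreal"
  assumes f[measurable]: "f \<in> borel_measurable borel" and w: "Re w > 0" and \<alpha>: "\<bar>Im w - y\<bar> \<le> \<alpha> * Re w" and \<kappa>: "\<kappa> \<ge> 0"
    and avg: "\<And>r. r \<ge> Re w \<Longrightarrow> (\<integral>\<^sup>+u. f u * indicator (cball y r) u \<partial>lborel) \<le> ennreal (2 * r * \<kappa>)"
  shows "(\<integral>\<^sup>+u. ennreal (Poisson_kernel w u) * f u \<partial>lborel) \<le> ennreal (16 * (1 + \<alpha>\<^sup>2) * \<kappa>)"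
proof -
  define s where "s = Re w"
  have s: "s > 0" using w s_def by simp
  define A where "A = 1 + \<alpha>\<^sup>2"
  have A: "A > 0" unfolding A_def by (simp add: add_pos_nonneg)
  have ker: "Poisson_kernel w u \<le> A * (s / (s\<^sup>2 + (u - y)\<^sup>2))" for u
  proof -
    have "(u - y)\<^sup>2 \<le> 2 * (u - Im w)\<^sup>2 + 2 * (Im w - y)\<^sup>2"
      using sum_squares_bound[of "u - Im w" "Im w - y"] by (simp add: power2_eq_square algebra_simps)
    moreover have "(Im w - y)\<^sup>2 \<le> \<alpha>\<^sup>2 * s\<^sup>2"
      using power_mono[OF \<alpha>, of 2] by (simp add: s_def power_mult_distrib)
    moreover have "A * (s\<^sup>2 + (u - Im w)\<^sup>2) * 2 = 2 * s\<^sup>2 + 2 * (\<alpha>\<^sup>2 * s\<^sup>2) + 2 * (u - Im w)\<^sup>2 + 2 * (\<alpha>\<^sup>2 * (u - Im w)\<^sup>2)"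
      unfolding A_def by (simp add: algebra_simps)
    moreover have "0 \<le> \<alpha>\<^sup>2 * (u - Im w)\<^sup>2" "0 \<le> s\<^sup>2" by auto
    ultimately have "s\<^sup>2 + (u - y)\<^sup>2 \<le> A * (s\<^sup>2 + (u - Im w)\<^sup>2) * 2" by linarith
    also have "\<dots> \<le> A * (s\<^sup>2 + (u - Im w)\<^sup>2) * pi"
      using A pi_ge_two by (intro mult_left_mono) auto
    finally have "s\<^sup>2 + (u - y)\<^sup>2 \<le> A * (pi * (s\<^sup>2 + (u - Im w)\<^sup>2))" by (simp add: mult.commute mult.left_commute)
    moreover have "s\<^sup>2 + (u - y)\<^sup>2 > 0" "pi * (s\<^sup>2 + (u - Im w)\<^sup>2) > 0" using s by (auto simp: add_pos_nonneg)
    ultimately show ?thesis unfolding Poisson_kernel_def s_def[symmetric] using s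
      by (simp add: divide_simps mult.commute mult.left_commute)
  qed
  have "(\<integral>\<^sup>+u. ennreal (Poisson_kernel w u) * f u \<partial>lborel)
    \<le> (\<integral>\<^sup>+u. (\<Sum>k. ennreal A * (ennreal (4 / 4 ^ k / s) * (f u * indicator (cball y (2 ^ k * s)) u))) \<partial>lborel)"
  proof (rule nn_integral_mono)
    fix u
    have "ennreal (Poisson_kernel w u) \<le> ennreal A * ennreal (s / (s\<^sup>2 + (u - y)\<^sup>2))"
      using ker[of u] A s by (simp flip: ennreal_mult)
    also have "\<dots> \<le> ennreal A * (\<Sum>k. ennreal (4 / 4 ^ k / s) * indicator (cball 0 (2 ^ k * s)) (u - y))"
      by (intro mult_left_mono dyadic_kernel_bound s) simp
    also have "\<dots> = ennreal A * (\<Sum>k. ennreal (4 / 4 ^ k / s) * indicator (cball y (2 ^ k * s)) u)"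
      by (simp add: indicator_def dist_real_def abs_minus_commute)
    finally have "ennreal (Poisson_kernel w u) * f u \<le> ennreal A * (\<Sum>k. ennreal (4 / 4 ^ k / s) * indicator (cball y (2 ^ k * s)) u) * f u"
      by (intro mult_right_mono) auto
    also have "\<dots> = (ennreal A * f u) * (\<Sum>k. ennreal (4 / 4 ^ k / s) * indicator (cball y (2 ^ k * s)) u)"
      by (simp only: mult_ac)
    also have "\<dots> = (\<Sum>k. (ennreal A * f u) * (ennreal (4 / 4 ^ k / s) * indicator (cball y (2 ^ k * s)) u))"
      by (rule ennreal_suminf_cmult[symmetric])
    also have "\<dots> = (\<Sum>k. ennreal A * (ennreal (4 / 4 ^ k / s) * (f u * indicator (cball y (2 ^ k * s)) u)))"
      by (simp only: mult_ac)
    finally show "ennreal (Poisson_kernel w u) * f u \<le> \<dots>" .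
  qed
  also have "\<dots> = (\<Sum>k. ennreal A * (ennreal (4 / 4 ^ k / s) * (\<integral>\<^sup>+u. f u * indicator (cball y (2 ^ k * s)) u \<partial>lborel)))"
  proof -
    have "(\<integral>\<^sup>+u. (\<Sum>k. ennreal A * (ennreal (4 / 4 ^ k / s) * (f u * indicator (cball y (2 ^ k * s)) u))) \<partial>lborel)
      = (\<Sum>k. \<integral>\<^sup>+u. ennreal A * (ennreal (4 / 4 ^ k / s) * (f u * indicator (cball y (2 ^ k * s)) u)) \<partial>lborel)"
      by (rule nn_integral_suminf) measurable
    moreover have "(\<integral>\<^sup>+u. ennreal A * (ennreal (4 / 4 ^ k / s) * (f u * indicator (cball y (2 ^ k * s)) u)) \<partial>lborel)
      = ennreal A * (ennreal (4 / 4 ^ k / s) * (\<integral>\<^sup>+u. f u * indicator (cball y (2 ^ k * s)) u \<partial>lborel))" for k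
      by (simp add: nn_integral_cmult)
    ultimately show ?thesis by (simp only:)
  qed
  also have "\<dots> \<le> (\<Sum>k. ennreal (8 * A * \<kappa> * (1 / 2) ^ k))"
  proof (rule suminf_le)
    fix k
    have "ennreal A * (ennreal (4 / 4 ^ k / s) * (\<integral>\<^sup>+u. f u * indicator (cball y (2 ^ k * s)) u \<partial>lborel))
      \<le> ennreal A * (ennreal (4 / 4 ^ k / s) * ennreal (2 * (2 ^ k * s) * \<kappa>))"
      using s by (intro mult_left_mono avg) (auto simp: s_def[symmetric])
    also have "\<dots> = ennreal (A * (4 / 4 ^ k / s * (2 * (2 ^ k * s) * \<kappa>)))"
      using A s \<kappa> by (simp flip: ennreal_mult)
    also have "A * (4 / 4 ^ k / s * (2 * (2 ^ k * s) * \<kappa>)) = 8 * A * \<kappa> * (2 ^ k / 4 ^ k)" using s by (simp add: field_simps)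
    also have "2 ^ k / 4 ^ k = (1 / 2 :: real) ^ k" by (simp flip: power_divide)
    finally show "ennreal A * (ennreal (4 / 4 ^ k / s) * (\<integral>\<^sup>+u. f u * indicator (cball y (2 ^ k * s)) u \<partial>lborel)) \<le> ennreal (8 * A * \<kappa> * (1 / 2) ^ k)" .
  qed auto
  also have "\<dots> = ennreal (\<Sum>k. 8 * A * \<kappa> * (1 / 2) ^ k)"
    using A \<kappa> by (intro suminf_ennreal2 summable_mult summable_geometric) auto
  also have "(\<Sum>k. 8 * A * \<kappa> * (1 / 2) ^ k) = 16 * A * \<kappa>"
    by (subst suminf_mult) (auto simp: suminf_geometric)
  finally show ?thesis by (simp add: A_def)
qed

section \<open>Boundary functions\<close>

lemma H2_holomorphic: "F \<in> H2 \<Longrightarrow> F holomorphic_on right_half_plane"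
  by (simp add: H2_def)

lemma SUP_line_eq_H2_norm_sq:
  "(SUP x\<in>{0::real<..}. \<integral>\<^sup>+y. ennreal ((cmod (F (Complex x y)))\<^sup>2) \<partial>lborel) = ennreal (2 * pi) * H2_norm_sq F"
proof -
  have "ennreal (2 * pi) * ennreal (1 / (2 * pi)) = 1"
    by (simp flip: ennreal_mult)
  then show ?thesis unfolding H2_norm_sq_def by (simp add: mult.assoc[symmetric])
qed

lemma H2_line_le:
  assumes "F \<in> H2" "x > 0"
  shows "(\<integral>\<^sup>+y. ennreal ((cmod (F (Complex x y)))\<^sup>2) \<partial>lborel) \<le> ennreal (2 * pi * enn2real (H2_norm_sq F))"
proof -
  have "(\<integral>\<^sup>+y. ennreal ((cmod (F (Complex x y)))\<^sup>2) \<partial>lborel)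
      \<le> (SUP x\<in>{0::real<..}. \<integral>\<^sup>+y. ennreal ((cmod (F (Complex x y)))\<^sup>2) \<partial>lborel)"
    using assms(2) by (intro SUP_upper) auto
  also have "\<dots> = ennreal (2 * pi) * ennreal (enn2real (H2_norm_sq F))"
    unfolding SUP_line_eq_H2_norm_sq using assms(1) by (simp add: H2_def less_top)
  also have "\<dots> = ennreal (2 * pi * enn2real (H2_norm_sq F))"
    by (rule ennreal_mult[symmetric]) auto
  finally show ?thesis .
qed

lemma H2_line_L2:
  assumes "F \<in> H2" "x > 0"
  shows "(\<lambda>y. F (Complex x y)) \<in> L2 lborel"
  using H2_line_le[OF assms] line_measurable[OF H2_holomorphic[OF assms(1)] assms(2)]
  by (auto simp: L2_iff_nn_integral intro: le_less_trans)

lemma H2_line_norm_le: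
  assumes "F \<in> H2" "x > 0"
  shows "(L2_norm lborel (\<lambda>y. F (Complex x y)))\<^sup>2 \<le> 2 * pi * enn2real (H2_norm_sq F)"
  using H2_line_le[OF assms] unfolding nn_integral_L2_norm[OF H2_line_L2[OF assms]]
  by (subst (asm) ennreal_le_iff) auto

lemma H2I:
  assumes "F holomorphic_on right_half_plane"
    and "\<And>x. x > 0 \<Longrightarrow> (\<integral>\<^sup>+y. ennreal ((cmod (F (Complex x y)))\<^sup>2) \<partial>lborel) \<le> ennreal C"
  shows "F \<in> H2"
proof -
  have "(SUP x\<in>{0::real<..}. \<integral>\<^sup>+y. ennreal ((cmod (F (Complex x y)))\<^sup>2) \<partial>lborel) \<le> ennreal C"
    using assms(2) by (intro SUP_least) auto
  then have "(SUP x\<in>{0::real<..}. \<integral>\<^sup>+y. ennreal ((cmod (F (Complex x y)))\<^sup>2) \<partial>lborel) < \<infinity>"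
    by (rule le_less_trans) simp
  then have "H2_norm_sq F < \<infinity>" unfolding H2_norm_sq_def by (simp add: ennreal_mult_less_top)
  with assms(1) show ?thesis by (simp add: H2_def)
qed

lemma H2_lincomb:
  assumes F: "F \<in> H2" and G: "G \<in> H2"
  shows "(\<lambda>s. a * F s + b * G s) \<in> H2"
proof (rule H2I)
  show "(\<lambda>s. a * F s + b * G s) holomorphic_on right_half_plane"
    using assms by (intro holomorphic_intros H2_holomorphic)
  fix x :: real assume x: "x > 0"
  note L = H2_line_L2[OF F x] H2_line_L2[OF G x]
  define KF where "KF = sqrt (2 * pi * enn2real (H2_norm_sq F))"
  define KG where "KG = sqrt (2 * pi * enn2real (H2_norm_sq G))"
  have K: "L2_norm lborel (\<lambda>y. F (Complex x y)) \<le> KF" "L2_norm lborel (\<lambda>y. G (Complex x y)) \<le> KG"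
    unfolding KF_def KG_def using H2_line_norm_le[OF F x] H2_line_norm_le[OF G x] by (auto intro: real_le_rsqrt)
  have "L2_norm lborel (\<lambda>y. a * F (Complex x y) + b * G (Complex x y))
     \<le> cmod a * L2_norm lborel (\<lambda>y. F (Complex x y)) + cmod b * L2_norm lborel (\<lambda>y. G (Complex x y))"
    using L2_norm_triangle[OF L2_scale[OF L(1), of a] L2_scale[OF L(2), of b]] by (simp add: L2_norm_scale)
  also have "\<dots> \<le> cmod a * KF + cmod b * KG" by (intro add_mono mult_left_mono K) auto
  finally have "(L2_norm lborel (\<lambda>y. a * F (Complex x y) + b * G (Complex x y)))\<^sup>2 \<le> (cmod a * KF + cmod b * KG)\<^sup>2"
    by (intro power_mono L2_norm_nonneg)
  then show "(\<integral>\<^sup>+y. ennreal ((cmod (a * F (Complex x y) + b * G (Complex x y)))\<^sup>2) \<partial>lborel) \<le> ennreal ((cmod a * KF + cmod b * KG)\<^sup>2)"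
    unfolding nn_integral_L2_norm[OF L2_lincomb[OF L]] by (rule ennreal_leI)
qed

lemma H2_diff: "F \<in> H2 \<Longrightarrow> G \<in> H2 \<Longrightarrow> (\<lambda>s. F s - G s) \<in> H2"
  using H2_lincomb[of F G 1 "-1"] by simp

lemma strip_integral_finite:
  assumes "\<And>x. x \<in> {a..b} \<Longrightarrow> (\<integral>\<^sup>+y. f x y \<partial>lborel) \<le> ennreal C"
  shows "(\<integral>\<^sup>+x. (\<integral>\<^sup>+y. f x y \<partial>lborel) * indicator {a..b::real} x \<partial>lborel) < \<infinity>"
proof -
  have "(\<integral>\<^sup>+x. (\<integral>\<^sup>+y. f x y \<partial>lborel) * indicator {a..b} x \<partial>lborel) \<le> (\<integral>\<^sup>+x. ennreal C * indicator {a..b} x \<partial>lborel)"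
    using assms by (intro nn_integral_mono) (auto simp: indicator_def)
  also have "\<dots> < \<infinity>"
    by (cases "a \<le> b") (simp_all add: nn_integral_cmult_indicator ennreal_mult_less_top)
  finally show ?thesis .
qed

text \<open>The product below is the restriction to a vertical line of a function holomorphic in a strip,
  so that shifting the line makes both factors live on the same line.\<close>

lemma L2_ip_lines:
  assumes F: "F \<in> H2" and x: "x > 0" and x': "x' > 0"
  shows "L2_ip lborel (\<lambda>y. F (Complex x y)) (\<lambda>y. F (Complex x' y)) =
    complex_of_real ((L2_norm lborel (\<lambda>y. F (Complex ((x + x') / 2) y)))\<^sup>2)"
proof -
  define m where "m = (x + x') / 2"
  define S where "S = {z. 0 < Re z \<and> Re z < x + x'}"
  define H where "H z = F z * cnj (F (of_real (x + x') - cnj z))" for z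
  have S: "convex S" "open S"
    unfolding S_def
    by (auto simp: Collect_conj_eq intro!: convex_Int open_Int convex_halfspace_Re_gt open_halfspace_Re_gt
        convex_halfspace_Re_lt open_halfspace_Re_lt)
  have hF: "F holomorphic_on right_half_plane" by (rule H2_holomorphic[OF F])
  have "(cnj \<circ> (\<lambda>z. F (of_real (x + x') - z)) \<circ> cnj) holomorphic_on S"
  proof (rule holomorphic_on_compose_cnj_cnj)
    have "F \<circ> (\<lambda>z. of_real (x + x') - z) holomorphic_on cnj ` S"
      by (intro holomorphic_on_compose_gen[OF _ hF] holomorphic_intros) (auto simp: S_def right_half_plane_def)
    then show "(\<lambda>z. F (of_real (x + x') - z)) holomorphic_on cnj ` S" by (simp add: o_def)
  qed (rule S)
  then have "(\<lambda>z. cnj (F (of_real (x + x') - cnj z))) holomorphic_on S" by (simp add: o_def)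
  moreover have "F holomorphic_on S"
    by (rule holomorphic_on_subset[OF hF]) (auto simp: S_def right_half_plane_def)
  ultimately have hH: "H holomorphic_on S" unfolding H_def by (intro holomorphic_intros)
  have Hv: "H (Complex u y) = F (Complex u y) * cnj (F (Complex (x + x' - u) y))" for u y
  proof -
    have "of_real (x + x') - cnj (Complex u y) = Complex (x + x' - u) y" by (simp add: complex_eq_iff)
    then show ?thesis by (simp add: H_def)
  qed
  have HI: "(\<integral>y. H (Complex u y) \<partial>lborel) = L2_ip lborel (\<lambda>y. F (Complex u y)) (\<lambda>y. F (Complex (x + x' - u) y))" for u
    by (simp add: Hv L2_ip_def)
  have int: "integrable lborel (\<lambda>y. H (Complex u y))" if "0 < u" "u < x + x'" for u
    unfolding Hv using that by (intro L2_ip_integrable H2_line_L2 F) auto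
  have sh: "(\<integral>y. H (Complex a y) \<partial>lborel) = (\<integral>y. H (Complex b y) \<partial>lborel)" if "0 < a" "a < b" "b < x + x'" for a b
  proof (rule line_integral_shift[OF that(2) S _ hH _ int int])
    show "{z. a \<le> Re z \<and> Re z \<le> b} \<subseteq> S" using that by (auto simp: S_def)
    let ?K = "2 * pi * enn2real (H2_norm_sq F)"
    show "(\<integral>\<^sup>+u. (\<integral>\<^sup>+y. ennreal (cmod (H (Complex u y))) \<partial>lborel) * indicator {a..b} u \<partial>lborel) < \<infinity>"
    proof (rule strip_integral_finite[where C="?K + ?K"])
      fix u assume "u \<in> {a..b}"
      then have u: "u > 0" "x + x' - u > 0" using that by auto
      note [measurable] = line_measurable[OF hF u(1)] line_measurable[OF hF u(2)]
      have "(\<integral>\<^sup>+y. ennreal (cmod (H (Complex u y))) \<partial>lborel)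
        \<le> (\<integral>\<^sup>+y. ennreal ((cmod (F (Complex u y)))\<^sup>2) + ennreal ((cmod (F (Complex (x + x' - u) y)))\<^sup>2) \<partial>lborel)"
      proof (rule nn_integral_mono)
        fix y
        have "cmod (F (Complex u y)) * cmod (F (Complex (x + x' - u) y)) \<le> (cmod (F (Complex u y)))\<^sup>2 + (cmod (F (Complex (x + x' - u) y)))\<^sup>2"
          using sum_squares_bound[of "cmod (F (Complex u y))" "cmod (F (Complex (x + x' - u) y))"]
            mult_nonneg_nonneg[OF norm_ge_zero[of "F (Complex u y)"] norm_ge_zero[of "F (Complex (x + x' - u) y)"]] by linarith
        then show "ennreal (cmod (H (Complex u y))) \<le> ennreal ((cmod (F (Complex u y)))\<^sup>2) + ennreal ((cmod (F (Complex (x + x' - u) y)))\<^sup>2)"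
          unfolding Hv by (simp add: norm_mult flip: ennreal_plus)
      qed
      also have "\<dots> = (\<integral>\<^sup>+y. ennreal ((cmod (F (Complex u y)))\<^sup>2) \<partial>lborel) + (\<integral>\<^sup>+y. ennreal ((cmod (F (Complex (x + x' - u) y)))\<^sup>2) \<partial>lborel)"
        by (rule nn_integral_add) measurable
      also have "\<dots> \<le> ennreal ?K + ennreal ?K" by (intro add_mono H2_line_le F u)
      also have "\<dots> = ennreal (?K + ?K)" by (rule ennreal_plus[symmetric]) auto
      finally show "(\<integral>\<^sup>+y. ennreal (cmod (H (Complex u y))) \<partial>lborel) \<le> ennreal (?K + ?K)" .
    qed
  qed (use that in auto)
  have "(\<integral>y. H (Complex x y) \<partial>lborel) = (\<integral>y. H (Complex m y) \<partial>lborel)"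
  proof (cases x m rule: linorder_cases)
    case less then show ?thesis using x x' by (intro sh) (auto simp: m_def)
  next
    case greater then show ?thesis using x x' by (intro sh[symmetric]) (auto simp: m_def)
  qed auto
  moreover have "x + x' - m = m" by (simp add: m_def field_simps)
  ultimately show ?thesis unfolding HI m_def[symmetric] by (simp add: L2_ip_self)
qed

lemma L2_norm_diff_lines:
  assumes F: "F \<in> H2" and x: "x > 0" and x': "x' > 0"
  shows "(L2_norm lborel (\<lambda>y. F (Complex x y) - F (Complex x' y)))\<^sup>2 =
    (L2_norm lborel (\<lambda>y. F (Complex x y)))\<^sup>2 + (L2_norm lborel (\<lambda>y. F (Complex x' y)))\<^sup>2
    - 2 * (L2_norm lborel (\<lambda>y. F (Complex ((x + x') / 2) y)))\<^sup>2"
  using L2_norm_add_power2[OF H2_line_L2[OF F x] H2_line_L2[OF F x'], of 1 "-1"] L2_ip_lines[OF assms]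
  by simp

text \<open>A single increase by \<epsilon> propagates: midpoint convexity forces increments of at
  least \<epsilon> along the whole arithmetic progression \<open>t k\<close>, which exceeds any
  bound.\<close>

lemma bounded_midpoint_convex_antimono:
  fixes N :: "real \<Rightarrow> real"
  assumes mid: "\<And>x y. x > 0 \<Longrightarrow> y > 0 \<Longrightarrow> 2 * N ((x + y) / 2) \<le> N x + N y"
    and bdd: "\<And>x. x > 0 \<Longrightarrow> N x \<le> K" and x: "0 < x" "x \<le> x'"
  shows "N x' \<le> N x"
proof (rule ccontr)
  assume "\<not> N x' \<le> N x"
  define d where "d = x' - x"
  define \<epsilon> where "\<epsilon> = N x' - N x"
  have e: "\<epsilon> > 0" using \<open>\<not> N x' \<le> N x\<close> by (simp add: \<epsilon>_def)
  have d: "d \<ge> 0" using x by (simp add: d_def)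
  define t where "t k = x + real k * d" for k
  have t: "t k > 0" for k using x d by (simp add: t_def add_pos_nonneg)
  have step: "N (t (Suc k)) - N (t k) \<ge> \<epsilon>" for k
  proof (induction k)
    case 0 then show ?case by (simp add: t_def d_def \<epsilon>_def)
  next
    case (Suc k)
    have "(t k + t (Suc (Suc k))) / 2 = t (Suc k)" by (simp add: t_def field_simps)
    then show ?case using mid[OF t[of k] t[of "Suc (Suc k)"]] Suc by simp
  qed
  have lin: "N (t k) \<ge> N x + real k * \<epsilon>" for k
  proof (induction k)
    case (Suc k) then show ?case using step[of k] by (simp add: algebra_simps)
  qed (simp add: t_def)
  obtain k where "real k * \<epsilon> > K - N x" using ex_less_of_nat_mult[OF e] by blast
  then show False using lin[of k] bdd[OF t[of k]] by linarith
qed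

lemma H2_line_norm_antimono:
  assumes F: "F \<in> H2" and x: "0 < x" "x \<le> x'"
  shows "(L2_norm lborel (\<lambda>y. F (Complex x' y)))\<^sup>2 \<le> (L2_norm lborel (\<lambda>y. F (Complex x y)))\<^sup>2"
proof (rule bounded_midpoint_convex_antimono[OF _ _ x])
  fix x y :: real assume "x > 0" "y > 0"
  then show "2 * (L2_norm lborel (\<lambda>v. F (Complex ((x + y) / 2) v)))\<^sup>2
    \<le> (L2_norm lborel (\<lambda>v. F (Complex x v)))\<^sup>2 + (L2_norm lborel (\<lambda>v. F (Complex y v)))\<^sup>2"
    using L2_norm_diff_lines[OF F, of x y] by (smt (verit) zero_le_power2)
qed (rule H2_line_norm_le[OF F])

text \<open>A representative of the boundary function in L2. It acquires a pointwise meaning only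
  with \<open>nontangential_limit_H2\<close>.\<close>

definition bdry :: "(complex \<Rightarrow> complex) \<Rightarrow> real \<Rightarrow> complex" where
  "bdry F = (SOME f. f \<in> L2 lborel \<and> ((\<lambda>x. L2_norm lborel (\<lambda>y. F (Complex x y) - f y)) \<longlongrightarrow> 0) (at_right 0))"

lemma bdry_exists:
  assumes F: "F \<in> H2"
  shows "\<exists>f. f \<in> L2 lborel \<and> ((\<lambda>x. L2_norm lborel (\<lambda>y. F (Complex x y) - f y)) \<longlongrightarrow> 0) (at_right 0)"
proof -
  define N where "N x = (L2_norm lborel (\<lambda>y. F (Complex x y)))\<^sup>2" for x
  define L where "L = Sup (N ` {0<..})"
  have bdd: "bdd_above (N ` {0<..})"
    unfolding N_def using H2_line_norm_le[OF F] by (intro bdd_aboveI2) auto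
  have NL: "N x \<le> L" if "x > 0" for x unfolding L_def using that bdd by (intro cSUP_upper) auto
  have C: "\<exists>\<delta>>0. \<forall>x x'. 0 < x \<longrightarrow> x \<le> \<delta> \<longrightarrow> 0 < x' \<longrightarrow> x' \<le> \<delta> \<longrightarrow> L2_norm lborel (\<lambda>y. F (Complex x y) - F (Complex x' y)) < e"
    if e: "e > 0" for e
  proof -
    have "L - e\<^sup>2 / 2 < L" using e by simp
    then obtain \<delta> where \<delta>: "\<delta> > 0" "L - e\<^sup>2 / 2 < N \<delta>"
      unfolding L_def using bdd by (subst (asm) less_cSUP_iff) auto
    have "L2_norm lborel (\<lambda>y. F (Complex x y) - F (Complex x' y)) < e"
      if x: "0 < x" "x \<le> \<delta>" "0 < x'" "x' \<le> \<delta>" for x x'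
    proof -
      \<comment> \<open>The midpoint also lies below \<delta>, so all three squared norms are
        between \<open>N \<delta>\<close> and the supremum \<open>L\<close>, which differ by less
        than \<open>e^2 / 2\<close>.\<close>
      have "N \<delta> \<le> N ((x + x') / 2)" unfolding N_def using x by (intro H2_line_norm_antimono[OF F]) auto
      then have "(L2_norm lborel (\<lambda>y. F (Complex x y) - F (Complex x' y)))\<^sup>2 < e\<^sup>2"
        using L2_norm_diff_lines[OF F x(1,3)] NL[OF x(1)] NL[OF x(3)] \<delta>(2) unfolding N_def by linarith
      then show ?thesis using e by (meson less_eq_real_def power2_less_imp_less)
    qed
    then show ?thesis using \<delta>(1) by blast
  qed
  define u where "u n = (\<lambda>y. F (Complex (1 / real (Suc n)) y))" for n
  have uL: "u n \<in> L2 lborel" for n unfolding u_def by (rule H2_line_L2[OF F]) simp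
  have small: "\<exists>n0. \<forall>n\<ge>n0. 1 / real (Suc n) \<le> \<delta>" if "\<delta> > 0" for \<delta>
  proof -
    have "\<forall>\<^sub>F n in sequentially. 1 / real (Suc n) < \<delta>"
      using order_tendstoD(2)[OF LIMSEQ_Suc[OF lim_1_over_n] that] by simp
    then show ?thesis unfolding eventually_sequentially by (meson less_imp_le)
  qed
  have Cu: "\<exists>n0. \<forall>m\<ge>n0. \<forall>n\<ge>n0. L2_norm lborel (\<lambda>y. u m y - u n y) < e" if pe: "e > 0" for e
  proof -
    obtain \<delta> where \<delta>: "\<delta> > 0" "\<And>x x'. 0 < x \<Longrightarrow> x \<le> \<delta> \<Longrightarrow> 0 < x' \<Longrightarrow> x' \<le> \<delta> \<Longrightarrow> L2_norm lborel (\<lambda>y. F (Complex x y) - F (Complex x' y)) < e"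
      using C[OF pe] by blast
    obtain n0 where "\<And>n. n \<ge> n0 \<Longrightarrow> 1 / real (Suc n) \<le> \<delta>" using small[OF \<delta>(1)] by blast
    then show ?thesis unfolding u_def by (intro exI[of _ n0] allI impI \<delta>(2)) auto
  qed
  obtain f r where f: "f \<in> L2 lborel" "(\<lambda>n. L2_norm lborel (\<lambda>y. u n y - f y)) \<longlonglongrightarrow> 0"
    "strict_mono (r :: nat \<Rightarrow> nat)" "AE y in lborel. (\<lambda>n. u (r n) y) \<longlonglongrightarrow> f y"
    by (rule L2_complete[OF uL Cu])
  have "((\<lambda>x. L2_norm lborel (\<lambda>y. F (Complex x y) - f y)) \<longlongrightarrow> 0) (at_right 0)"
  proof (rule tendstoI)
    fix e :: real assume e: "e > 0"
    then obtain \<delta> where \<delta>: "\<delta> > 0" "\<And>x x'. 0 < x \<Longrightarrow> x \<le> \<delta> \<Longrightarrow> 0 < x' \<Longrightarrow> x' \<le> \<delta> \<Longrightarrow> L2_norm lborel (\<lambda>y. F (Complex x y) - F (Complex x' y)) < e / 2"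
      using C[of "e / 2"] by auto
    obtain n0 where n0: "\<And>n. n \<ge> n0 \<Longrightarrow> 1 / real (Suc n) \<le> \<delta>" using small[OF \<delta>(1)] by blast
    have "\<forall>\<^sub>F n in sequentially. L2_norm lborel (\<lambda>y. u n y - f y) < e / 2"
      using order_tendstoD(2)[OF f(2), of "e / 2"] e by simp
    then obtain n1 where n1: "\<And>n. n \<ge> n1 \<Longrightarrow> L2_norm lborel (\<lambda>y. u n y - f y) < e / 2"
      unfolding eventually_sequentially by blast
    define n where "n = max n0 n1"
    have "\<forall>\<^sub>F x in at_right 0. x \<in> {0<..<\<delta>}" by (rule eventually_at_right_real[OF \<delta>(1)])
    then show "\<forall>\<^sub>F x in at_right 0. dist (L2_norm lborel (\<lambda>y. F (Complex x y) - f y)) 0 < e"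
    proof eventually_elim
      case (elim x)
      then have x: "x > 0" "x \<le> \<delta>" by auto
      have "L2_norm lborel (\<lambda>y. F (Complex x y) - f y)
        \<le> L2_norm lborel (\<lambda>y. F (Complex x y) - u n y) + L2_norm lborel (\<lambda>y. u n y - f y)"
        by (rule L2_norm_triangle_diff[OF H2_line_L2[OF F x(1)] uL f(1)])
      also have "\<dots> < e / 2 + e / 2"
        unfolding u_def using n0[of n] n1[of n] x by (intro add_strict_mono \<delta>(2)) (auto simp: n_def u_def)
      finally show ?case by (simp add: dist_real_def L2_norm_nonneg)
    qed
  qed
  with f(1) show ?thesis by blast
qed

lemma bdry_L2: "F \<in> H2 \<Longrightarrow> bdry F \<in> L2 lborel"
  using someI_ex[OF bdry_exists] unfolding bdry_def by blast

lemma tendsto_bdry: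
  "F \<in> H2 \<Longrightarrow> ((\<lambda>x. L2_norm lborel (\<lambda>y. F (Complex x y) - bdry F y)) \<longlongrightarrow> 0) (at_right 0)"
  using someI_ex[OF bdry_exists] unfolding bdry_def by blast

lemma filterlim_inverse_Suc_at_right: "filterlim (\<lambda>n. 1 / real (Suc n)) (at_right 0) sequentially"
  unfolding filterlim_at using LIMSEQ_Suc[OF lim_1_over_n] by (auto intro!: always_eventually)

lemma LIMSEQ_bdry:
  "F \<in> H2 \<Longrightarrow> (\<lambda>n. L2_norm lborel (\<lambda>y. F (Complex (1 / real (Suc n)) y) - bdry F y)) \<longlonglongrightarrow> 0"
  using filterlim_compose[OF tendsto_bdry filterlim_inverse_Suc_at_right] by simp

lemma bdry_AE_eqI:
  assumes F: "F \<in> H2" and g: "AE y in lborel. (\<lambda>n. F (Complex (1 / real (Suc n)) y)) \<longlonglongrightarrow> g y"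
  shows "AE y in lborel. bdry F y = g y"
  by (rule L2_limit_AE_unique[OF _ bdry_L2[OF F] LIMSEQ_bdry[OF F] g]) (simp add: H2_line_L2[OF F])

text \<open>Monotonicity of the line norms turns the supremum in the Hardy norm into a limit at the
  axis.\<close>

lemma H2_norm_sq_eq_bdry:
  assumes F: "F \<in> H2"
  shows "H2_norm_sq F = ennreal ((L2_norm lborel (bdry F))\<^sup>2 / (2 * pi))"
proof -
  define N where "N x = (L2_norm lborel (\<lambda>y. F (Complex x y)))\<^sup>2" for x
  define b where "b = (L2_norm lborel (bdry F))\<^sup>2"
  have lim: "(\<lambda>n. N (1 / real (Suc n))) \<longlonglongrightarrow> b"
    unfolding N_def b_def
    by (intro tendsto_intros tendsto_L2_norm LIMSEQ_bdry[OF F] bdry_L2[OF F]) (simp add: H2_line_L2[OF F])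
  have le: "N x \<le> b" if "x > 0" for x
  proof (rule tendsto_lowerbound[OF lim])
    have "\<forall>\<^sub>F n in sequentially. 1 / real (Suc n) < x"
      using order_tendstoD(2)[OF LIMSEQ_Suc[OF lim_1_over_n] that] by simp
    then show "\<forall>\<^sub>F n in sequentially. N x \<le> N (1 / real (Suc n))"
      by eventually_elim (auto simp: N_def intro!: H2_line_norm_antimono[OF F])
  qed simp
  have "(SUP x\<in>{0::real<..}. \<integral>\<^sup>+y. ennreal ((cmod (F (Complex x y)))\<^sup>2) \<partial>lborel) = (SUP x\<in>{0::real<..}. ennreal (N x))"
    unfolding N_def by (intro SUP_cong refl nn_integral_L2_norm H2_line_L2[OF F]) simp
  also have "\<dots> = ennreal b"
  proof (rule antisym)
    show "(SUP x\<in>{0::real<..}. ennreal (N x)) \<le> ennreal b" by (intro SUP_least ennreal_leI le) simp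
    have "(\<lambda>n. ennreal (N (1 / real (Suc n)))) \<longlonglongrightarrow> ennreal b" by (intro tendsto_intros lim)
    then show "ennreal b \<le> (SUP x\<in>{0::real<..}. ennreal (N x))"
      by (rule LIMSEQ_le_const2) (auto intro!: SUP_upper)
  qed
  finally show ?thesis
    unfolding H2_norm_sq_def b_def by (simp flip: ennreal_mult)
qed

lemma bdry_lincomb:
  assumes F: "F \<in> H2" and G: "G \<in> H2"
  shows "AE y in lborel. bdry (\<lambda>s. a * F s + b * G s) y = a * bdry F y + b * bdry G y"
proof -
  let ?x = "\<lambda>n. 1 / real (Suc n)"
  let ?u = "\<lambda>n y. a * F (Complex (?x n) y) + b * G (Complex (?x n) y)"
  let ?f = "\<lambda>y. a * bdry F y + b * bdry G y"
  note FG = H2_lincomb[OF F G, of a b]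
  have L: "(\<lambda>y. F (Complex (?x n) y)) \<in> L2 lborel" "(\<lambda>y. G (Complex (?x n) y)) \<in> L2 lborel" for n
    by (auto intro: H2_line_L2 F G)
  have fL: "?f \<in> L2 lborel" by (intro L2_lincomb bdry_L2 F G)
  have "(\<lambda>n. L2_norm lborel (\<lambda>y. ?u n y - ?f y)) \<longlonglongrightarrow> 0"
  proof (rule Lim_null_comparison)
    show "\<forall>\<^sub>F n in sequentially. norm (L2_norm lborel (\<lambda>y. ?u n y - ?f y)) \<le>
      cmod a * L2_norm lborel (\<lambda>y. F (Complex (?x n) y) - bdry F y) + cmod b * L2_norm lborel (\<lambda>y. G (Complex (?x n) y) - bdry G y)"
    proof (rule always_eventually, rule allI)
      fix n
      have "(\<lambda>y. ?u n y - ?f y) = (\<lambda>y. a * (F (Complex (?x n) y) - bdry F y) + b * (G (Complex (?x n) y) - bdry G y))"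
        by (auto simp: algebra_simps)
      then show "norm (L2_norm lborel (\<lambda>y. ?u n y - ?f y)) \<le>
          cmod a * L2_norm lborel (\<lambda>y. F (Complex (?x n) y) - bdry F y) + cmod b * L2_norm lborel (\<lambda>y. G (Complex (?x n) y) - bdry G y)"
        using L2_norm_triangle[OF L2_scale[OF L2_diff[OF L(1)[of n] bdry_L2[OF F]], of a] L2_scale[OF L2_diff[OF L(2)[of n] bdry_L2[OF G]], of b]]
        by (simp add: L2_norm_scale L2_norm_nonneg)
    qed
    show "(\<lambda>n. cmod a * L2_norm lborel (\<lambda>y. F (Complex (?x n) y) - bdry F y) + cmod b * L2_norm lborel (\<lambda>y. G (Complex (?x n) y) - bdry G y)) \<longlonglongrightarrow> 0"
      using tendsto_add[OF tendsto_mult_left[OF LIMSEQ_bdry[OF F], of "cmod a"] tendsto_mult_left[OF LIMSEQ_bdry[OF G], of "cmod b"]] by simp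
  qed
  moreover have "(\<lambda>n. L2_norm lborel (\<lambda>y. ?u n y - bdry (\<lambda>s. a * F s + b * G s) y)) \<longlonglongrightarrow> 0"
    using LIMSEQ_bdry[OF FG] by simp
  ultimately have "(\<lambda>n. L2_norm lborel (\<lambda>y. ?u n y - bdry (\<lambda>s. a * F s + b * G s) y) + L2_norm lborel (\<lambda>y. ?u n y - ?f y)) \<longlonglongrightarrow> 0"
    using tendsto_add by fastforce
  then have "L2_norm lborel (\<lambda>y. bdry (\<lambda>s. a * F s + b * G s) y - ?f y) \<le> 0"
  proof (rule tendsto_lowerbound)
    show "\<forall>\<^sub>F n in sequentially. L2_norm lborel (\<lambda>y. bdry (\<lambda>s. a * F s + b * G s) y - ?f y)
      \<le> L2_norm lborel (\<lambda>y. ?u n y - bdry (\<lambda>s. a * F s + b * G s) y) + L2_norm lborel (\<lambda>y. ?u n y - ?f y)"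
    proof (rule always_eventually, rule allI)
      fix n
      show "L2_norm lborel (\<lambda>y. bdry (\<lambda>s. a * F s + b * G s) y - ?f y)
        \<le> L2_norm lborel (\<lambda>y. ?u n y - bdry (\<lambda>s. a * F s + b * G s) y) + L2_norm lborel (\<lambda>y. ?u n y - ?f y)"
        using L2_norm_triangle_diff[OF bdry_L2[OF FG] L2_lincomb[OF L(1)[of n] L(2)[of n], of a b] fL]
        by (simp add: L2_norm_minus_commute[of lborel "bdry _"])
    qed
  qed simp
  then have "L2_norm lborel (\<lambda>y. bdry (\<lambda>s. a * F s + b * G s) y - ?f y) = 0"
    using L2_norm_nonneg antisym by blast
  then show ?thesis
    using L2_norm_eq_0_iff[OF L2_diff[OF bdry_L2[OF FG] fL]] by simp
qed

lemma H2_norm_sq_lincomb: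
  assumes F: "F \<in> H2" and G: "G \<in> H2"
  shows "enn2real (H2_norm_sq (\<lambda>s. a * F s + b * G s)) =
    ((cmod a)\<^sup>2 * (L2_norm lborel (bdry F))\<^sup>2 + (cmod b)\<^sup>2 * (L2_norm lborel (bdry G))\<^sup>2
      + 2 * Re (a * cnj b * L2_ip lborel (bdry F) (bdry G))) / (2 * pi)"
proof -
  have "L2_norm lborel (bdry (\<lambda>s. a * F s + b * G s)) = L2_norm lborel (\<lambda>y. a * bdry F y + b * bdry G y)"
    by (intro L2_norm_cong_AE L2_measurable bdry_lincomb bdry_L2 L2_lincomb H2_lincomb F G)
  then have "enn2real (H2_norm_sq (\<lambda>s. a * F s + b * G s)) =
      (L2_norm lborel (\<lambda>y. a * bdry F y + b * bdry G y))\<^sup>2 / (2 * pi)"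
    unfolding H2_norm_sq_eq_bdry[OF H2_lincomb[OF F G]] by simp
  then show ?thesis
    by (simp only: L2_norm_add_power2[OF bdry_L2[OF F] bdry_L2[OF G]])
qed

text \<open>Sesquilinearity of \<open>H2_inner\<close> is not visible in the polarization formula;
  it is inherited from the boundary functions through this identity.\<close>

lemma H2_inner_eq_bdry:
  assumes F: "F \<in> H2" and G: "G \<in> H2"
  shows "H2_inner F G = L2_ip lborel (bdry F) (bdry G) / (2 * pi)"
proof -
  define A where "A = (L2_norm lborel (bdry F))\<^sup>2"
  define B where "B = (L2_norm lborel (bdry G))\<^sup>2"
  define p where "p = L2_ip lborel (bdry F) (bdry G)"
  have n: "enn2real (H2_norm_sq (\<lambda>s. F s + b * G s)) = (A + (cmod b)\<^sup>2 * B + 2 * Re (cnj b * p)) / (2 * pi)" for b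
    using H2_norm_sq_lincomb[OF F G, of 1 b] by (simp add: A_def B_def p_def)
  have "H2_inner F G = (\<Sum>k<4. \<i> ^ k * complex_of_real ((A + (cmod (\<i> ^ k))\<^sup>2 * B + 2 * Re (cnj (\<i> ^ k) * p)) / (2 * pi))) / 4"
    unfolding H2_inner_def n ..
  also have "\<dots> = p / (2 * pi)"
  proof -
    have s4: "(\<Sum>k<4. f k) = f 0 + f 1 + f 2 + f 3" for f :: "nat \<Rightarrow> complex"
      by (simp add: eval_nat_numeral)
    have "\<i> ^ 3 = - \<i>" by (simp add: eval_nat_numeral)
    then show ?thesis unfolding s4 by (simp add: norm_power complex_eq_iff field_simps)
  qed
  finally show ?thesis by (simp add: p_def)
qed

section \<open>The Poisson formula and reproducing kernels\<close>

lemma real_kernel_L2: "Re w > 0 \<Longrightarrow> (\<lambda>y. complex_of_real (Poisson_kernel w y)) \<in> L2 lborel"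
proof -
  assume w: "Re w > 0"
  define c where "c = Re w / (pi * (Re w)\<^sup>2)"
  have c: "c > 0" using w by (simp add: c_def)
  have b: "Poisson_kernel w y \<le> c" for y
    unfolding Poisson_kernel_def c_def using w
    by (intro divide_left_mono mult_left_mono mult_pos_pos) (auto simp: add_pos_nonneg)
  have "integrable lborel (\<lambda>y. (c * Re w / pi) * (1 / ((Re w)\<^sup>2 + (y - Im w)\<^sup>2)))"
    by (intro integrable_mult_right integrable_inverse_square_plus w)
  then have "integrable lborel (\<lambda>y. (Poisson_kernel w y)\<^sup>2)"
  proof (rule Bochner_Integration.integrable_bound)
    show "AE y in lborel. norm ((Poisson_kernel w y)\<^sup>2) \<le> norm ((c * Re w / pi) * (1 / ((Re w)\<^sup>2 + (y - Im w)\<^sup>2)))"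
    proof (rule AE_I2)
      fix y
      have "(Poisson_kernel w y)\<^sup>2 \<le> c * Poisson_kernel w y"
        unfolding power2_eq_square using b[of y] Poisson_kernel_nonneg[OF w] by (intro mult_right_mono)
      also have "\<dots> = (c * Re w / pi) * (1 / ((Re w)\<^sup>2 + (y - Im w)\<^sup>2))" by (simp add: Poisson_kernel_def)
      finally show "norm ((Poisson_kernel w y)\<^sup>2) \<le> norm ((c * Re w / pi) * (1 / ((Re w)\<^sup>2 + (y - Im w)\<^sup>2)))"
        using c w by simp
    qed
  qed measurable
  then show ?thesis by (simp add: L2_def)
qed

lemma Poisson_kernel_integral:
  assumes "Re w > 0"
  shows "integrable lborel (Poisson_kernel w)" and "(\<integral>y. Poisson_kernel w y \<partial>lborel) = 1"
proof -
  have eq: "Poisson_kernel w = (\<lambda>y. (Re w / pi) * (1 / ((Re w)\<^sup>2 + (y - Im w)\<^sup>2)))"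
    by (auto simp: Poisson_kernel_def)
  show "integrable lborel (Poisson_kernel w)"
    unfolding eq by (intro integrable_mult_right integrable_inverse_square_plus assms)
  show "(\<integral>y. Poisson_kernel w y \<partial>lborel) = 1"
    unfolding eq by (subst integral_mult_right_zero) (use integrable_inverse_square_plus(2)[OF assms, of "Im w"] assms in simp)
qed

text \<open>Stated at the shifted point, so that the kernel does not depend on \<open>a\<close> and
  the passage to the axis is a plain L2 limit.\<close>

lemma Poisson_line_H2:
  assumes F: "F \<in> H2" and a: "a > 0" and w: "Re w > 0"
  shows "F (w + of_real a) = L2_ip lborel (\<lambda>y. F (Complex a y)) (\<lambda>y. of_real (Poisson_kernel w y))"
proof -
  let ?K = "2 * pi * enn2real (H2_norm_sq F)"
  have "F (w + of_real a) = (\<integral>y. F (Complex a y) * of_real ((Re (w + of_real a) - a) /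
      (pi * ((Re (w + of_real a) - a)\<^sup>2 + (y - Im (w + of_real a))\<^sup>2))) \<partial>lborel)"
  proof (rule Poisson_formula_line[OF H2_holomorphic[OF F] a, where C="?K"])
    show "a < Re (w + of_real a)" using w by simp
    fix x assume "x \<ge> a"
    then have x: "x > 0" using a by simp
    have "(\<integral>\<^sup>+y. ennreal ((cmod (F (Complex x y)))\<^sup>2 / (1 + (y - Im (w + of_real a))\<^sup>2)) \<partial>lborel)
      \<le> (\<integral>\<^sup>+y. ennreal ((cmod (F (Complex x y)))\<^sup>2) \<partial>lborel)"
      by (intro nn_integral_mono ennreal_leI) (simp add: divide_le_eq add_pos_nonneg algebra_simps)
    also have "\<dots> \<le> ennreal ?K" by (rule H2_line_le[OF F x])
    finally show "(\<integral>\<^sup>+y. ennreal ((cmod (F (Complex x y)))\<^sup>2 / (1 + (y - Im (w + of_real a))\<^sup>2)) \<partial>lborel) \<le> ennreal ?K" .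
  qed
  then show ?thesis by (simp add: L2_ip_def Poisson_kernel_def)
qed

lemma H2_limit_from_right:
  assumes "F \<in> H2" "Re w > 0"
  shows "(\<lambda>n. F (w + of_real (1 / real (Suc n)))) \<longlonglongrightarrow> F w"
proof -
  have "isCont F w"
    using holomorphic_on_imp_continuous_on[OF H2_holomorphic[OF assms(1)]] assms(2) open_right_half_plane
    by (simp add: continuous_on_eq_continuous_at right_half_plane_def)
  moreover have "(\<lambda>n. w + of_real (1 / real (Suc n))) \<longlonglongrightarrow> w + of_real 0"
    by (intro tendsto_intros LIMSEQ_Suc[OF lim_1_over_n])
  ultimately show ?thesis by (intro isCont_tendsto_compose[of w F]) auto
qed

lemma Poisson_formula_H2:
  assumes F: "F \<in> H2" and w: "Re w > 0"
  shows "F w = L2_ip lborel (bdry F) (\<lambda>y. of_real (Poisson_kernel w y))"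
proof -
  have "(\<lambda>n. L2_ip lborel (\<lambda>y. F (Complex (1 / real (Suc n)) y)) (\<lambda>y. of_real (Poisson_kernel w y)))
      \<longlonglongrightarrow> L2_ip lborel (bdry F) (\<lambda>y. of_real (Poisson_kernel w y))"
    by (intro tendsto_L2_ip LIMSEQ_bdry F bdry_L2 real_kernel_L2 w H2_line_L2) simp
  moreover have eq: "F (w + of_real (1 / real (Suc n)))
      = L2_ip lborel (\<lambda>y. F (Complex (1 / real (Suc n)) y)) (\<lambda>y. of_real (Poisson_kernel w y))" for n
    by (rule Poisson_line_H2[OF F _ w]) simp
  moreover note H2_limit_from_right[OF F w, unfolded eq]
  ultimately show ?thesis using LIMSEQ_unique by blast
qed

lemma Cauchy_kernel_line:
  fixes w :: complex
  assumes x: "Re w < x"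
  shows "(\<lambda>y. cnj (1 / (Complex x y - w))) \<in> L2 lborel"
    and "(L2_norm lborel (\<lambda>y. cnj (1 / (Complex x y - w))))\<^sup>2 = pi / (x - Re w)"
proof -
  have eq: "(cmod (cnj (1 / (Complex x y - w))))\<^sup>2 = 1 / ((x - Re w)\<^sup>2 + (y - Im w)\<^sup>2)" for y
    unfolding complex_mod_cnj by (simp add: norm_divide power_divide cmod_power2)
  have d: "x - Re w > 0" using x by simp
  show "(\<lambda>y. cnj (1 / (Complex x y - w))) \<in> L2 lborel"
    unfolding L2_def mem_Collect_eq eq
    by (intro conjI integrable_inverse_square_plus d) measurable
  show "(L2_norm lborel (\<lambda>y. cnj (1 / (Complex x y - w))))\<^sup>2 = pi / (x - Re w)"
    unfolding L2_norm_power2 eq by (rule integrable_inverse_square_plus(2)[OF d])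
qed

text \<open>The pole lies to the left, so the line can be moved to infinity, where the
  Cauchy-Schwarz inequality bounds the integral by a multiple of
  \<open>(b - Re w)^(-1/2)\<close>.\<close>

lemma Cauchy_integral_outside:
  assumes F: "F \<in> H2" and a: "a > 0" and w: "Re w < a"
  shows "L2_ip lborel (\<lambda>y. F (Complex a y)) (\<lambda>y. cnj (1 / (Complex a y - w))) = 0"
proof -
  let ?K = "2 * pi * enn2real (H2_norm_sq F)"
  define S where "S = {z. max 0 (Re w) < Re z}"
  define H where "H z = F z * (1 / (z - w))" for z
  have S: "convex S" "open S"
    unfolding S_def
    by (auto simp: Collect_conj_eq intro!: convex_Int open_Int convex_halfspace_Re_gt open_halfspace_Re_gt)
  have hF: "F holomorphic_on right_half_plane" by (rule H2_holomorphic[OF F])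
  have hH: "H holomorphic_on S"
    unfolding H_def by (intro holomorphic_intros holomorphic_on_subset[OF hF]) (auto simp: S_def right_half_plane_def)
  have HI: "(\<integral>y. H (Complex x y) \<partial>lborel) = L2_ip lborel (\<lambda>y. F (Complex x y)) (\<lambda>y. cnj (1 / (Complex x y - w)))" for x
    by (simp add: H_def L2_ip_def)
  have int: "integrable lborel (\<lambda>y. H (Complex x y))" if "x \<ge> a" for x
    using L2_ip_integrable[OF H2_line_L2[OF F] Cauchy_kernel_line(1)[of w x], of x] that a w by (simp add: H_def)
  have sh: "L2_ip lborel (\<lambda>y. F (Complex a y)) (\<lambda>y. cnj (1 / (Complex a y - w)))
     = L2_ip lborel (\<lambda>y. F (Complex b y)) (\<lambda>y. cnj (1 / (Complex b y - w)))" if b: "b > a" for b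
    unfolding HI[symmetric]
  proof (rule line_integral_shift[OF b S _ hH _ int int])
    show "{z. a \<le> Re z \<and> Re z \<le> b} \<subseteq> S" using a w by (auto simp: S_def)
    show "(\<integral>\<^sup>+x. (\<integral>\<^sup>+y. ennreal (cmod (H (Complex x y))) \<partial>lborel) * indicator {a..b} x \<partial>lborel) < \<infinity>"
    proof (rule strip_integral_finite[where C="?K + pi / (a - Re w)"])
      fix x assume "x \<in> {a..b}"
      then have x: "x > 0" "Re w < x" "a \<le> x" using a w by auto
      note [measurable] = line_measurable[OF hF x(1)] L2_measurable[OF Cauchy_kernel_line(1)[OF x(2)]]
      have "(\<integral>\<^sup>+y. ennreal (cmod (H (Complex x y))) \<partial>lborel)
        \<le> (\<integral>\<^sup>+y. ennreal ((cmod (F (Complex x y)))\<^sup>2) + ennreal ((cmod (cnj (1 / (Complex x y - w))))\<^sup>2) \<partial>lborel)"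
      proof (rule nn_integral_mono)
        fix y
        let ?q = "cnj (1 / (Complex x y - w))"
        have "cmod (F (Complex x y)) * cmod ?q \<le> (cmod (F (Complex x y)))\<^sup>2 + (cmod ?q)\<^sup>2"
          using sum_squares_bound[of "cmod (F (Complex x y))" "cmod ?q"]
            mult_nonneg_nonneg[OF norm_ge_zero[of "F (Complex x y)"] norm_ge_zero[of ?q]] by linarith
        moreover have "cmod (H (Complex x y)) = cmod (F (Complex x y)) * cmod ?q"
          unfolding H_def norm_mult complex_mod_cnj ..
        ultimately show "ennreal (cmod (H (Complex x y))) \<le> ennreal ((cmod (F (Complex x y)))\<^sup>2) + ennreal ((cmod ?q)\<^sup>2)"
          by (simp del: complex_cnj_divide flip: ennreal_plus)
      qed
      also have "\<dots> = (\<integral>\<^sup>+y. ennreal ((cmod (F (Complex x y)))\<^sup>2) \<partial>lborel) + (\<integral>\<^sup>+y. ennreal ((cmod (cnj (1 / (Complex x y - w))))\<^sup>2) \<partial>lborel)"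
        by (rule nn_integral_add) measurable
      also have "\<dots> \<le> ennreal ?K + ennreal (pi / (a - Re w))"
      proof (intro add_mono H2_line_le F x)
        show "(\<integral>\<^sup>+y. ennreal ((cmod (cnj (1 / (Complex x y - w))))\<^sup>2) \<partial>lborel) \<le> ennreal (pi / (a - Re w))"
          unfolding nn_integral_L2_norm[OF Cauchy_kernel_line(1)[OF x(2)]] Cauchy_kernel_line(2)[OF x(2)]
          using w x by (intro ennreal_leI divide_left_mono) auto
      qed
      also have "\<dots> = ennreal (?K + pi / (a - Re w))" using w by (intro ennreal_plus[symmetric]) auto
      finally show "(\<integral>\<^sup>+y. ennreal (cmod (H (Complex x y))) \<partial>lborel) \<le> ennreal (?K + pi / (a - Re w))" .
    qed
  qed (use b in auto)
  let ?I = "L2_ip lborel (\<lambda>y. F (Complex a y)) (\<lambda>y. cnj (1 / (Complex a y - w)))"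
  have bound: "cmod ?I \<le> sqrt ?K * sqrt (pi / (b - Re w))" if b: "b > a" for b
  proof -
    have b': "Re w < b" "b > 0" using b w a by auto
    have "L2_norm lborel (\<lambda>y. F (Complex b y)) \<le> sqrt ?K"
      using H2_line_norm_le[OF F b'(2)] by (rule real_le_rsqrt)
    moreover have "L2_norm lborel (\<lambda>y. cnj (1 / (Complex b y - w))) \<le> sqrt (pi / (b - Re w))"
      using Cauchy_kernel_line(2)[OF b'(1)] by (intro real_le_rsqrt) simp
    ultimately show ?thesis unfolding sh[OF b]
      by (intro order_trans[OF L2_Cauchy_Schwarz[OF H2_line_L2[OF F b'(2)] Cauchy_kernel_line(1)[OF b'(1)]]] mult_mono L2_norm_nonneg)
        (auto simp: L2_norm_nonneg)
  qed
  have "((\<lambda>b. sqrt ?K * sqrt (pi / (b - Re w))) \<longlongrightarrow> sqrt ?K * sqrt 0) at_top"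
    by (intro tendsto_intros real_tendsto_divide_at_top[OF tendsto_const]) 
      (auto intro!: filterlim_tendsto_add_at_top[OF tendsto_const filterlim_ident, of "- Re w", simplified])
  from tendsto_lowerbound[OF this eventually_mono[OF eventually_gt_at_top[of a] bound]]
  have "cmod ?I \<le> sqrt ?K * sqrt 0" by simp
  then show ?thesis by simp
qed

text \<open>With the factor \<open>1 / (2 * pi)\<close> in the norm this is the reproducing kernel
  at \<open>w\<close>; it is also the transform of \<open>power_fun w\<close>.\<close>

definition H2_kernel :: "complex \<Rightarrow> complex \<Rightarrow> complex" where
  "H2_kernel w s = 1 / (s + cnj w)"

lemma H2_kernel_in_H2:
  assumes w: "Re w > 0"
  shows "H2_kernel w \<in> H2"
proof (rule H2I)
  show "H2_kernel w holomorphic_on right_half_plane"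
    unfolding H2_kernel_def using w
    by (intro holomorphic_intros) (auto simp: right_half_plane_def complex_eq_iff)
  fix x :: real assume x: "x > 0"
  have "(cmod (H2_kernel w (Complex x y)))\<^sup>2 = 1 / ((x + Re w)\<^sup>2 + (y - Im w)\<^sup>2)" for y
    by (simp add: H2_kernel_def norm_divide power_divide cmod_power2)
  then have "(\<integral>\<^sup>+y. ennreal ((cmod (H2_kernel w (Complex x y)))\<^sup>2) \<partial>lborel) = ennreal (pi / (x + Re w))"
    using nn_integral_inverse_square_plus[of "x + Re w" "Im w"] w x by simp
  also have "\<dots> \<le> ennreal (pi / Re w)" using w x by (intro ennreal_leI divide_left_mono) auto
  finally show "(\<integral>\<^sup>+y. ennreal ((cmod (H2_kernel w (Complex x y)))\<^sup>2) \<partial>lborel) \<le> ennreal (pi / Re w)" .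
qed

lemma H2_bdry_continuous:
  assumes F: "F \<in> H2" and c: "\<And>y. continuous (at (Complex 0 y) within {z. 0 \<le> Re z}) F"
  shows "AE y in lborel. bdry F y = F (Complex 0 y)"
proof (rule bdry_AE_eqI[OF F], rule AE_I2)
  fix y
  have "(\<lambda>n. Complex (1 / real (Suc n)) y) \<longlonglongrightarrow> Complex 0 y"
    by (intro tendsto_intros LIMSEQ_Suc[OF lim_1_over_n])
  then show "(\<lambda>n. F (Complex (1 / real (Suc n)) y)) \<longlonglongrightarrow> F (Complex 0 y)"
    using c[of y] unfolding continuous_within_sequentially by (auto simp: o_def)
qed

lemma bdry_H2_kernel:
  assumes w: "Re w > 0"
  shows "AE y in lborel. bdry (H2_kernel w) y = H2_kernel w (Complex 0 y)"
proof (rule H2_bdry_continuous[OF H2_kernel_in_H2[OF w]])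
  fix y
  have "isCont (H2_kernel w) (Complex 0 y)"
    unfolding H2_kernel_def using w by (intro continuous_intros) (auto simp: complex_eq_iff)
  then show "continuous (at (Complex 0 y) within {z. 0 \<le> Re z}) (H2_kernel w)"
    by (rule continuous_at_imp_continuous_at_within)
qed

text \<open>On the axis the kernel plus its conjugate \<open>c\<close> is \<open>2 * pi\<close>
  times the Poisson kernel. Pairing \<open>bdry F\<close> with \<open>c\<close> integrates it
  against a function whose pole \<open>- cnj w\<close> is in the left half-plane, which gives 0, so
  only the Poisson part remains.\<close>

lemma H2_reproducing:
  assumes F: "F \<in> H2" and w: "Re w > 0"
  shows "H2_inner F (H2_kernel w) = F w"
proof -
  let ?k = "\<lambda>y. H2_kernel w (Complex 0 y)"
  let ?x = "\<lambda>n. 1 / real (Suc n)"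
  have kL: "?k \<in> L2 lborel"
    by (rule L2_cong_AE[OF _ bdry_L2[OF H2_kernel_in_H2[OF w]]])
      (auto simp: H2_kernel_def intro: AE_mp[OF bdry_H2_kernel[OF w]])
  define c where "c = (\<lambda>y. cnj (1 / (Complex 0 y + cnj w)))"
  have cL: "c \<in> L2 lborel" unfolding c_def using Cauchy_kernel_line(1)[of "- cnj w" 0] w by simp
  have c0: "L2_ip lborel (bdry F) c = 0"
  proof -
    have "(\<lambda>n. L2_ip lborel (\<lambda>y. F (Complex (?x n) y)) c) \<longlonglongrightarrow> L2_ip lborel (bdry F) c"
      by (intro tendsto_L2_ip LIMSEQ_bdry F bdry_L2 cL H2_line_L2) simp
    moreover have "L2_ip lborel (\<lambda>y. F (Complex (?x n) y)) c = 0" for n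
    proof -
      \<comment> \<open>Moving the line by \<open>?x n\<close> moves the pole along, and it stays to
        the left of the line.\<close>
      have "c y = cnj (1 / (Complex (?x n) y - (of_real (?x n) - cnj w)))" for y
      proof -
        have "Complex (?x n) y - (of_real (?x n) - cnj w) = Complex 0 y + cnj w" by (simp add: complex_eq_iff)
        then show ?thesis by (simp only: c_def)
      qed
      then have ceq: "c = (\<lambda>y. cnj (1 / (Complex (?x n) y - (of_real (?x n) - cnj w))))" by (rule ext)
      show ?thesis unfolding ceq by (rule Cauchy_integral_outside[OF F]) (use w in auto)
    qed
    ultimately show ?thesis by (simp add: LIMSEQ_const_iff)
  qed
  have pk: "?k y = of_real (2 * pi) * of_real (Poisson_kernel w y) + (-1) * c y" for y
  proof -
    have nz: "Complex 0 y + cnj w \<noteq> 0" "cnj (Complex 0 y + cnj w) \<noteq> 0" using w by (auto simp: complex_eq_iff)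
    have "?k y + c y = (Complex 0 y + cnj w + cnj (Complex 0 y + cnj w)) / ((Complex 0 y + cnj w) * cnj (Complex 0 y + cnj w))"
      unfolding H2_kernel_def c_def complex_cnj_divide using nz by (simp add: divide_simps del: complex_cnj_add)
    also have "Complex 0 y + cnj w + cnj (Complex 0 y + cnj w) = of_real (2 * Re w)" by (simp add: complex_eq_iff)
    also have "(Complex 0 y + cnj w) * cnj (Complex 0 y + cnj w) = of_real ((Re w)\<^sup>2 + (y - Im w)\<^sup>2)"
      by (subst complex_mult_cnj) simp
    also have "of_real (2 * Re w) / of_real ((Re w)\<^sup>2 + (y - Im w)\<^sup>2) = complex_of_real (2 * pi * Poisson_kernel w y)"
      unfolding of_real_divide[symmetric] Poisson_kernel_def by simp
    finally show ?thesis by (simp add: algebra_simps)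
  qed
  have "L2_ip lborel (bdry F) (bdry (H2_kernel w)) = L2_ip lborel (bdry F) ?k"
    by (intro L2_ip_cong_AE L2_measurable bdry_L2 F H2_kernel_in_H2 w kL bdry_H2_kernel) auto
  also have "\<dots> = 2 * pi * F w"
    unfolding pk using L2_ip_lincomb_right[OF real_kernel_L2[OF w] cL bdry_L2[OF F], of "of_real (2 * pi)" "-1"]
      Poisson_formula_H2[OF F w] c0 by simp
  finally show ?thesis unfolding H2_inner_eq_bdry[OF F H2_kernel_in_H2[OF w]] by simp
qed

text \<open>Jensen's inequality for the probability density \<open>Poisson_kernel w\<close>,
  obtained from nonnegativity of a variance.\<close>

lemma norm_H2_power2_le_Poisson:
  assumes F: "F \<in> H2" and w: "Re w > 0"
  shows "ennreal ((cmod (F w))\<^sup>2) \<le> (\<integral>\<^sup>+y. ennreal (Poisson_kernel w y) * ennreal ((cmod (bdry F y))\<^sup>2) \<partial>lborel)"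
proof -
  define P where "P = Poisson_kernel w"
  define f where "f y = cmod (bdry F y)" for y
  note [measurable] = L2_measurable[OF bdry_L2[OF F]]
  have P: "P y \<ge> 0" for y unfolding P_def by (rule Poisson_kernel_nonneg[OF w])
  have Pm[measurable]: "P \<in> borel_measurable borel" unfolding P_def by measurable
  have i0: "integrable lborel P" "(\<integral>y. P y \<partial>lborel) = 1" unfolding P_def using Poisson_kernel_integral[OF w] .
  have i1: "integrable lborel (\<lambda>y. P y * f y)"
  proof -
    have "integrable lborel (\<lambda>y. norm (bdry F y * cnj (of_real (Poisson_kernel w y))))"
      by (intro integrable_norm L2_ip_integrable bdry_L2 F real_kernel_L2 w)
    then show ?thesis using P by (simp add: norm_mult P_def f_def mult.commute)
  qed
  have i2: "integrable lborel (\<lambda>y. P y * (f y)\<^sup>2)"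
  proof (rule Bochner_Integration.integrable_bound)
    show "integrable lborel (\<lambda>y. (1 / (pi * Re w)) * (f y)\<^sup>2)"
      unfolding f_def by (intro integrable_mult_right L2_integrable bdry_L2 F)
    show "AE y in lborel. norm (P y * (f y)\<^sup>2) \<le> norm (1 / (pi * Re w) * (f y)\<^sup>2)"
    proof (rule AE_I2)
      fix y
      have "P y \<le> Re w / (pi * (Re w)\<^sup>2)" unfolding P_def Poisson_kernel_def using w
        by (intro divide_left_mono mult_left_mono mult_pos_pos) (auto simp: add_pos_nonneg)
      also have "\<dots> = 1 / (pi * Re w)" using w by (simp add: power2_eq_square)
      finally show "norm (P y * (f y)\<^sup>2) \<le> norm (1 / (pi * Re w) * (f y)\<^sup>2)"
        using P[of y] w mult_right_mono[of "P y" "1 / (pi * Re w)" "(f y)\<^sup>2"] by (simp add: abs_mult)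
    qed
  qed (simp add: f_def)
  define m where "m = (\<integral>y. P y * f y \<partial>lborel)"
  have "cmod (F w) \<le> m"
  proof -
    have "cmod (F w) \<le> (\<integral>y. norm (bdry F y * cnj (of_real (Poisson_kernel w y))) \<partial>lborel)"
      unfolding Poisson_formula_H2[OF F w] L2_ip_def by (rule integral_norm_bound)
    also have "\<dots> = m" unfolding m_def using P
      by (intro Bochner_Integration.integral_cong) (auto simp: norm_mult P_def f_def mult.commute)
    finally show ?thesis .
  qed
  have "0 \<le> (\<integral>y. P y * (f y - m)\<^sup>2 \<partial>lborel)" using P by (intro integral_nonneg_AE) auto
  also have "(\<lambda>y. P y * (f y - m)\<^sup>2) = (\<lambda>y. P y * (f y)\<^sup>2 + ((- 2 * m) * (P y * f y) + m\<^sup>2 * P y))"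
    by (auto simp: power2_diff algebra_simps)
  also have "(\<integral>y. P y * (f y)\<^sup>2 + ((- 2 * m) * (P y * f y) + m\<^sup>2 * P y) \<partial>lborel)
    = (\<integral>y. P y * (f y)\<^sup>2 \<partial>lborel) + ((- 2 * m) * m + m\<^sup>2 * 1)"
    using i0 i1 i2 unfolding m_def by (simp del: mult_minus_left)
  finally have "m\<^sup>2 \<le> (\<integral>y. P y * (f y)\<^sup>2 \<partial>lborel)" by (simp add: power2_eq_square)
  moreover have "(cmod (F w))\<^sup>2 \<le> m\<^sup>2" using \<open>cmod (F w) \<le> m\<close> by (intro power_mono) auto
  ultimately have "ennreal ((cmod (F w))\<^sup>2) \<le> ennreal (\<integral>y. P y * (f y)\<^sup>2 \<partial>lborel)" by (intro ennreal_leI) simp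
  also have "\<dots> = (\<integral>\<^sup>+y. ennreal (P y * (f y)\<^sup>2) \<partial>lborel)"
    using P by (intro nn_integral_eq_integral[symmetric] i2) auto
  also have "\<dots> = (\<integral>\<^sup>+y. ennreal (Poisson_kernel w y) * ennreal ((cmod (bdry F y))\<^sup>2) \<partial>lborel)"
    using P by (simp add: P_def f_def ennreal_mult)
  finally show ?thesis .
qed

section \<open>Nontangential limits\<close>

lemma H2_shift:
  assumes F: "F \<in> H2" and x: "x > 0"
  shows "(\<lambda>s. F (s + of_real x)) \<in> H2"
proof (rule H2I)
  have "F \<circ> (\<lambda>s. s + of_real x) holomorphic_on right_half_plane"
    using x by (intro holomorphic_on_compose_gen[OF _ H2_holomorphic[OF F]] holomorphic_intros)
      (auto simp: right_half_plane_def)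
  then show "(\<lambda>s. F (s + of_real x)) holomorphic_on right_half_plane" by (simp add: o_def)
  fix u :: real assume "u > 0"
  then have "u + x > 0" using x by simp
  moreover have "Complex u y + of_real x = Complex (u + x) y" for y by (simp add: complex_eq_iff)
  ultimately show "(\<integral>\<^sup>+y. ennreal ((cmod (F (Complex u y + of_real x)))\<^sup>2) \<partial>lborel) \<le> ennreal (2 * pi * enn2real (H2_norm_sq F))"
    using H2_line_le[OF F] by simp
qed

lemma isCont_H2: "F \<in> H2 \<Longrightarrow> Re w > 0 \<Longrightarrow> isCont F w"
  using holomorphic_on_imp_continuous_on[OF H2_holomorphic] open_right_half_plane
  by (auto simp: continuous_on_eq_continuous_at right_half_plane_def)

lemma continuous_shift:
  assumes F: "F \<in> H2" and x: "x > 0" and s: "0 \<le> Re s"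
  shows "isCont (\<lambda>s. F (s + of_real x)) s"
proof -
  have "isCont F (s + of_real x)" using x s by (intro isCont_H2[OF F]) simp
  moreover have "isCont (\<lambda>s. s + complex_of_real x) s" by (intro continuous_intros)
  ultimately show ?thesis using isCont_o2 by blast
qed

lemma bdry_shift:
  assumes F: "F \<in> H2" and x: "x > 0"
  shows "AE y in lborel. bdry (\<lambda>s. F (s + of_real x)) y = F (Complex x y)"
proof -
  have "AE y in lborel. bdry (\<lambda>s. F (s + of_real x)) y = F (Complex 0 y + of_real x)"
  proof (rule H2_bdry_continuous[OF H2_shift[OF F x]])
    fix y
    show "continuous (at (Complex 0 y) within {z. 0 \<le> Re z}) (\<lambda>s. F (s + of_real x))"
      by (rule continuous_at_imp_continuous_at_within[OF continuous_shift[OF F x]]) simp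
  qed
  moreover have "Complex 0 y + of_real x = Complex x y" for y by (simp add: complex_eq_iff)
  ultimately show ?thesis by simp
qed

lemma bdry_diff_shift:
  assumes F: "F \<in> H2" and x: "x > 0"
  shows "AE y in lborel. bdry (\<lambda>s. F s - F (s + of_real x)) y = bdry F y - F (Complex x y)"
  using bdry_lincomb[OF F H2_shift[OF F x], of 1 "-1"] bdry_shift[OF F x] by eventually_elim simp

text \<open>A Carleson constant 1, which turns \<open>Carleson_weak_type\<close> into the
  Hardy-Littlewood maximal inequality.\<close>

lemma imaginary_axis_measure:
  assumes r: "r > 0"
  shows "emeasure (distr lborel borel (\<lambda>y. Complex 0 y)) (halfplane_square t r) \<le> ennreal (2 * 1 * r)"
proof -
  have "emeasure (distr lborel borel (\<lambda>y. Complex 0 y)) (halfplane_square t r)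
    = emeasure lborel ((\<lambda>y. Complex 0 y) -` halfplane_square t r \<inter> space lborel)"
    by (rule emeasure_distr) auto
  also have "(\<lambda>y. Complex 0 y) -` halfplane_square t r \<inter> space lborel = {t - r..t + r}"
    using r by (auto simp: halfplane_square_def)
  also have "emeasure lborel {t - r..t + r} = ennreal (2 * 1 * r)" using r by simp
  finally show ?thesis by simp
qed

text \<open>Shifts of \<open>F\<close> to the right are continuous up to the axis, and the maximal
  inequality controls the difference on cones outside a small set of vertices. Shifts for which
  these sets have summable measure let Borel-Cantelli dispose of them.\<close>

lemma nontangential_limit_H2:
  assumes F: "F \<in> H2"
  shows "AE y in lborel. has_nontangential_limit F y (bdry F y)"
proof -
  \<comment> \<open>A squared error \<open>(1/4)^k\<close> against the threshold
    \<open>(1/2)^k\<close> leaves exceptional sets of measure of order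
    \<open>(1/2)^k\<close>.\<close>
  have "\<exists>x>0. (L2_norm lborel (\<lambda>y. F (Complex x y) - bdry F y))\<^sup>2 \<le> (1/4)^k" for k
  proof -
    have "\<forall>\<^sub>F x in at_right 0. L2_norm lborel (\<lambda>y. F (Complex x y) - bdry F y) < (1/2)^k"
      using order_tendstoD(2)[OF tendsto_bdry[OF F], of "(1/2)^k"] by simp
    moreover have "\<forall>\<^sub>F x in at_right (0::real). x > 0" by (simp add: eventually_at_right_less)
    ultimately have "\<forall>\<^sub>F x in at_right 0. x > 0 \<and> L2_norm lborel (\<lambda>y. F (Complex x y) - bdry F y) < (1/2)^k"
      by eventually_elim simp
    then obtain x where x: "x > 0" "L2_norm lborel (\<lambda>y. F (Complex x y) - bdry F y) < (1/2)^k"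
      using eventually_happens' trivial_limit_at_right_real by blast
    have "(L2_norm lborel (\<lambda>y. F (Complex x y) - bdry F y))\<^sup>2 \<le> ((1/2)^k)\<^sup>2"
      using x by (intro power_mono L2_norm_nonneg) auto
    also have "\<dots> = ((1/2)\<^sup>2)^k" by (simp only: power_mult[symmetric] mult.commute)
    also have "\<dots> = (1/4)^k" by (simp add: power2_eq_square)
    finally show ?thesis using x by blast
  qed
  then obtain x where x: "\<And>k::nat. x k > 0" "\<And>k. (L2_norm lborel (\<lambda>y. F (Complex (x k) y) - bdry F y))\<^sup>2 \<le> (1/4)^k"
    by metis
  define D where "D k s = F s - F (s + of_real (x k))" for k s
  have D: "D k \<in> H2" for k unfolding D_def by (intro H2_diff H2_shift F x)
  note [measurable] = L2_measurable[OF bdry_L2[OF D]]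
  have Db: "AE y in lborel. \<forall>k. bdry (D k) y = bdry F y - F (Complex (x k) y)"
    unfolding D_def AE_all_countable by (intro allI bdry_diff_shift F x)
  define f where "f k y = ennreal ((cmod (bdry (D k) y))\<^sup>2)" for k y
  have fm[measurable]: "f k \<in> borel_measurable borel" for k unfolding f_def by measurable
  have fint: "(\<integral>\<^sup>+y. f k y \<partial>lborel) \<le> ennreal ((1/4)^k)" for k
  proof -
    have "L2_norm lborel (bdry (D k)) = L2_norm lborel (\<lambda>y. bdry F y - F (Complex (x k) y))"
      using Db by (intro L2_norm_cong_AE L2_measurable L2_diff bdry_L2 F D H2_line_L2 x) auto
    then have "(L2_norm lborel (bdry (D k)))\<^sup>2 \<le> (1/4)^k"
      using x(2)[of k] by (simp add: L2_norm_minus_commute[of lborel "bdry F"])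
    then show ?thesis unfolding f_def nn_integral_L2_norm[OF bdry_L2[OF D]] by (rule ennreal_leI)
  qed
  have "\<exists>B. B \<in> sets borel \<and> large_average_region (f k) ((1/2)^k) \<subseteq> B \<and>
      emeasure (distr lborel borel (\<lambda>y. Complex 0 y)) B \<le> ennreal (5 * (1/2)^k)" for k
  proof -
    obtain B where B: "B \<in> sets borel" "large_average_region (f k) ((1/2)^k) \<subseteq> B"
      "emeasure (distr lborel borel (\<lambda>y. Complex 0 y)) B \<le> ennreal (5 * 1 / (1/2)^k) * (\<integral>\<^sup>+y. f k y \<partial>lborel)"
      by (rule Carleson_weak_type[of "distr lborel borel (\<lambda>y. Complex 0 y)" 1 "f k" "(1/2)^k"])
        (auto intro: le_less_trans[OF fint] imaginary_axis_measure[simplified])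
    note B(3)
    also have "ennreal (5 * 1 / (1/2)^k) * (\<integral>\<^sup>+y. f k y \<partial>lborel) \<le> ennreal (5 * 1 / (1/2)^k) * ennreal ((1/4)^k)"
      by (intro mult_left_mono fint) simp
    also have "\<dots> = ennreal (5 * 1 / (1/2)^k * (1/4)^k)" by (rule ennreal_mult[symmetric]) auto
    also have "5 * 1 / (1/2)^k * (1/4)^k = 5 * (1/2::real)^k"
    proof -
      have "(1/4::real)^k = (1/2)^k * (1/2)^k" by (simp flip: power_mult_distrib)
      then show ?thesis by simp
    qed
    finally show ?thesis using B(1,2) by blast
  qed
  then obtain B where B: "\<And>k. B k \<in> sets borel" "\<And>k. large_average_region (f k) ((1/2)^k) \<subseteq> B k"
      "\<And>k. emeasure (distr lborel borel (\<lambda>y. Complex 0 y)) (B k) \<le> ennreal (5 * (1/2)^k)"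
    by metis
  note [measurable] = B(1)
  \<comment> \<open>The first set governs the cones with vertex \<open>y\<close> through averages,
    the second the boundary value at \<open>y\<close> itself. Their measures, 5 and 1 times
    \<open>(1/2)^k\<close>, add up to the constant 6.\<close>
  define A where "A k = {y \<in> space lborel. Complex 0 y \<in> B k} \<union> {y \<in> space lborel. 1 \<le> ennreal (2^k) * f k y}" for k
  have Am[measurable]: "A k \<in> sets lborel" for k unfolding A_def by measurable
  have Ale: "emeasure lborel (A k) \<le> ennreal (6 * (1/2)^k)" for k
  proof -
    have "emeasure lborel {y \<in> space lborel. Complex 0 y \<in> B k} = emeasure (distr lborel borel (\<lambda>y. Complex 0 y)) (B k)"
      by (subst emeasure_distr) (auto intro: arg_cong[where f="emeasure lborel"])
    then have 1: "emeasure lborel {y \<in> space lborel. Complex 0 y \<in> B k} \<le> ennreal (5 * (1/2)^k)" using B(3) by simp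
    have "emeasure lborel {y \<in> space lborel. 1 \<le> ennreal (2^k) * f k y}
      \<le> ennreal (2^k) * (\<integral>\<^sup>+y. f k y * indicator (space lborel) y \<partial>lborel)"
      by (rule nn_integral_Markov_inequality) auto
    also have "\<dots> \<le> ennreal (2^k) * ennreal ((1/4)^k)"
      using fint[of k] by (intro mult_left_mono) auto
    also have "\<dots> = ennreal (2^k * (1/4)^k)" by (rule ennreal_mult[symmetric]) auto
    also have "2^k * (1/4)^k = (1/2::real)^k" by (simp flip: power_mult_distrib)
    finally have 2: "emeasure lborel {y \<in> space lborel. 1 \<le> ennreal (2^k) * f k y} \<le> ennreal ((1/2)^k)" .
    have "emeasure lborel (A k) \<le> emeasure lborel {y \<in> space lborel. Complex 0 y \<in> B k} + emeasure lborel {y \<in> space lborel. 1 \<le> ennreal (2^k) * f k y}"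
      unfolding A_def by (rule emeasure_subadditive) measurable
    also have "\<dots> \<le> ennreal (5 * (1/2)^k) + ennreal ((1/2)^k)" by (intro add_mono 1 2)
    also have "\<dots> = ennreal (6 * (1/2)^k)" by (simp flip: ennreal_plus)
    finally show ?thesis .
  qed
  have "AE y in lborel. eventually (\<lambda>k. y \<in> space lborel - A k) sequentially"
  proof (rule borel_cantelli_AE1)
    show "A k \<in> sets lborel" for k by measurable
    show "emeasure lborel (A k) < \<infinity>" for k using Ale[of k] by (rule le_less_trans) simp
    have le: "measure lborel (A k) \<le> 6 * (1/2)^k" for k
      unfolding measure_def using Ale[of k] by (intro enn2real_leI) auto
    have "summable (\<lambda>k. 6 * (1/2::real)^k)" by (intro summable_mult summable_geometric) simp
    then show "summable (\<lambda>k. measure lborel (A k))"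
      by (rule summable_comparison_test'[where N=0]) (simp add: le del: power_one_over)
  qed
  with Db show ?thesis
  proof eventually_elim
    case (elim y)
    then obtain k0 where k0: "\<And>k. k \<ge> k0 \<Longrightarrow> y \<notin> A k" unfolding eventually_sequentially by auto
    have small: "(cmod (bdry F y - F (Complex (x k) y)))\<^sup>2 \<le> (1/2)^k" if "k \<ge> k0" for k
    proof -
      define X where "X = (cmod (bdry F y - F (Complex (x k) y)))\<^sup>2"
      have "f k y = ennreal X" unfolding f_def X_def using spec[OF elim(1), of k] by metis
      moreover have "\<not> 1 \<le> ennreal (2^k) * f k y" using k0[OF that] by (auto simp: A_def)
      ultimately have "\<not> ennreal 1 \<le> ennreal (2^k * X)" by (simp add: ennreal_mult X_def)
      then have "2^k * X \<le> 1" using ennreal_leI by (meson linear)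
      then show ?thesis unfolding X_def[symmetric] by (simp add: field_simps power_divide)
    qed
    show ?case
      unfolding has_nontangential_limit_def
    proof (intro allI impI tendstoI)
      fix \<alpha> e :: real assume \<alpha>: "\<alpha> > 0" and e: "e > 0"
      \<comment> \<open>The exceptional sets do not depend on the aperture \<alpha>; it enters only
        through the constant, so one null set serves all cones.\<close>
      have cone: "(cmod (D k s))\<^sup>2 \<le> 16 * (1 + \<alpha>\<^sup>2) * (1/2)^k" if k: "k \<ge> k0" and s: "Re s > 0" "\<bar>Im s - y\<bar> < \<alpha> * Re s" for k s
      proof -
        have notin: "Complex 0 y \<notin> large_average_region (f k) ((1/2)^k)"
          using k0[OF k] B(2)[of k] by (auto simp: A_def)
        have avg: "(\<integral>\<^sup>+u. f k u * indicator (cball y r) u \<partial>lborel) \<le> ennreal (2 * r * (1/2)^k)" if "r > 0" for r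
        proof (rule ccontr)
          assume "\<not> (\<integral>\<^sup>+u. f k u * indicator (cball y r) u \<partial>lborel) \<le> ennreal (2 * r * (1/2)^k)"
          then have "Complex 0 y \<in> large_average_region (f k) ((1/2)^k)"
            unfolding large_average_region_def using that by (auto simp: not_le intro!: exI[of _ r])
          with notin show False by simp
        qed
        have "ennreal ((cmod (D k s))\<^sup>2) \<le> (\<integral>\<^sup>+u. ennreal (Poisson_kernel s u) * f k u \<partial>lborel)"
          unfolding f_def by (rule norm_H2_power2_le_Poisson[OF D s(1)])
        also have "\<dots> \<le> ennreal (16 * (1 + \<alpha>\<^sup>2) * (1/2)^k)"
          using s by (intro Poisson_integral_le_averages[where y=y] avg fm) auto
        finally show ?thesis by (subst (asm) ennreal_le_iff) auto
      qed
      have "(\<lambda>k. 16 * (1 + \<alpha>\<^sup>2) * (1/2)^k) \<longlonglongrightarrow> 16 * (1 + \<alpha>\<^sup>2) * 0"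
        by (intro tendsto_intros LIMSEQ_realpow_zero) auto
      then have "\<forall>\<^sub>F k in sequentially. 16 * (1 + \<alpha>\<^sup>2) * (1/2)^k < (e/3)\<^sup>2"
        using e by (intro order_tendstoD) auto
      then obtain k where k: "k \<ge> k0" "16 * (1 + \<alpha>\<^sup>2) * (1/2)^k < (e/3)\<^sup>2"
        using eventually_happens'[OF _ eventually_conj[OF eventually_ge_at_top[of k0]]] by (metis sequentially_bot)
      have "1 * (1/2::real)^k \<le> 16 * (1 + \<alpha>\<^sup>2) * (1/2)^k"
        by (intro mult_right_mono) auto
      then have "(cmod (bdry F y - F (Complex (x k) y)))\<^sup>2 < (e/3)\<^sup>2" using small[OF k(1)] k(2) by linarith
      then have t3: "cmod (bdry F y - F (Complex (x k) y)) < e/3" using e by (meson less_eq_real_def power2_less_imp_less divide_nonneg_pos zero_less_numeral)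
      have "isCont F (Complex (x k) y)" using x(1) by (intro isCont_H2[OF F]) simp
      then obtain \<delta> where \<delta>: "\<delta> > 0" "\<And>s. dist s (Complex (x k) y) < \<delta> \<Longrightarrow> dist (F s) (F (Complex (x k) y)) < e/3"
        using e unfolding continuous_at_eps_delta by (metis divide_pos_pos zero_less_numeral)
      show "\<forall>\<^sub>F s in at (Complex 0 y) within {z. 0 < Re z \<and> \<bar>Im z - y\<bar> < \<alpha> * Re z}. dist (F s) (bdry F y) < e"
        unfolding eventually_at
      proof (intro exI[of _ \<delta>] conjI ballI impI \<delta>(1))
        fix s assume s: "s \<in> {z. 0 < Re z \<and> \<bar>Im z - y\<bar> < \<alpha> * Re z}" "s \<noteq> Complex 0 y \<and> dist s (Complex 0 y) < \<delta>"
        have "(s + of_real (x k)) - Complex (x k) y = s - Complex 0 y" by (simp add: complex_eq_iff)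
        then have "dist (s + of_real (x k)) (Complex (x k) y) < \<delta>" using s(2) by (simp only: dist_norm)
        then have t2: "cmod (F (s + of_real (x k)) - F (Complex (x k) y)) < e/3" using \<delta>(2) by (simp add: dist_norm)
        have "(cmod (D k s))\<^sup>2 < (e/3)\<^sup>2" using cone[OF k(1), of s] s(1) k(2) by auto
        then have t1: "cmod (F s - F (s + of_real (x k))) < e/3" using e unfolding D_def by (meson less_eq_real_def power2_less_imp_less divide_nonneg_pos zero_less_numeral)
        have "F s - bdry F y = (F s - F (s + of_real (x k))) + ((F (s + of_real (x k)) - F (Complex (x k) y)) - (bdry F y - F (Complex (x k) y)))" by simp
        then have "cmod (F s - bdry F y) \<le> cmod (F s - F (s + of_real (x k))) + (cmod (F (s + of_real (x k)) - F (Complex (x k) y)) + cmod (bdry F y - F (Complex (x k) y)))"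
          using order_trans[OF norm_triangle_ineq add_left_mono[OF norm_triangle_ineq4]] by (simp only:)
        then show "dist (F s) (bdry F y) < e" using t1 t2 t3 by (simp add: dist_norm)
      qed
    qed
  qed
qed

section \<open>Polynomials in \<open>L\<^sup>2(0,1)\<close> and the transform\<close>

lemma exp_integral_half_line:
  fixes p :: complex
  assumes p: "Re p > 0"
  shows "set_integrable lborel {0..} (\<lambda>t. exp (- p * of_real t))"
    and "(LINT t:{0..}|lborel. exp (- p * of_real t)) = 1 / p"
proof -
  have "(\<integral>\<^sup>+t. ennreal (exp (- Re p * t)) * indicator {0..} t \<partial>lborel) = ennreal (0 - (- exp (- Re p * 0) / Re p))"
  proof (rule nn_integral_FTC_atLeast)
    show "DERIV (\<lambda>t. - exp (- Re p * t) / Re p) t :> exp (- Re p * t)" for t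
      using p by (auto intro!: derivative_eq_intros)
    have "((\<lambda>t. exp (- Re p * t)) \<longlongrightarrow> 0) at_top"
      using p by (intro filterlim_compose[OF exp_at_bot] filterlim_tendsto_neg_mult_at_bot[OF tendsto_const _ filterlim_ident]) auto
    then have "((\<lambda>t. - exp (- Re p * t) / Re p) \<longlongrightarrow> - 0 / Re p) at_top"
      by (intro tendsto_intros) (use p in auto)
    then show "((\<lambda>t. - exp (- Re p * t) / Re p) \<longlongrightarrow> 0) at_top" by simp
  qed auto
  then have nn: "(\<integral>\<^sup>+t. ennreal (exp (- Re p * t)) * indicator {0..} t \<partial>lborel) < \<infinity>" by simp
  show si: "set_integrable lborel {0..} (\<lambda>t. exp (- p * of_real t))"
    unfolding set_integrable_def
  proof (rule integrableI_bounded)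
    have "(\<integral>\<^sup>+t. ennreal (norm (indicator {0..} t *\<^sub>R exp (- p * of_real t))) \<partial>lborel)
      = (\<integral>\<^sup>+t. ennreal (exp (- Re p * t)) * indicator {0..} t \<partial>lborel)"
      by (intro nn_integral_cong) (auto simp: indicator_def norm_exp)
    then show "(\<integral>\<^sup>+t. ennreal (norm (indicator {0..} t *\<^sub>R exp (- p * of_real t))) \<partial>lborel) < \<infinity>" using nn by simp
  qed measurable
  have pn: "p \<noteq> 0" using p by auto
  have fin: "(LINT t:{0..b}|lborel. exp (- p * of_real t)) = (1 - exp (- p * of_real b)) / p" if "b \<ge> 0" for b
  proof -
    have "((\<lambda>t. exp (- p * of_real t)) has_integral (- exp (- p * of_real b) / p - (- exp (- p * of_real 0) / p))) {0..b}"
    proof (rule fundamental_theorem_of_calculus[OF that])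
      fix t
      have "((\<lambda>z. - exp (- p * z) / p) has_field_derivative exp (- p * of_real t)) (at (of_real t))"
        using pn by (auto intro!: derivative_eq_intros)
      then show "((\<lambda>t. - exp (- p * complex_of_real t) / p) has_vector_derivative exp (- p * of_real t)) (at t within {0..b})"
        by (rule has_vector_derivative_real_field)
    qed
    moreover have "set_integrable lborel {0..b} (\<lambda>t. exp (- p * of_real t))"
      by (intro borel_integrable_atLeastAtMost' continuous_intros)
    from set_borel_integral_eq_integral(2)[OF this]
    have "(LINT t:{0..b}|lborel. exp (- p * of_real t)) = integral {0..b} (\<lambda>t. exp (- p * of_real t))" .
    ultimately show ?thesis by (simp add: integral_unique diff_divide_distrib)
  qed
  have "((\<lambda>b. LINT t:{0..b}|lborel. exp (- p * of_real t)) \<longlongrightarrow> (LINT t:{0..}|lborel. exp (- p * of_real t))) at_top"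
    by (intro tendsto_set_lebesgue_integral_at_top si) auto
  then have A: "((\<lambda>b. (1 - exp (- p * of_real b)) / p) \<longlongrightarrow> (LINT t:{0..}|lborel. exp (- p * of_real t))) at_top"
    by (rule Lim_transform_eventually) (rule eventually_mono[OF eventually_ge_at_top[of 0]], rule fin)
  have B: "((\<lambda>b. (1 - exp (- p * of_real b)) / p) \<longlongrightarrow> (1 - 0) / p) at_top"
  proof (intro tendsto_intros pn)
    have "((\<lambda>t. exp (- Re p * t)) \<longlongrightarrow> 0) at_top"
      using p by (intro filterlim_compose[OF exp_at_bot] filterlim_tendsto_neg_mult_at_bot[OF tendsto_const _ filterlim_ident]) auto
    then have "((\<lambda>b. norm (exp (- p * complex_of_real b))) \<longlongrightarrow> 0) at_top" by (simp add: norm_exp)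
    then show "((\<lambda>b. exp (- p * complex_of_real b)) \<longlongrightarrow> 0) at_top" by (rule tendsto_norm_zero_cancel)
  qed
  show "(LINT t:{0..}|lborel. exp (- p * of_real t)) = 1 / p"
    using tendsto_unique[OF trivial_limit_at_top_linorder A B] by simp
qed

lemma nn_integral_exp_interval:
  fixes b :: real
  assumes "b \<ge> 0"
  shows "(\<integral>\<^sup>+t. ennreal (exp (- t)) * indicator {0..b} t \<partial>lborel) = ennreal (1 - exp (- b))"
proof -
  have "(\<integral>\<^sup>+t. ennreal (exp (- t)) * indicator {0..b} t \<partial>lborel) = ennreal (- exp (- b) - (- exp (- 0)))"
    by (rule nn_integral_FTC_Icc[where F="\<lambda>t. - exp (- t)"])
      (use assms in \<open>auto intro!: derivative_eq_intros\<close>)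
  then show ?thesis by simp
qed

lemma nn_integral_exp_half_line: "(\<integral>\<^sup>+t. ennreal (exp (- t)) * indicator {0..} t \<partial>lborel) = 1"
proof -
  have "((\<lambda>t::real. - exp (- t)) \<longlongrightarrow> - 0) at_top"
    by (intro tendsto_minus filterlim_compose[OF exp_at_bot] filterlim_uminus_at_bot_at_top)
  then have "(\<integral>\<^sup>+t. ennreal (exp (- t)) * indicator {0..} t \<partial>lborel) = ennreal (0 - (- exp (- 0::real)))"
    by (intro nn_integral_FTC_atLeast[where F="\<lambda>t. - exp (- t)"]) (auto intro!: derivative_eq_intros)
  then show ?thesis by simp
qed

text \<open>The change of variables \<open>x = exp (- t)\<close> as an identity of measures, so that
  integrability and integrals transfer together. The two measures are compared on upper
  rays.\<close>

lemma unit_interval_eq_distr: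
  "density lborel (indicator {0<..<1::real}) =
    distr (density lborel (\<lambda>t. ennreal (exp (- t)) * indicator {0..} t)) borel (\<lambda>t. exp (- t))" (is "?M = ?N")
proof (rule measure_eqI_lessThan)
  show "sets ?M = sets borel" "sets ?N = sets borel" by auto
  have M: "emeasure ?M {x<..} = emeasure lborel ({0<..<1} \<inter> {x<..})" for x
    by (subst emeasure_density) (auto simp: indicator_inter_arith[symmetric] intro!: nn_integral_cong)
  show "emeasure ?M {x<..} < \<infinity>" for x
  proof -
    have "emeasure lborel ({0<..<1} \<inter> {x<..}) \<le> emeasure lborel {0<..<1::real}" by (intro emeasure_mono) auto
    then show ?thesis unfolding M by (rule le_less_trans) simp
  qed
  fix x :: real
  have "emeasure ?N {x<..} = emeasure (density lborel (\<lambda>t. ennreal (exp (- t)) * indicator {0..} t)) {t. x < exp (- t)}"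
    by (subst emeasure_distr) (auto intro!: arg_cong[where f="emeasure _"])
  also have "\<dots> = (\<integral>\<^sup>+t. ennreal (exp (- t)) * indicator {0..} t * indicator {t. x < exp (- t)} t \<partial>lborel)"
    by (rule emeasure_density) measurable
  finally have N: "emeasure ?N {x<..} = (\<integral>\<^sup>+t. ennreal (exp (- t)) * indicator {0..} t * indicator {t. x < exp (- t)} t \<partial>lborel)" .
  consider "x \<le> 0" | "0 < x" "x < 1" | "x \<ge> 1" by linarith
  then show "emeasure ?M {x<..} = emeasure ?N {x<..}"
  proof cases
    case 1
    have "{0<..<1} \<inter> {x<..} = {0<..<1}" using 1 by auto
    moreover have "x < exp (- t)" for t using 1 by (meson exp_gt_zero le_less_trans)
    ultimately show ?thesis unfolding M N by (simp add: nn_integral_exp_half_line)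
  next
    case 2
    have "{0<..<1} \<inter> {x<..} = {x<..<1}" using 2 by auto
    then have "emeasure ?M {x<..} = ennreal (1 - x)" unfolding M using 2 by simp
    moreover have "emeasure ?N {x<..} = (\<integral>\<^sup>+t. ennreal (exp (- t)) * indicator {0..- ln x} t \<partial>lborel)"
      unfolding N
    proof (rule nn_integral_cong_AE)
      have iff: "x < exp (- t) \<longleftrightarrow> t < - ln x" for t
        using 2 by (metis exp_less_cancel_iff exp_ln minus_less_iff neg_less_iff_less)
      show "AE t in lborel. ennreal (exp (- t)) * indicator {0..} t * indicator {t. x < exp (- t)} t
        = ennreal (exp (- t)) * indicator {0..- ln x} t"
        using AE_lborel_singleton[of "- ln x"] by eventually_elim (auto simp: indicator_def iff)
    qed
    ultimately show ?thesis using 2 nn_integral_exp_interval[of "- ln x"] by simp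
  next
    case 3
    have "{0<..<1} \<inter> {x<..} = {}" using 3 by auto
    moreover have z: "ennreal (exp (- t)) * indicator {0..} t * indicator {t. x < exp (- t)} t = 0" for t
    proof (cases "0 \<le> t")
      case True
      then have "exp (- t) \<le> 1" by simp
      then have "\<not> x < exp (- t)" using 3 by linarith
      then show ?thesis by (simp add: indicator_def)
    qed simp
    ultimately show ?thesis unfolding M N z by simp
  qed
qed

lemma unit_interval_measurable_iff:
  "f \<in> borel_measurable unit_interval \<longleftrightarrow> (\<lambda>x. indicator {0<..<1} x *\<^sub>R f x) \<in> borel_measurable borel"
  for f :: "real \<Rightarrow> complex"
  by (subst borel_measurable_restrict_space_iff) auto

lemma unit_interval_substitution:
  fixes h :: "real \<Rightarrow> complex"
  assumes h: "h \<in> borel_measurable unit_interval"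
  shows "integrable unit_interval h \<longleftrightarrow> set_integrable lborel {0..} (\<lambda>t. of_real (exp (- t)) * h (exp (- t)))"
    and "(\<integral>x. h x \<partial>unit_interval) = (LINT t:{0..}|lborel. of_real (exp (- t)) * h (exp (- t)))"
proof -
  define g where "g x = indicator {0<..<1} x *\<^sub>R h x" for x
  have gm[measurable]: "g \<in> borel_measurable borel" using h unfolding unit_interval_measurable_iff g_def .
  have dm: "integrable (density lborel (indicator {0<..<1::real})) g \<longleftrightarrow> integrable lborel (\<lambda>x. indicator {0<..<1} x *\<^sub>R g x)"
    "(\<integral>x. g x \<partial>density lborel (indicator {0<..<1::real})) = (\<integral>x. indicator {0<..<1} x *\<^sub>R g x \<partial>lborel)"
  proof -
    have "(indicator {0<..<1::real} :: real \<Rightarrow> ennreal) = (\<lambda>x. ennreal (indicator {0<..<1} x))" by (auto simp: indicator_def)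
    then show "integrable (density lborel (indicator {0<..<1::real})) g \<longleftrightarrow> integrable lborel (\<lambda>x. indicator {0<..<1} x *\<^sub>R g x)"
      "(\<integral>x. g x \<partial>density lborel (indicator {0<..<1::real})) = (\<integral>x. indicator {0<..<1} x *\<^sub>R g x \<partial>lborel)"
      by (simp_all add: integrable_density integral_density)
  qed
  have gg: "indicator {0<..<1} x *\<^sub>R g x = indicator {0<..<1} x *\<^sub>R h x" for x by (simp add: g_def indicator_def)
  have A: "integrable unit_interval h \<longleftrightarrow> integrable (density lborel (indicator {0<..<1::real})) g"
    "(\<integral>x. h x \<partial>unit_interval) = (\<integral>x. g x \<partial>density lborel (indicator {0<..<1::real}))"
    unfolding dm gg by (auto simp: integrable_restrict_space integral_restrict_space)
  have dn: "(\<lambda>t. ennreal (exp (- t)) * indicator {0..} t) = (\<lambda>t::real. ennreal (exp (- t) * indicator {0..} t))"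
    by (auto simp: indicator_def)
  have ae: "AE t in lborel. (exp (- t) * indicator {0..} t) *\<^sub>R g (exp (- t)) = indicator {0..} t *\<^sub>R (of_real (exp (- t)) * h (exp (- t)))"
    using AE_lborel_singleton[of 0]
    by eventually_elim (auto simp: indicator_def g_def scaleR_conv_of_real)
  have gm2: "(\<lambda>t. (exp (- t) * indicator {0..} t) *\<^sub>R g (exp (- t))) \<in> borel_measurable lborel" by measurable
  \<comment> \<open>At \<open>t = 0\<close> the argument of \<open>h\<close> is 1, outside the unit
    interval, where \<open>h\<close> is arbitrary; the singleton term isolates that value for the
    sake of measurability.\<close>
  have eqt: "indicator {0..} t *\<^sub>R (of_real (exp (- t)) * h (exp (- t))) =
     (exp (- t) * indicator {0..} t) *\<^sub>R g (exp (- t)) + indicator {0} t *\<^sub>R h 1" for t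
    by (auto simp: indicator_def g_def scaleR_conv_of_real)
  have hm2: "(\<lambda>t. indicator {0..} t *\<^sub>R (of_real (exp (- t)) * h (exp (- t)))) \<in> borel_measurable lborel"
    unfolding eqt by measurable
  have B: "integrable (density lborel (indicator {0<..<1::real})) g \<longleftrightarrow> integrable lborel (\<lambda>t. (exp (- t) * indicator {0..} t) *\<^sub>R g (exp (- t)))"
    "(\<integral>x. g x \<partial>density lborel (indicator {0<..<1::real})) = (\<integral>t. (exp (- t) * indicator {0..} t) *\<^sub>R g (exp (- t)) \<partial>lborel)"
    unfolding unit_interval_eq_distr dn
    by (simp_all add: integrable_distr_eq integral_distr integrable_density integral_density)
  show "integrable unit_interval h \<longleftrightarrow> set_integrable lborel {0..} (\<lambda>t. of_real (exp (- t)) * h (exp (- t)))"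
    unfolding A(1) B(1) set_integrable_def by (rule integrable_cong_AE[OF gm2 hm2 ae])
  show "(\<integral>x. h x \<partial>unit_interval) = (LINT t:{0..}|lborel. of_real (exp (- t)) * h (exp (- t)))"
    unfolding A(2) B(2) set_lebesgue_integral_def by (rule integral_cong_AE[OF gm2 hm2 ae])
qed

text \<open>The exponent is chosen so that pairing with \<open>power_fun s\<close> is evaluation of
  the transform at \<open>s\<close>. At \<open>s = n + 1/2\<close> it is the monomial of degree
  \<open>n\<close>.\<close>

definition power_fun :: "complex \<Rightarrow> real \<Rightarrow> complex" where
  "power_fun s x = of_real x powr (cnj s - 1 / 2)"

lemma power_fun_exp: "power_fun s (exp (- t)) = exp (- of_real t * (cnj s - 1 / 2))"
proof -
  have "complex_of_real (exp (- t)) \<noteq> 0" by simp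
  moreover have "Ln (complex_of_real (exp (- t))) = of_real (- t)"
    by (metis Ln_of_real exp_gt_zero ln_exp)
  ultimately show ?thesis unfolding power_fun_def powr_def by (simp add: mult.commute)
qed

lemma power_fun_measurable [measurable]: "power_fun s \<in> borel_measurable unit_interval"
  unfolding unit_interval_measurable_iff
proof (rule borel_measurable_continuous_on_indicator)
  show "continuous_on {0<..<1} (power_fun s)"
    unfolding power_fun_def by (intro continuous_intros) (auto simp: complex_nonpos_Reals_iff)
qed simp

lemma power_fun_L2:
  assumes s: "Re s > 0"
  shows "power_fun s \<in> L2 unit_interval"
proof -
  have "integrable unit_interval (\<lambda>x. power_fun s x * cnj (power_fun s x))"
  proof (subst unit_interval_substitution(1))
    have eq: "of_real (exp (- t)) * (power_fun s (exp (- t)) * cnj (power_fun s (exp (- t)))) = exp (- of_real (2 * Re s) * of_real t)" for t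
    proof -
      have "of_real (exp (- t)) * (power_fun s (exp (- t)) * cnj (power_fun s (exp (- t))))
         = exp (of_real (- t) + (- of_real t * (cnj s - 1 / 2) + cnj (- of_real t * (cnj s - 1 / 2))))"
        unfolding power_fun_exp exp_cnj exp_add exp_of_real by simp
      also have "of_real (- t) + (- of_real t * (cnj s - 1 / 2) + cnj (- of_real t * (cnj s - 1 / 2))) = - of_real (2 * Re s) * of_real t"
        by (simp add: complex_eq_iff algebra_simps)
      finally show ?thesis .
    qed
    show "set_integrable lborel {0..} (\<lambda>t. of_real (exp (- t)) * (power_fun s (exp (- t)) * cnj (power_fun s (exp (- t)))))"
      unfolding eq using s by (intro exp_integral_half_line) simp
  qed measurable
  then have "integrable unit_interval (\<lambda>x. Re (power_fun s x * cnj (power_fun s x)))" by (rule integrable_Re)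
  moreover have "Re (power_fun s x * cnj (power_fun s x)) = (cmod (power_fun s x))\<^sup>2" for x
    by (metis Re_complex_of_real complex_norm_square)
  ultimately show ?thesis by (simp add: L2_def del: times_complex.sel)
qed

lemma power_fun_ip:
  assumes s: "Re s > 0" and w: "Re w > 0"
  shows "L2_ip unit_interval (power_fun w) (power_fun s) = 1 / (s + cnj w)"
proof -
  have eq: "of_real (exp (- t)) * (power_fun w (exp (- t)) * cnj (power_fun s (exp (- t)))) = exp (- (s + cnj w) * of_real t)" for t
  proof -
    have "of_real (exp (- t)) * (power_fun w (exp (- t)) * cnj (power_fun s (exp (- t))))
       = exp (of_real (- t) + (- of_real t * (cnj w - 1 / 2) + cnj (- of_real t * (cnj s - 1 / 2))))"
      unfolding power_fun_exp exp_cnj exp_add exp_of_real by simp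
    also have "of_real (- t) + (- of_real t * (cnj w - 1 / 2) + cnj (- of_real t * (cnj s - 1 / 2))) = - (s + cnj w) * of_real t"
      by (simp add: algebra_simps)
    finally show ?thesis .
  qed
  have "L2_ip unit_interval (power_fun w) (power_fun s) = (LINT t:{0..}|lborel. exp (- (s + cnj w) * of_real t))"
    unfolding L2_ip_def eq[symmetric] by (rule unit_interval_substitution(2)) measurable
  also have "\<dots> = 1 / (s + cnj w)" using s w by (intro exp_integral_half_line) simp
  finally show ?thesis .
qed

lemma power_fun_norm:
  assumes s: "Re s > 0"
  shows "(L2_norm unit_interval (power_fun s))\<^sup>2 = 1 / (2 * Re s)"
proof -
  have "complex_of_real ((L2_norm unit_interval (power_fun s))\<^sup>2) = 1 / (s + cnj s)"
    unfolding L2_ip_self[symmetric] by (rule power_fun_ip[OF s s])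
  also have "\<dots> = of_real (1 / (2 * Re s))" by (simp add: complex_add_cnj)
  finally show ?thesis by (simp only: of_real_eq_iff)
qed

lemma transform_integrand_eq:
  "of_real (exp (- t)) * (f (exp (- t)) * cnj (power_fun s (exp (- t)))) =
    exp (- s * of_real t) * exp (- of_real t / 2) * f (exp (- t))"
proof -
  have "of_real (exp (- t)) * cnj (power_fun s (exp (- t))) = exp (of_real (- t) + cnj (- of_real t * (cnj s - 1 / 2)))"
    unfolding power_fun_exp exp_cnj exp_add exp_of_real by simp
  also have "of_real (- t) + cnj (- of_real t * (cnj s - 1 / 2)) = - s * of_real t + (- of_real t / 2)"
    by (simp add: field_simps)
  also have "exp \<dots> = exp (- s * of_real t) * exp (- of_real t / 2)" by (rule exp_add)
  finally show ?thesis by (metis mult.assoc mult.commute)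
qed

lemma U_op_eq_ip:
  assumes f: "f \<in> L2 unit_interval" and s: "Re s > 0"
  shows "U_op f s = L2_ip unit_interval f (power_fun s)"
proof -
  have [measurable]: "f \<in> borel_measurable unit_interval" by (rule L2_measurable[OF f])
  have "L2_ip unit_interval f (power_fun s) = (LINT t:{0..}|lborel. of_real (exp (- t)) * (f (exp (- t)) * cnj (power_fun s (exp (- t)))))"
    unfolding L2_ip_def by (rule unit_interval_substitution(2)) measurable
  also have "\<dots> = (LINT t:{0..}|lborel. exp (- s * of_real t) * exp (- of_real t / 2) * f (exp (- t)))"
    unfolding transform_integrand_eq[of _ f s] ..
  also have "\<dots> = U_op f s"
    unfolding U_op_def set_lebesgue_integral_def
  proof (rule integral_cong_AE)
    have "set_integrable lborel {0..} (\<lambda>t. of_real (exp (- t)) * (f (exp (- t)) * cnj (power_fun s (exp (- t)))))"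
      using unit_interval_substitution(1)[of "\<lambda>x. f x * cnj (power_fun s x)"] L2_ip_integrable[OF f power_fun_L2[OF s]] by simp
    then have m: "(\<lambda>t. indicator {0..} t *\<^sub>R (of_real (exp (- t)) * (f (exp (- t)) * cnj (power_fun s (exp (- t)))))) \<in> borel_measurable lborel"
      unfolding set_integrable_def by (rule borel_measurable_integrable)
    show m1: "(\<lambda>t. indicator {0..} t *\<^sub>R (exp (- s * of_real t) * exp (- of_real t / 2) * f (exp (- t)))) \<in> borel_measurable lborel"
      using m unfolding transform_integrand_eq[of _ f s] .
    have "(\<lambda>t. indicator {0<..} t *\<^sub>R (indicator {0..} t *\<^sub>R (exp (- s * of_real t) * exp (- of_real t / 2) * f (exp (- t))))) \<in> borel_measurable lborel"
      by (intro borel_measurable_scaleR borel_measurable_indicator m1) auto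
    moreover have ii: "indicator {0<..} t *\<^sub>R (indicator {0..} t *\<^sub>R z) = indicator {0<..} t *\<^sub>R z" for t :: real and z :: complex
      by (auto simp: indicator_def)
    ultimately show "(\<lambda>t. indicator {0<..} t *\<^sub>R (exp (- s * of_real t) * exp (- of_real t / 2) * f (exp (- t)))) \<in> borel_measurable lborel"
      by (simp only: ii)
    show "AE t in lborel. indicator {0..} t *\<^sub>R (exp (- s * of_real t) * exp (- of_real t / 2) * f (exp (- t)))
      = indicator {0<..} t *\<^sub>R (exp (- s * of_real t) * exp (- of_real t / 2) * f (exp (- t)))"
      using AE_lborel_singleton[of "0::real"] by eventually_elim (auto simp: indicator_def)
  qed
  finally show ?thesis ..
qed

lemma norm_U_op_le:
  assumes f: "f \<in> L2 unit_interval" and s: "Re s > 0"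
  shows "cmod (U_op f s) \<le> L2_norm unit_interval f * sqrt (1 / (2 * Re s))"
  using L2_Cauchy_Schwarz[OF f power_fun_L2[OF s]] power_fun_norm[OF s] U_op_eq_ip[OF f s]
  by (metis L2_norm_nonneg real_sqrt_unique)

lemma U_op_lincomb:
  assumes "f \<in> L2 unit_interval" "g \<in> L2 unit_interval" "Re s > 0"
  shows "U_op (\<lambda>x. a * f x + b * g x) s = a * U_op f s + b * U_op g s"
  using assms by (simp add: U_op_eq_ip L2_lincomb L2_ip_lincomb_left power_fun_L2)

lemma U_op_power_fun:
  assumes "Re w > 0" "Re s > 0"
  shows "U_op (power_fun w) s = H2_kernel w s"
  using assms by (simp add: U_op_eq_ip power_fun_L2 power_fun_ip H2_kernel_def)

section \<open>Density of polynomials\<close>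

definition poly_fun :: "complex poly \<Rightarrow> real \<Rightarrow> complex" where
  "poly_fun p x = poly p (of_real x)"

lemma bounded_L2_unit_interval:
  assumes [measurable]: "f \<in> borel_measurable unit_interval" and b: "\<And>x. x \<in> {0<..<1} \<Longrightarrow> cmod (f x) \<le> B"
  shows "f \<in> L2 unit_interval" "L2_norm unit_interval f \<le> B"
proof -
  have fm: "emeasure unit_interval {0<..<1} = 1" by (simp add: emeasure_restrict_space)
  have B: "B \<ge> 0" using order_trans[OF norm_ge_zero b[of "1/2"]] by simp
  have "(\<integral>\<^sup>+x. ennreal ((cmod (f x))\<^sup>2) \<partial>unit_interval) \<le> (\<integral>\<^sup>+x. ennreal (B\<^sup>2) \<partial>unit_interval)"
    using b by (intro nn_integral_mono ennreal_leI power_mono) (auto simp: space_restrict_space)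
  also have "\<dots> = ennreal (B\<^sup>2)" by (simp add: fm)
  finally have le: "(\<integral>\<^sup>+x. ennreal ((cmod (f x))\<^sup>2) \<partial>unit_interval) \<le> ennreal (B\<^sup>2)" .
  then show L: "f \<in> L2 unit_interval" by (auto simp: L2_iff_nn_integral intro: le_less_trans)
  have "(L2_norm unit_interval f)\<^sup>2 \<le> B\<^sup>2" using le unfolding nn_integral_L2_norm[OF L] by (subst (asm) ennreal_le_iff) auto
  then show "L2_norm unit_interval f \<le> B" using B by (rule power2_le_imp_le)
qed

lemma continuous_measurable_unit_interval:
  fixes f :: "real \<Rightarrow> complex"
  assumes "continuous_on {0..1} f"
  shows "f \<in> borel_measurable unit_interval"
  unfolding unit_interval_measurable_iff
  by (rule borel_measurable_continuous_on_indicator) (auto intro: continuous_on_subset[OF assms])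

lemma poly_fun_L2: "poly_fun p \<in> L2 unit_interval"
proof -
  have c: "continuous_on {0..1} (poly_fun p)" unfolding poly_fun_def by (intro continuous_intros)
  then have "bounded (poly_fun p ` {0..1})" by (intro compact_imp_bounded compact_continuous_image) auto
  then obtain B where "\<forall>x\<in>{0..1}. cmod (poly_fun p x) \<le> B" unfolding bounded_iff by auto
  then show ?thesis by (intro bounded_L2_unit_interval(1)[of _ B] continuous_measurable_unit_interval c) auto
qed

text \<open>This class is closed under linear combinations and L2 limits, so density is reached by
  climbing from continuous functions through indicators of compact and Borel sets to simple
  functions.\<close>

definition poly_approximable :: "(real \<Rightarrow> complex) \<Rightarrow> bool" where
  "poly_approximable f \<longleftrightarrow> f \<in> L2 unit_interval \<and> (\<forall>e>0. \<exists>p. L2_norm unit_interval (\<lambda>x. f x - poly_fun p x) < e)"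

lemma poly_approximable_lincomb:
  assumes f: "poly_approximable f" and g: "poly_approximable g"
  shows "poly_approximable (\<lambda>x. a * f x + b * g x)"
  unfolding poly_approximable_def
proof (intro conjI allI impI)
  have L: "f \<in> L2 unit_interval" "g \<in> L2 unit_interval" using f g by (auto simp: poly_approximable_def)
  then show "(\<lambda>x. a * f x + b * g x) \<in> L2 unit_interval" by (rule L2_lincomb)
  fix e :: real assume e: "e > 0"
  define d where "d = e / (cmod a + cmod b + 1)"
  have s: "cmod a + cmod b + 1 > 0" by (simp add: add_nonneg_pos)
  have d: "d > 0" "(cmod a + cmod b) * d < e"
    unfolding d_def using e s by (auto simp: field_simps)
  obtain p q where p: "L2_norm unit_interval (\<lambda>x. f x - poly_fun p x) < d" and q: "L2_norm unit_interval (\<lambda>x. g x - poly_fun q x) < d"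
    using f g d(1) unfolding poly_approximable_def by blast
  have "(\<lambda>x. (a * f x + b * g x) - poly_fun (smult a p + smult b q) x) = (\<lambda>x. a * (f x - poly_fun p x) + b * (g x - poly_fun q x))"
    by (auto simp: poly_fun_def algebra_simps)
  then have "L2_norm unit_interval (\<lambda>x. (a * f x + b * g x) - poly_fun (smult a p + smult b q) x)
    \<le> cmod a * L2_norm unit_interval (\<lambda>x. f x - poly_fun p x) + cmod b * L2_norm unit_interval (\<lambda>x. g x - poly_fun q x)"
    using L2_norm_triangle[OF L2_scale[OF L2_diff[OF L(1) poly_fun_L2[of p]], of a] L2_scale[OF L2_diff[OF L(2) poly_fun_L2[of q]], of b]]
    by (simp add: L2_norm_scale)
  also have "\<dots> \<le> cmod a * d + cmod b * d" using p q by (intro add_mono mult_left_mono) auto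
  also have "\<dots> < e" using d(2) by (simp add: algebra_simps)
  finally show "\<exists>p. L2_norm unit_interval (\<lambda>x. (a * f x + b * g x) - poly_fun p x) < e" by blast
qed

lemma poly_approximable_limit:
  assumes u: "\<And>n. poly_approximable (u n)" and f: "f \<in> L2 unit_interval"
    and lim: "(\<lambda>n. L2_norm unit_interval (\<lambda>x. u n x - f x)) \<longlonglongrightarrow> 0"
  shows "poly_approximable f"
  unfolding poly_approximable_def
proof (intro conjI allI impI f)
  fix e :: real assume e: "e > 0"
  have "\<forall>\<^sub>F n in sequentially. L2_norm unit_interval (\<lambda>x. u n x - f x) < e / 2"
    using order_tendstoD(2)[OF lim, of "e / 2"] e by simp
  then obtain n where n: "L2_norm unit_interval (\<lambda>x. u n x - f x) < e / 2" by (auto simp: eventually_sequentially)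
  have uL: "u n \<in> L2 unit_interval" using u by (simp add: poly_approximable_def)
  obtain p where p: "L2_norm unit_interval (\<lambda>x. u n x - poly_fun p x) < e / 2"
    using u[of n] e unfolding poly_approximable_def by (meson half_gt_zero)
  have "L2_norm unit_interval (\<lambda>x. f x - poly_fun p x) < e"
    using L2_norm_triangle_diff[OF f uL poly_fun_L2[of p]] n p L2_norm_minus_commute[of unit_interval f "u n"] by linarith
  then show "\<exists>p. L2_norm unit_interval (\<lambda>x. f x - poly_fun p x) < e" by blast
qed

lemma L2_dominated_convergence:
  assumes um: "\<And>n. u n \<in> borel_measurable M" and f: "f \<in> borel_measurable M" and w: "integrable M w"
    and lim: "AE x in M. (\<lambda>n. u n x) \<longlonglongrightarrow> f x" and bd: "\<And>n. AE x in M. (cmod (u n x - f x))\<^sup>2 \<le> w x"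
  shows "(\<lambda>n. L2_norm M (\<lambda>x. u n x - f x)) \<longlonglongrightarrow> 0"
proof -
  note [measurable] = um f
  have "(\<lambda>n. \<integral>x. (cmod (u n x - f x))\<^sup>2 \<partial>M) \<longlonglongrightarrow> (\<integral>x. 0 \<partial>M)"
  proof (rule integral_dominated_convergence[where w=w])
    show "AE x in M. (\<lambda>n. (cmod (u n x - f x))\<^sup>2) \<longlonglongrightarrow> 0"
      using lim
    proof eventually_elim
      case (elim x)
      then have "(\<lambda>n. cmod (u n x - f x)) \<longlonglongrightarrow> 0" by (simp add: LIM_zero tendsto_norm_zero)
      then show ?case using tendsto_power[of _ 0 sequentially 2] by fastforce
    qed
  qed (use w bd in auto)
  then have "(\<lambda>n. sqrt (\<integral>x. (cmod (u n x - f x))\<^sup>2 \<partial>M)) \<longlonglongrightarrow> sqrt 0" by (intro tendsto_real_sqrt) simp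
  then show ?thesis by (simp add: L2_norm_def)
qed

text \<open>On the unit interval the uniform norm dominates the L2 norm, so the Stone-Weierstrass
  theorem applies.\<close>

lemma poly_approximable_continuous:
  fixes g :: "real \<Rightarrow> real"
  assumes g: "continuous_on {0..1} g"
  shows "poly_approximable (\<lambda>x. of_real (g x))"
  unfolding poly_approximable_def
proof (intro conjI allI impI)
  have c: "continuous_on {0..1} (\<lambda>x. complex_of_real (g x))" by (intro continuous_intros g)
  then have "bounded ((\<lambda>x. complex_of_real (g x)) ` {0..1})" by (intro compact_imp_bounded compact_continuous_image) auto
  then obtain B where "\<forall>x\<in>{0..1}. cmod (complex_of_real (g x)) \<le> B" unfolding bounded_iff by auto
  then show "(\<lambda>x. complex_of_real (g x)) \<in> L2 unit_interval"
    by (intro bounded_L2_unit_interval(1)[of _ B] continuous_measurable_unit_interval c) auto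
  fix e :: real assume e: "e > 0"
  obtain q where q: "real_polynomial_function q" "\<And>x. x \<in> {0..1} \<Longrightarrow> \<bar>g x - q x\<bar> < e / 2"
    using Stone_Weierstrass_real_polynomial_function[OF compact_Icc g, of "e / 2"] e by auto
  obtain a n where an: "q = (\<lambda>x. \<Sum>i\<le>n. a i * x ^ i)"
    using q(1) unfolding real_polynomial_function_iff_sum by blast
  define p where "p = (\<Sum>i\<le>n. monom (complex_of_real (a i)) i)"
  have p: "poly_fun p x = of_real (q x)" for x
    by (simp add: poly_fun_def p_def an poly_sum poly_monom)
  have "L2_norm unit_interval (\<lambda>x. of_real (g x) - poly_fun p x) \<le> e / 2"
  proof (rule bounded_L2_unit_interval(2))
    show "(\<lambda>x. complex_of_real (g x) - poly_fun p x) \<in> borel_measurable unit_interval"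
      unfolding poly_fun_def by (intro continuous_measurable_unit_interval continuous_intros c)
    fix x :: real assume "x \<in> {0<..<1}"
    then show "cmod (of_real (g x) - poly_fun p x) \<le> e / 2"
      using q(2)[of x] unfolding p by (simp flip: of_real_diff)
  qed
  then show "\<exists>p. L2_norm unit_interval (\<lambda>x. complex_of_real (g x) - poly_fun p x) < e" using e by (intro exI[of _ p]) simp
qed

lemma poly_approximable_compact:
  fixes K :: "real set"
  assumes K: "compact K"
  shows "poly_approximable (indicator K)"
proof (cases "K = {}")
  case True
  \<comment> \<open>The distance to the empty set is 0 by convention, so the ramps of the other case
    would be constantly 1.\<close>
  have "poly_approximable (\<lambda>x. of_real 0)" by (rule poly_approximable_continuous) simp
  moreover have "(indicator K :: real \<Rightarrow> complex) = (\<lambda>x. of_real 0)" using True by auto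
  ultimately show ?thesis by simp
next
  case False
  \<comment> \<open>Continuous ramps that equal 1 on \<open>K\<close> and decrease pointwise to its
    indicator.\<close>
  define u where "u n x = max 0 (1 - real n * infdist x K)" for n x
  have uc: "continuous_on A (u n)" for A n unfolding u_def by (intro continuous_intros)
  have K': "K \<in> sets borel" "closed K" using K by (auto simp: compact_imp_closed)
  have im: "(indicator K :: real \<Rightarrow> complex) \<in> borel_measurable unit_interval"
    using K' by (intro measurable_restrict_space1 borel_measurable_indicator) auto
  show ?thesis
  proof (rule poly_approximable_limit[OF poly_approximable_continuous[OF uc]])
    show "indicator K \<in> L2 unit_interval"
      by (rule bounded_L2_unit_interval(1)[OF im, of 1]) (simp add: indicator_def)
    show "(\<lambda>n. L2_norm unit_interval (\<lambda>x. complex_of_real (u n x) - indicator K x)) \<longlonglongrightarrow> 0"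
    proof (rule L2_dominated_convergence[OF _ im, where w="\<lambda>_. 1"])
      show "(\<lambda>x. complex_of_real (u n x)) \<in> borel_measurable unit_interval" for n
        by (intro continuous_measurable_unit_interval continuous_intros uc)
      show "integrable unit_interval (\<lambda>_. 1::real)"
        using L2_integrable[OF bounded_L2_unit_interval(1)[of "\<lambda>_. 1" 1]] by simp
      have u01: "0 \<le> u n x" "u n x \<le> 1" for n x unfolding u_def by (auto simp: infdist_nonneg)
      show "AE x in unit_interval. (cmod (complex_of_real (u n x) - indicator K x))\<^sup>2 \<le> 1" for n
      proof (rule AE_I2)
        fix x
        have "\<bar>u n x - indicator K x\<bar> \<le> 1" using u01[of n x] by (auto simp: indicator_def)
        moreover have "complex_of_real (u n x) - indicator K x = of_real (u n x - indicator K x)" by (simp add: indicator_def)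
        ultimately show "(cmod (complex_of_real (u n x) - indicator K x))\<^sup>2 \<le> 1"
          by (simp add: abs_square_le_1 del: of_real_diff)
      qed
      show "AE x in unit_interval. (\<lambda>n. complex_of_real (u n x)) \<longlonglongrightarrow> indicator K x"
      proof (rule AE_I2)
        fix x
        show "(\<lambda>n. complex_of_real (u n x)) \<longlonglongrightarrow> indicator K x"
        proof (cases "x \<in> K")
          case True
          then show ?thesis by (simp add: u_def)
        next
          case False
          then have d: "infdist x K > 0"
            using K'(2) \<open>K \<noteq> {}\<close> by (simp add: infdist_pos_not_in_closed)
          have "\<forall>\<^sub>F n in sequentially. real n * infdist x K \<ge> 1"
          proof -
            obtain N where "real N * infdist x K > 1" using ex_less_of_nat_mult[OF d] by blast
            moreover have "real N * infdist x K \<le> real n * infdist x K" if "n \<ge> N" for n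
              using that d by (intro mult_right_mono) auto
            ultimately show ?thesis unfolding eventually_sequentially
              by (meson less_imp_le order_trans)
          qed
          then have "\<forall>\<^sub>F n in sequentially. complex_of_real (u n x) = 0"
            by eventually_elim (simp add: u_def)
          then show ?thesis using False by (simp add: tendsto_eventually)
        qed
      qed
    qed
  qed
qed

text \<open>Inner regularity exhausts \<open>B\<close> by compact sets, and the squared L2 distance
  of two nested indicators is the measure of the difference.\<close>

lemma poly_approximable_Borel:
  fixes B :: "real set"
  assumes B: "B \<in> sets borel"
  shows "poly_approximable (indicator B)"
proof -
  define M where "M = density lborel (indicator {0<..<1::real})"
  have sM: "sets M = sets borel" by (simp add: M_def)
  have eM: "emeasure M A = emeasure lborel ({0<..<1} \<inter> A)" if "A \<in> sets borel" for A
    unfolding M_def using that by (subst emeasure_density) (auto simp: indicator_inter_arith[symmetric] intro!: nn_integral_cong)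
  have "space M = UNIV" by (simp add: M_def)
  then have fin: "emeasure M (space M) \<noteq> \<infinity>" using eM[of UNIV] by simp
  have finA: "emeasure M A < \<infinity>" if "A \<in> sets borel" for A
    using emeasure_space[of M A] fin by (metis infinity_ennreal_def less_top top.not_eq_extremum top_unique)
  have im: "(indicator A :: real \<Rightarrow> complex) \<in> borel_measurable unit_interval" if "A \<in> sets borel" for A :: "real set"
    using that by (intro measurable_restrict_space1 borel_measurable_indicator) auto
  have ib: "emeasure M B = (SUP K \<in> {K. K \<subseteq> B \<and> compact K}. emeasure M K)"
    by (rule inner_regular[OF sM fin B])
  have "\<exists>K\<subseteq>B. compact K \<and> emeasure M (B - K) < ennreal (1 / real (Suc n))" for n
  proof (cases "emeasure M B = 0")
    \<comment> \<open>A null set needs its own case: subtraction in \<open>ennreal\<close> truncates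
      at 0, so the value would not become strictly smaller.\<close>
    case True then show ?thesis by (intro exI[of _ "{}"]) auto
  next
    case False
    have "emeasure M B - ennreal (1 / real (Suc n)) < emeasure M B"
      using finA[OF B] False by (intro ennreal_between) (auto simp: zero_less_iff_neq_zero)
    then obtain K where K: "K \<subseteq> B" "compact K" "emeasure M B - ennreal (1 / real (Suc n)) < emeasure M K"
      unfolding ib less_SUP_iff by auto
    have Kb: "K \<in> sets borel" using K(2) by (simp add: compact_imp_closed)
    have "emeasure M (B - K) = emeasure M B - emeasure M K"
      using K Kb B finA[OF Kb] by (intro emeasure_Diff) (auto simp: sM)
    moreover have "emeasure M B - emeasure M K < ennreal (1 / real (Suc n))"
    proof -
      have eq: "emeasure M B = ennreal (measure M B)" "emeasure M K = ennreal (measure M K)"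
        using finA[OF B] finA[OF Kb] by (simp_all add: emeasure_eq_ennreal_measure less_top)
      have "\<not> measure M K \<le> measure M B - 1 / real (Suc n)"
      proof
        assume "measure M K \<le> measure M B - 1 / real (Suc n)"
        then have "emeasure M K \<le> ennreal (measure M B - 1 / real (Suc n))" unfolding eq by (rule ennreal_leI)
        also have "\<dots> = emeasure M B - ennreal (1 / real (Suc n))" unfolding eq by (simp add: ennreal_minus)
        finally show False using K(3) by simp
      qed
      then show ?thesis unfolding eq by (simp add: ennreal_minus ennreal_less_iff ennreal_lessI)
    qed
    ultimately show ?thesis using K by auto
  qed
  then obtain K where K: "\<And>n. K n \<subseteq> B" "\<And>n. compact (K n)" "\<And>n. emeasure M (B - K n) < ennreal (1 / real (Suc n))" by metis
  have Kb: "K n \<in> sets borel" for n using K(2) by (simp add: compact_imp_closed)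
  show ?thesis
  proof (rule poly_approximable_limit[OF poly_approximable_compact[OF K(2)]])
    show "indicator B \<in> L2 unit_interval"
      by (rule bounded_L2_unit_interval(1)[OF im[OF B], of 1]) (simp add: indicator_def)
    have le: "(L2_norm unit_interval (\<lambda>x. indicator (K n) x - indicator B x))\<^sup>2 \<le> 1 / real (Suc n)" for n
    proof -
      have L: "(\<lambda>x. indicator (K n) x - indicator B x) \<in> L2 unit_interval"
      proof (rule bounded_L2_unit_interval(1)[where B=1])
        show "(\<lambda>x. indicator (K n) x - indicator B x :: complex) \<in> borel_measurable unit_interval"
          by (intro borel_measurable_diff im Kb B)
      qed (simp add: indicator_def)
      have "(\<integral>\<^sup>+x. ennreal ((cmod (indicator (K n) x - indicator B x))\<^sup>2) \<partial>unit_interval)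
        = (\<integral>\<^sup>+x. indicator ({0<..<1} \<inter> (B - K n)) x \<partial>lborel)"
        using K(1)[of n] by (subst nn_integral_restrict_space) (auto intro!: nn_integral_cong simp: indicator_def)
      also have "\<dots> = emeasure M (B - K n)" using B Kb by (subst eM) auto
      also have "\<dots> \<le> ennreal (1 / real (Suc n))" using K(3)[of n] by simp
      finally show ?thesis unfolding nn_integral_L2_norm[OF L] by (subst (asm) ennreal_le_iff) auto
    qed
    show "(\<lambda>n. L2_norm unit_interval (\<lambda>x. indicator (K n) x - indicator B x)) \<longlonglongrightarrow> 0"
    proof (rule Lim_null_comparison)
      show "\<forall>\<^sub>F n in sequentially. norm (L2_norm unit_interval (\<lambda>x. indicator (K n) x - indicator B x)) \<le> sqrt (1 / real (Suc n))"
        using le by (intro always_eventually allI) (auto simp: L2_norm_nonneg intro: real_le_rsqrt)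
      show "(\<lambda>n. sqrt (1 / real (Suc n))) \<longlonglongrightarrow> 0"
        using tendsto_real_sqrt[OF LIMSEQ_Suc[OF lim_1_over_n]] by simp
    qed
  qed
qed

lemma poly_fun_dense:
  assumes f: "f \<in> L2 unit_interval"
  shows "poly_approximable f"
proof -
  define g where "g x = indicator {0<..<1} x *\<^sub>R f x" for x
  have gm: "g \<in> borel_measurable borel"
    using L2_measurable[OF f] unfolding unit_interval_measurable_iff g_def .
  obtain u where u: "\<And>i. simple_function borel (u i)" "\<And>x. (\<lambda>i. u i x) \<longlonglongrightarrow> g x" "\<And>i x. dist (u i x) 0 \<le> 2 * dist (g x) 0"
    using borel_measurable_implies_sequence_metric[OF gm, of 0] by auto
  have ua: "poly_approximable (u i)" for i
  proof -
    have fin: "finite (range (u i))" using u(1)[of i] by (simp add: simple_function_def)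
    have "poly_approximable (\<lambda>x. \<Sum>y\<in>A. y * indicator (u i -` {y}) x)" if "finite A" "A \<subseteq> range (u i)" for A
      using that
    proof (induction A rule: finite_induct)
      case empty
      have "poly_approximable (\<lambda>x. of_real 0)" by (rule poly_approximable_continuous) simp
      then show ?case by simp
    next
      case (insert y A)
      have "u i -` {y} \<in> sets borel" using u(1)[of i] insert by (auto simp: simple_function_def)
      from poly_approximable_lincomb[OF poly_approximable_Borel[OF this] insert.IH, of y 1] insert.prems
      have "poly_approximable (\<lambda>x. y * indicator (u i -` {y}) x + (\<Sum>y\<in>A. y * indicator (u i -` {y}) x))" by simp
      then show ?case by (simp only: sum.insert[OF insert.hyps])
    qed
    from this[OF fin order_refl] have "poly_approximable (\<lambda>x. \<Sum>y\<in>range (u i). y * indicator (u i -` {y}) x)" .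
    moreover have "(\<Sum>y\<in>range (u i). y * indicator (u i -` {y}) x) = u i x" for x
    proof -
      have "(\<Sum>y\<in>range (u i). y * indicator (u i -` {y}) x) = (\<Sum>y\<in>range (u i). if y = u i x then y else 0)"
        by (intro sum.cong) (auto simp: indicator_def)
      then show ?thesis using fin by simp
    qed
    ultimately show ?thesis by simp
  qed
  show ?thesis
  proof (rule poly_approximable_limit[OF ua f])
    show "(\<lambda>n. L2_norm unit_interval (\<lambda>x. u n x - f x)) \<longlonglongrightarrow> 0"
    proof (rule L2_dominated_convergence)
      show "u n \<in> borel_measurable unit_interval" for n
        using ua[of n] by (auto simp: poly_approximable_def L2_measurable)
      show "f \<in> borel_measurable unit_interval" by (rule L2_measurable[OF f])
      \<comment> \<open>From \<open>cmod (u n x) \<le> 2 * cmod (f x)\<close> the difference is at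
        most three times \<open>cmod (f x)\<close>, whence the 9.\<close>
      show "integrable unit_interval (\<lambda>x. 9 * (cmod (f x))\<^sup>2)"
        by (intro integrable_mult_right L2_integrable f)
      have gf: "g x = f x" if "x \<in> space unit_interval" for x using that by (simp add: g_def space_restrict_space)
      show "AE x in unit_interval. (\<lambda>n. u n x) \<longlonglongrightarrow> f x"
        using u(2) gf by (intro AE_I2) metis
      show "AE x in unit_interval. (cmod (u n x - f x))\<^sup>2 \<le> 9 * (cmod (f x))\<^sup>2" for n
      proof (rule AE_I2)
        fix x assume "x \<in> space unit_interval"
        then have "cmod (u n x) \<le> 2 * cmod (f x)" using u(3)[of n x] gf by simp
        then have "cmod (u n x - f x) \<le> 3 * cmod (f x)" using norm_triangle_ineq4[of "u n x" "f x"] by linarith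
        then have "(cmod (u n x - f x))\<^sup>2 \<le> (3 * cmod (f x))\<^sup>2" by (intro power_mono) auto
        then show "(cmod (u n x - f x))\<^sup>2 \<le> 9 * (cmod (f x))\<^sup>2" by (simp add: power_mult_distrib)
      qed
    qed
  qed
qed

section \<open>The Hardy space norm and unitarity of the transform\<close>

definition H2_norm :: "(complex \<Rightarrow> complex) \<Rightarrow> real" where
  "H2_norm F = sqrt (enn2real (H2_norm_sq F))"

lemma H2_norm_eq_bdry: "F \<in> H2 \<Longrightarrow> H2_norm F = L2_norm lborel (bdry F) / sqrt (2 * pi)"
  by (simp add: H2_norm_def H2_norm_sq_eq_bdry real_sqrt_divide L2_norm_nonneg)

lemma H2_norm_nonneg: "0 \<le> H2_norm F"
  by (simp add: H2_norm_def)

lemma H2_norm_sq_cong: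
  assumes "\<And>s. Re s > 0 \<Longrightarrow> F s = G s"
  shows "H2_norm_sq F = H2_norm_sq G"
proof -
  have "(SUP x\<in>{0::real<..}. \<integral>\<^sup>+y. ennreal ((cmod (F (Complex x y)))\<^sup>2) \<partial>lborel)
     = (SUP x\<in>{0::real<..}. \<integral>\<^sup>+y. ennreal ((cmod (G (Complex x y)))\<^sup>2) \<partial>lborel)"
    using assms by (intro SUP_cong refl nn_integral_cong) simp
  then show ?thesis by (simp add: H2_norm_sq_def)
qed

lemma H2_cong:
  assumes "\<And>s. Re s > 0 \<Longrightarrow> F s = G s"
  shows "F \<in> H2 \<longleftrightarrow> G \<in> H2"
proof -
  have "F holomorphic_on right_half_plane \<longleftrightarrow> G holomorphic_on right_half_plane"
    using assms by (intro holomorphic_cong) (auto simp: right_half_plane_def)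
  then show ?thesis using H2_norm_sq_cong[OF assms] by (simp add: H2_def)
qed

lemma H2_norm_cong: "(\<And>s. Re s > 0 \<Longrightarrow> F s = G s) \<Longrightarrow> H2_norm F = H2_norm G"
  unfolding H2_norm_def using H2_norm_sq_cong[of F G] by simp

lemma H2_inner_cong:
  assumes "\<And>s. Re s > 0 \<Longrightarrow> F s = F' s" "\<And>s. Re s > 0 \<Longrightarrow> G s = G' s"
  shows "H2_inner F G = H2_inner F' G'"
  unfolding H2_inner_def using assms
  by (intro arg_cong[where f="\<lambda>x. x / 4"] sum.cong refl arg_cong2[where f="(*)"] arg_cong[where f=complex_of_real]
      arg_cong[where f=enn2real] H2_norm_sq_cong) auto

lemma bdry_cong: "(\<And>s. Re s > 0 \<Longrightarrow> F s = G s) \<Longrightarrow> F \<in> H2 \<Longrightarrow> AE y in lborel. bdry F y = bdry G y"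
proof -
  assume eq: "\<And>s. Re s > 0 \<Longrightarrow> F s = G s" and F: "F \<in> H2"
  have G: "G \<in> H2" using H2_cong[OF eq] F by simp
  have "(\<lambda>s. 1 * F s + (-1) * G s) \<in> H2" by (rule H2_lincomb[OF F G])
  moreover have "H2_norm (\<lambda>s. 1 * F s + (-1) * G s) = H2_norm (\<lambda>s. 0)" using eq by (intro H2_norm_cong) simp
  moreover have "H2_norm (\<lambda>s. 0) = 0" by (simp add: H2_norm_def H2_norm_sq_def)
  ultimately have "L2_norm lborel (bdry (\<lambda>s. 1 * F s + (-1) * G s)) = 0"
    by (simp add: H2_norm_eq_bdry)
  then have "AE y in lborel. bdry (\<lambda>s. 1 * F s + (-1) * G s) y = 0"
    using L2_norm_eq_0_iff[OF bdry_L2[OF \<open>(\<lambda>s. 1 * F s + (-1) * G s) \<in> H2\<close>]] by simp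
  then show ?thesis using bdry_lincomb[OF F G, of 1 "-1"] by eventually_elim simp
qed

lemma H2_inner_lincomb_left:
  assumes "F \<in> H2" "G \<in> H2" "E \<in> H2"
  shows "H2_inner (\<lambda>s. a * F s + b * G s) E = a * H2_inner F E + b * H2_inner G E"
proof -
  have "L2_ip lborel (bdry (\<lambda>s. a * F s + b * G s)) (bdry E) = L2_ip lborel (\<lambda>y. a * bdry F y + b * bdry G y) (bdry E)"
    using assms by (intro L2_ip_cong_AE L2_measurable L2_lincomb bdry_L2 H2_lincomb bdry_lincomb) auto
  then show ?thesis
    using assms by (simp add: H2_inner_eq_bdry H2_lincomb L2_ip_lincomb_left bdry_L2 add_divide_distrib)
qed

lemma H2_inner_cnj: "F \<in> H2 \<Longrightarrow> G \<in> H2 \<Longrightarrow> H2_inner G F = cnj (H2_inner F G)"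
  by (simp add: H2_inner_eq_bdry flip: L2_ip_cnj)

lemma H2_inner_lincomb_right:
  assumes "F \<in> H2" "G \<in> H2" "E \<in> H2"
  shows "H2_inner E (\<lambda>s. a * F s + b * G s) = cnj a * H2_inner E F + cnj b * H2_inner E G"
proof -
  have "H2_inner E (\<lambda>s. a * F s + b * G s) = cnj (a * H2_inner F E + b * H2_inner G E)"
    using assms H2_inner_cnj[OF H2_lincomb[OF assms(1,2)] assms(3)] by (simp add: H2_inner_lincomb_left)
  also have "\<dots> = cnj a * cnj (H2_inner F E) + cnj b * cnj (H2_inner G E)" by simp
  finally show ?thesis using assms by (simp flip: H2_inner_cnj)
qed

lemma H2_inner_self: "F \<in> H2 \<Longrightarrow> H2_inner F F = of_real ((H2_norm F)\<^sup>2)"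
  by (simp add: H2_inner_eq_bdry H2_norm_eq_bdry L2_ip_self power_divide)

lemma H2_Cauchy_Schwarz:
  assumes "F \<in> H2" "G \<in> H2"
  shows "cmod (H2_inner F G) \<le> H2_norm F * H2_norm G"
proof -
  have "sqrt (2 * pi) * sqrt (2 * pi) = 2 * pi" by simp
  then show ?thesis
    using L2_Cauchy_Schwarz[OF bdry_L2[OF assms(1)] bdry_L2[OF assms(2)]] assms
    by (simp add: H2_inner_eq_bdry H2_norm_eq_bdry norm_divide norm_mult divide_right_mono del: real_sqrt_mult)
qed

lemma H2_norm_lincomb_le:
  assumes "F \<in> H2" "G \<in> H2"
  shows "H2_norm (\<lambda>s. a * F s + b * G s) \<le> cmod a * H2_norm F + cmod b * H2_norm G"
proof -
  have "L2_norm lborel (bdry (\<lambda>s. a * F s + b * G s)) = L2_norm lborel (\<lambda>y. a * bdry F y + b * bdry G y)"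
    using assms by (intro L2_norm_cong_AE L2_measurable bdry_lincomb bdry_L2 L2_lincomb H2_lincomb)
  also have "\<dots> \<le> cmod a * L2_norm lborel (bdry F) + cmod b * L2_norm lborel (bdry G)"
    using L2_norm_triangle[OF L2_scale[OF bdry_L2[OF assms(1)], of a] L2_scale[OF bdry_L2[OF assms(2)], of b]] by (simp add: L2_norm_scale)
  finally show ?thesis
    unfolding H2_norm_eq_bdry[OF assms(1)] H2_norm_eq_bdry[OF assms(2)] H2_norm_eq_bdry[OF H2_lincomb[OF assms]]
    by (simp add: divide_le_eq add_divide_distrib[symmetric] del: real_sqrt_mult)
qed

lemma H2_norm_le_add_diff:
  assumes "F \<in> H2" "G \<in> H2"
  shows "H2_norm F \<le> H2_norm G + H2_norm (\<lambda>s. F s - G s)"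
  using H2_norm_lincomb_le[OF assms(2) H2_diff[OF assms], of 1 1] by simp

lemma H2_line_integral_le_norm:
  assumes "F \<in> H2" "x > 0"
  shows "(\<integral>\<^sup>+y. ennreal ((cmod (F (Complex x y)))\<^sup>2) \<partial>lborel) \<le> ennreal (2 * pi * (H2_norm F)\<^sup>2)"
  using H2_line_le[OF assms] by (simp add: H2_norm_def)

lemma H2I_norm:
  assumes h: "F holomorphic_on right_half_plane" and c: "c \<ge> 0"
    and b: "\<And>x. x > 0 \<Longrightarrow> (\<integral>\<^sup>+y. ennreal ((cmod (F (Complex x y)))\<^sup>2) \<partial>lborel) \<le> ennreal (2 * pi * c\<^sup>2)"
  shows "F \<in> H2" "H2_norm F \<le> c"
proof -
  show F: "F \<in> H2" by (rule H2I[OF h b])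
  have "(SUP x\<in>{0::real<..}. \<integral>\<^sup>+y. ennreal ((cmod (F (Complex x y)))\<^sup>2) \<partial>lborel) \<le> ennreal (2 * pi * c\<^sup>2)"
    using b by (intro SUP_least) auto
  then have "H2_norm_sq F \<le> ennreal (1 / (2 * pi)) * ennreal (2 * pi * c\<^sup>2)"
    unfolding H2_norm_sq_def by (intro mult_left_mono) auto
  also have "\<dots> = ennreal (c\<^sup>2)" by (simp flip: ennreal_mult)
  finally have "enn2real (H2_norm_sq F) \<le> c\<^sup>2" by (intro enn2real_leI) auto
  then show "H2_norm F \<le> c" unfolding H2_norm_def using c by (simp add: real_le_lsqrt)
qed

text \<open>Fatou's lemma on each vertical line: norm bounds survive limits that are known only
  pointwise.\<close>

lemma H2_pointwise_limit:
  assumes G: "\<And>n. G n \<in> H2" and h: "F holomorphic_on right_half_plane"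
    and lim: "\<And>s. Re s > 0 \<Longrightarrow> (\<lambda>n. G n s) \<longlonglongrightarrow> F s" and b: "\<forall>\<^sub>F n in sequentially. H2_norm (G n) \<le> c" and c: "c \<ge> 0"
  shows "F \<in> H2" "H2_norm F \<le> c"
proof -
  have le: "(\<integral>\<^sup>+y. ennreal ((cmod (F (Complex x y)))\<^sup>2) \<partial>lborel) \<le> ennreal (2 * pi * c\<^sup>2)" if x: "x > 0" for x
  proof -
    note [measurable] = line_measurable[OF H2_holomorphic[OF G] x]
    have "(\<integral>\<^sup>+y. ennreal ((cmod (F (Complex x y)))\<^sup>2) \<partial>lborel) = (\<integral>\<^sup>+y. liminf (\<lambda>n. ennreal ((cmod (G n (Complex x y)))\<^sup>2)) \<partial>lborel)"
    proof (rule nn_integral_cong)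
      fix y
      have "(\<lambda>n. ennreal ((cmod (G n (Complex x y)))\<^sup>2)) \<longlonglongrightarrow> ennreal ((cmod (F (Complex x y)))\<^sup>2)"
        using x by (intro tendsto_intros lim) simp
      from lim_imp_Liminf[OF _ this]
      show "ennreal ((cmod (F (Complex x y)))\<^sup>2) = liminf (\<lambda>n. ennreal ((cmod (G n (Complex x y)))\<^sup>2))" by simp
    qed
    also have "\<dots> \<le> liminf (\<lambda>n. \<integral>\<^sup>+y. ennreal ((cmod (G n (Complex x y)))\<^sup>2) \<partial>lborel)"
      by (rule nn_integral_liminf) measurable
    also have "\<dots> \<le> ennreal (2 * pi * c\<^sup>2)"
    proof (rule Liminf_le[OF sequentially_bot])
      show "\<forall>\<^sub>F n in sequentially. (\<integral>\<^sup>+y. ennreal ((cmod (G n (Complex x y)))\<^sup>2) \<partial>lborel) \<le> ennreal (2 * pi * c\<^sup>2)"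
        using b
      proof eventually_elim
        case (elim n)
        have "(\<integral>\<^sup>+y. ennreal ((cmod (G n (Complex x y)))\<^sup>2) \<partial>lborel) \<le> ennreal (2 * pi * (H2_norm (G n))\<^sup>2)"
          by (rule H2_line_integral_le_norm[OF G x])
        also have "\<dots> \<le> ennreal (2 * pi * c\<^sup>2)"
          using elim by (intro ennreal_leI mult_left_mono power_mono H2_norm_nonneg) auto
        finally show ?case .
      qed
    qed
    finally show ?thesis .
  qed
  show "F \<in> H2" "H2_norm F \<le> c" using H2I_norm[OF h c le] by auto
qed

lemma H2_zero: "(\<lambda>s. 0) \<in> H2"
  using H2_lincomb[OF H2_kernel_in_H2 H2_kernel_in_H2, of 1 1 0 0] by simp

lemma H2_sum:
  assumes "finite A" "\<And>i. i \<in> A \<Longrightarrow> F i \<in> H2"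
  shows "(\<lambda>s. \<Sum>i\<in>A. c i * F i s) \<in> H2"
  using assms
proof (induction A rule: finite_induct)
  case empty
  then show ?case using H2_zero by simp
next
  case (insert i A)
  then show ?case using H2_lincomb[of "F i" "\<lambda>s. \<Sum>i\<in>A. c i * F i s" "c i" 1] by simp
qed

lemma H2_inner_sum_right:
  assumes "finite A" "\<And>i. i \<in> A \<Longrightarrow> F i \<in> H2" "E \<in> H2"
  shows "H2_inner E (\<lambda>s. \<Sum>i\<in>A. c i * F i s) = (\<Sum>i\<in>A. cnj (c i) * H2_inner E (F i))"
  using assms(1,2)
proof (induction A rule: finite_induct)
  case empty
  then show ?case using H2_inner_lincomb_right[OF assms(3,3,3), of 0 0] by simp
next
  case (insert i A)
  then show ?case
    using H2_inner_lincomb_right[OF _ H2_sum[of A F c] assms(3), of "F i" "c i" 1] by simp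
qed

lemma power_fun_nat:
  assumes "x \<in> space unit_interval"
  shows "power_fun (of_nat i + 1 / 2) x = of_real x ^ i"
proof -
  have "x > 0" using assms by (simp add: space_restrict_space)
  moreover have "cnj (of_nat i + 1 / 2) - 1 / 2 = of_nat i" by simp
  ultimately show ?thesis unfolding power_fun_def by (simp only: powr_nat' of_real_eq_0_iff) simp
qed

lemma U_op_poly_fun:
  assumes s: "Re s > 0"
  shows "U_op (poly_fun p) s = (\<Sum>i\<le>degree p. coeff p i * H2_kernel (of_nat i + 1 / 2) s)"
proof -
  have L: "power_fun (of_nat i + 1 / 2) \<in> L2 unit_interval" for i by (intro power_fun_L2) (simp add: add_nonneg_pos)
  have eq: "poly_fun p x = (\<Sum>i\<le>degree p. coeff p i * power_fun (of_nat i + 1 / 2) x)" if "x \<in> space unit_interval" for x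
    by (simp add: poly_fun_def poly_altdef power_fun_nat[OF that])
  have "U_op (poly_fun p) s = L2_ip unit_interval (poly_fun p) (power_fun s)"
    by (rule U_op_eq_ip[OF poly_fun_L2 s])
  also have "\<dots> = (\<integral>x. (\<Sum>i\<le>degree p. coeff p i * (power_fun (of_nat i + 1 / 2) x * cnj (power_fun s x))) \<partial>unit_interval)"
    unfolding L2_ip_def by (intro Bochner_Integration.integral_cong refl) (simp add: eq sum_distrib_right mult.assoc)
  also have "\<dots> = (\<Sum>i\<le>degree p. coeff p i * L2_ip unit_interval (power_fun (of_nat i + 1 / 2)) (power_fun s))"
    unfolding L2_ip_def using L2_ip_integrable[OF L power_fun_L2[OF s]]
    by (subst Bochner_Integration.integral_sum) auto
  also have "\<dots> = (\<Sum>i\<le>degree p. coeff p i * H2_kernel (of_nat i + 1 / 2) s)"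
    using s by (intro sum.cong refl) (simp add: U_op_power_fun[symmetric] U_op_eq_ip[OF L s] add_nonneg_pos)
  finally show ?thesis .
qed

lemma U_op_poly_fun_H2:
  shows "U_op (poly_fun p) \<in> H2" and "F \<in> H2 \<Longrightarrow> H2_inner F (U_op (poly_fun p)) = (\<Sum>i\<le>degree p. cnj (coeff p i) * F (of_nat i + 1 / 2))"
proof -
  have r: "Re (of_nat i + 1 / 2 :: complex) > 0" for i by (simp add: add_nonneg_pos)
  let ?G = "\<lambda>s. \<Sum>i\<le>degree p. coeff p i * H2_kernel (of_nat i + 1 / 2) s"
  have G: "?G \<in> H2" by (rule H2_sum) (auto intro!: H2_kernel_in_H2 simp: add_nonneg_pos)
  then show "U_op (poly_fun p) \<in> H2" using H2_cong[of "U_op (poly_fun p)" ?G] U_op_poly_fun by simp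
  assume F: "F \<in> H2"
  have "H2_inner F (U_op (poly_fun p)) = H2_inner F ?G" by (rule H2_inner_cong) (auto simp: U_op_poly_fun)
  also have "\<dots> = (\<Sum>i\<le>degree p. cnj (coeff p i) * F (of_nat i + 1 / 2))"
    using r by (subst H2_inner_sum_right) (auto intro!: H2_kernel_in_H2 F simp: H2_reproducing[OF F r])
  finally show "H2_inner F (U_op (poly_fun p)) = (\<Sum>i\<le>degree p. cnj (coeff p i) * F (of_nat i + 1 / 2))" .
qed

text \<open>Since monomials are sent to kernels, the reproducing property rewrites the squared norm
  of the image through its values at the points \<open>i + 1/2\<close>. These values are inner
  products with monomials, which reassemble to the squared norm of the polynomial.\<close>

lemma U_op_poly_fun_isometry: "H2_norm (U_op (poly_fun p)) = L2_norm unit_interval (poly_fun p)"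
proof -
  have r: "Re (of_nat i + 1 / 2 :: complex) > 0" for i by (simp add: add_nonneg_pos)
  have L: "power_fun (of_nat i + 1 / 2) \<in> L2 unit_interval" for i by (intro power_fun_L2 r)
  have "complex_of_real ((H2_norm (U_op (poly_fun p)))\<^sup>2) = (\<Sum>i\<le>degree p. cnj (coeff p i) * U_op (poly_fun p) (of_nat i + 1 / 2))"
    by (simp only: H2_inner_self[OF U_op_poly_fun_H2(1), symmetric] U_op_poly_fun_H2(2)[OF U_op_poly_fun_H2(1)])
  also have "\<dots> = (\<Sum>i\<le>degree p. cnj (coeff p i) * L2_ip unit_interval (poly_fun p) (power_fun (of_nat i + 1 / 2)))"
    by (simp only: U_op_eq_ip[OF poly_fun_L2 r])
  also have "\<dots> = (\<integral>x. (\<Sum>i\<le>degree p. cnj (coeff p i) * (poly_fun p x * cnj (power_fun (of_nat i + 1 / 2) x))) \<partial>unit_interval)"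
    unfolding L2_ip_def using L2_ip_integrable[OF poly_fun_L2 L]
    by (subst Bochner_Integration.integral_sum) auto
  also have "\<dots> = L2_ip unit_interval (poly_fun p) (poly_fun p)"
    unfolding L2_ip_def
    by (intro Bochner_Integration.integral_cong refl)
      (simp add: power_fun_nat poly_fun_def[of p] poly_altdef[of p] sum_distrib_left mult_ac)
  also have "\<dots> = complex_of_real ((L2_norm unit_interval (poly_fun p))\<^sup>2)" by (rule L2_ip_self)
  finally have "(H2_norm (U_op (poly_fun p)))\<^sup>2 = (L2_norm unit_interval (poly_fun p))\<^sup>2" by (simp only: of_real_eq_iff)
  then show ?thesis by (simp add: H2_norm_nonneg L2_norm_nonneg)
qed

lemma U_op_diff:
  assumes "f \<in> L2 unit_interval" "g \<in> L2 unit_interval" "Re s > 0"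
  shows "U_op (\<lambda>x. f x - g x) s = U_op f s - U_op g s"
  using U_op_lincomb[OF assms, of 1 "-1"] by simp

text \<open>Extension by density. Point evaluations of the transform are bounded by the L2 norm,
  locally uniformly in the half-plane, so approximating polynomials yield holomorphy, and Fatou's
  lemma yields the norm.\<close>

lemma U_op_isometry:
  assumes f: "f \<in> L2 unit_interval"
  shows "U_op f \<in> H2" and "H2_norm (U_op f) = L2_norm unit_interval f"
proof -
  have "\<exists>p. L2_norm unit_interval (\<lambda>x. f x - poly_fun p x) < 1 / real (Suc n)" for n
    using poly_fun_dense[OF f] unfolding poly_approximable_def by simp
  then obtain p where p: "\<And>n. L2_norm unit_interval (\<lambda>x. f x - poly_fun (p n) x) < 1 / real (Suc n)" by metis
  have null: "(\<lambda>n. 1 / real (Suc n)) \<longlonglongrightarrow> 0" by (rule LIMSEQ_Suc[OF lim_1_over_n])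
  have le: "cmod (U_op (poly_fun (p n)) s - U_op f s) \<le> 1 / real (Suc n) * sqrt (1 / (2 * Re s))" if s: "Re s > 0" for n s
  proof -
    have "cmod (U_op (poly_fun (p n)) s - U_op f s) = cmod (U_op (\<lambda>x. f x - poly_fun (p n) x) s)"
      by (simp add: U_op_diff[OF f poly_fun_L2 s] norm_minus_commute)
    also have "\<dots> \<le> L2_norm unit_interval (\<lambda>x. f x - poly_fun (p n) x) * sqrt (1 / (2 * Re s))"
      by (intro norm_U_op_le L2_diff f poly_fun_L2 s)
    also have "\<dots> \<le> 1 / real (Suc n) * sqrt (1 / (2 * Re s))"
      using p[of n] s by (intro mult_right_mono) auto
    finally show ?thesis .
  qed
  have pw: "(\<lambda>n. U_op (poly_fun (p n)) s) \<longlonglongrightarrow> U_op f s" if s: "Re s > 0" for s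
  proof -
    have "(\<lambda>n. U_op (poly_fun (p n)) s - U_op f s) \<longlonglongrightarrow> 0"
      by (rule Lim_null_comparison[OF always_eventually[OF allI[OF le[OF s]]]])
        (use tendsto_mult_right[OF null, of "sqrt (1 / (2 * Re s))"] in simp)
    then show ?thesis by (simp add: LIM_zero_iff)
  qed
  have hol: "U_op f holomorphic_on right_half_plane"
  proof (rule holomorphic_uniform_sequence[OF open_right_half_plane])
    show "U_op (poly_fun (p n)) holomorphic_on right_half_plane" for n by (rule H2_holomorphic[OF U_op_poly_fun_H2(1)])
    fix s assume "s \<in> right_half_plane"
    then have s: "Re s > 0" by (simp add: right_half_plane_def)
    define d where "d = Re s / 2"
    have d: "d > 0" using s by (simp add: d_def)
    have ge: "Re z \<ge> d" if "z \<in> cball s d" for z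
      using that abs_Re_le_cmod[of "s - z"] by (auto simp: dist_norm d_def)
    have "uniform_limit (cball s d) (\<lambda>n. U_op (poly_fun (p n))) (U_op f) sequentially"
    proof (rule uniform_limitI)
      fix e :: real assume e: "e > 0"
      have "(\<lambda>n. 1 / real (Suc n) * sqrt (1 / (2 * d))) \<longlonglongrightarrow> 0 * sqrt (1 / (2 * d))"
        by (intro tendsto_intros null)
      then have "\<forall>\<^sub>F n in sequentially. 1 / real (Suc n) * sqrt (1 / (2 * d)) < e" using e by (intro order_tendstoD(2)) auto
      then show "\<forall>\<^sub>F n in sequentially. \<forall>z\<in>cball s d. dist (U_op (poly_fun (p n)) z) (U_op f z) < e"
      proof eventually_elim
        case (elim n)
        show ?case
        proof
          fix z assume z: "z \<in> cball s d"
          have "cmod (U_op (poly_fun (p n)) z - U_op f z) \<le> 1 / real (Suc n) * sqrt (1 / (2 * Re z))"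
            using ge[OF z] d by (intro le) simp
          also have "\<dots> \<le> 1 / real (Suc n) * sqrt (1 / (2 * d))"
            using ge[OF z] d by (intro mult_left_mono real_sqrt_le_mono divide_left_mono) auto
          finally show "dist (U_op (poly_fun (p n)) z) (U_op f z) < e" using elim by (simp add: dist_norm)
        qed
      qed
    qed
    moreover have "cball s d \<subseteq> right_half_plane" using ge d by (force simp: right_half_plane_def)
    ultimately show "\<exists>d>0. cball s d \<subseteq> right_half_plane \<and> uniform_limit (cball s d) (\<lambda>n. U_op (poly_fun (p n))) (U_op f) sequentially"
      using d by blast
  qed
  have lp: "(\<lambda>n. L2_norm unit_interval (poly_fun (p n))) \<longlonglongrightarrow> L2_norm unit_interval f"
  proof (rule tendsto_L2_norm[OF poly_fun_L2 f])
    show "(\<lambda>n. L2_norm unit_interval (\<lambda>x. poly_fun (p n) x - f x)) \<longlonglongrightarrow> 0"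
      using p by (intro Lim_null_comparison[OF _ null] always_eventually allI)
        (simp add: L2_norm_nonneg L2_norm_minus_commute[of unit_interval _ f] less_imp_le)
  qed
  obtain B where B: "\<And>n. L2_norm unit_interval (poly_fun (p n)) \<le> B"
  proof -
    have "Bseq (\<lambda>n. L2_norm unit_interval (poly_fun (p n)))" using lp by (intro convergent_imp_Bseq convergentI)
    then show thesis using that by (auto simp: Bseq_def L2_norm_nonneg)
  qed
  have B0: "B \<ge> 0" using B[of 0] L2_norm_nonneg order_trans by blast
  show UH: "U_op f \<in> H2"
    by (rule H2_pointwise_limit(1)[OF U_op_poly_fun_H2(1) hol pw _ B0]) (auto simp: U_op_poly_fun_isometry B)
  \<comment> \<open>\<open>U_op f - U_op (poly_fun (p n))\<close> is the pointwise limit in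
    \<open>m\<close> of the transforms of \<open>p m - p n\<close>, whose norms are known
    exactly.\<close>
  have dn: "H2_norm (\<lambda>s. U_op f s - U_op (poly_fun (p n)) s) \<le> 2 / real (Suc n)" for n
  proof (rule H2_pointwise_limit(2)[where G="\<lambda>m. U_op (poly_fun (p m - p n))"])
    show "U_op (poly_fun (p m - p n)) \<in> H2" for m by (rule U_op_poly_fun_H2(1))
    show "(\<lambda>s. U_op f s - U_op (poly_fun (p n)) s) holomorphic_on right_half_plane"
      by (intro holomorphic_on_diff hol H2_holomorphic U_op_poly_fun_H2(1))
    have pd: "poly_fun (p m - p n) = (\<lambda>x. poly_fun (p m) x - poly_fun (p n) x)" for m by (auto simp: poly_fun_def)
    show "(\<lambda>m. U_op (poly_fun (p m - p n)) s) \<longlonglongrightarrow> U_op f s - U_op (poly_fun (p n)) s" if "Re s > 0" for s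
      unfolding pd by (simp add: U_op_diff[OF poly_fun_L2 poly_fun_L2 that]) (intro tendsto_intros pw that)
    show "\<forall>\<^sub>F m in sequentially. H2_norm (U_op (poly_fun (p m - p n))) \<le> 2 / real (Suc n)"
      using eventually_ge_at_top[of n]
    proof eventually_elim
      case (elim m)
      have "L2_norm unit_interval (\<lambda>x. poly_fun (p m) x - poly_fun (p n) x)
        \<le> L2_norm unit_interval (\<lambda>x. poly_fun (p m) x - f x) + L2_norm unit_interval (\<lambda>x. f x - poly_fun (p n) x)"
        by (rule L2_norm_triangle_diff[OF poly_fun_L2 f poly_fun_L2])
      also have "\<dots> \<le> 1 / real (Suc m) + 1 / real (Suc n)"
        using p[of m] p[of n] L2_norm_minus_commute[of unit_interval "poly_fun (p m)" f] by simp
      also have "1 / real (Suc m) \<le> 1 / real (Suc n)" using elim by (simp add: frac_le)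
      finally show ?case unfolding U_op_poly_fun_isometry by (simp add: pd)
    qed
  qed simp
  have "(\<lambda>n. H2_norm (U_op (poly_fun (p n)))) \<longlonglongrightarrow> H2_norm (U_op f)"
  proof (rule LIM_zero_cancel, rule Lim_null_comparison)
    show "\<forall>\<^sub>F n in sequentially. norm (H2_norm (U_op (poly_fun (p n))) - H2_norm (U_op f)) \<le> 2 * (1 / real (Suc n))"
    proof (rule always_eventually, rule allI)
      fix n
      have "H2_norm (\<lambda>s. U_op (poly_fun (p n)) s - U_op f s) = H2_norm (\<lambda>s. U_op f s - U_op (poly_fun (p n)) s)"
        unfolding H2_norm_def H2_norm_sq_def by (simp add: norm_minus_commute)
      then show "norm (H2_norm (U_op (poly_fun (p n))) - H2_norm (U_op f)) \<le> 2 * (1 / real (Suc n))"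
        using H2_norm_le_add_diff[OF UH U_op_poly_fun_H2(1)[of "p n"]] H2_norm_le_add_diff[OF U_op_poly_fun_H2(1)[of "p n"] UH] dn[of n]
        by simp
    qed
    show "(\<lambda>n. 2 * (1 / real (Suc n))) \<longlonglongrightarrow> 0" using tendsto_mult_left[OF null, of 2] by simp
  qed
  with lp show "H2_norm (U_op f) = L2_norm unit_interval f"
    unfolding U_op_poly_fun_isometry using LIMSEQ_unique by blast
qed

text \<open>By the isometry the boundary functions of the range form a closed subspace. The part of
  \<open>bdry F\<close> orthogonal to it is orthogonal to every reproducing kernel, since kernels
  are transforms, and therefore belongs to a function that vanishes at each point.\<close>

lemma U_op_surjective:
  assumes F: "F \<in> H2"
  obtains f where "f \<in> L2 unit_interval" "\<And>s. Re s > 0 \<Longrightarrow> U_op f s = F s"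
proof -
  define K where "K = {g \<in> L2 lborel. \<exists>f\<in>L2 unit_interval. AE y in lborel. g y = bdry (U_op f) y}"
  have bU: "bdry (U_op f) \<in> K" if "f \<in> L2 unit_interval" for f
    unfolding K_def using that by (auto intro!: bdry_L2 U_op_isometry bexI[of _ f])
  \<comment> \<open>The factor \<open>sqrt (2 * pi)\<close> is the ratio of the boundary norm to
    \<open>H2_norm\<close>.\<close>
  have bdiff: "L2_norm lborel (\<lambda>y. bdry (U_op f) y - bdry (U_op g) y) = sqrt (2 * pi) * L2_norm unit_interval (\<lambda>x. f x - g x)"
    if fg: "f \<in> L2 unit_interval" "g \<in> L2 unit_interval" for f g
  proof -
    note H = U_op_isometry(1)[OF fg(1)] U_op_isometry(1)[OF fg(2)]
    have "AE y in lborel. bdry (U_op (\<lambda>x. f x - g x)) y = bdry (\<lambda>s. 1 * U_op f s + (-1) * U_op g s) y"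
      by (intro bdry_cong U_op_isometry L2_diff fg) (simp add: U_op_diff fg)
    with bdry_lincomb[OF H, of 1 "-1"] have "AE y in lborel. bdry (U_op f) y - bdry (U_op g) y = bdry (U_op (\<lambda>x. f x - g x)) y"
      by eventually_elim simp
    then have "L2_norm lborel (\<lambda>y. bdry (U_op f) y - bdry (U_op g) y) = L2_norm lborel (bdry (U_op (\<lambda>x. f x - g x)))"
      by (intro L2_norm_cong_AE L2_measurable L2_diff bdry_L2 U_op_isometry fg)
    also have "\<dots> = sqrt (2 * pi) * H2_norm (U_op (\<lambda>x. f x - g x))"
      by (subst H2_norm_eq_bdry[OF U_op_isometry(1)[OF L2_diff[OF fg]]]) simp
    finally show ?thesis by (simp add: U_op_isometry(2)[OF L2_diff[OF fg]])
  qed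
  obtain k where k: "k \<in> K" "\<And>g. g \<in> K \<Longrightarrow> L2_ip lborel (\<lambda>x. bdry F x - k x) g = 0"
  proof (rule L2_projection[of K lborel "bdry F"])
    show "K \<subseteq> L2 lborel" by (auto simp: K_def)
    show "K \<noteq> {}" using bU[OF L2_zero] by auto
    show "bdry F \<in> L2 lborel" by (rule bdry_L2[OF F])
    show "(\<lambda>x. a * f x + b * g x) \<in> K" if fg: "f \<in> K" "g \<in> K" for f g a b
    proof -
      obtain f' g' where f': "f' \<in> L2 unit_interval" "AE y in lborel. f y = bdry (U_op f') y"
        and g': "g' \<in> L2 unit_interval" "AE y in lborel. g y = bdry (U_op g') y"
        using fg by (auto simp: K_def)
      have "AE y in lborel. bdry (U_op (\<lambda>x. a * f' x + b * g' x)) y = bdry (\<lambda>s. a * U_op f' s + b * U_op g' s) y"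
        by (intro bdry_cong U_op_isometry L2_lincomb f' g') (simp add: U_op_lincomb f' g')
      with bdry_lincomb[OF U_op_isometry(1)[OF f'(1)] U_op_isometry(1)[OF g'(1)], of a b] f'(2) g'(2)
      have "AE y in lborel. a * f y + b * g y = bdry (U_op (\<lambda>x. a * f' x + b * g' x)) y"
        by eventually_elim simp
      moreover have "(\<lambda>x. a * f x + b * g x) \<in> L2 lborel" using fg by (intro L2_lincomb) (auto simp: K_def)
      ultimately show ?thesis unfolding K_def using L2_lincomb[OF f'(1) g'(1)] by blast
    qed
    show "f \<in> K" if u: "\<And>n::nat. u n \<in> K" and f: "f \<in> L2 lborel" and l: "(\<lambda>n. L2_norm lborel (\<lambda>x. u n x - f x)) \<longlonglongrightarrow> 0" for u f
    proof -
      have uL: "u n \<in> L2 lborel" for n using u by (auto simp: K_def)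
      have "\<forall>n. \<exists>v\<in>L2 unit_interval. AE y in lborel. u n y = bdry (U_op v) y" using u by (auto simp: K_def)
      then obtain v where v: "\<And>n. v n \<in> L2 unit_interval" "\<And>n. AE y in lborel. u n y = bdry (U_op (v n)) y" by metis
      have uv: "L2_norm lborel (\<lambda>x. u m x - u n x) = sqrt (2 * pi) * L2_norm unit_interval (\<lambda>x. v m x - v n x)" for m n
      proof -
        have "AE y in lborel. u m y - u n y = bdry (U_op (v m)) y - bdry (U_op (v n)) y"
          using v(2)[of m] v(2)[of n] by eventually_elim simp
        then have "L2_norm lborel (\<lambda>x. u m x - u n x) = L2_norm lborel (\<lambda>y. bdry (U_op (v m)) y - bdry (U_op (v n)) y)"
          by (intro L2_norm_cong_AE L2_measurable L2_diff uL bdry_L2 U_op_isometry v)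
        then show ?thesis by (simp add: bdiff v)
      qed
      have pp: "sqrt (2 * pi) > 0" by simp
      have C: "\<exists>N. \<forall>m\<ge>N. \<forall>n\<ge>N. L2_norm unit_interval (\<lambda>x. v m x - v n x) < e" if e: "e > 0" for e
      proof -
        have "sqrt (2 * pi) * e / 2 > 0" using e by simp
        from LIMSEQ_D[OF l this] obtain N where N: "\<And>n. n \<ge> N \<Longrightarrow> L2_norm lborel (\<lambda>x. u n x - f x) < sqrt (2 * pi) * e / 2"
          by (auto simp: L2_norm_nonneg)
        have "L2_norm unit_interval (\<lambda>x. v m x - v n x) < e" if "m \<ge> N" "n \<ge> N" for m n
        proof -
          have "L2_norm lborel (\<lambda>x. u m x - u n x) < sqrt (2 * pi) * e"
            using L2_norm_triangle_diff[OF uL[of m] f uL[of n]] N[OF that(1)] N[OF that(2)]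
              L2_norm_minus_commute[of lborel f "u n"] by linarith
          then show ?thesis unfolding uv using pp by (simp only: mult_less_cancel_left_pos)
        qed
        then show ?thesis by blast
      qed
      obtain w r where w: "w \<in> L2 unit_interval" "(\<lambda>n. L2_norm unit_interval (\<lambda>x. v n x - w x)) \<longlonglongrightarrow> 0"
        "strict_mono (r :: nat \<Rightarrow> nat)" "AE x in unit_interval. (\<lambda>n. v (r n) x) \<longlonglongrightarrow> w x"
        by (rule L2_complete[OF v(1) C])
      have bw: "bdry (U_op w) \<in> L2 lborel" by (intro bdry_L2 U_op_isometry w)
      have "L2_norm lborel (\<lambda>x. u n x - bdry (U_op w) x) = sqrt (2 * pi) * L2_norm unit_interval (\<lambda>x. v n x - w x)" for n
      proof -
        have "AE y in lborel. u n y - bdry (U_op w) y = bdry (U_op (v n)) y - bdry (U_op w) y"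
          using v(2)[of n] by eventually_elim simp
        then have "L2_norm lborel (\<lambda>x. u n x - bdry (U_op w) x) = L2_norm lborel (\<lambda>y. bdry (U_op (v n)) y - bdry (U_op w) y)"
          by (intro L2_norm_cong_AE L2_measurable L2_diff uL bdry_L2 U_op_isometry v w)
        then show ?thesis by (simp add: bdiff v w)
      qed
      then have "(\<lambda>n. L2_norm lborel (\<lambda>x. u n x - bdry (U_op w) x)) \<longlonglongrightarrow> 0"
        using tendsto_mult_left[OF w(2), of "sqrt (2 * pi)"] by simp
      with l have "(\<lambda>n. L2_norm lborel (\<lambda>x. u n x - f x) + L2_norm lborel (\<lambda>x. u n x - bdry (U_op w) x)) \<longlonglongrightarrow> 0"
        using tendsto_add by fastforce
      then have "L2_norm lborel (\<lambda>x. f x - bdry (U_op w) x) \<le> 0"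
        by (rule tendsto_lowerbound)
          (auto intro!: always_eventually simp: L2_norm_minus_commute[of lborel _ f] intro: L2_norm_triangle_diff[OF f uL bw])
      then have "AE x in lborel. f x - bdry (U_op w) x = 0"
        using L2_norm_eq_0_iff[OF L2_diff[OF f bw]] L2_norm_nonneg[of lborel "\<lambda>x. f x - bdry (U_op w) x"] by auto
      then show "f \<in> K" unfolding K_def using f w(1) by auto
    qed
  next
    fix k assume "k \<in> K" "\<And>g. g \<in> K \<Longrightarrow> L2_ip lborel (\<lambda>x. bdry F x - k x) g = 0"
    then show thesis by (rule that)
  qed
  obtain f where f: "f \<in> L2 unit_interval" "AE y in lborel. k y = bdry (U_op f) y" using k(1) by (auto simp: K_def)
  have "U_op f w = F w" if w: "Re w > 0" for w
  proof -
    note H = F U_op_isometry(1)[OF f(1)]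
    have "AE y in lborel. bdry (\<lambda>s. 1 * F s + (-1) * U_op f s) y = bdry F y - k y"
      using bdry_lincomb[OF H, of 1 "-1"] f(2) by eventually_elim simp
    then have "L2_ip lborel (bdry (\<lambda>s. 1 * F s + (-1) * U_op f s)) (bdry (U_op (power_fun w))) = L2_ip lborel (\<lambda>y. bdry F y - k y) (bdry (U_op (power_fun w)))"
      using k(1) by (intro L2_ip_cong_AE L2_measurable bdry_L2 H2_lincomb H L2_diff U_op_isometry power_fun_L2 w) (auto simp: K_def)
    also have "\<dots> = 0" by (intro k bU power_fun_L2 w)
    finally have "H2_inner (\<lambda>s. 1 * F s + (-1) * U_op f s) (U_op (power_fun w)) = 0"
      by (subst H2_inner_eq_bdry) (auto intro!: H2_diff H U_op_isometry power_fun_L2 w)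
    moreover have "H2_inner (\<lambda>s. 1 * F s + (-1) * U_op f s) (U_op (power_fun w)) = H2_inner (\<lambda>s. 1 * F s + (-1) * U_op f s) (H2_kernel w)"
      by (rule H2_inner_cong) (auto simp: U_op_power_fun w)
    moreover have "\<dots> = F w - U_op f w" using H2_reproducing[OF H2_lincomb[OF H, of 1 "-1"] w] by simp
    ultimately show ?thesis by simp
  qed
  with f(1) show thesis by (rule that)
qed

lemma U_inv:
  assumes F: "F \<in> H2"
  shows "U_inv F \<in> L2 unit_interval" and "Re s > 0 \<Longrightarrow> U_op (U_inv F) s = F s"
proof -
  have "\<exists>f. f \<in> L2 unit_interval \<and> (\<forall>s\<in>right_half_plane. U_op f s = F s)"
    using U_op_surjective[OF F] by (metis mem_Collect_eq right_half_plane_def)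
  then have "U_inv F \<in> L2 unit_interval \<and> (\<forall>s\<in>right_half_plane. U_op (U_inv F) s = F s)"
    unfolding U_inv_def by (rule someI_ex)
  then show "U_inv F \<in> L2 unit_interval" "Re s > 0 \<Longrightarrow> U_op (U_inv F) s = F s"
    by (auto simp: right_half_plane_def)
qed

section \<open>Boundary values of self-maps\<close>

lemma filterlim_cone:
  assumes "\<alpha> > 0"
  shows "filterlim (\<lambda>n. Complex (1 / real (Suc n)) y)
    (at (Complex 0 y) within {z. Re z > 0 \<and> \<bar>Im z - y\<bar> < \<alpha> * Re z}) sequentially"
  unfolding filterlim_at
proof (intro conjI always_eventually allI)
  show "(\<lambda>n. Complex (1 / real (Suc n)) y) \<longlonglongrightarrow> Complex 0 y"
    by (intro tendsto_intros LIMSEQ_Suc[OF lim_1_over_n])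
qed (use assms in \<open>auto simp: complex_eq_iff\<close>)

lemma nontangential_limit_LIMSEQ:
  assumes "has_nontangential_limit f y l"
  shows "(\<lambda>n. f (Complex (1 / real (Suc n)) y)) \<longlonglongrightarrow> l"
proof -
  have "(f \<longlongrightarrow> l) (at (Complex 0 y) within {z. Re z > 0 \<and> \<bar>Im z - y\<bar> < 1 * Re z})"
    using assms zero_less_one unfolding has_nontangential_limit_def by blast
  from filterlim_compose[OF this filterlim_cone[OF zero_less_one]] show ?thesis .
qed

lemma boundary_value_eq:
  assumes "has_nontangential_limit f y l"
  shows "boundary_value f y = l"
proof -
  have "(THE l. has_nontangential_limit f y l) = l"
    using assms by (intro the_equality) (auto intro: LIMSEQ_unique[OF nontangential_limit_LIMSEQ nontangential_limit_LIMSEQ])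
  with assms show ?thesis unfolding boundary_value_def by auto
qed

lemma nontangential_limit_cong:
  assumes "has_nontangential_limit f y l" "\<And>s. Re s > 0 \<Longrightarrow> f s = g s"
  shows "has_nontangential_limit g y l"
  unfolding has_nontangential_limit_def
proof (intro allI impI)
  fix \<alpha> :: real assume "\<alpha> > 0"
  then have "(f \<longlongrightarrow> l) (at (Complex 0 y) within {z. Re z > 0 \<and> \<bar>Im z - y\<bar> < \<alpha> * Re z})"
    using assms(1) by (simp add: has_nontangential_limit_def)
  then show "(g \<longlongrightarrow> l) (at (Complex 0 y) within {z. Re z > 0 \<and> \<bar>Im z - y\<bar> < \<alpha> * Re z})"
    by (rule Lim_transform_eventually) (auto simp: eventually_at_filter assms(2))
qed

lemma nontangential_limit_mult:
  assumes "has_nontangential_limit f y l" "has_nontangential_limit g y k"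
  shows "has_nontangential_limit (\<lambda>s. f s * g s) y (l * k)"
  using assms unfolding has_nontangential_limit_def by (auto intro: tendsto_mult)

lemma nontangential_limit_isCont:
  assumes "isCont g (Complex 0 y)"
  shows "has_nontangential_limit g y (g (Complex 0 y))"
  using assms unfolding has_nontangential_limit_def isCont_def by (auto intro: tendsto_within_subset)

lemma bounded_mult_kernel_H2:
  assumes q: "q holomorphic_on right_half_plane" and b: "\<And>s. Re s > 0 \<Longrightarrow> cmod (q s) \<le> 1"
  shows "(\<lambda>s. q s * H2_kernel 1 s) \<in> H2"
proof (rule H2I)
  show "(\<lambda>s. q s * H2_kernel 1 s) holomorphic_on right_half_plane"
    by (intro holomorphic_on_mult q H2_holomorphic H2_kernel_in_H2) simp
  fix x :: real assume x: "x > 0"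
  have "(\<integral>\<^sup>+y. ennreal ((cmod (q (Complex x y) * H2_kernel 1 (Complex x y)))\<^sup>2) \<partial>lborel)
    \<le> (\<integral>\<^sup>+y. ennreal ((cmod (H2_kernel 1 (Complex x y)))\<^sup>2) \<partial>lborel)"
    using b x by (intro nn_integral_mono ennreal_leI power_mono) (auto simp: norm_mult intro!: mult_left_le_one_le)
  also have "\<dots> \<le> ennreal (2 * pi * enn2real (H2_norm_sq (H2_kernel 1)))"
    by (intro H2_line_le H2_kernel_in_H2 x) simp
  finally show "(\<integral>\<^sup>+y. ennreal ((cmod (q (Complex x y) * H2_kernel 1 (Complex x y)))\<^sup>2) \<partial>lborel)
    \<le> ennreal (2 * pi * enn2real (H2_norm_sq (H2_kernel 1)))" .
qed

text \<open>The truncation \<open>L / (1 + \<epsilon> L)\<close> keeps the real part nonnegative and makes the Poisson formula applicable.\<close>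

lemma nonneg_real_part_line_integral:
  assumes L: "L holomorphic_on right_half_plane" and pos: "\<And>s. Re s > 0 \<Longrightarrow> 0 \<le> Re (L s)" and x: "x > 0"
  shows "(\<integral>\<^sup>+y. ennreal (Re (L (Complex x y)) / (1 + y\<^sup>2)) \<partial>lborel) \<le> ennreal (pi * cmod (L (of_real (x + 1))))"
proof -
  define e where "e n = 1 / real (Suc n)" for n
  have e: "e n > 0" for n by (simp add: e_def)
  define g where "g n s = L s / (1 + of_real (e n) * L s)" for n s
  have sq: "(cmod (1 + of_real (e n) * z))\<^sup>2 = 1 + 2 * e n * Re z + (e n * cmod z)\<^sup>2" for n z
    unfolding power_mult_distrib cmod_power2 by (simp add: power2_eq_square algebra_simps)
  have den: "1 \<le> cmod (1 + of_real (e n) * z)" "e n * cmod z \<le> cmod (1 + of_real (e n) * z)" if "0 \<le> Re z" for n z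
  proof -
    have p: "0 \<le> 2 * e n * Re z" using that e[of n] by simp
    show "1 \<le> cmod (1 + of_real (e n) * z)"
      by (rule power2_le_imp_le) (use p sq[of n z] in auto)
    show "e n * cmod z \<le> cmod (1 + of_real (e n) * z)"
      by (rule power2_le_imp_le) (use p sq[of n z] in auto)
  qed
  have nz: "1 + of_real (e n) * L s \<noteq> 0" if "Re s > 0" for n s using den(1)[OF pos[OF that], of n] by auto
  have gh: "g n holomorphic_on right_half_plane" for n
    unfolding g_def by (intro holomorphic_intros L) (auto simp: nz right_half_plane_def)
  have gb: "cmod (g n s) \<le> 1 / e n" "cmod (g n s) \<le> cmod (L s)" if s: "Re s > 0" for n s
  proof -
    have D: "cmod (1 + of_real (e n) * L s) > 0" using nz[OF s] by simp
    show "cmod (g n s) \<le> 1 / e n"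
      unfolding g_def using den(2)[OF pos[OF s], of n] D e[of n] by (simp add: norm_divide divide_simps mult.commute)
    have "cmod (L s) * 1 \<le> cmod (L s) * cmod (1 + of_real (e n) * L s)"
      by (intro mult_left_mono den(1) pos s) simp
    then show "cmod (g n s) \<le> cmod (L s)" unfolding g_def using D by (simp add: norm_divide divide_le_eq)
  qed
  have gp: "0 \<le> Re (g n s)" if s: "Re s > 0" for n s
  proof -
    have "Re (g n s) = (Re (L s) * (1 + e n * Re (L s)) + Im (L s) * (e n * Im (L s))) / (cmod (1 + of_real (e n) * L s))\<^sup>2"
      unfolding g_def by (simp add: Re_divide cmod_power2)
    also have "Re (L s) * (1 + e n * Re (L s)) + Im (L s) * (e n * Im (L s)) = Re (L s) + e n * ((Re (L s))\<^sup>2 + (Im (L s))\<^sup>2)"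
      by (simp add: power2_eq_square algebra_simps)
    finally show ?thesis using pos[OF s] e[of n] by simp
  qed
  \<comment> \<open>At distance 1 from the line and height 0 the Poisson kernel is
    \<open>1 / (pi * (1 + y^2))\<close>, the weight in the claim up to the factor pi.\<close>
  define w where "w = complex_of_real (x + 1)"
  have wx: "Re w - x = 1" "Im w = 0" by (auto simp: w_def)
  \<comment> \<open>For fixed \<open>n\<close> the function \<open>g n\<close> is bounded, so the
    Poisson formula holds for it, and its real part at \<open>w\<close> is at most
    \<open>cmod (L w)\<close>. As this does not depend on \<open>n\<close>, Fatou's lemma can remove
    the truncation.\<close>
  have le: "(\<integral>\<^sup>+y. ennreal (Re (g n (Complex x y)) / (1 + y\<^sup>2)) \<partial>lborel) \<le> ennreal (pi * cmod (L w))" for n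
  proof -
    have C: "(\<integral>\<^sup>+y. ennreal ((cmod (g n (Complex u y)))\<^sup>2 / (1 + (y - Im w)\<^sup>2)) \<partial>lborel) \<le> ennreal ((1 / e n)\<^sup>2 * pi)" if u: "u \<ge> x" for u
    proof -
      have "(\<integral>\<^sup>+y. ennreal ((cmod (g n (Complex u y)))\<^sup>2 / (1 + (y - Im w)\<^sup>2)) \<partial>lborel)
        \<le> (\<integral>\<^sup>+y. ennreal ((1 / e n)\<^sup>2) * ennreal (1 / (1\<^sup>2 + (y - Im w)\<^sup>2)) \<partial>lborel)"
      proof (rule nn_integral_mono)
        fix y
        have "(cmod (g n (Complex u y)))\<^sup>2 \<le> (1 / e n)\<^sup>2" using u x by (intro power_mono gb) auto
        then have "(cmod (g n (Complex u y)))\<^sup>2 / (1 + (y - Im w)\<^sup>2) \<le> (1 / e n)\<^sup>2 * (1 / (1\<^sup>2 + (y - Im w)\<^sup>2))"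
          by (simp add: divide_right_mono)
        then show "ennreal ((cmod (g n (Complex u y)))\<^sup>2 / (1 + (y - Im w)\<^sup>2)) \<le> ennreal ((1 / e n)\<^sup>2) * ennreal (1 / (1\<^sup>2 + (y - Im w)\<^sup>2))"
          by (subst ennreal_mult[symmetric]) (auto intro!: ennreal_leI)
      qed
      also have "\<dots> = ennreal ((1 / e n)\<^sup>2) * ennreal (pi / 1)"
        by (subst nn_integral_cmult) (auto simp: nn_integral_inverse_square_plus[of 1, simplified])
      also have "\<dots> = ennreal ((1 / e n)\<^sup>2 * pi)" by (simp flip: ennreal_mult)
      finally show ?thesis .
    qed
    define k where "k y = 1 / (pi * (1\<^sup>2 + (y - 0)\<^sup>2))" for y :: real
    have k: "k y \<ge> 0" for y by (simp add: k_def)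
    have ki: "integrable lborel k"
    proof -
      have keq: "k = (\<lambda>y. (1 / pi) * (1 / (1\<^sup>2 + (y - 0)\<^sup>2)))" by (auto simp: k_def)
      show ?thesis unfolding keq by (intro integrable_mult_right integrable_inverse_square_plus) simp
    qed
    have gw: "g n w = (\<integral>y. g n (Complex x y) * of_real (k y) \<partial>lborel)"
      using Poisson_formula_line[OF gh x _ C] by (simp add: wx k_def w_def)
    have gki: "integrable lborel (\<lambda>y. g n (Complex x y) * of_real (k y))"
    proof (rule Bochner_Integration.integrable_bound)
      show "integrable lborel (\<lambda>y. (1 / e n) * k y)" by (intro integrable_mult_right ki)
      have [measurable]: "k \<in> borel_measurable borel" unfolding k_def by measurable
      note [measurable] = line_measurable[OF gh x]
      show "(\<lambda>y. g n (Complex x y) * of_real (k y)) \<in> borel_measurable lborel" by measurable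
      show "AE y in lborel. norm (g n (Complex x y) * of_real (k y)) \<le> norm ((1 / e n) * k y)"
      proof (rule AE_I2)
        fix y
        have "cmod (g n (Complex x y)) * k y \<le> (1 / e n) * k y" using x k by (intro mult_right_mono gb) auto
        then show "norm (g n (Complex x y) * of_real (k y)) \<le> norm ((1 / e n) * k y)"
          using k[of y] e[of n] by (simp add: norm_mult abs_mult)
      qed
    qed
    have ri: "integrable lborel (\<lambda>y. Re (g n (Complex x y)) * k y)" using integrable_Re[OF gki] by simp
    have "(\<integral>\<^sup>+y. ennreal (Re (g n (Complex x y)) / (1 + y\<^sup>2)) \<partial>lborel)
      = (\<integral>\<^sup>+y. ennreal (pi * (Re (g n (Complex x y)) * k y)) \<partial>lborel)"
      by (intro nn_integral_cong) (simp add: k_def)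
    also have "\<dots> = ennreal (\<integral>y. pi * (Re (g n (Complex x y)) * k y) \<partial>lborel)"
      using ri gp x k by (intro nn_integral_eq_integral integrable_mult_right) (auto intro!: AE_I2)
    also have "(\<integral>y. pi * (Re (g n (Complex x y)) * k y) \<partial>lborel) = pi * Re (g n w)"
      unfolding gw using integral_Re[OF gki] by simp
    also have "\<dots> \<le> pi * cmod (L w)"
      using complex_Re_le_cmod[of "g n w"] gb(2)[of w n] x by (simp add: w_def)
    finally show ?thesis by (auto intro: ennreal_leI)
  qed
  note [measurable] = line_measurable[OF gh x]
  have "(\<integral>\<^sup>+y. ennreal (Re (L (Complex x y)) / (1 + y\<^sup>2)) \<partial>lborel)
    = (\<integral>\<^sup>+y. liminf (\<lambda>n. ennreal (Re (g n (Complex x y)) / (1 + y\<^sup>2))) \<partial>lborel)"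
  proof (rule nn_integral_cong)
    fix y
    have "e \<longlonglongrightarrow> 0" unfolding e_def by (rule LIMSEQ_Suc[OF lim_1_over_n])
    then have "(\<lambda>n. g n (Complex x y)) \<longlonglongrightarrow> L (Complex x y) / (1 + of_real 0 * L (Complex x y))"
      unfolding g_def by (intro tendsto_intros) auto
    then have "(\<lambda>n. ennreal (Re (g n (Complex x y)) / (1 + y\<^sup>2))) \<longlonglongrightarrow> ennreal (Re (L (Complex x y)) / (1 + y\<^sup>2))"
      by (intro tendsto_intros) (auto simp: add_nonneg_eq_0_iff)
    from lim_imp_Liminf[OF _ this]
    show "ennreal (Re (L (Complex x y)) / (1 + y\<^sup>2)) = liminf (\<lambda>n. ennreal (Re (g n (Complex x y)) / (1 + y\<^sup>2)))" by simp
  qed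
  also have "\<dots> \<le> liminf (\<lambda>n. \<integral>\<^sup>+y. ennreal (Re (g n (Complex x y)) / (1 + y\<^sup>2)) \<partial>lborel)"
    by (rule nn_integral_liminf) measurable
  also have "\<dots> \<le> ennreal (pi * cmod (L w))"
    by (rule Liminf_le[OF sequentially_bot]) (auto intro!: always_eventually le)
  finally show ?thesis unfolding w_def .
qed

text \<open>The function \<open>q = 1 / (1 + \<phi>)\<close> is bounded by 1, so its product with a
  kernel lies in \<open>H2\<close> and \<open>q\<close> has nontangential limits. Limit 0 would mean
  that \<phi> tends to infinity. But \<open>ln (cmod (1 + \<phi>))\<close> is the nonnegative real
  part of \<open>L\<close>, whose weighted line integrals stay bounded; by Fatou's lemma it cannot
  tend to infinity along the approach to \<open>y\<close>, for almost every
  \<open>y\<close>.\<close>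

lemma selfmap_nontangential_limit:
  assumes \<phi>: "\<phi> holomorphic_on right_half_plane" "\<phi> ` right_half_plane \<subseteq> right_half_plane"
  shows "AE y in lborel. \<exists>l. has_nontangential_limit \<phi> y l \<and> 0 \<le> Re l"
proof -
  have pos: "Re (\<phi> s) > 0" if "Re s > 0" for s using \<phi>(2) that by (auto simp: right_half_plane_def)
  have nz: "1 + \<phi> s \<noteq> 0" "cmod (1 + \<phi> s) > 1" if "Re s > 0" for s
  proof -
    show "cmod (1 + \<phi> s) > 1" using pos[OF that] complex_Re_le_cmod[of "1 + \<phi> s"] by simp
    then show "1 + \<phi> s \<noteq> 0" by auto
  qed
  define q where "q s = 1 / (1 + \<phi> s)" for s
  have qh: "q holomorphic_on right_half_plane"
    unfolding q_def by (intro holomorphic_intros \<phi>) (auto simp: right_half_plane_def nz)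
  define Q where "Q s = q s * H2_kernel 1 s" for s
  have Q: "Q \<in> H2"
    unfolding Q_def
  proof (rule bounded_mult_kernel_H2[OF qh])
    fix s assume "Re s > 0"
    then show "cmod (q s) \<le> 1"
      using nz(2)[of s] frac_le[of 1 1 1 "cmod (1 + \<phi> s)"] by (simp add: q_def norm_divide)
  qed
  \<comment> \<open>\<open>1 + \<phi> s\<close> stays in the half-plane \<open>Re z > 1\<close>,
    where the principal logarithm is holomorphic with positive real part.\<close>
  define L where "L s = Ln (1 + \<phi> s)" for s
  have Lh: "L holomorphic_on right_half_plane"
    unfolding L_def using pos
    by (intro holomorphic_intros \<phi>) (force simp: right_half_plane_def complex_nonpos_Reals_iff)
  have LRe: "Re (L s) = ln (cmod (1 + \<phi> s))" if "Re s > 0" for s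
    unfolding L_def using nz(1)[OF that] by simp
  have Lpos: "0 \<le> Re (L s)" if "Re s > 0" for s
    using LRe[OF that] nz(2)[OF that] by simp
  let ?x = "\<lambda>n. 1 / real (Suc n)"
  note [measurable] = line_measurable[OF Lh]
  have "(\<integral>\<^sup>+y. liminf (\<lambda>n. ennreal (Re (L (Complex (?x n) y)) / (1 + y\<^sup>2))) \<partial>lborel)
    \<le> liminf (\<lambda>n. \<integral>\<^sup>+y. ennreal (Re (L (Complex (?x n) y)) / (1 + y\<^sup>2)) \<partial>lborel)"
    by (rule nn_integral_liminf) simp
  also have "\<dots> \<le> liminf (\<lambda>n. ennreal (pi * cmod (L (of_real (?x n + 1)))))"
    by (intro Liminf_mono always_eventually allI nonneg_real_part_line_integral Lh Lpos) auto
  also have "\<dots> = ennreal (pi * cmod (L 1))"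
  proof (rule lim_imp_Liminf[OF sequentially_bot])
    have "isCont L 1"
      using holomorphic_on_imp_continuous_on[OF Lh] open_right_half_plane
      by (simp add: continuous_on_eq_continuous_at right_half_plane_def)
    moreover have "(\<lambda>n. complex_of_real (?x n + 1)) \<longlonglongrightarrow> of_real (0 + 1)"
      by (intro tendsto_intros LIMSEQ_Suc[OF lim_1_over_n])
    ultimately have "(\<lambda>n. L (of_real (?x n + 1))) \<longlonglongrightarrow> L 1"
      by (intro isCont_tendsto_compose[of 1 L]) auto
    then show "(\<lambda>n. ennreal (pi * cmod (L (of_real (?x n + 1))))) \<longlonglongrightarrow> ennreal (pi * cmod (L 1))"
      by (intro tendsto_intros)
  qed
  also have "\<dots> < \<infinity>" by simp
  finally have "AE y in lborel. liminf (\<lambda>n. ennreal (Re (L (Complex (?x n) y)) / (1 + y\<^sup>2))) \<noteq> \<infinity>"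
    by (intro nn_integral_PInf_AE) auto
  with nontangential_limit_H2[OF Q] show ?thesis
  proof eventually_elim
    case (elim y)
    let ?b = "bdry Q y"
    have qQ: "q s = Q s * (s + 1)" if "Re s > 0" for s
    proof -
      have "s + 1 \<noteq> 0" using that by (auto simp: complex_eq_iff)
      then show ?thesis by (simp add: Q_def H2_kernel_def)
    qed
    have "has_nontangential_limit (\<lambda>s. Q s * (s + 1)) y (?b * (Complex 0 y + 1))"
      by (intro nontangential_limit_mult elim nontangential_limit_isCont continuous_intros)
    then have q: "has_nontangential_limit q y (?b * (Complex 0 y + 1))"
      by (rule nontangential_limit_cong) (simp add: qQ)
    \<comment> \<open>A zero limit of \<open>q\<close> would push \<open>Re (L s)\<close> beyond
      every \<open>M * (1 + y^2)\<close> along the sequence, against the finite lower limit at this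
      \<open>y\<close>.\<close>
    have "?b * (Complex 0 y + 1) \<noteq> 0"
    proof
      assume z: "?b * (Complex 0 y + 1) = 0"
      have "(\<lambda>n. q (Complex (?x n) y)) \<longlonglongrightarrow> 0" using nontangential_limit_LIMSEQ[OF q] z by simp
      have "\<forall>\<^sub>F n in sequentially. ennreal M \<le> ennreal (Re (L (Complex (?x n) y)) / (1 + y\<^sup>2))" if "M \<ge> 0" for M
      proof -
        have "\<forall>\<^sub>F n in sequentially. cmod (q (Complex (?x n) y)) < exp (- (M * (1 + y\<^sup>2)))"
          using order_tendstoD(2)[OF tendsto_norm_zero[OF \<open>(\<lambda>n. q (Complex (?x n) y)) \<longlonglongrightarrow> 0\<close>], of "exp (- (M * (1 + y\<^sup>2)))"] by simp
        then show ?thesis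
        proof eventually_elim
          case (elim n)
          have r: "Re (Complex (?x n) y) > 0" by simp
          have p: "cmod (1 + \<phi> (Complex (?x n) y)) > 0" by (rule less_trans[OF zero_less_one nz(2)[OF r]])
          have "1 / cmod (1 + \<phi> (Complex (?x n) y)) < exp (- (M * (1 + y\<^sup>2)))"
            using elim by (simp add: q_def norm_divide)
          then have "1 < exp (- (M * (1 + y\<^sup>2))) * cmod (1 + \<phi> (Complex (?x n) y))"
            using p by (simp only: divide_less_eq if_True)
          then have "exp (M * (1 + y\<^sup>2)) * 1 < exp (M * (1 + y\<^sup>2)) * (exp (- (M * (1 + y\<^sup>2))) * cmod (1 + \<phi> (Complex (?x n) y)))"
            by (intro mult_strict_left_mono) auto
          then have "exp (M * (1 + y\<^sup>2)) < cmod (1 + \<phi> (Complex (?x n) y))"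
            by (simp only: mult.assoc[symmetric] exp_minus_inverse mult_1 mult_1_right)
          then have "M * (1 + y\<^sup>2) < ln (cmod (1 + \<phi> (Complex (?x n) y)))"
            using p by (metis exp_less_cancel_iff exp_ln)
          then have "M \<le> Re (L (Complex (?x n) y)) / (1 + y\<^sup>2)"
            unfolding LRe[OF r] by (simp add: le_divide_eq add_pos_nonneg)
          then show ?case by (rule ennreal_leI)
        qed
      qed
      then have M: "ennreal M \<le> liminf (\<lambda>n. ennreal (Re (L (Complex (?x n) y)) / (1 + y\<^sup>2)))" if "M \<ge> 0" for M
        using that by (intro Liminf_bounded) auto
      define LI where "LI = liminf (\<lambda>n. ennreal (Re (L (Complex (?x n) y)) / (1 + y\<^sup>2)))"
      obtain m where "LI = ennreal m" "m \<ge> 0"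
        using elim(2) unfolding LI_def[symmetric] by (cases LI) auto
      with M[of "m + 1"] show False unfolding LI_def[symmetric] by simp
    qed
    define l where "l = 1 / (?b * (Complex 0 y + 1)) - 1"
    have "has_nontangential_limit (\<lambda>s. 1 / q s - 1) y l"
      using q \<open>?b * (Complex 0 y + 1) \<noteq> 0\<close> unfolding has_nontangential_limit_def l_def by (auto intro!: tendsto_intros)
    then have l: "has_nontangential_limit \<phi> y l"
      by (rule nontangential_limit_cong) (use nz(1) in \<open>simp add: q_def\<close>)
    have "0 \<le> Re l"
    proof (rule tendsto_lowerbound)
      show "(\<lambda>n. Re (\<phi> (Complex (?x n) y))) \<longlonglongrightarrow> Re l"
        by (intro tendsto_intros nontangential_limit_LIMSEQ l)
      show "\<forall>\<^sub>F n in sequentially. 0 \<le> Re (\<phi> (Complex (?x n) y))"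
        by (intro always_eventually allI less_imp_le pos) simp
    qed simp
    with l show ?case by blast
  qed
qed

section \<open>The Carleson embedding\<close>

lemma nn_integral_linear_ramp:
  fixes c :: real
  assumes "c \<ge> 0"
  shows "(\<integral>\<^sup>+l. (if 0 < l \<and> l < c then ennreal (2 * l) else 0) \<partial>lborel) = ennreal (c\<^sup>2)"
proof -
  have "(\<integral>\<^sup>+l. (if 0 < l \<and> l < c then ennreal (2 * l) else 0) \<partial>lborel) = (\<integral>\<^sup>+l. ennreal (2 * l) * indicator {0..c} l \<partial>lborel)"
  proof (rule nn_integral_cong_AE)
    show "AE l in lborel. (if 0 < l \<and> l < c then ennreal (2 * l) else 0) = ennreal (2 * l) * indicator {0..c} l"
      using AE_lborel_singleton[of c] AE_lborel_singleton[of "0::real"] by eventually_elim (auto simp: indicator_def)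
  qed
  also have "\<dots> = ennreal (c\<^sup>2 - 0\<^sup>2)"
    using assms by (intro nn_integral_FTC_Icc[where F="\<lambda>l. l\<^sup>2"]) (auto intro!: derivative_eq_intros)
  finally show ?thesis by simp
qed

lemma norm_H2_le_Poisson:
  assumes F: "F \<in> H2" and w: "Re w > 0"
  shows "ennreal (cmod (F w)) \<le> (\<integral>\<^sup>+y. ennreal (Poisson_kernel w y) * ennreal (cmod (bdry F y)) \<partial>lborel)"
proof -
  have "ennreal (cmod (F w)) \<le> (\<integral>\<^sup>+y. ennreal (norm (bdry F y * cnj (of_real (Poisson_kernel w y)))) \<partial>lborel)"
    unfolding Poisson_formula_H2[OF F w] L2_ip_def
    by (intro integral_norm_bound_ennreal L2_ip_integrable bdry_L2 F real_kernel_L2 w)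
  also have "\<dots> = (\<integral>\<^sup>+y. ennreal (Poisson_kernel w y) * ennreal (cmod (bdry F y)) \<partial>lborel)"
    using Poisson_kernel_nonneg[OF w] by (intro nn_integral_cong) (simp add: norm_mult ennreal_mult mult.commute)
  finally show ?thesis .
qed

lemma closed_half_plane_borel [measurable]: "{z. 0 \<le> Re z} \<in> sets borel"
  by (intro borel_closed closed_halfspace_Re_ge)

text \<open>Marcinkiewicz interpolation by hand: at level \<open>l\<close> only the part
  \<open>fl l\<close> of the boundary modulus above \<open>l / 2\<close> matters, and to it the weak
  type estimate applies. The threshold \<open>l / 32\<close> is the one at which averages give
  Poisson integrals of at most \<open>l / 2\<close>. It leads to \<open>5 * 32 = 160\<close>,
  doubled by the layer cake weight \<open>2 * l\<close> and again by the range
  \<open>l < 2 * f y\<close>, hence 640.\<close>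

lemma Carleson_embedding:
  fixes \<nu> :: "complex measure"
  assumes sets[measurable_cong]: "sets \<nu> = sets borel"
    and \<nu>: "\<And>t r. r > 0 \<Longrightarrow> emeasure \<nu> (halfplane_square t r) \<le> ennreal (2 * \<delta> * r)" and \<delta>: "\<delta> \<ge> 0"
    and supp: "emeasure \<nu> {z. Re z < 0} = 0"
    and G: "G \<in> H2" and cont: "continuous_on {z. 0 \<le> Re z} G"
  shows "(\<integral>\<^sup>+z. ennreal ((cmod (G z))\<^sup>2) * indicator {z. 0 \<le> Re z} z \<partial>\<nu>) \<le> ennreal (640 * \<delta> * (L2_norm lborel (bdry G))\<^sup>2)"
proof -
  define D where "D = {z. 0 \<le> Re z}"
  have Dm[measurable]: "D \<in> sets borel" unfolding D_def by measurable
  define g where "g z = indicator D z *\<^sub>R G z" for z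
  have gm[measurable]: "g \<in> borel_measurable borel"
    unfolding g_def using cont by (intro borel_measurable_continuous_on_indicator) (auto simp: D_def[symmetric])
  define f where "f y = cmod (bdry G y)" for y
  have fm[measurable]: "f \<in> borel_measurable borel" unfolding f_def using L2_measurable[OF bdry_L2[OF G]] by simp
  have f0: "f y \<ge> 0" for y by (simp add: f_def)
  define fl where "fl l y = (if l / 2 < f y then ennreal (f y) else 0)" for l y
  have flm[measurable]: "fl l \<in> borel_measurable borel" for l unfolding fl_def by measurable
  have fL: "(\<integral>\<^sup>+y. ennreal ((f y)\<^sup>2) \<partial>lborel) = ennreal ((L2_norm lborel (bdry G))\<^sup>2)"
    unfolding f_def by (rule nn_integral_L2_norm[OF bdry_L2[OF G]])
  have flfin: "(\<integral>\<^sup>+y. fl l y \<partial>lborel) < \<infinity>" if l: "l > 0" for l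
  proof -
    have "(\<integral>\<^sup>+y. fl l y \<partial>lborel) \<le> (\<integral>\<^sup>+y. ennreal (2 / l) * ennreal ((f y)\<^sup>2) \<partial>lborel)"
    proof (rule nn_integral_mono)
      fix y
      have "f y \<le> 2 / l * (f y)\<^sup>2" if "l / 2 < f y"
      proof -
        have "1 * f y \<le> (2 / l * f y) * f y" using that l f0[of y] by (intro mult_right_mono) (auto simp: field_simps)
        then show ?thesis by (simp add: power2_eq_square mult.assoc)
      qed
      then show "fl l y \<le> ennreal (2 / l) * ennreal ((f y)\<^sup>2)"
        unfolding fl_def using l by (auto simp flip: ennreal_mult intro!: ennreal_leI)
    qed
    also have "\<dots> < \<infinity>" by (simp add: nn_integral_cmult fL ennreal_mult_less_top)
    finally show ?thesis .
  qed
  \<comment> \<open>The part of the boundary modulus below \<open>l / 2\<close> contributes at most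
    \<open>l / 2\<close>, because the Poisson kernel has mass 1; the other half comes from the small
    averages of \<open>fl l\<close>.\<close>
  have below: "cmod (G s) \<le> l" if l: "l > 0" and s: "0 \<le> Re s" "s \<notin> large_average_region (fl l) (l / 32)" for l s
  proof -
    have avg: "(\<integral>\<^sup>+u. fl l u * indicator (cball (Im s) r) u \<partial>lborel) \<le> ennreal (2 * r * (l / 32))" if "r > 0" "r \<ge> Re s" for r
    proof (rule ccontr)
      assume "\<not> (\<integral>\<^sup>+u. fl l u * indicator (cball (Im s) r) u \<partial>lborel) \<le> ennreal (2 * r * (l / 32))"
      then have "s \<in> large_average_region (fl l) (l / 32)"
        unfolding large_average_region_def using s(1) that by (intro CollectI conjI exI[of _ r]) (simp_all only: not_le simp_thms)
      with s(2) show False by simp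
    qed
    \<comment> \<open>A point on the axis has no Poisson kernel, so the estimate is made slightly to
      the right and transferred by continuity of \<open>G\<close>.\<close>
    have n: "cmod (G (s + of_real (1 / real (Suc n)))) \<le> l" for n
    proof -
      define w where "w = s + of_real (1 / real (Suc n))"
      have w: "Re w > 0" "Im w = Im s" "Re w \<ge> Re s" using s(1) by (auto simp: w_def add_nonneg_pos)
      have "(\<integral>\<^sup>+u. ennreal (Poisson_kernel w u) * fl l u \<partial>lborel) \<le> ennreal (16 * (1 + 0\<^sup>2) * (l / 32))"
      proof (rule Poisson_integral_le_averages[OF flm w(1)])
        show "\<bar>Im w - Im s\<bar> \<le> 0 * Re w" using w by simp
        show "0 \<le> l / 32" using l by simp
        fix r assume "Re w \<le> r"
        then show "(\<integral>\<^sup>+u. fl l u * indicator (cball (Im s) r) u \<partial>lborel) \<le> ennreal (2 * r * (l / 32))" using w by (intro avg) auto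
      qed
      then have P1: "(\<integral>\<^sup>+u. ennreal (Poisson_kernel w u) * fl l u \<partial>lborel) \<le> ennreal (l / 2)" by simp
      have P0: "(\<integral>\<^sup>+u. ennreal (Poisson_kernel w u) \<partial>lborel) = 1"
        using nn_integral_eq_integral[OF Poisson_kernel_integral(1)[OF w(1)]] Poisson_kernel_nonneg[OF w(1)]
          Poisson_kernel_integral(2)[OF w(1)] by simp
      have "ennreal (cmod (G w)) \<le> (\<integral>\<^sup>+u. ennreal (Poisson_kernel w u) * ennreal (f u) \<partial>lborel)"
        unfolding f_def by (rule norm_H2_le_Poisson[OF G w(1)])
      also have "\<dots> \<le> (\<integral>\<^sup>+u. ennreal (l / 2) * ennreal (Poisson_kernel w u) + ennreal (Poisson_kernel w u) * fl l u \<partial>lborel)"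
      proof (rule nn_integral_mono)
        fix u
        have "ennreal (f u) \<le> ennreal (l / 2) + fl l u"
          unfolding fl_def using l by (auto simp: not_less intro: ennreal_leI add_increasing)
        then have "ennreal (Poisson_kernel w u) * ennreal (f u) \<le> ennreal (Poisson_kernel w u) * (ennreal (l / 2) + fl l u)"
          by (intro mult_left_mono) auto
        then show "ennreal (Poisson_kernel w u) * ennreal (f u) \<le> ennreal (l / 2) * ennreal (Poisson_kernel w u) + ennreal (Poisson_kernel w u) * fl l u"
          by (simp add: distrib_left mult.commute)
      qed
      also have "\<dots> = ennreal (l / 2) + (\<integral>\<^sup>+u. ennreal (Poisson_kernel w u) * fl l u \<partial>lborel)"
        by (subst nn_integral_add) (auto simp: nn_integral_cmult P0)
      also have "\<dots> \<le> ennreal (l / 2) + ennreal (l / 2)" by (intro add_left_mono P1)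
      also have "\<dots> = ennreal l" using l by (simp flip: ennreal_plus)
      finally show ?thesis unfolding w_def using l by (subst (asm) ennreal_le_iff) auto
    qed
    have "(\<lambda>n. s + of_real (1 / real (Suc n))) \<longlonglongrightarrow> s + of_real 0"
      by (intro tendsto_intros LIMSEQ_Suc[OF lim_1_over_n])
    then have "(\<lambda>n. G (s + of_real (1 / real (Suc n)))) \<longlonglongrightarrow> G s"
      using s(1) by (intro continuous_on_tendsto_compose[OF cont]) (auto intro!: always_eventually add_nonneg_nonneg)
    then have "(\<lambda>n. cmod (G (s + of_real (1 / real (Suc n))))) \<longlonglongrightarrow> cmod (G s)" by (rule tendsto_norm)
    from tendsto_upperbound[OF this always_eventually[OF allI[OF n]] sequentially_bot] show ?thesis .
  qed
  have weak: "emeasure \<nu> {z. l < cmod (g z)} \<le> ennreal (160 * \<delta> / l) * (\<integral>\<^sup>+y. fl l y \<partial>lborel)" if l: "l > 0" for l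
  proof -
    obtain B where B: "B \<in> sets borel" "large_average_region (fl l) (l / 32) \<subseteq> B"
      "emeasure \<nu> B \<le> ennreal (5 * \<delta> / (l / 32)) * (\<integral>\<^sup>+y. fl l y \<partial>lborel)"
      by (rule Carleson_weak_type[OF sets \<nu> \<delta> flm flfin[OF l], of "l / 32"]) (use l in auto)
    have "{z. l < cmod (g z)} \<subseteq> B"
    proof
      fix z assume "z \<in> {z. l < cmod (g z)}"
      then have "z \<in> D" "l < cmod (G z)" using l by (cases "z \<in> D"; simp add: g_def)+
      then show "z \<in> B" using below[OF l, of z] B(2) by (auto simp: D_def not_le)
    qed
    then have "emeasure \<nu> {z. l < cmod (g z)} \<le> emeasure \<nu> B" using B(1) by (intro emeasure_mono) (auto simp: sets)
    also note B(3)
    finally show ?thesis by (simp add: mult.commute)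
  qed
  \<comment> \<open>Growing squares, joined with the null left half-plane, exhaust the plane with
    finite measure; Fubini requires this.\<close>
  have sf: "sigma_finite_measure \<nu>"
  proof (rule sigma_finite_measure.intro, intro exI[of _ "range (\<lambda>n. halfplane_square 0 (real (Suc n)) \<union> {z. Re z < 0})"] conjI)
    have nm: "{z. Re z < 0} \<in> sets borel" by (intro borel_open open_halfspace_Re_lt)
    show "countable (range (\<lambda>n. halfplane_square 0 (real (Suc n)) \<union> {z. Re z < 0}))" by simp
    show "range (\<lambda>n. halfplane_square 0 (real (Suc n)) \<union> {z. Re z < 0}) \<subseteq> sets \<nu>" using nm by (auto simp: sets)
    have sp: "space \<nu> = UNIV" using sets_eq_imp_space_eq[OF sets] by simp
    show "\<Union> (range (\<lambda>n. halfplane_square 0 (real (Suc n)) \<union> {z. Re z < 0})) = space \<nu>"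
      unfolding sp
    proof (rule UNIV_eq_I[symmetric])
      fix z :: complex
      obtain n where n: "max \<bar>Re z\<bar> \<bar>Im z\<bar> < real n" using reals_Archimedean2 by blast
      then have "z \<in> halfplane_square 0 (real (Suc n)) \<union> {z. Re z < 0}" by (auto simp: halfplane_square_def)
      then show "z \<in> \<Union> (range (\<lambda>n. halfplane_square 0 (real (Suc n)) \<union> {z. Re z < 0}))" by blast
    qed
    show "\<forall>a\<in>range (\<lambda>n. halfplane_square 0 (real (Suc n)) \<union> {z. Re z < 0}). emeasure \<nu> a \<noteq> \<infinity>"
    proof
      fix a assume "a \<in> range (\<lambda>n. halfplane_square 0 (real (Suc n)) \<union> {z. Re z < 0})"
      then obtain n where a: "a = halfplane_square 0 (real (Suc n)) \<union> {z. Re z < 0}" by auto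
      have "emeasure \<nu> a \<le> emeasure \<nu> (halfplane_square 0 (real (Suc n))) + emeasure \<nu> {z. Re z < 0}"
        unfolding a using nm by (intro emeasure_subadditive) (auto simp: sets)
      also have "\<dots> \<le> ennreal (2 * \<delta> * real (Suc n)) + 0" unfolding supp by (intro add_right_mono \<nu>) simp
      also have "\<dots> < \<infinity>" by simp
      finally show "emeasure \<nu> a \<noteq> \<infinity>" by simp
    qed
  qed
  interpret pair_sigma_finite lborel \<nu>
    using sf by (simp add: pair_sigma_finite_def lborel.sigma_finite_measure_axioms)
  have "(\<integral>\<^sup>+z. ennreal ((cmod (G z))\<^sup>2) * indicator {z. 0 \<le> Re z} z \<partial>\<nu>) = (\<integral>\<^sup>+z. ennreal ((cmod (g z))\<^sup>2) \<partial>\<nu>)"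
    by (intro nn_integral_cong) (auto simp: g_def D_def indicator_def)
  \<comment> \<open>Layer cake: the squared modulus is the integral of \<open>2 * l\<close> over the
    levels below the modulus.\<close>
  also have "\<dots> = (\<integral>\<^sup>+z. (\<integral>\<^sup>+l. (if 0 < l \<and> l < cmod (g z) then ennreal (2 * l) else 0) \<partial>lborel) \<partial>\<nu>)"
    by (simp add: nn_integral_linear_ramp)
  also have "\<dots> = (\<integral>\<^sup>+l. (\<integral>\<^sup>+z. (if 0 < l \<and> l < cmod (g z) then ennreal (2 * l) else 0) \<partial>\<nu>) \<partial>lborel)"
    by (rule Fubini') measurable
  also have "\<dots> \<le> (\<integral>\<^sup>+l. (\<integral>\<^sup>+y. (if 0 < l \<and> l < 2 * f y then ennreal (320 * \<delta>) * ennreal (f y) else 0) \<partial>lborel) \<partial>lborel)"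
  proof (rule nn_integral_mono)
    fix l :: real
    show "(\<integral>\<^sup>+z. (if 0 < l \<and> l < cmod (g z) then ennreal (2 * l) else 0) \<partial>\<nu>)
      \<le> (\<integral>\<^sup>+y. (if 0 < l \<and> l < 2 * f y then ennreal (320 * \<delta>) * ennreal (f y) else 0) \<partial>lborel)"
    proof (cases "l > 0")
      case True
      have "(\<integral>\<^sup>+z. (if 0 < l \<and> l < cmod (g z) then ennreal (2 * l) else 0) \<partial>\<nu>) = (\<integral>\<^sup>+z. ennreal (2 * l) * indicator {z. l < cmod (g z)} z \<partial>\<nu>)"
        using True by (intro nn_integral_cong) (auto simp: indicator_def)
      also have "\<dots> = ennreal (2 * l) * emeasure \<nu> {z. l < cmod (g z)}"
        by (rule nn_integral_cmult_indicator) measurable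
      also have "\<dots> \<le> ennreal (2 * l) * (ennreal (160 * \<delta> / l) * (\<integral>\<^sup>+y. fl l y \<partial>lborel))"
        by (intro mult_left_mono weak True) simp
      also have "\<dots> = ennreal (320 * \<delta>) * (\<integral>\<^sup>+y. fl l y \<partial>lborel)"
      proof -
        have "ennreal (2 * l) * ennreal (160 * \<delta> / l) = ennreal (320 * \<delta>)"
          using True \<delta> by (subst ennreal_mult[symmetric]) auto
        then show ?thesis by (simp add: mult.assoc[symmetric])
      qed
      also have "\<dots> = (\<integral>\<^sup>+y. ennreal (320 * \<delta>) * fl l y \<partial>lborel)" by (rule nn_integral_cmult[symmetric]) measurable
      also have "\<dots> = (\<integral>\<^sup>+y. (if 0 < l \<and> l < 2 * f y then ennreal (320 * \<delta>) * ennreal (f y) else 0) \<partial>lborel)"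
        using True by (intro nn_integral_cong) (auto simp: fl_def)
      finally show ?thesis .
    qed (simp add: not_less)
  qed
  also have "\<dots> = (\<integral>\<^sup>+y. (\<integral>\<^sup>+l. (if 0 < l \<and> l < 2 * f y then ennreal (320 * \<delta>) * ennreal (f y) else 0) \<partial>lborel) \<partial>lborel)"
    by (rule lborel_pair.Fubini'[symmetric]) measurable
  also have "\<dots> = (\<integral>\<^sup>+y. ennreal (640 * \<delta>) * ennreal ((f y)\<^sup>2) \<partial>lborel)"
  proof (rule nn_integral_cong)
    fix y
    have "(\<integral>\<^sup>+l. (if 0 < l \<and> l < 2 * f y then ennreal (320 * \<delta>) * ennreal (f y) else 0) \<partial>lborel)
      = (\<integral>\<^sup>+l. ennreal (320 * \<delta>) * ennreal (f y) * indicator {0<..<2 * f y} l \<partial>lborel)"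
      by (intro nn_integral_cong) (auto simp: indicator_def)
    also have "\<dots> = ennreal (320 * \<delta>) * ennreal (f y) * ennreal (2 * f y)"
      using f0[of y] by (simp add: nn_integral_cmult_indicator)
    also have "\<dots> = ennreal (320 * \<delta> * f y * (2 * f y))"
      using \<delta> f0[of y] by (subst ennreal_mult[symmetric], simp, simp, subst ennreal_mult[symmetric]) simp_all
    also have "320 * \<delta> * f y * (2 * f y) = 640 * \<delta> * (f y)\<^sup>2" by (simp add: power2_eq_square)
    also have "ennreal \<dots> = ennreal (640 * \<delta>) * ennreal ((f y)\<^sup>2)" using \<delta> by (intro ennreal_mult) auto
    finally show "(\<integral>\<^sup>+l. (if 0 < l \<and> l < 2 * f y then ennreal (320 * \<delta>) * ennreal (f y) else 0) \<partial>lborel) = ennreal (640 * \<delta>) * ennreal ((f y)\<^sup>2)" .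
  qed
  also have "\<dots> = ennreal (640 * \<delta>) * ennreal ((L2_norm lborel (bdry G))\<^sup>2)"
    by (simp add: nn_integral_cmult fL)
  also have "\<dots> = ennreal (640 * \<delta> * (L2_norm lborel (bdry G))\<^sup>2)" using \<delta> by (intro ennreal_mult[symmetric]) auto
  finally show ?thesis .
qed

section \<open>Weighted composition operators\<close>

lemma H2_norm_kernel:
  assumes w: "Re w > 0"
  shows "(H2_norm (H2_kernel w))\<^sup>2 = 1 / (2 * Re w)"
proof -
  have "complex_of_real ((H2_norm (H2_kernel w))\<^sup>2) = H2_kernel w w"
    using H2_inner_self[OF H2_kernel_in_H2[OF w]] H2_reproducing[OF H2_kernel_in_H2[OF w] w] by simp
  also have "\<dots> = of_real (1 / (2 * Re w))" by (simp add: H2_kernel_def complex_add_cnj)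
  finally show ?thesis by (simp only: of_real_eq_iff)
qed

lemma norm_H2_le:
  assumes F: "F \<in> H2" and w: "Re w > 0"
  shows "cmod (F w) \<le> H2_norm F * sqrt (1 / (2 * Re w))"
  using H2_Cauchy_Schwarz[OF F H2_kernel_in_H2[OF w]] H2_norm_kernel[OF w] H2_reproducing[OF F w]
  by (metis H2_norm_nonneg real_sqrt_unique)

lemma U_op_cong_AE:
  assumes "f \<in> L2 unit_interval" "g \<in> L2 unit_interval" "AE x in unit_interval. f x = g x" "Re s > 0"
  shows "U_op f s = U_op g s"
  unfolding U_op_eq_ip[OF assms(1,4)] U_op_eq_ip[OF assms(2,4)] using assms
  by (intro L2_ip_cong_AE L2_measurable power_fun_L2) auto

lemma U_inv_U_op:
  assumes f: "f \<in> L2 unit_interval"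
  shows "AE x in unit_interval. U_inv (U_op f) x = f x"
proof -
  note F = U_op_isometry(1)[OF f]
  have d: "(\<lambda>x. U_inv (U_op f) x - f x) \<in> L2 unit_interval" by (intro L2_diff U_inv F f)
  have "H2_norm (U_op (\<lambda>x. U_inv (U_op f) x - f x)) = H2_norm (\<lambda>s. 0)"
    by (rule H2_norm_cong) (simp add: U_op_diff[OF U_inv(1)[OF F] f] U_inv(2)[OF F])
  also have "\<dots> = 0" by (simp add: H2_norm_def H2_norm_sq_def)
  finally have "L2_norm unit_interval (\<lambda>x. U_inv (U_op f) x - f x) = 0"
    by (simp add: U_op_isometry(2)[OF d])
  then show ?thesis using L2_norm_eq_0_iff[OF d] by simp
qed

lemma tendsto_H2_norm_shift:
  assumes F: "F \<in> H2"
  shows "((\<lambda>x. H2_norm (\<lambda>s. F s - F (s + of_real x))) \<longlongrightarrow> 0) (at_right 0)"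
proof -
  have "((\<lambda>x. L2_norm lborel (\<lambda>y. F (Complex x y) - bdry F y) / sqrt (2 * pi)) \<longlongrightarrow> 0 / sqrt (2 * pi)) (at_right 0)"
    by (intro tendsto_intros tendsto_bdry F) simp
  moreover have "\<forall>\<^sub>F x in at_right 0. L2_norm lborel (\<lambda>y. F (Complex x y) - bdry F y) / sqrt (2 * pi) = H2_norm (\<lambda>s. F s - F (s + of_real x))"
    using eventually_at_right_less[of 0]
  proof eventually_elim
    case (elim x)
    have D: "(\<lambda>s. F s - F (s + of_real x)) \<in> H2" by (intro H2_diff H2_shift F elim)
    have "L2_norm lborel (bdry (\<lambda>s. F s - F (s + of_real x))) = L2_norm lborel (\<lambda>y. bdry F y - F (Complex x y))"
      by (intro L2_norm_cong_AE L2_measurable bdry_L2 D L2_diff F H2_line_L2 elim bdry_diff_shift)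
    then show ?case by (simp add: H2_norm_eq_bdry[OF D] L2_norm_minus_commute[of lborel "bdry F"])
  qed
  ultimately show ?thesis using Lim_transform_eventually by fastforce
qed

locale weighted_composition =
  fixes T :: "(real \<Rightarrow> complex) \<Rightarrow> real \<Rightarrow> complex" and h \<phi> :: "complex \<Rightarrow> complex"
  assumes bounded_linear: "L2_bounded_linear unit_interval T"
    and symbols: "associated_symbols T h \<phi>"
begin

definition B :: "(complex \<Rightarrow> complex) \<Rightarrow> complex \<Rightarrow> complex" where
  "B G s = h s * G (\<phi> s)"

lemma h_holomorphic: "h holomorphic_on right_half_plane"
  and \<phi>_holomorphic: "\<phi> holomorphic_on right_half_plane"
  and \<phi>_image: "\<phi> ` right_half_plane \<subseteq> right_half_plane"
  using symbols by (auto simp: associated_symbols_def)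

lemma \<phi>_pos: "Re s > 0 \<Longrightarrow> Re (\<phi> s) > 0"
  using \<phi>_image by (auto simp: right_half_plane_def)

lemma B_H2: "G \<in> H2 \<Longrightarrow> B G \<in> H2"
  using symbols by (auto simp: associated_symbols_def is_H2_adjoint_def B_def[abs_def])

lemma T_L2: "f \<in> L2 unit_interval \<Longrightarrow> T f \<in> L2 unit_interval"
  using bounded_linear by (simp add: L2_bounded_linear_def)

lemma T_cong_AE:
  "f \<in> L2 unit_interval \<Longrightarrow> g \<in> L2 unit_interval \<Longrightarrow> AE x in unit_interval. f x = g x \<Longrightarrow>
   AE x in unit_interval. T f x = T g x"
  using bounded_linear unfolding L2_bounded_linear_def by blast

lemma T_diff:
  assumes "f \<in> L2 unit_interval" "g \<in> L2 unit_interval"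
  shows "AE x in unit_interval. T (\<lambda>x. f x - g x) x = T f x - T g x"
proof -
  have "\<forall>a b. AE x in unit_interval. T (\<lambda>x. a * f x + b * g x) x = a * T f x + b * T g x"
    using bounded_linear assms unfolding L2_bounded_linear_def by blast
  from spec[OF spec[OF this, of 1], of "-1"] show ?thesis by simp
qed

text \<open>The choice inside \<open>U_inv\<close> is harmless, since \<open>T\<close> respects
  equality almost everywhere. In this form the preimage \<open>f\<close> is explicit.\<close>

lemma adjoint:
  assumes f: "f \<in> L2 unit_interval" and G: "G \<in> H2"
  shows "H2_inner (U_op (T f)) G = H2_inner (U_op f) (B G)"
proof -
  note F = U_op_isometry(1)[OF f]
  have "H2_inner (T0_op T (U_op f)) G = H2_inner (U_op f) (B G)"
    using symbols F G by (simp add: associated_symbols_def is_H2_adjoint_def B_def[abs_def])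
  moreover have "H2_inner (T0_op T (U_op f)) G = H2_inner (U_op (T f)) G"
    unfolding T0_op_def
    by (intro H2_inner_cong U_op_cong_AE T_L2 T_cong_AE U_inv_U_op U_inv(1) F f) auto
  ultimately show ?thesis by simp
qed

text \<open>The bound for \<open>B\<close> comes from that for \<open>T\<close> by duality: with
  \<open>U_op u = B G\<close>, the squared norm of \<open>B G\<close> is the inner product of
  \<open>U_op (T u)\<close> with \<open>G\<close>.\<close>

lemma bounds:
  "\<exists>C\<ge>0. (\<forall>f\<in>L2 unit_interval. L2_norm unit_interval (T f) \<le> C * L2_norm unit_interval f) \<and>
    (\<forall>G\<in>H2. H2_norm (B G) \<le> C * H2_norm G)"
proof -
  obtain C0 where C0: "\<forall>f\<in>L2 unit_interval. L2_norm unit_interval (T f) \<le> C0 * L2_norm unit_interval f"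
    using bounded_linear unfolding L2_bounded_linear_def by blast
  \<comment> \<open>\<open>L2_bounded_linear\<close> does not fix the sign of its constant.\<close>
  define C where "C = max C0 0"
  have C: "C \<ge> 0" "L2_norm unit_interval (T f) \<le> C * L2_norm unit_interval f" if "f \<in> L2 unit_interval" for f
  proof -
    show "C \<ge> 0" by (simp add: C_def)
    have "C0 * L2_norm unit_interval f \<le> C * L2_norm unit_interval f"
      unfolding C_def by (intro mult_right_mono L2_norm_nonneg) simp
    then show "L2_norm unit_interval (T f) \<le> C * L2_norm unit_interval f" using C0 that by fastforce
  qed
  have Cn: "C \<ge> 0" by (simp add: C_def)
  have "H2_norm (B G) \<le> C * H2_norm G" if G: "G \<in> H2" for G
  proof -
    note BG = B_H2[OF G]
    define u where "u = U_inv (B G)"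
    have u: "u \<in> L2 unit_interval" "\<And>s. Re s > 0 \<Longrightarrow> U_op u s = B G s"
      unfolding u_def using U_inv[OF BG] by auto
    have nu: "L2_norm unit_interval u = H2_norm (B G)"
      using U_op_isometry(2)[OF u(1)] H2_norm_cong[of "U_op u" "B G"] u(2) by simp
    have "complex_of_real ((H2_norm (B G))\<^sup>2) = H2_inner (U_op u) (B G)"
      unfolding H2_inner_self[OF BG, symmetric] by (rule H2_inner_cong) (simp_all add: u(2))
    also have "\<dots> = H2_inner (U_op (T u)) G" by (rule adjoint[OF u(1) G, symmetric])
    finally have "(H2_norm (B G))\<^sup>2 = cmod (H2_inner (U_op (T u)) G)"
      by (metis norm_of_real abs_of_nonneg zero_le_power2)
    also have "\<dots> \<le> H2_norm (U_op (T u)) * H2_norm G"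
      by (intro H2_Cauchy_Schwarz U_op_isometry T_L2 u G)
    also have "\<dots> \<le> (C * H2_norm (B G)) * H2_norm G"
      using C(2)[OF u(1)] by (intro mult_right_mono H2_norm_nonneg) (simp add: U_op_isometry(2)[OF T_L2[OF u(1)]] nu)
    finally have le: "H2_norm (B G) * H2_norm (B G) \<le> H2_norm (B G) * (C * H2_norm G)"
      by (simp add: power2_eq_square mult_ac)
    show ?thesis
    proof (cases "H2_norm (B G) = 0")
      case True
      then show ?thesis using Cn H2_norm_nonneg[of G] by simp
    next
      case False
      then have "H2_norm (B G) > 0" using H2_norm_nonneg[of "B G"] by simp
      then show ?thesis using le by (rule mult_left_le_imp_le[rotated])
    qed
  qed
  then show ?thesis using Cn C(2) by blast
qed

lemma B_diff: "B (\<lambda>s. F s - G s) = (\<lambda>s. B F s - B G s)"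
  by (auto simp: B_def algebra_simps)

text \<open>A limit along a fixed sequence is Borel measurable by construction;
  \<open>boundary_limits\<close> identifies it almost everywhere with the nontangential
  limit.\<close>

definition \<phi>b :: "real \<Rightarrow> complex" where
  "\<phi>b y = lim (\<lambda>n. \<phi> (Complex (1 / real (Suc n)) y))"

definition hb :: "real \<Rightarrow> complex" where
  "hb y = lim (\<lambda>n. h (Complex (1 / real (Suc n)) y))"

lemma \<phi>b_measurable [measurable]: "\<phi>b \<in> borel_measurable borel"
  unfolding \<phi>b_def by (intro borel_measurable_lim_metric line_measurable \<phi>_holomorphic) simp

lemma hb_measurable [measurable]: "hb \<in> borel_measurable borel"
  unfolding hb_def by (intro borel_measurable_lim_metric line_measurable h_holomorphic) simp

text \<open>For \<phi> this is the result on self-maps. The weight is recovered from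
  \<open>h s = B (H2_kernel 1) s * (\<phi> s + 1)\<close>, the product of an \<open>H2\<close>
  function and a function whose limits are then known.\<close>

lemma boundary_limits:
  "AE y in lborel. has_nontangential_limit \<phi> y (\<phi>b y) \<and> 0 \<le> Re (\<phi>b y) \<and> has_nontangential_limit h y (hb y)"
proof -
  have k1: "H2_kernel 1 \<in> H2" by (rule H2_kernel_in_H2) simp
  show ?thesis
    using selfmap_nontangential_limit[OF \<phi>_holomorphic \<phi>_image] nontangential_limit_H2[OF B_H2[OF k1]]
  proof eventually_elim
    case (elim y)
    then obtain l where l: "has_nontangential_limit \<phi> y l" "0 \<le> Re l" by blast
    have l': "\<phi>b y = l" unfolding \<phi>b_def by (rule limI[OF nontangential_limit_LIMSEQ[OF l(1)]])
    have "has_nontangential_limit (\<lambda>s. \<phi> s + 1) y (l + 1)"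
      using l(1) unfolding has_nontangential_limit_def by (auto intro!: tendsto_intros)
    then have "has_nontangential_limit (\<lambda>s. B (H2_kernel 1) s * (\<phi> s + 1)) y (bdry (B (H2_kernel 1)) y * (l + 1))"
      by (intro nontangential_limit_mult elim(2))
    then have m: "has_nontangential_limit h y (bdry (B (H2_kernel 1)) y * (l + 1))"
    proof (rule nontangential_limit_cong)
      fix s :: complex assume "Re s > 0"
      then have "\<phi> s + 1 \<noteq> 0" using \<phi>_pos[of s] by (auto simp: complex_eq_iff)
      then show "B (H2_kernel 1) s * (\<phi> s + 1) = h s" by (simp add: B_def H2_kernel_def)
    qed
    have "hb y = bdry (B (H2_kernel 1)) y * (l + 1)" unfolding hb_def by (rule limI[OF nontangential_limit_LIMSEQ[OF m]])
    with l l' m show ?case by simp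
  qed
qed

text \<open>The symbol measure as an actual Borel measure on the plane, built from the measurable
  versions \<open>hb\<close> and \<open>\<phi>b\<close> of the boundary values.\<close>

definition \<nu> :: "complex measure" where
  "\<nu> = distr (density lborel (\<lambda>y. ennreal ((cmod (hb y))\<^sup>2))) borel \<phi>b"

lemma sets_\<nu> [measurable_cong]: "sets \<nu> = sets borel"
  by (simp add: \<nu>_def)

lemma nn_integral_\<nu>:
  assumes [measurable]: "F \<in> borel_measurable borel"
  shows "(\<integral>\<^sup>+z. F z \<partial>\<nu>) = (\<integral>\<^sup>+y. ennreal ((cmod (hb y))\<^sup>2) * F (\<phi>b y) \<partial>lborel)"
  unfolding \<nu>_def by (subst nn_integral_distr) (auto simp: nn_integral_density)

lemma emeasure_\<nu>:
  assumes [measurable]: "E \<in> sets borel"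
  shows "emeasure \<nu> E = (\<integral>\<^sup>+y. ennreal ((cmod (hb y))\<^sup>2) * indicator E (\<phi>b y) \<partial>lborel)"
  using nn_integral_\<nu>[of "indicator E"] by (simp add: sets_\<nu>)

text \<open>Here the nontangential values of the statement are exchanged for \<open>\<phi>b\<close>
  and \<open>hb\<close>: they differ on a null set only, and completion does not change integrals of
  Borel functions.\<close>

lemma symbol_measure_eq:
  assumes E[measurable]: "E \<in> sets borel"
  shows "symbol_measure h \<phi> E = emeasure \<nu> E"
proof -
  have "AE y in lborel. ennreal ((cmod (boundary_value h y))\<^sup>2) * indicator {y. boundary_value \<phi> y \<in> E} y =
      ennreal ((cmod (hb y))\<^sup>2) * indicator E (\<phi>b y)"
    using boundary_limits by eventually_elim (auto simp: boundary_value_eq indicator_def)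
  then have "AE y in lebesgue. ennreal ((cmod (boundary_value h y))\<^sup>2) * indicator {y. boundary_value \<phi> y \<in> E} y =
      ennreal ((cmod (hb y))\<^sup>2) * indicator E (\<phi>b y)"
    by (rule AE_completion)
  then have "symbol_measure h \<phi> E = (\<integral>\<^sup>+y. ennreal ((cmod (hb y))\<^sup>2) * indicator E (\<phi>b y) \<partial>lebesgue)"
    unfolding symbol_measure_def by (rule nn_integral_cong_AE)
  also have "\<dots> = (\<integral>\<^sup>+y. ennreal ((cmod (hb y))\<^sup>2) * indicator E (\<phi>b y) \<partial>lborel)"
    by (rule nn_integral_completion)
  finally show ?thesis by (simp add: emeasure_\<nu>)
qed

lemma emeasure_\<nu>_left_half_plane: "emeasure \<nu> {z. Re z < 0} = 0"
proof -
  have [measurable]: "{z. Re z < 0} \<in> sets borel" by (intro borel_open open_halfspace_Re_lt)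
  have "(\<integral>\<^sup>+y. ennreal ((cmod (hb y))\<^sup>2) * indicator {z. Re z < 0} (\<phi>b y) \<partial>lborel) = (\<integral>\<^sup>+y. 0 \<partial>(lborel :: real measure))"
  proof (rule nn_integral_cong_AE)
    show "AE y in lborel. ennreal ((cmod (hb y))\<^sup>2) * indicator {z. Re z < 0} (\<phi>b y) = 0"
      using boundary_limits by eventually_elim (simp add: not_less)
  qed
  then show ?thesis by (simp add: emeasure_\<nu>)
qed

text \<open>The boundary function of \<open>B G\<close> is \<open>hb y * G (\<phi>b y)\<close>.
  Continuity of \<open>G\<close> up to the axis is what makes this a limit, since
  \<open>\<phi>b y\<close> may lie on the axis.\<close>

lemma nn_integral_\<nu>_eq_norm_B:
  assumes G: "G \<in> H2" and cont: "continuous_on {z. 0 \<le> Re z} G"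
  shows "(\<integral>\<^sup>+z. ennreal ((cmod (G z))\<^sup>2) * indicator {z. 0 \<le> Re z} z \<partial>\<nu>) = ennreal (2 * pi * (H2_norm (B G))\<^sup>2)"
proof -
  define g where "g z = indicator {z. 0 \<le> Re z} z *\<^sub>R G z" for z
  have [measurable]: "g \<in> borel_measurable borel"
    unfolding g_def using cont by (intro borel_measurable_continuous_on_indicator) auto
  note BG = B_H2[OF G]
  have bd: "AE y in lborel. bdry (B G) y = hb y * g (\<phi>b y)"
  proof (rule bdry_AE_eqI[OF BG])
    show "AE y in lborel. (\<lambda>n. B G (Complex (1 / real (Suc n)) y)) \<longlonglongrightarrow> hb y * g (\<phi>b y)"
      using boundary_limits
    proof eventually_elim
      case (elim y)
      have "(\<lambda>n. G (\<phi> (Complex (1 / real (Suc n)) y))) \<longlonglongrightarrow> G (\<phi>b y)"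
        using elim nontangential_limit_LIMSEQ[of \<phi> y "\<phi>b y"]
        by (intro continuous_on_tendsto_compose[OF cont]) (auto intro!: always_eventually less_imp_le \<phi>_pos)
      moreover have "(\<lambda>n. h (Complex (1 / real (Suc n)) y)) \<longlonglongrightarrow> hb y"
        using elim nontangential_limit_LIMSEQ by blast
      ultimately have "(\<lambda>n. B G (Complex (1 / real (Suc n)) y)) \<longlonglongrightarrow> hb y * G (\<phi>b y)"
        unfolding B_def by (intro tendsto_mult)
      then show ?case using elim by (simp add: g_def)
    qed
  qed
  have "(\<integral>\<^sup>+z. ennreal ((cmod (G z))\<^sup>2) * indicator {z. 0 \<le> Re z} z \<partial>\<nu>) = (\<integral>\<^sup>+z. ennreal ((cmod (g z))\<^sup>2) \<partial>\<nu>)"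
    by (intro nn_integral_cong) (auto simp: g_def indicator_def)
  also have "\<dots> = (\<integral>\<^sup>+y. ennreal ((cmod (hb y))\<^sup>2) * ennreal ((cmod (g (\<phi>b y)))\<^sup>2) \<partial>lborel)"
    by (rule nn_integral_\<nu>) measurable
  also have "\<dots> = (\<integral>\<^sup>+y. ennreal ((cmod (bdry (B G) y))\<^sup>2) \<partial>lborel)"
    using bd by (intro nn_integral_cong_AE) (auto elim!: eventually_mono simp: norm_mult power_mult_distrib ennreal_mult)
  also have "\<dots> = ennreal ((L2_norm lborel (bdry (B G)))\<^sup>2)" by (rule nn_integral_L2_norm[OF bdry_L2[OF BG]])
  also have "(L2_norm lborel (bdry (B G)))\<^sup>2 = 2 * pi * (H2_norm (B G))\<^sup>2"
    by (simp add: H2_norm_eq_bdry[OF BG] power_divide)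
  finally show ?thesis .
qed

text \<open>Testing on the kernel at the centre: on the square \<open>cmod (z + cnj w)\<close>
  squared is at most \<open>(3 * r)^2 + r^2 = 10 * r^2\<close>, and the remaining
  \<open>2 * pi\<close> is the normalization of the norm.\<close>

lemma emeasure_\<nu>_square_le:
  assumes r: "r > 0"
  shows "emeasure \<nu> (halfplane_square t r) \<le> ennreal (20 * pi * r\<^sup>2 * (H2_norm (B (H2_kernel (Complex r t))))\<^sup>2)"
proof -
  define w where "w = Complex r t"
  have w: "Re w > 0" using r by (simp add: w_def)
  have cont: "continuous_on {z. 0 \<le> Re z} (H2_kernel w)"
    unfolding H2_kernel_def using w by (intro continuous_intros) (auto simp: complex_eq_iff)
  have "emeasure \<nu> (halfplane_square t r) = (\<integral>\<^sup>+z. indicator (halfplane_square t r) z \<partial>\<nu>)"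
    by (simp add: sets_\<nu>)
  also have "\<dots> \<le> (\<integral>\<^sup>+z. ennreal (10 * r\<^sup>2) * (ennreal ((cmod (H2_kernel w z))\<^sup>2) * indicator {z. 0 \<le> Re z} z) \<partial>\<nu>)"
  proof (rule nn_integral_mono)
    fix z
    show "indicator (halfplane_square t r) z \<le> ennreal (10 * r\<^sup>2) * (ennreal ((cmod (H2_kernel w z))\<^sup>2) * indicator {z. 0 \<le> Re z} z)"
    proof (cases "z \<in> halfplane_square t r")
      case True
      then have z: "0 \<le> Re z" "Re z \<le> 2 * r" "\<bar>Im z - t\<bar> \<le> r" by (auto simp: halfplane_square_def)
      have "(cmod (z + cnj w))\<^sup>2 = (Re z + r)\<^sup>2 + \<bar>Im z - t\<bar>\<^sup>2" by (simp add: cmod_power2 w_def)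
      also have "\<dots> \<le> (3 * r)\<^sup>2 + r\<^sup>2" using z r by (intro add_mono power_mono) auto
      finally have le: "(cmod (z + cnj w))\<^sup>2 \<le> 10 * r\<^sup>2" by (simp add: power_mult_distrib)
      have "z + cnj w \<noteq> 0" using z w by (auto simp: complex_eq_iff)
      then have "1 \<le> 10 * r\<^sup>2 * (cmod (H2_kernel w z))\<^sup>2"
        using le by (simp add: H2_kernel_def norm_divide power_divide)
      then have "ennreal 1 \<le> ennreal (10 * r\<^sup>2 * (cmod (H2_kernel w z))\<^sup>2)" by (rule ennreal_leI)
      also have "\<dots> = ennreal (10 * r\<^sup>2) * ennreal ((cmod (H2_kernel w z))\<^sup>2)" by (intro ennreal_mult) auto
      finally show ?thesis using True z by simp
    qed simp
  qed
  also have "\<dots> = ennreal (10 * r\<^sup>2) * (\<integral>\<^sup>+z. ennreal ((cmod (H2_kernel w z))\<^sup>2) * indicator {z. 0 \<le> Re z} z \<partial>\<nu>)"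
  proof (rule nn_integral_cmult)
    have "H2_kernel w \<in> borel_measurable borel" unfolding H2_kernel_def by measurable
    then show "(\<lambda>z. ennreal ((cmod (H2_kernel w z))\<^sup>2) * indicator {z. 0 \<le> Re z} z) \<in> borel_measurable \<nu>" by measurable
  qed
  also have "\<dots> = ennreal (10 * r\<^sup>2) * ennreal (2 * pi * (H2_norm (B (H2_kernel w)))\<^sup>2)"
    by (simp only: nn_integral_\<nu>_eq_norm_B[OF H2_kernel_in_H2[OF w] cont])
  also have "\<dots> = ennreal (10 * r\<^sup>2 * (2 * pi * (H2_norm (B (H2_kernel w)))\<^sup>2))" by (intro ennreal_mult[symmetric]) auto
  finally show ?thesis by (simp add: w_def mult_ac)
qed

end

section \<open>Decay of normalized kernels and weak convergence\<close>

lemma kernel_decay: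
  assumes a: "a \<ge> 1 / 2" and \<rho>: "\<rho> > 0" and w: "w \<in> S_region \<rho>"
  shows "cmod (H2_kernel (of_real a) w) * sqrt (2 * Re w) \<le> 2 * sqrt (2 * \<rho>)"
proof -
  have wp: "Re w > 0" using w by (auto simp: S_region_def right_half_plane_def)
  have ge1: "1 / 2 \<le> cmod (w + of_real a)"
    using complex_Re_le_cmod[of "w + of_real a"] wp a by simp
  have k: "cmod (H2_kernel (of_real a) w) = 1 / cmod (w + of_real a)"
    by (simp add: H2_kernel_def norm_divide)
  from w consider "Re w < \<rho>" | "1 / \<rho> < cmod w" by (auto simp: S_region_def)
  then show ?thesis
  proof cases
    case 1
    \<comment> \<open>Near the axis the kernel is bounded by 2, and \<open>sqrt (2 * Re w)\<close>
      is small.\<close>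
    have "1 / cmod (w + of_real a) \<le> 1 / (1 / 2)" using ge1 by (intro divide_left_mono) auto
    then have "1 / cmod (w + of_real a) * sqrt (2 * Re w) \<le> 2 * sqrt (2 * \<rho>)"
      using 1 wp by (intro mult_mono) auto
    then show ?thesis by (simp only: k)
  next
    case 2
    \<comment> \<open>Far out the kernel decays like \<open>1 / cmod w\<close>, while
      \<open>Re w \<le> cmod w\<close> lets the square root grow only like
      \<open>sqrt (cmod w)\<close>.\<close>
    have "(cmod w)\<^sup>2 \<le> (cmod (w + of_real a))\<^sup>2"
      unfolding cmod_power2 using wp a by (auto intro!: power_mono)
    then have ge: "cmod w \<le> cmod (w + of_real a)" by (rule power2_le_imp_le) simp
    have wn: "cmod w > 0" using wp by auto
    have "1 \<le> \<rho> * cmod w" using 2 \<rho> by (simp add: field_simps)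
    then have "2 * cmod w * 1 \<le> 2 * cmod w * (\<rho> * cmod w)" by (intro mult_left_mono) auto
    then have "2 * Re w \<le> 2 * \<rho> * (cmod w)\<^sup>2"
      using complex_Re_le_cmod[of w] by (simp add: power2_eq_square mult_ac)
    then have "sqrt (2 * Re w) \<le> sqrt (2 * \<rho>) * cmod w"
      by (metis abs_of_nonneg norm_ge_zero real_sqrt_abs real_sqrt_le_iff real_sqrt_mult)
    also have "\<dots> \<le> sqrt (2 * \<rho>) * cmod (w + of_real a)" using ge \<rho> by (intro mult_left_mono) auto
    finally have "sqrt (2 * Re w) / cmod (w + of_real a) \<le> sqrt (2 * \<rho>)"
      using pos_divide_le_eq[of "cmod (w + of_real a)"] ge wn by (metis less_le_trans)
    also have "\<dots> \<le> 2 * sqrt (2 * \<rho>)" using \<rho> by simp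
    finally show ?thesis unfolding k by simp
  qed
qed

text \<open>The product is the modulus of the inner product of \<open>F\<close> with the normalized
  kernel at \<open>w\<close>. For finite combinations of kernels at \<open>i + 1/2\<close> the decay
  is explicit; density of polynomials passes it to all \<open>F\<close>, because the pairing is
  bounded by the norm.\<close>

lemma H2_decay:
  assumes F: "F \<in> H2" and e: "e > 0"
  shows "\<exists>\<rho>>0. \<forall>w\<in>S_region \<rho>. cmod (F w) * sqrt (2 * Re w) < e"
proof -
  define g where "g = U_inv F"
  have g: "g \<in> L2 unit_interval" "\<And>s. Re s > 0 \<Longrightarrow> U_op g s = F s"
    unfolding g_def using U_inv[OF F] by auto
  obtain p where p: "L2_norm unit_interval (\<lambda>x. g x - poly_fun p x) < e / 2"
    using poly_fun_dense[OF g(1)] e unfolding poly_approximable_def by (meson half_gt_zero)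
  define c where "c = (\<Sum>i\<le>degree p. cmod (coeff p i))"
  have c: "c \<ge> 0" by (simp add: c_def sum_nonneg)
  \<comment> \<open>With this choice \<open>c * (2 * sqrt (2 * \<rho>))\<close>, the bound for the
    polynomial part, is below \<open>e / 2\<close>; the crude estimate of \<open>sqrt 2\<close> by 2
    accounts for the 8.\<close>
  define \<rho> where "\<rho> = (e / (8 * (c + 1)))\<^sup>2"
  have q: "e / (8 * (c + 1)) > 0" using e c by (intro divide_pos_pos) auto
  have \<rho>: "\<rho> > 0" unfolding \<rho>_def by (rule zero_less_power[OF q])
  have "sqrt (2 * \<rho>) \<le> sqrt (2\<^sup>2 * \<rho>)" using \<rho> by (intro real_sqrt_le_mono) auto
  also have "\<dots> = 2 * (e / (8 * (c + 1)))" unfolding \<rho>_def real_sqrt_mult real_sqrt_abs abs_of_pos[OF q] by simp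
  finally have "c * (2 * sqrt (2 * \<rho>)) \<le> c * (2 * (2 * (e / (8 * (c + 1)))))" using c by (intro mult_left_mono) auto
  also have "\<dots> = (e / 2) * (c / (c + 1))"
  proof -
    have "c * (2 * (2 * (e / (8 * k)))) = (e / 2) * (c / k)" for k :: real
      by (cases "k = 0") (simp_all add: field_simps)
    then show ?thesis .
  qed
  also have "\<dots> < (e / 2) * 1" using e c by (intro mult_strict_left_mono) (auto simp: divide_less_eq)
  finally have small: "c * (2 * sqrt (2 * \<rho>)) < e / 2" by simp
  have "cmod (F w) * sqrt (2 * Re w) < e" if w: "w \<in> S_region \<rho>" for w
  proof -
    have wp: "Re w > 0" using w by (auto simp: S_region_def right_half_plane_def)
    have "cmod (U_op (\<lambda>x. g x - poly_fun p x) w) \<le> L2_norm unit_interval (\<lambda>x. g x - poly_fun p x) * sqrt (1 / (2 * Re w))"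
      by (intro norm_U_op_le L2_diff g poly_fun_L2 wp)
    then have "cmod (F w - U_op (poly_fun p) w) * sqrt (2 * Re w) \<le> L2_norm unit_interval (\<lambda>x. g x - poly_fun p x) * sqrt (1 / (2 * Re w)) * sqrt (2 * Re w)"
      using g(2)[OF wp] wp by (intro mult_right_mono) (auto simp: U_op_diff[OF g(1) poly_fun_L2 wp])
    also have "\<dots> = L2_norm unit_interval (\<lambda>x. g x - poly_fun p x)"
      using wp by (simp add: real_sqrt_divide)
    finally have 1: "cmod (F w - U_op (poly_fun p) w) * sqrt (2 * Re w) < e / 2" using p by linarith
    have "cmod (U_op (poly_fun p) w) * sqrt (2 * Re w) \<le> (\<Sum>i\<le>degree p. cmod (coeff p i) * cmod (H2_kernel (of_nat i + 1 / 2) w)) * sqrt (2 * Re w)"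
      unfolding U_op_poly_fun[OF wp] by (intro mult_right_mono sum_norm_le) (auto simp: norm_mult wp less_imp_le)
    also have "\<dots> = (\<Sum>i\<le>degree p. cmod (coeff p i) * (cmod (H2_kernel (of_real (real i + 1 / 2)) w) * sqrt (2 * Re w)))"
      by (simp add: sum_distrib_right mult.assoc)
    also have "\<dots> \<le> (\<Sum>i\<le>degree p. cmod (coeff p i) * (2 * sqrt (2 * \<rho>)))"
      by (intro sum_mono mult_left_mono kernel_decay \<rho> w) auto
    also have "\<dots> = c * (2 * sqrt (2 * \<rho>))" by (simp add: c_def sum_distrib_right)
    finally have 2: "cmod (U_op (poly_fun p) w) * sqrt (2 * Re w) < e / 2" using small by linarith
    have "cmod (F w) * sqrt (2 * Re w) \<le> (cmod (F w - U_op (poly_fun p) w) + cmod (U_op (poly_fun p) w)) * sqrt (2 * Re w)"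
      using norm_triangle_ineq[of "F w - U_op (poly_fun p) w" "U_op (poly_fun p) w"] wp by (intro mult_right_mono) auto
    then show ?thesis using 1 2 by (simp add: distrib_right)
  qed
  with \<rho> show ?thesis by blast
qed

text \<open>Against the transform of a polynomial the inner product is a finite combination of point
  values; bounded norms and density give the rest.\<close>

lemma H2_weak_null:
  assumes D: "\<And>n. D n \<in> H2" and b: "\<And>n. H2_norm (D n) \<le> M" and H: "H \<in> H2"
    and pw: "\<And>s. Re s > 0 \<Longrightarrow> (\<lambda>n. D n s) \<longlonglongrightarrow> 0"
  shows "(\<lambda>n. H2_inner (D n) H) \<longlonglongrightarrow> 0"
proof (rule LIMSEQ_I)
  fix e :: real assume e: "e > 0"
  have M: "M \<ge> 0" using b[of 0] H2_norm_nonneg order_trans by blast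
  define g where "g = U_inv H"
  have g: "g \<in> L2 unit_interval" "\<And>s. Re s > 0 \<Longrightarrow> U_op g s = H s"
    unfolding g_def using U_inv[OF H] by auto
  have "e / (2 * (M + 1)) > 0" using e M by simp
  then obtain p where p: "L2_norm unit_interval (\<lambda>x. g x - poly_fun p x) < e / (2 * (M + 1))"
    using poly_fun_dense[OF g(1)] unfolding poly_approximable_def by blast
  note P = U_op_poly_fun_H2(1)[of p]
  have d: "H2_norm (\<lambda>s. H s - U_op (poly_fun p) s) < e / (2 * (M + 1))"
  proof -
    have "H2_norm (\<lambda>s. H s - U_op (poly_fun p) s) = H2_norm (U_op (\<lambda>x. g x - poly_fun p x))"
      by (rule H2_norm_cong) (simp add: U_op_diff[OF g(1) poly_fun_L2] g(2))
    then show ?thesis using p by (simp add: U_op_isometry(2)[OF L2_diff[OF g(1) poly_fun_L2]])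
  qed
  have r: "Re (of_nat i + 1 / 2 :: complex) > 0" for i by (simp add: add_nonneg_pos)
  have "(\<lambda>n. \<Sum>i\<le>degree p. cnj (coeff p i) * D n (of_nat i + 1 / 2)) \<longlonglongrightarrow> (\<Sum>i\<le>degree p. cnj (coeff p i) * 0)"
    by (intro tendsto_intros pw r)
  then have "(\<lambda>n. H2_inner (D n) (U_op (poly_fun p))) \<longlonglongrightarrow> 0"
    by (simp add: U_op_poly_fun_H2(2)[OF D])
  from LIMSEQ_D[OF this, of "e / 2"] e obtain N where N: "\<And>n. n \<ge> N \<Longrightarrow> cmod (H2_inner (D n) (U_op (poly_fun p))) < e / 2" by auto
  show "\<exists>N. \<forall>n\<ge>N. norm (H2_inner (D n) H - 0) < e"
  proof (intro exI allI impI)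
    fix n assume n: "n \<ge> N"
    have "H2_inner (D n) (\<lambda>s. H s - U_op (poly_fun p) s) = H2_inner (D n) H - H2_inner (D n) (U_op (poly_fun p))"
      using H2_inner_lincomb_right[OF H P D[of n], where a=1 and b="-1"] by simp
    then have "cmod (H2_inner (D n) H - H2_inner (D n) (U_op (poly_fun p))) \<le> H2_norm (D n) * H2_norm (\<lambda>s. H s - U_op (poly_fun p) s)"
      using H2_Cauchy_Schwarz[OF D[of n] H2_diff[OF H P]] by simp
    also have "\<dots> \<le> M * (e / (2 * (M + 1)))" using d b M by (intro mult_mono H2_norm_nonneg) auto
    also have "\<dots> = (e / 2) * (M / (M + 1))" by simp
    also have "\<dots> \<le> (e / 2) * 1" using e M by (intro mult_left_mono) (auto simp: divide_le_eq)
    finally have "cmod (H2_inner (D n) H - H2_inner (D n) (U_op (poly_fun p))) \<le> e / 2" by simp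
    then show "norm (H2_inner (D n) H - 0) < e"
      using N[OF n] norm_triangle_sub[of "H2_inner (D n) H" "H2_inner (D n) (U_op (poly_fun p))"] by simp
  qed
qed

text \<open>Point evaluations are bounded by the norm, so a bounded set in \<open>H2\<close> is
  locally bounded and Montel's theorem supplies the subsequence; Fatou's lemma keeps the limit in
  \<open>H2\<close>.\<close>

lemma H2_Montel:
  assumes F: "\<And>n. F n \<in> H2" and b: "\<And>n. H2_norm (F n) \<le> M"
  obtains G r where "G \<in> H2" "strict_mono (r :: nat \<Rightarrow> nat)" "\<And>s. Re s > 0 \<Longrightarrow> (\<lambda>n. F (r n) s) \<longlonglongrightarrow> G s"
proof -
  have M: "M \<ge> 0" using b[of 0] H2_norm_nonneg order_trans by blast
  obtain G r where G: "G holomorphic_on right_half_plane" "strict_mono (r :: nat \<Rightarrow> nat)"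
      "\<And>s. s \<in> right_half_plane \<Longrightarrow> (\<lambda>n. F (r n) s) \<longlonglongrightarrow> G s"
  proof (rule Montel[OF open_right_half_plane, of "{f \<in> H2. H2_norm f \<le> M}" F])
    show "f holomorphic_on right_half_plane" if "f \<in> {f \<in> H2. H2_norm f \<le> M}" for f
      using that H2_holomorphic by auto
    show "range F \<subseteq> {f \<in> H2. H2_norm f \<le> M}" using F b by auto
    show "\<exists>B. \<forall>f\<in>{f \<in> H2. H2_norm f \<le> M}. \<forall>z\<in>K. cmod (f z) \<le> B" if K: "compact K" "K \<subseteq> right_half_plane" for K
    proof (cases "K = {}")
      case False
      obtain z0 where z0: "z0 \<in> K" "\<And>z. z \<in> K \<Longrightarrow> Re z0 \<le> Re z"
        using continuous_attains_inf[OF K(1) False continuous_on_Re[OF continuous_on_id]] by auto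
      have p: "Re z0 > 0" using z0(1) K(2) by (auto simp: right_half_plane_def)
      have "cmod (f z) \<le> M * sqrt (1 / (2 * Re z0))" if f: "f \<in> H2" "H2_norm f \<le> M" and z: "z \<in> K" for f z
      proof -
        have "cmod (f z) \<le> H2_norm f * sqrt (1 / (2 * Re z))"
          using z0(2)[OF z] p by (intro norm_H2_le f) simp
        also have "\<dots> \<le> M * sqrt (1 / (2 * Re z0))"
          using z0(2)[OF z] p f M by (intro mult_mono real_sqrt_le_mono divide_left_mono) auto
        finally show ?thesis .
      qed
      then show ?thesis by blast
    qed simp
  next
    fix g r assume "g holomorphic_on right_half_plane" "strict_mono (r :: nat \<Rightarrow> nat)"
      "\<And>x. x \<in> right_half_plane \<Longrightarrow> (\<lambda>n. F (r n) x) \<longlonglongrightarrow> g x"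
    then show thesis by (rule that)
  qed
  have "G \<in> H2"
    by (rule H2_pointwise_limit(1)[of "\<lambda>n. F (r n)", OF F G(1) _ _ M]) (auto simp: G right_half_plane_def b)
  with G show thesis by (intro that) (auto simp: right_half_plane_def)
qed

lemma S_region_mono: "0 < \<rho>' \<Longrightarrow> \<rho>' \<le> \<rho> \<Longrightarrow> S_region \<rho>' \<subseteq> S_region \<rho>"
proof
  fix z assume r: "0 < \<rho>'" "\<rho>' \<le> \<rho>" and z: "z \<in> S_region \<rho>'"
  have "1 / \<rho> \<le> 1 / \<rho>'" using r by (intro divide_left_mono) auto
  with z r show "z \<in> S_region \<rho>" by (auto simp: S_region_def)
qed

section \<open>Compactness and the Carleson condition\<close>

context weighted_composition
begin

text \<open>The Carleson condition with the supremum unfolded, on closed squares. The bound is in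
  terms of the half-length \<open>r\<close>, so \<delta> here corresponds to
  \<open>\<delta> / 2\<close> in the quotient by the length.\<close>

definition vanishing :: bool where
  "vanishing \<longleftrightarrow> (\<forall>\<delta>>0. \<exists>\<rho>>0. \<forall>t r. Complex r t \<in> S_region \<rho> \<longrightarrow>
     emeasure \<nu> (halfplane_square t r) \<le> ennreal (\<delta> * r))"

text \<open>In general only an inclusion of squares holds, because an interval may lack its end
  points while \<open>halfplane_square\<close> is closed.\<close>

lemma interval_bounds:
  assumes J: "bounded_nondegenerate_interval J"
  defines "r \<equiv> interval_length J / 2" and "t \<equiv> (Inf J + Sup J) / 2"
  shows "r > 0" "carleson_square J \<subseteq> halfplane_square t r" "carleson_centre J = Complex r t"
proof -
  show "r > 0" using J by (simp add: bounded_nondegenerate_interval_def interval_length_def r_def)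
  show "carleson_centre J = Complex r t" by (simp add: carleson_centre_def r_def t_def)
  have J': "bounded J" using J by (simp add: bounded_nondegenerate_interval_def)
  have "Inf J \<le> x" "x \<le> Sup J" if "x \<in> J" for x
    using that J' by (auto intro: cInf_lower cSup_upper bounded_imp_bdd_below bounded_imp_bdd_above)
  note bd = this
  show "carleson_square J \<subseteq> halfplane_square t r"
  proof
    fix z assume z: "z \<in> carleson_square J"
    then have "Inf J \<le> Im z" "Im z \<le> Sup J" using bd by (auto simp: carleson_square_def)
    then have "\<bar>Im z - t\<bar> \<le> r" by (simp add: r_def t_def interval_length_def abs_le_iff field_simps)
    with z show "z \<in> halfplane_square t r" by (simp add: carleson_square_def halfplane_square_def r_def)
  qed
qed

lemma symbol_measure_mono: "E \<subseteq> E' \<Longrightarrow> symbol_measure h \<phi> E \<le> symbol_measure h \<phi> E'"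
  unfolding symbol_measure_def by (intro nn_integral_mono mult_left_mono) (auto simp: indicator_def)

text \<open>Squares over arbitrary intervals are enclosed in closed squares with the same centre,
  and closed intervals attain these. The regions \<open>S_region\<close> shrink with the radius, so
  a bound at one radius holds at all smaller ones.\<close>

lemma tendsto_0_iff_vanishing:
  "((\<lambda>r. SUP J\<in>{J. bounded_nondegenerate_interval J \<and> carleson_centre J \<in> S_region r}.
        symbol_measure h \<phi> (carleson_square J) / ennreal (interval_length J)) \<longlongrightarrow> 0) (at_right (0::real))
   \<longleftrightarrow> vanishing" (is "(?f \<longlongrightarrow> 0) _ \<longleftrightarrow> _")
proof
  assume l: "(?f \<longlongrightarrow> 0) (at_right 0)"
  show vanishing
    unfolding vanishing_def
  proof (intro allI impI)
    fix \<delta> :: real assume \<delta>: "\<delta> > 0"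
    have "\<forall>\<^sub>F x in at_right 0. ?f x < ennreal (\<delta> / 2)"
      using \<delta> by (intro order_tendstoD(2)[OF l]) simp
    moreover have "\<forall>\<^sub>F x in at_right (0::real). x > 0" by (simp add: eventually_at_right_less)
    ultimately have "\<forall>\<^sub>F x in at_right 0. x > 0 \<and> ?f x < ennreal (\<delta> / 2)" by eventually_elim simp
    then obtain \<rho> where \<rho>: "\<rho> > 0" "?f \<rho> < ennreal (\<delta> / 2)"
      using eventually_happens' trivial_limit_at_right_real by blast
    show "\<exists>\<rho>>0. \<forall>t r. Complex r t \<in> S_region \<rho> \<longrightarrow> emeasure \<nu> (halfplane_square t r) \<le> ennreal (\<delta> * r)"
    proof (intro exI[of _ \<rho>] conjI allI impI \<rho>(1))
      fix t r assume S: "Complex r t \<in> S_region \<rho>"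
      then have r: "r > 0" by (simp add: S_region_def right_half_plane_def)
      \<comment> \<open>For the closed interval the Carleson square coincides with the closed
        square.\<close>
      define J where "J = {t - r..t + r}"
      have IS: "Inf J = t - r" "Sup J = t + r" using r by (auto simp: J_def)
      have len: "interval_length J = 2 * r" by (simp add: interval_length_def IS)
      have J: "bounded_nondegenerate_interval J"
        using r by (simp add: bounded_nondegenerate_interval_def IS) (simp add: J_def is_interval_cc)
      have c: "carleson_centre J = Complex r t" by (simp add: carleson_centre_def len IS)
      have sq: "carleson_square J = halfplane_square t r"
        unfolding carleson_square_def halfplane_square_def len by (auto simp: J_def)
      have "symbol_measure h \<phi> (carleson_square J) / ennreal (interval_length J) \<le> ?f \<rho>"
        using J c S by (intro SUP_upper) auto
      then have "emeasure \<nu> (halfplane_square t r) / ennreal (2 * r) < ennreal (\<delta> / 2)"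
        using \<rho>(2) unfolding sq len symbol_measure_eq[OF borel_halfplane_square] by (rule le_less_trans)
      then have "emeasure \<nu> (halfplane_square t r) < ennreal (\<delta> / 2) * ennreal (2 * r)"
        using r by (subst (asm) divide_less_ennreal) auto
      also have "\<dots> = ennreal (\<delta> / 2 * (2 * r))" using r \<delta> by (intro ennreal_mult[symmetric]) auto
      finally show "emeasure \<nu> (halfplane_square t r) \<le> ennreal (\<delta> * r)" by simp
    qed
  qed
next
  assume v: vanishing
  show "(?f \<longlongrightarrow> 0) (at_right 0)"
  proof (rule order_tendstoI)
    fix a :: ennreal assume "0 < a"
    then obtain b where b: "0 < b" "b < a" using dense by blast
    then obtain \<delta> where \<delta>: "b = ennreal \<delta>" "\<delta> > 0"
      by (cases b) (auto simp: top_unique)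
    obtain \<rho> where \<rho>: "\<rho> > 0" "\<And>t r. Complex r t \<in> S_region \<rho> \<Longrightarrow> emeasure \<nu> (halfplane_square t r) \<le> ennreal (\<delta> * r)"
      using v \<delta>(2) unfolding vanishing_def by blast
    have "\<forall>\<^sub>F x in at_right 0. x \<in> {0<..<\<rho>}" by (rule eventually_at_right_real[OF \<rho>(1)])
    then show "\<forall>\<^sub>F x in at_right 0. ?f x < a"
    proof eventually_elim
      case (elim x)
      have "?f x \<le> ennreal \<delta>"
      proof (rule SUP_least)
        fix J assume "J \<in> {J. bounded_nondegenerate_interval J \<and> carleson_centre J \<in> S_region x}"
        then have J: "bounded_nondegenerate_interval J" "carleson_centre J \<in> S_region x" by auto
        define r where "r = interval_length J / 2"
        define t where "t = (Inf J + Sup J) / 2"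
        note ib = interval_bounds[OF J(1), folded r_def t_def]
        have S: "Complex r t \<in> S_region \<rho>" using J(2) S_region_mono[of x \<rho>] elim unfolding ib(3) by auto
        have "symbol_measure h \<phi> (carleson_square J) \<le> symbol_measure h \<phi> (halfplane_square t r)"
          by (rule symbol_measure_mono[OF ib(2)])
        also have "\<dots> = emeasure \<nu> (halfplane_square t r)" by (rule symbol_measure_eq) simp
        also have "\<dots> \<le> ennreal (\<delta> * r)" by (rule \<rho>(2)[OF S])
        also have "\<dots> \<le> ennreal (interval_length J * \<delta>)"
          using ib(1) \<delta>(2) by (intro ennreal_leI) (simp add: r_def)
        also have "\<dots> = ennreal (interval_length J) * ennreal \<delta>"
          using ib(1) \<delta>(2) by (intro ennreal_mult) (auto simp: r_def)
        finally show "symbol_measure h \<phi> (carleson_square J) / ennreal (interval_length J) \<le> ennreal \<delta>"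
          using ib(1) by (intro divide_le_posI_ennreal) (auto simp: r_def)
      qed
      then show ?case using b(2) unfolding \<delta>(1) by (rule le_less_trans)
    qed
  qed simp
qed

text \<open>Let \<open>G n\<close> be the normalized kernels at centres \<open>w n\<close> of
  squares that violate the bound, and let \<open>U_op (f n) = B (G n)\<close>. The norms of
  \<open>B (G n)\<close> stay away from zero, and their squares are the inner products of
  \<open>U_op (T (f n))\<close> with \<open>G n\<close>. Along a subsequence on which
  \<open>T (f n)\<close> converges to some \<open>g\<close>, these inner products become small,
  because \<open>U_op g\<close> decays by \<open>H2_decay\<close>.\<close>

lemma compact_imp_vanishing:
  assumes comp: "L2_compact unit_interval T"
  shows vanishing
proof (rule ccontr)
  assume "\<not> vanishing"
  then obtain \<delta> where \<delta>: "\<delta> > 0"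
    and "\<not> (\<exists>\<rho>>0. \<forall>t r. Complex r t \<in> S_region \<rho> \<longrightarrow> emeasure \<nu> (halfplane_square t r) \<le> ennreal (\<delta> * r))"
    unfolding vanishing_def by blast
  then have ex: "\<exists>t r. Complex r t \<in> S_region \<rho> \<and> \<not> emeasure \<nu> (halfplane_square t r) \<le> ennreal (\<delta> * r)" if "\<rho> > 0" for \<rho>
    using that by blast
  have "\<forall>n. \<exists>t r. Complex r t \<in> S_region (1 / real (Suc n)) \<and> \<not> emeasure \<nu> (halfplane_square t r) \<le> ennreal (\<delta> * r)"
    by (intro allI ex) simp
  then obtain t r where tr: "\<And>n. Complex (r n) (t n) \<in> S_region (1 / real (Suc n))"
    "\<And>n. \<not> emeasure \<nu> (halfplane_square (t n) (r n)) \<le> ennreal (\<delta> * r n)" by metis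
  define w where "w n = Complex (r n) (t n)" for n
  have rp: "r n > 0" for n using tr(1)[of n] by (simp add: S_region_def right_half_plane_def)
  have w: "Re (w n) > 0" for n by (simp add: w_def rp)
  obtain C where C: "C \<ge> 0" "\<forall>f\<in>L2 unit_interval. L2_norm unit_interval (T f) \<le> C * L2_norm unit_interval f"
    "\<forall>G\<in>H2. H2_norm (B G) \<le> C * H2_norm G" using bounds by blast
  define G where "G n s = of_real (sqrt (2 * r n)) * H2_kernel (w n) s" for n s
  \<comment> \<open>Scaling is written as a combination with coefficient 0, the form that the
    general lemmas accept.\<close>
  have G0: "G n = (\<lambda>s. of_real (sqrt (2 * r n)) * H2_kernel (w n) s + 0 * H2_kernel (w n) s)" for n by (auto simp: G_def)
  have k: "H2_kernel (w n) \<in> H2" for n by (rule H2_kernel_in_H2[OF w])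
  have G: "G n \<in> H2" for n unfolding G0 by (intro H2_lincomb k)
  have Gn: "H2_norm (G n) \<le> 1" for n
  proof -
    have "H2_norm (G n) \<le> sqrt (2 * r n) * H2_norm (H2_kernel (w n))"
      unfolding G0 using H2_norm_lincomb_le[OF k[of n] k[of n], where a="of_real (sqrt (2 * r n))" and b=0] rp[of n] by simp
    also have "H2_norm (H2_kernel (w n)) = sqrt (1 / (2 * r n))"
      using H2_norm_kernel[OF w[of n]] H2_norm_nonneg by (metis complex.sel(1) real_sqrt_unique w_def)
    also have "sqrt (2 * r n) * sqrt (1 / (2 * r n)) = 1"
      using rp[of n] by (simp flip: real_sqrt_mult)
    finally show ?thesis .
  qed
  have BGH: "B (G n) \<in> H2" for n by (rule B_H2[OF G])
  have BG: "B (G n) s = of_real (sqrt (2 * r n)) * B (H2_kernel (w n)) s" for n s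
    by (simp add: B_def G_def)
  \<comment> \<open>\<open>emeasure_\<nu>_square_le\<close> is applied to the kernel
    \<open>G n / sqrt (2 * r n)\<close>, which turns \<open>20 * pi * r^2\<close> into
    \<open>10 * pi * r\<close>; a mass above \<open>\<delta> * r n\<close> then gives this
    constant.\<close>
  have lower: "\<delta> / (10 * pi) < (H2_norm (B (G n)))\<^sup>2" for n
  proof -
    have Bk: "B (H2_kernel (w n)) s = of_real (1 / sqrt (2 * r n)) * B (G n) s + 0 * B (G n) s" for s
      unfolding BG using rp[of n] by (simp flip: of_real_mult)
    have "H2_norm (B (H2_kernel (w n))) \<le> 1 / sqrt (2 * r n) * H2_norm (B (G n))"
      using H2_norm_lincomb_le[OF BGH[of n] BGH[of n], where a="of_real (1 / sqrt (2 * r n))" and b=0] rp[of n]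
      unfolding Bk[abs_def, symmetric] by (simp add: norm_divide)
    then have "(H2_norm (B (H2_kernel (w n))))\<^sup>2 \<le> (1 / sqrt (2 * r n) * H2_norm (B (G n)))\<^sup>2"
      by (intro power_mono H2_norm_nonneg)
    also have "\<dots> = (H2_norm (B (G n)))\<^sup>2 / (2 * r n)" using rp[of n] by (simp add: power_mult_distrib power_divide)
    finally have le: "(H2_norm (B (H2_kernel (w n))))\<^sup>2 \<le> (H2_norm (B (G n)))\<^sup>2 / (2 * r n)" .
    have "emeasure \<nu> (halfplane_square (t n) (r n)) \<le> ennreal (20 * pi * (r n)\<^sup>2 * (H2_norm (B (H2_kernel (w n))))\<^sup>2)"
      unfolding w_def by (rule emeasure_\<nu>_square_le[OF rp])
    also have "\<dots> \<le> ennreal (20 * pi * (r n)\<^sup>2 * ((H2_norm (B (G n)))\<^sup>2 / (2 * r n)))"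
      by (intro ennreal_leI mult_left_mono le) auto
    also have "20 * pi * (r n)\<^sup>2 * ((H2_norm (B (G n)))\<^sup>2 / (2 * r n)) = 10 * pi * r n * (H2_norm (B (G n)))\<^sup>2"
      using rp[of n] by (simp add: power2_eq_square)
    finally have "\<not> ennreal (10 * pi * r n * (H2_norm (B (G n)))\<^sup>2) \<le> ennreal (\<delta> * r n)"
      using tr(2)[of n] order_trans by blast
    then have "\<delta> * r n < 10 * pi * r n * (H2_norm (B (G n)))\<^sup>2" using ennreal_leI by (meson not_le)
    then show ?thesis using rp[of n] by (simp add: divide_less_eq mult_ac)
  qed
  define f where "f n = U_inv (B (G n))" for n
  have f: "f n \<in> L2 unit_interval" "\<And>s. Re s > 0 \<Longrightarrow> U_op (f n) s = B (G n) s" for n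
    unfolding f_def using U_inv[OF BGH] by auto
  have "L2_norm unit_interval (f n) \<le> C" for n
  proof -
    have "L2_norm unit_interval (f n) = H2_norm (B (G n))"
      using U_op_isometry(2)[OF f(1)[of n]] H2_norm_cong[of "U_op (f n)" "B (G n)"] f(2)[of _ n] by simp
    also have "\<dots> \<le> C * H2_norm (G n)" by (rule bspec[OF C(3) G])
    also have "\<dots> \<le> C * 1" using Gn[of n] C(1) by (intro mult_left_mono)
    finally show ?thesis by simp
  qed
  then obtain \<sigma> g where g: "g \<in> L2 unit_interval" "strict_mono (\<sigma> :: nat \<Rightarrow> nat)"
    "(\<lambda>n. L2_norm unit_interval (\<lambda>x. T (f (\<sigma> n)) x - g x)) \<longlonglongrightarrow> 0"
    using comp f(1) unfolding L2_compact_def by blast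
  \<comment> \<open>Pairing with \<open>G n\<close> evaluates at \<open>w n\<close> with the weight
    \<open>sqrt (2 * r n)\<close>, which exactly compensates the bound for evaluating the transform
    of \<open>T (f n) - g\<close> there.\<close>
  have upper: "(H2_norm (B (G n)))\<^sup>2 \<le> L2_norm unit_interval (\<lambda>x. T (f n) x - g x) + cmod (U_op g (w n)) * sqrt (2 * r n)" for n
  proof -
    have Tf: "T (f n) \<in> L2 unit_interval" by (rule T_L2[OF f(1)])
    note UT = U_op_isometry(1)[OF Tf]
    have "complex_of_real ((H2_norm (B (G n)))\<^sup>2) = H2_inner (U_op (f n)) (B (G n))"
      unfolding H2_inner_self[OF BGH, symmetric] by (rule H2_inner_cong) (simp_all add: f(2))
    also have "\<dots> = H2_inner (U_op (T (f n))) (G n)" by (rule adjoint[OF f(1) G, symmetric])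
    also have "\<dots> = of_real (sqrt (2 * r n)) * U_op (T (f n)) (w n)"
      unfolding G0 by (subst H2_inner_lincomb_right[OF k k UT]) (simp add: H2_reproducing[OF UT w])
    finally have "(H2_norm (B (G n)))\<^sup>2 = cmod (of_real (sqrt (2 * r n)) * U_op (T (f n)) (w n))"
      by (metis norm_of_real abs_of_nonneg zero_le_power2)
    also have "\<dots> = sqrt (2 * r n) * cmod (U_op (T (f n)) (w n))"
      using rp[of n] by (simp add: norm_mult)
    also have "\<dots> \<le> sqrt (2 * r n) * (cmod (U_op (\<lambda>x. T (f n) x - g x) (w n)) + cmod (U_op g (w n)))"
      using norm_triangle_ineq[of "U_op (\<lambda>x. T (f n) x - g x) (w n)" "U_op g (w n)"] rp[of n]
      by (intro mult_left_mono) (auto simp: U_op_diff[OF Tf g(1) w])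
    also have "\<dots> \<le> sqrt (2 * r n) * (L2_norm unit_interval (\<lambda>x. T (f n) x - g x) * sqrt (1 / (2 * r n)) + cmod (U_op g (w n)))"
      using norm_U_op_le[OF L2_diff[OF Tf g(1)] w[of n]] rp[of n] by (intro mult_left_mono add_right_mono) (auto simp: w_def)
    also have "\<dots> = L2_norm unit_interval (\<lambda>x. T (f n) x - g x) + cmod (U_op g (w n)) * sqrt (2 * r n)"
      using rp[of n] by (simp add: distrib_left real_sqrt_divide mult_ac)
    finally show ?thesis .
  qed
  \<comment> \<open>Half of the lower bound, so that two terms below \<open>e\<close> contradict
    it.\<close>
  define e where "e = \<delta> / (10 * pi) / 2"
  have e: "e > 0" using \<delta> by (simp add: e_def)
  obtain \<rho> where \<rho>: "\<rho> > 0" "\<forall>z\<in>S_region \<rho>. cmod (U_op g z) * sqrt (2 * Re z) < e"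
    using H2_decay[OF U_op_isometry(1)[OF g(1)] e] by blast
  have "\<forall>\<^sub>F n in sequentially. 1 / real (Suc n) < \<rho>"
    using order_tendstoD(2)[OF LIMSEQ_Suc[OF lim_1_over_n] \<rho>(1)] by simp
  then have "\<forall>\<^sub>F n in sequentially. 1 / real (Suc (\<sigma> n)) < \<rho>"
    using filterlim_subseq[OF g(2)] by (auto simp: filterlim_iff)
  moreover have "\<forall>\<^sub>F n in sequentially. L2_norm unit_interval (\<lambda>x. T (f (\<sigma> n)) x - g x) < e"
    using order_tendstoD(2)[OF g(3) e] .
  ultimately have "\<forall>\<^sub>F n in sequentially. False"
  proof eventually_elim
    case (elim n)
    have "w (\<sigma> n) \<in> S_region \<rho>"
      using S_region_mono[of "1 / real (Suc (\<sigma> n))" \<rho>] elim(1) tr(1)[of "\<sigma> n"] unfolding w_def by auto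
    from bspec[OF \<rho>(2) this] have "cmod (U_op g (w (\<sigma> n))) * sqrt (2 * r (\<sigma> n)) < e" by (simp add: w_def)
    then have "(H2_norm (B (G (\<sigma> n))))\<^sup>2 < e + e" using upper[of "\<sigma> n"] elim(2) by linarith
    then show ?case using lower[of "\<sigma> n"] by (simp add: e_def)
  qed
  then show False by simp
qed

text \<open>A square with centre outside the region has
  \<open>\<rho> \<le> r \<le> 1 / \<rho>\<close> and lies in the disc of radius
  \<open>8 / \<rho>\<close>, so removing the compact set leaves only points with
  \<open>Re z < \<rho> / 8\<close>. That strip is covered by small squares with centres in the
  region, whose bounds add up to at most \<open>4 * \<delta> * r\<close>.\<close>

lemma restricted_Carleson:
  assumes \<rho>: "\<rho> > 0" and \<delta>: "\<delta> > 0"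
    and sm: "\<And>t r. Complex r t \<in> S_region \<rho> \<Longrightarrow> emeasure \<nu> (halfplane_square t r) \<le> ennreal (\<delta> * r)"
    and r: "r > 0"
  shows "emeasure \<nu> (halfplane_square t r - {z. \<rho> / 8 \<le> Re z \<and> cmod z \<le> 8 / \<rho>}) \<le> ennreal (2 * (2 * \<delta>) * r)"
proof (cases "Complex r t \<in> S_region \<rho>")
  case True
  have "emeasure \<nu> (halfplane_square t r - {z. \<rho> / 8 \<le> Re z \<and> cmod z \<le> 8 / \<rho>}) \<le> emeasure \<nu> (halfplane_square t r)"
    by (intro emeasure_mono) (auto simp: sets_\<nu>)
  also have "\<dots> \<le> ennreal (\<delta> * r)" by (rule sm[OF True])
  also have "\<dots> \<le> ennreal (2 * (2 * \<delta>) * r)" using \<delta> r by (intro ennreal_leI) simp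
  finally show ?thesis .
next
  case False
  then have r1: "\<rho> \<le> r" and c1: "cmod (Complex r t) \<le> 1 / \<rho>"
    using r by (auto simp: S_region_def right_half_plane_def not_less)
  have r2: "r \<le> 1 / \<rho>" "\<bar>t\<bar> \<le> 1 / \<rho>"
    using c1 abs_Re_le_cmod[of "Complex r t"] abs_Im_le_cmod[of "Complex r t"] by auto
  \<comment> \<open>Squares of this half-base have centres with real part \<open>\<rho> / 2\<close>,
    inside the region, and their height \<rho> exceeds that of the remaining strip.\<close>
  define \<eta> where "\<eta> = \<rho> / 2"
  have \<eta>: "\<eta> > 0" "\<eta> \<le> r" using \<rho> r1 by (auto simp: \<eta>_def)
  \<comment> \<open>\<open>Suc m\<close> squares are used below: the upper end of the base has index
    \<open>m\<close> when \<open>r / \<eta>\<close> is an integer.\<close>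
  define m where "m = nat \<lceil>r / \<eta>\<rceil>"
  define c where "c j = t - r + (2 * real j + 1) * \<eta>" for j
  have m1: "r / \<eta> \<le> real m" "real m \<le> r / \<eta> + 1"
    using r \<eta> by (auto simp: m_def) (linarith+)?
  have "halfplane_square t r - {z. \<rho> / 8 \<le> Re z \<and> cmod z \<le> 8 / \<rho>} \<subseteq> (\<Union>j<Suc m. halfplane_square (c j) \<eta>)"
  proof
    fix z assume z: "z \<in> halfplane_square t r - {z. \<rho> / 8 \<le> Re z \<and> cmod z \<le> 8 / \<rho>}"
    then have zq: "0 \<le> Re z" "Re z \<le> 2 * r" "\<bar>Im z - t\<bar> \<le> r" by (auto simp: halfplane_square_def)
    have "cmod z \<le> \<bar>Re z\<bar> + \<bar>Im z\<bar>" by (rule cmod_le)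
    also have "\<dots> \<le> 2 / \<rho> + (1 / \<rho> + 1 / \<rho>)" using zq r2 by (intro add_mono) auto
    also have "\<dots> \<le> 8 / \<rho>" using \<rho> by (simp add: field_simps)
    finally have "Re z < \<rho> / 8" using z by auto
    then have re: "0 \<le> Re z" "Re z \<le> 2 * \<eta>" using zq \<rho> by (auto simp: \<eta>_def)
    define x where "x = (Im z - (t - r)) / (2 * \<eta>)"
    have "x \<le> (2 * r) / (2 * \<eta>)" unfolding x_def using zq \<eta> by (intro divide_right_mono) auto
    then have x: "0 \<le> x" "x \<le> r / \<eta>" using zq \<eta> by (auto simp: x_def)
    define j where "j = nat \<lfloor>x\<rfloor>"
    have j: "real j \<le> x" "x < real j + 1" using x by (auto simp: j_def)
    have "j < Suc m" using j x m1 by linarith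
    have "Im z - (t - r) = x * (2 * \<eta>)" using \<eta> by (simp add: x_def)
    moreover have "real j * (2 * \<eta>) \<le> x * (2 * \<eta>)" "x * (2 * \<eta>) \<le> (real j + 1) * (2 * \<eta>)"
      using j \<eta> by (auto intro: mult_right_mono)
    ultimately have "\<bar>Im z - c j\<bar> \<le> \<eta>" unfolding c_def by (simp add: abs_le_iff algebra_simps)
    then have "z \<in> halfplane_square (c j) \<eta>" using re by (simp add: halfplane_square_def)
    then show "z \<in> (\<Union>j<Suc m. halfplane_square (c j) \<eta>)" using \<open>j < Suc m\<close> by blast
  qed
  then have "emeasure \<nu> (halfplane_square t r - {z. \<rho> / 8 \<le> Re z \<and> cmod z \<le> 8 / \<rho>}) \<le> emeasure \<nu> (\<Union>j<Suc m. halfplane_square (c j) \<eta>)"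
    by (intro emeasure_mono) (auto simp: sets_\<nu>)
  also have "\<dots> \<le> (\<Sum>j<Suc m. emeasure \<nu> (halfplane_square (c j) \<eta>))"
    by (intro emeasure_subadditive_finite) (auto simp: sets_\<nu>)
  also have "\<dots> \<le> (\<Sum>j<Suc m. ennreal (\<delta> * \<eta>))"
    using \<eta> \<rho> by (intro sum_mono sm) (auto simp: S_region_def right_half_plane_def \<eta>_def)
  also have "\<dots> = ennreal (real (Suc m)) * ennreal (\<delta> * \<eta>)"
    by (simp only: sum_constant card_lessThan ennreal_of_nat_eq_real_of_nat)
  also have "\<dots> = ennreal (real (Suc m) * (\<delta> * \<eta>))"
    using \<delta> \<eta> by (intro ennreal_mult[symmetric]) auto
  also have "\<dots> \<le> ennreal (2 * (2 * \<delta>) * r)"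
  proof (rule ennreal_leI)
    have "real (Suc m) * (\<delta> * \<eta>) \<le> (r / \<eta> + 2) * (\<delta> * \<eta>)"
      using m1 \<delta> \<eta> by (intro mult_right_mono) auto
    also have "\<dots> = \<delta> * (r + 2 * \<eta>)" using \<eta> by (simp add: field_simps)
    also have "\<dots> \<le> \<delta> * (4 * r)" using \<eta> \<delta> by (intro mult_left_mono) auto
    finally show "real (Suc m) * (\<delta> * \<eta>) \<le> 2 * (2 * \<delta>) * r" by simp
  qed
  finally show ?thesis .
qed

text \<open>The embedding is available only for functions continuous up to the axis, so each
  \<open>E n\<close> is replaced by a shift \<open>G n\<close> of it; boundedness of
  \<open>B\<close> absorbs the error \<open>1 / real (Suc n)\<close>.\<close>

lemma norm_B_tendsto_0:
  assumes v: vanishing and E: "\<And>n. E n \<in> H2" and M: "\<And>n. H2_norm (E n) \<le> M"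
    and pw: "\<And>s. Re s > 0 \<Longrightarrow> (\<lambda>n. E n s) \<longlonglongrightarrow> 0"
  shows "(\<lambda>n. H2_norm (B (E n))) \<longlonglongrightarrow> 0"
proof -
  have M0: "M \<ge> 0" using M[of 0] H2_norm_nonneg order_trans by blast
  obtain C where C: "C \<ge> 0" "\<forall>G\<in>H2. H2_norm (B G) \<le> C * H2_norm G" using bounds by blast
  have null: "(\<lambda>n. 1 / real (Suc n)) \<longlonglongrightarrow> 0" by (rule LIMSEQ_Suc[OF lim_1_over_n])
  have "\<exists>x>0. H2_norm (\<lambda>s. E n s - E n (s + of_real x)) < 1 / real (Suc n)" for n
  proof -
    have "\<forall>\<^sub>F x in at_right 0. H2_norm (\<lambda>s. E n s - E n (s + of_real x)) < 1 / real (Suc n)"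
      by (intro order_tendstoD(2)[OF tendsto_H2_norm_shift[OF E]]) simp
    moreover have "\<forall>\<^sub>F x in at_right (0::real). x > 0" by (simp add: eventually_at_right_less)
    ultimately have "\<forall>\<^sub>F x in at_right 0. x > 0 \<and> H2_norm (\<lambda>s. E n s - E n (s + of_real x)) < 1 / real (Suc n)"
      by eventually_elim simp
    then show ?thesis using eventually_happens' trivial_limit_at_right_real by blast
  qed
  then obtain x where x: "\<And>n. x n > 0" "\<And>n. H2_norm (\<lambda>s. E n s - E n (s + of_real (x n))) < 1 / real (Suc n)" by metis
  define G where "G n s = E n (s + of_real (x n))" for n s
  have G: "G n \<in> H2" for n unfolding G_def by (intro H2_shift E x)
  have EG: "(\<lambda>s. E n s - G n s) \<in> H2" "H2_norm (\<lambda>s. E n s - G n s) \<le> 1 / real (Suc n)" for n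
    using x(2)[of n] H2_diff[OF E G] by (auto simp: G_def)
  have Gn: "H2_norm (G n) \<le> M + 1" for n
  proof -
    have "H2_norm (\<lambda>s. G n s - E n s) = H2_norm (\<lambda>s. E n s - G n s)"
      unfolding H2_norm_def H2_norm_sq_def by (simp add: norm_minus_commute)
    moreover have "1 / real (Suc n) \<le> 1" by simp
    ultimately show ?thesis using H2_norm_le_add_diff[OF G E, of n n] EG(2)[of n] M[of n] by linarith
  qed
  have cont: "continuous_on {z. 0 \<le> Re z} (G n)" for n
    unfolding G_def by (intro continuous_at_imp_continuous_on ballI continuous_shift E x) simp
  have Gpw: "(\<lambda>n. G n z) \<longlonglongrightarrow> 0" if z: "Re z > 0" for z
  proof (rule Lim_null_comparison)
    show "\<forall>\<^sub>F n in sequentially. norm (G n z) \<le> cmod (E n z) + 1 / real (Suc n) * sqrt (1 / (2 * Re z))"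
    proof (rule always_eventually, rule allI)
      fix n
      have "cmod (E n z - G n z) \<le> H2_norm (\<lambda>s. E n s - G n s) * sqrt (1 / (2 * Re z))"
        by (rule norm_H2_le[OF EG(1) z])
      also have "\<dots> \<le> 1 / real (Suc n) * sqrt (1 / (2 * Re z))" using EG(2)[of n] z by (intro mult_right_mono) auto
      finally show "norm (G n z) \<le> cmod (E n z) + 1 / real (Suc n) * sqrt (1 / (2 * Re z))"
        using norm_triangle_sub[of "G n z" "E n z"] by (simp add: norm_minus_commute)
    qed
    show "(\<lambda>n. cmod (E n z) + 1 / real (Suc n) * sqrt (1 / (2 * Re z))) \<longlonglongrightarrow> 0"
      using tendsto_add[OF tendsto_norm[OF pw[OF z]] tendsto_mult_right[OF null, of "sqrt (1 / (2 * Re z))"]] by simp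
  qed
  define D where "D = {z. 0 \<le> Re z}"
  have Dm[measurable]: "D \<in> sets borel" unfolding D_def by measurable
  define g where "g n z = indicator D z *\<^sub>R G n z" for n z
  have gm[measurable]: "g n \<in> borel_measurable borel" for n
    unfolding g_def using cont by (intro borel_measurable_continuous_on_indicator) (auto simp: D_def)
  have small: "\<forall>\<^sub>F n in sequentially. 2 * pi * (H2_norm (B (G n)))\<^sup>2 \<le> e" if e: "e > 0" for e
  proof -
    \<comment> \<open>\<open>1280 = 640 * 2\<close> is the embedding constant with the
      \<open>2 * \<delta>\<close> of \<open>restricted_Carleson\<close>;
      \<open>2 * pi * (M + 1)^2\<close> bounds the squared boundary norm of \<open>G n\<close>, the
      extra 1 being the cost of the shift.\<close>
    define Q where "Q = 1280 * (2 * pi * (M + 1)\<^sup>2)"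
    have Q: "Q > 0" using M0 by (simp add: Q_def)
    define \<delta> where "\<delta> = e / 2 / Q"
    have \<delta>: "\<delta> > 0" using e Q by (simp add: \<delta>_def)
    obtain \<rho> where \<rho>: "\<rho> > 0" "\<And>t r. Complex r t \<in> S_region \<rho> \<Longrightarrow> emeasure \<nu> (halfplane_square t r) \<le> ennreal (\<delta> * r)"
      using v \<delta> unfolding vanishing_def by blast
    define K where "K = {z. \<rho> / 8 \<le> Re z \<and> cmod z \<le> 8 / \<rho>}"
    have Kc: "closed K"
      unfolding K_def by (intro closed_Collect_conj closed_Collect_le continuous_intros)
    then have Km[measurable]: "K \<in> sets borel" by (rule borel_closed)
    have KD: "K \<subseteq> D" using \<rho>(1) by (auto simp: K_def D_def)
    define \<nu>' where "\<nu>' = density \<nu> (indicator (- K))"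
    have s': "sets \<nu>' = sets borel" by (simp add: \<nu>'_def sets_\<nu>)
    have em': "emeasure \<nu>' A = emeasure \<nu> (A - K)" if A: "A \<in> sets borel" for A
    proof -
      have "emeasure \<nu>' A = (\<integral>\<^sup>+z. indicator (- K) z * indicator A z \<partial>\<nu>)"
        unfolding \<nu>'_def using A by (intro emeasure_density) (auto simp: sets_\<nu>)
      also have "\<dots> = (\<integral>\<^sup>+z. indicator (A - K) z \<partial>\<nu>)"
        by (intro nn_integral_cong) (auto simp: indicator_def)
      also have "\<dots> = emeasure \<nu> (A - K)" using A by (intro nn_integral_indicator) (auto simp: sets_\<nu>)
      finally show ?thesis .
    qed
    have out: "(\<integral>\<^sup>+z. ennreal ((cmod (g n z))\<^sup>2) * indicator (- K) z \<partial>\<nu>) \<le> ennreal (e / 2)" for n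
    proof -
      have "(\<integral>\<^sup>+z. ennreal ((cmod (g n z))\<^sup>2) * indicator (- K) z \<partial>\<nu>) = (\<integral>\<^sup>+z. indicator (- K) z * ennreal ((cmod (g n z))\<^sup>2) \<partial>\<nu>)"
        by (simp only: mult.commute)
      also have "\<dots> = (\<integral>\<^sup>+z. ennreal ((cmod (g n z))\<^sup>2) \<partial>\<nu>')"
        unfolding \<nu>'_def by (intro nn_integral_density[symmetric]) measurable
      also have "\<dots> = (\<integral>\<^sup>+z. ennreal ((cmod (G n z))\<^sup>2) * indicator {z. 0 \<le> Re z} z \<partial>\<nu>')"
        by (intro nn_integral_cong) (auto simp: g_def D_def indicator_def)
      also have "\<dots> \<le> ennreal (640 * (2 * \<delta>) * (L2_norm lborel (bdry (G n)))\<^sup>2)"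
      proof (rule Carleson_embedding[OF s' _ _ _ G cont])
        show "emeasure \<nu>' (halfplane_square t r) \<le> ennreal (2 * (2 * \<delta>) * r)" if "r > 0" for t r
          using restricted_Carleson[OF \<rho>(1) \<delta> \<rho>(2) that, of t] by (simp add: em' K_def)
        show "0 \<le> 2 * \<delta>" using \<delta> by simp
        have lm: "{z. Re z < 0} \<in> sets borel" by (intro borel_open open_halfspace_Re_lt)
        have "emeasure \<nu>' {z. Re z < 0} \<le> emeasure \<nu> {z. Re z < 0}"
          unfolding em'[OF lm] using lm by (intro emeasure_mono) (auto simp: sets_\<nu>)
        then show "emeasure \<nu>' {z. Re z < 0} = 0" by (simp add: emeasure_\<nu>_left_half_plane)
      qed
      also have "\<dots> \<le> ennreal (e / 2)"
      proof (rule ennreal_leI)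
        have "(L2_norm lborel (bdry (G n)))\<^sup>2 = 2 * pi * (H2_norm (G n))\<^sup>2"
          by (simp add: H2_norm_eq_bdry[OF G] power_divide)
        also have "\<dots> \<le> 2 * pi * (M + 1)\<^sup>2" using Gn[of n] by (intro mult_left_mono power_mono H2_norm_nonneg) auto
        finally have "640 * (2 * \<delta>) * (L2_norm lborel (bdry (G n)))\<^sup>2 \<le> 640 * (2 * \<delta>) * (2 * pi * (M + 1)\<^sup>2)"
          using \<delta> by (intro mult_left_mono) auto
        also have "\<dots> = \<delta> * Q" by (simp add: Q_def)
        also have "\<dots> = e / 2" using Q by (simp add: \<delta>_def)
        finally show "640 * (2 * \<delta>) * (L2_norm lborel (bdry (G n)))\<^sup>2 \<le> e / 2" .
      qed
      finally show ?thesis .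
    qed
    \<comment> \<open>On \<open>K\<close> the real part is at least \<open>\<rho> / 8\<close>, so
      point evaluations are uniformly bounded there and a constant majorant exists.\<close>
    define b where "b = ((M + 1) * sqrt (1 / (2 * (\<rho> / 8))))\<^sup>2"
    have "(\<lambda>n. \<integral>\<^sup>+z. ennreal ((cmod (g n z))\<^sup>2) * indicator K z \<partial>\<nu>) \<longlonglongrightarrow> (\<integral>\<^sup>+z. 0 \<partial>\<nu>)"
    proof (rule nn_integral_dominated_convergence[where w="\<lambda>z. ennreal b * indicator K z"])
      show "(\<lambda>z. ennreal ((cmod (g n z))\<^sup>2) * indicator K z) \<in> borel_measurable \<nu>" for n by measurable
      show "(\<lambda>z. ennreal b * indicator K z) \<in> borel_measurable \<nu>" by measurable
      show "AE z in \<nu>. ennreal ((cmod (g n z))\<^sup>2) * indicator K z \<le> ennreal b * indicator K z" for n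
      proof (rule AE_I2)
        fix z
        show "ennreal ((cmod (g n z))\<^sup>2) * indicator K z \<le> ennreal b * indicator K z"
        proof (cases "z \<in> K")
          case True
          then have z: "Re z > 0" "\<rho> / 8 \<le> Re z" "g n z = G n z" using KD \<rho>(1) by (auto simp: K_def g_def)
          have "cmod (G n z) \<le> H2_norm (G n) * sqrt (1 / (2 * Re z))" by (rule norm_H2_le[OF G z(1)])
          also have "\<dots> \<le> (M + 1) * sqrt (1 / (2 * (\<rho> / 8)))"
            using Gn[of n] z \<rho>(1) M0 by (intro mult_mono real_sqrt_le_mono divide_left_mono) auto
          finally have "(cmod (g n z))\<^sup>2 \<le> b" unfolding b_def z(3) by (intro power_mono) auto
          then show ?thesis by (intro mult_right_mono ennreal_leI) auto
        qed simp
      qed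
      show "(\<integral>\<^sup>+z. ennreal b * indicator K z \<partial>\<nu>) < \<infinity>"
      proof -
        \<comment> \<open>Finite mass of \<open>K\<close> comes from a single large square, whose
          mass is bounded by testing on the kernel at its centre.\<close>
        have "K \<subseteq> halfplane_square 0 (8 / \<rho>)"
        proof
          fix z assume "z \<in> K"
          then have "\<rho> / 8 \<le> Re z" "cmod z \<le> 8 / \<rho>" by (auto simp: K_def)
          then show "z \<in> halfplane_square 0 (8 / \<rho>)"
            using abs_Re_le_cmod[of z] abs_Im_le_cmod[of z] \<rho>(1) unfolding halfplane_square_def by (simp; linarith)
        qed
        then have "emeasure \<nu> K \<le> emeasure \<nu> (halfplane_square 0 (8 / \<rho>))"
          by (intro emeasure_mono) (auto simp: sets_\<nu>)
        also have "\<dots> < \<infinity>"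
          using emeasure_\<nu>_square_le[of "8 / \<rho>" 0] \<rho>(1) by (intro le_less_trans[OF emeasure_\<nu>_square_le]) auto
        finally have "emeasure \<nu> K < \<infinity>" .
        then show ?thesis by (simp add: nn_integral_cmult_indicator sets_\<nu> ennreal_mult_less_top)
      qed
      show "AE z in \<nu>. (\<lambda>n. ennreal ((cmod (g n z))\<^sup>2) * indicator K z) \<longlonglongrightarrow> 0"
      proof (rule AE_I2)
        fix z
        show "(\<lambda>n. ennreal ((cmod (g n z))\<^sup>2) * indicator K z) \<longlonglongrightarrow> 0"
        proof (cases "z \<in> K")
          case True
          then have z: "Re z > 0" "\<And>n. g n z = G n z" using KD \<rho>(1) by (auto simp: K_def g_def)
          have "(\<lambda>n. ennreal ((cmod (G n z))\<^sup>2)) \<longlonglongrightarrow> ennreal ((cmod 0)\<^sup>2)" by (intro tendsto_intros Gpw z)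
          then show ?thesis using True z(2) by simp
        qed simp
      qed
    qed simp
    then have "\<forall>\<^sub>F n in sequentially. (\<integral>\<^sup>+z. ennreal ((cmod (g n z))\<^sup>2) * indicator K z \<partial>\<nu>) < ennreal (e / 2)"
      using e by (intro order_tendstoD(2)) auto
    then show ?thesis
    proof eventually_elim
      case (elim n)
      have "ennreal (2 * pi * (H2_norm (B (G n)))\<^sup>2) = (\<integral>\<^sup>+z. ennreal ((cmod (G n z))\<^sup>2) * indicator {z. 0 \<le> Re z} z \<partial>\<nu>)"
        by (rule nn_integral_\<nu>_eq_norm_B[OF G cont, symmetric])
      also have "\<dots> = (\<integral>\<^sup>+z. ennreal ((cmod (g n z))\<^sup>2) * indicator K z + ennreal ((cmod (g n z))\<^sup>2) * indicator (- K) z \<partial>\<nu>)"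
        by (intro nn_integral_cong) (auto simp: g_def D_def indicator_def)
      also have "\<dots> = (\<integral>\<^sup>+z. ennreal ((cmod (g n z))\<^sup>2) * indicator K z \<partial>\<nu>) + (\<integral>\<^sup>+z. ennreal ((cmod (g n z))\<^sup>2) * indicator (- K) z \<partial>\<nu>)"
        by (rule nn_integral_add) measurable
      also have "\<dots> \<le> ennreal (e / 2) + ennreal (e / 2)" using elim by (intro add_mono out) auto
      also have "\<dots> = ennreal e" using e by (simp flip: ennreal_plus)
      finally show ?case using e by (subst (asm) ennreal_le_iff) auto
    qed
  qed
  show ?thesis
  proof (rule LIMSEQ_I)
    fix e :: real assume e: "e > 0"
    have "\<forall>\<^sub>F n in sequentially. 2 * pi * (H2_norm (B (G n)))\<^sup>2 \<le> 2 * pi * (e / 3)\<^sup>2" using e by (intro small) simp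
    moreover have "\<forall>\<^sub>F n in sequentially. C * (1 / real (Suc n)) < e / 3"
      using order_tendstoD(2)[OF tendsto_mult_left[OF null, of C], of "e / 3"] e by simp
    ultimately have "\<forall>\<^sub>F n in sequentially. norm (H2_norm (B (E n)) - 0) < e"
    proof eventually_elim
      case (elim n)
      have "(H2_norm (B (G n)))\<^sup>2 \<le> (e / 3)\<^sup>2" using elim(1) by simp
      then have 1: "H2_norm (B (G n)) \<le> e / 3" by (rule power2_le_imp_le) (use e in simp)
      have "H2_norm (B (\<lambda>s. E n s - G n s)) \<le> C * H2_norm (\<lambda>s. E n s - G n s)" by (rule bspec[OF C(2) EG(1)])
      also have "\<dots> \<le> C * (1 / real (Suc n))" by (intro mult_left_mono EG C)
      finally have "H2_norm (\<lambda>s. B (E n) s - B (G n) s) < e / 3" using elim(2) by (simp only: B_diff[of "E n" "G n"])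
      then have "H2_norm (B (E n)) < e" using 1 e H2_norm_le_add_diff[OF B_H2[OF E] B_H2[OF G], of n n] by linarith
      then show ?case by (simp add: H2_norm_nonneg)
    qed
    then show "\<exists>no. \<forall>n\<ge>no. norm (H2_norm (B (E n)) - 0) < e" by (simp add: eventually_sequentially)
  qed
qed

text \<open>After passing to a subsequence with pointwise convergent transforms and subtracting the
  limit, let \<open>d n\<close> be the remainder and \<open>E n = U_op (T (d n))\<close>. The
  squared norm of \<open>T (d n)\<close> is the inner product of \<open>U_op (d n)\<close> with
  \<open>B (E n)\<close>, so it is enough that \<open>B (E n)\<close> tends to zero. Pointwise
  convergence of \<open>E n\<close> to zero holds because \<open>E n s\<close> is the pairing of
  \<open>U_op (d n)\<close> with the fixed function \<open>B (H2_kernel s)\<close>.\<close>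

lemma vanishing_imp_compact:
  assumes v: vanishing
  shows "L2_compact unit_interval T"
  unfolding L2_compact_def
proof (intro allI impI, elim conjE exE)
  fix f :: "nat \<Rightarrow> real \<Rightarrow> complex" and b
  assume f: "\<forall>n. f n \<in> L2 unit_interval" and b: "\<forall>n. L2_norm unit_interval (f n) \<le> b"
  obtain C where C: "C \<ge> 0" "\<forall>f\<in>L2 unit_interval. L2_norm unit_interval (T f) \<le> C * L2_norm unit_interval f"
    using bounds by blast
  have fL: "f n \<in> L2 unit_interval" for n using f by blast
  have UH: "U_op (f n) \<in> H2" for n by (rule U_op_isometry(1)[OF fL])
  have "H2_norm (U_op (f n)) \<le> b" for n using b by (simp add: U_op_isometry(2)[OF fL])
  then obtain F r where F: "F \<in> H2" "strict_mono (r :: nat \<Rightarrow> nat)" "\<And>s. Re s > 0 \<Longrightarrow> (\<lambda>n. U_op (f (r n)) s) \<longlonglongrightarrow> F s"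
    using H2_Montel[of "\<lambda>n. U_op (f n)" b, OF UH] by metis
  define u where "u = U_inv F"
  have u: "u \<in> L2 unit_interval" "\<And>s. Re s > 0 \<Longrightarrow> U_op u s = F s" unfolding u_def using U_inv[OF F(1)] by auto
  define d where "d n = (\<lambda>x. f (r n) x - u x)" for n
  have d: "d n \<in> L2 unit_interval" for n unfolding d_def by (intro L2_diff fL u)
  define b' where "b' = b + L2_norm unit_interval u"
  have dn: "L2_norm unit_interval (d n) \<le> b'" for n
  proof -
    have "L2_norm unit_interval (d n) \<le> L2_norm unit_interval (f (r n)) + L2_norm unit_interval u"
      unfolding d_def using L2_norm_triangle_diff[OF fL L2_zero u(1), of "r n"] L2_norm_minus_commute[of unit_interval "\<lambda>x. 0" u] by simp
    then show ?thesis using b[rule_format, of "r n"] by (simp add: b'_def)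
  qed
  have b'0: "b' \<ge> 0" using dn[of 0] L2_norm_nonneg order_trans by blast
  have Ud: "U_op (d n) \<in> H2" "H2_norm (U_op (d n)) \<le> b'" for n
    using U_op_isometry[OF d] dn by auto
  have dpw: "(\<lambda>n. U_op (d n) s) \<longlonglongrightarrow> 0" if s: "Re s > 0" for s
  proof -
    have "(\<lambda>n. U_op (f (r n)) s - F s) \<longlonglongrightarrow> 0" using F(3)[OF s] by (simp add: LIM_zero)
    then show ?thesis unfolding d_def by (simp add: U_op_diff[OF fL u(1) s] u(2)[OF s])
  qed
  have Td: "T (d n) \<in> L2 unit_interval" for n by (rule T_L2[OF d])
  define E where "E n = U_op (T (d n))" for n
  have E: "E n \<in> H2" for n unfolding E_def by (rule U_op_isometry(1)[OF Td])
  have En: "H2_norm (E n) = L2_norm unit_interval (T (d n))" for n unfolding E_def by (rule U_op_isometry(2)[OF Td])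
  have "H2_norm (E n) \<le> C * b'" for n
    unfolding En using bspec[OF C(2) d[of n]] mult_left_mono[OF dn[of n] C(1)] by linarith
  moreover have "(\<lambda>n. E n s) \<longlonglongrightarrow> 0" if s: "Re s > 0" for s
  proof -
    have "E n s = H2_inner (U_op (d n)) (B (H2_kernel s))" for n
      using H2_reproducing[OF E s, of n] adjoint[OF d H2_kernel_in_H2[OF s], of n] by (simp add: E_def)
    then show ?thesis
      using H2_weak_null[OF Ud B_H2[OF H2_kernel_in_H2[OF s]] dpw] by simp
  qed
  ultimately have BE: "(\<lambda>n. H2_norm (B (E n))) \<longlonglongrightarrow> 0" by (intro norm_B_tendsto_0[OF v E])
  have sq: "(L2_norm unit_interval (T (d n)))\<^sup>2 \<le> b' * H2_norm (B (E n))" for n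
  proof -
    have "complex_of_real ((H2_norm (E n))\<^sup>2) = H2_inner (U_op (d n)) (B (E n))"
      unfolding H2_inner_self[OF E, symmetric] using adjoint[OF d E, of n n] by (simp add: E_def)
    then have "(H2_norm (E n))\<^sup>2 = cmod (H2_inner (U_op (d n)) (B (E n)))"
      by (metis norm_of_real abs_of_nonneg zero_le_power2)
    also have "\<dots> \<le> H2_norm (U_op (d n)) * H2_norm (B (E n))" by (intro H2_Cauchy_Schwarz Ud B_H2 E)
    also have "\<dots> \<le> b' * H2_norm (B (E n))" by (intro mult_right_mono Ud H2_norm_nonneg)
    finally show ?thesis unfolding En .
  qed
  have "(\<lambda>n. L2_norm unit_interval (T (d n))) \<longlonglongrightarrow> 0"
  proof (rule Lim_null_comparison)
    show "\<forall>\<^sub>F n in sequentially. norm (L2_norm unit_interval (T (d n))) \<le> sqrt (b' * H2_norm (B (E n)))"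
      by (intro always_eventually allI) (simp add: L2_norm_nonneg real_le_rsqrt[OF sq])
    show "(\<lambda>n. sqrt (b' * H2_norm (B (E n)))) \<longlonglongrightarrow> 0"
      using tendsto_real_sqrt[OF tendsto_mult_left[OF BE, of b']] by simp
  qed
  moreover have "L2_norm unit_interval (T (d n)) = L2_norm unit_interval (\<lambda>x. T (f (r n)) x - T u x)" for n
    unfolding d_def by (intro L2_norm_cong_AE L2_measurable T_L2 L2_diff fL u T_diff)
  ultimately show "\<exists>r. \<exists>g\<in>L2 unit_interval. strict_mono r \<and> (\<lambda>n. L2_norm unit_interval (\<lambda>x. T (f (r n)) x - g x)) \<longlonglongrightarrow> 0"
    using F(2) T_L2[OF u(1)] by (intro exI[of _ r] bexI[of _ "T u"]) auto
qed

end

theorem theorem2p6: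
  fixes T :: "(real \<Rightarrow> complex) \<Rightarrow> real \<Rightarrow> complex"
    and h \<phi> :: "complex \<Rightarrow> complex"
  assumes "monomial_operator T"
    and "associated_symbols T h \<phi>"
  shows "L2_compact unit_interval T \<longleftrightarrow>
    ((\<lambda>r. SUP J\<in>{J. bounded_nondegenerate_interval J \<and> carleson_centre J \<in> S_region r}.
        symbol_measure h \<phi> (carleson_square J) / ennreal (interval_length J))
      \<longlongrightarrow> 0) (at_right (0::real))"
proof -
  interpret weighted_composition T h \<phi>
    using assms by unfold_locales (auto simp: monomial_operator_def)
  show ?thesis
    unfolding tendsto_0_iff_vanishing using compact_imp_vanishing vanishing_imp_compact by blast
qed

end
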